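(* Let $\nu>0$, $T^*>0$, $\mathbf{u}_0\in H^1(\mathbb{T}^3)$, let $m\geq1$ be an integer, and let $\mathbf{f}\in L^2(0,T^*;\dot H^{m-1})$. Let $\mathbf{u}\in C([0,T^*];H^1)\cap L^2(0,T^*;H^2)$ be the unique strong solution on $[0,T^*]$ of $$\partial_t\mathbf{u}+(\nabla\times\mathbf{u})\times\mathbf{u}=\nu\triangle\mathbf{u}+\mathbf{f},\qquad \mathbf{u}(0)=\mathbf{u}_0,$$ on $\mathbb{T}^3$ (assumed to exist on $[0,T^*]$). Then for every $\epsilon\in(0,T^* )$, $$\mathbf{u}\in L^\infty(\epsilon,T^*;H^m)\cap L^2(\epsilon,T^*;H^{m+1}).$$ Moreover, if $m\geq5$ and in addition $\partial_t\mathbf{f}\in L^2(0,T^*;\dot H^2)$, then for every $\epsilon\in(0,T^* )$, $$\mathbf{u}\in H^1(\epsilon,T^*;H^4)\cap H^2(\epsilon,T^*;H^2);$$ in particular, $\mathbf{u}$ is a classical solution on $[\epsilon,T^*]$, that is, $$\mathbf{u}\in C^0([\epsilon,T^*];C^2)\cap C^1([\epsilon,T^*];C^0).$$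
   Context: $\mathbb{T}^3=\mathbb{R}^3/(2\pi\mathbb{Z})^3$. All functions $\mathbf{u},\mathbf{f}$ are $\mathbb{R}^3$-valued; $L^2$, $H^s$, $C^k$ denote spaces of such vector fields on $\mathbb{T}^3$, and $\dot H^s$ (with $\dot L^2=\dot H^0$) denotes the subspace of $H^s$ of fields with zero mean. Solutions $\mathbf{u}$ are not required to be divergence-free or mean-free. A strong solution on $[0,T^*]$ with data $\mathbf{u}_0\in H^1$ and forcing $\mathbf{f}\in L^2(0,T^*;\dot L^2)$ is a function $\mathbf{u}\in C([0,T^*];H^1)\cap L^2(0,T^*;H^2)$ with $\partial_t\mathbf{u}\in L^2(0,T^*;L^2)$ that satisfies $\partial_t\mathbf{u}+(\nabla\times\mathbf{u})\times\mathbf{u}=\nu\triangle\mathbf{u}+\mathbf{f}$ in the sense of $L^2(0,T^*;L^2)$, with $\mathbf{u}(0)=\mathbf{u}_0$ in the sense of $C([0,T^*];H^1)$. Strong solutions are unique. Here $H^k(\epsilon,T^*;Y)$ is the Bochner–Sobolev space of $Y$-valued functions of time with $k$ weak time derivatives in $L^2(\epsilon,T^*;Y)$. *)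

theory Defs
  imports "HOL-Analysis.Analysis"
begin

section \<open>Fields on the torus\<close>

text \<open>
  A field on \<open>\<real>\<^sup>3/(2\<pi>\<int>)\<^sup>3\<close> is a function on \<open>\<real>\<^sup>3\<close> that is \<open>2\<pi>\<close>-periodic in each
  coordinate. Elements of Lebesgue and Sobolev spaces are represented by such functions, equality in
  these spaces being equality almost everywhere (\<open>eq_field\<close>).
\<close>

type_synonym field = "real^3 \<Rightarrow> real^3"

definition torus_periodic :: "(real^3 \<Rightarrow> 'b) \<Rightarrow> bool" where
  "torus_periodic g \<longleftrightarrow> (\<forall>x i. g (x + axis i (2 * pi)) = g x)"

definition torus :: "(real^3) measure" where
  "torus = lebesgue_on (cbox 0 (\<chi> i. 2 * pi))"

definition eq_field :: "field \<Rightarrow> field \<Rightarrow> bool" where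
  "eq_field g h \<longleftrightarrow> (AE x in torus. g x = h x)"


section \<open>Normed spaces of fields\<close>

text \<open>
  A space of fields is given by its set of elements and its norm; the norm is only meaningful on the
  elements.
\<close>

record field_space =
  Elems :: "field set"
  Norm :: "field \<Rightarrow> real"

definition L2_space :: field_space where
  "L2_space = \<lparr>
     Elems = {g. torus_periodic g \<and> g \<in> borel_measurable torus \<and>
                 integrable torus (\<lambda>x. (norm (g x))\<^sup>2)},
     Norm = (\<lambda>g. sqrt (\<integral>x. (norm (g x))\<^sup>2 \<partial>torus))\<rparr>"

definition wave_vector :: "int^3 \<Rightarrow> real^3" where
  "wave_vector k = (\<chi> i. real_of_int (k $ i))"

definition fourier_coeff :: "field \<Rightarrow> int^3 \<Rightarrow> complex^3" where
  "fourier_coeff g k = (\<chi> j.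
     (\<integral>x. complex_of_real (g x $ j) * cis (- (wave_vector k \<bullet> x)) \<partial>torus)
       / complex_of_real ((2 * pi) ^ 3))"

definition sobolev_term :: "nat \<Rightarrow> field \<Rightarrow> int^3 \<Rightarrow> real" where
  "sobolev_term s g k = (1 + (norm (wave_vector k))\<^sup>2) ^ s * (norm (fourier_coeff g k))\<^sup>2"

definition H_space :: "nat \<Rightarrow> field_space" where
  "H_space s = \<lparr>
     Elems = {g \<in> Elems L2_space. sobolev_term s g summable_on UNIV},
     Norm = (\<lambda>g. sqrt (infsum (sobolev_term s g) UNIV))\<rparr>"

definition Hdot_space :: "nat \<Rightarrow> field_space" where
  "Hdot_space s = \<lparr>
     Elems = {g \<in> Elems (H_space s). (\<integral>x. g x \<partial>torus) = 0},
     Norm = Norm (H_space s)\<rparr>"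

primrec Ck :: "nat \<Rightarrow> ('a::euclidean_space \<Rightarrow> 'b::real_normed_vector) \<Rightarrow> bool" where
  "Ck 0 g \<longleftrightarrow> continuous_on UNIV g"
| "Ck (Suc n) g \<longleftrightarrow> (\<forall>x. g differentiable (at x)) \<and>
     (\<forall>b\<in>Basis. Ck n (\<lambda>x. frechet_derivative g (at x) b))"

text \<open>
  The following is the sum of the suprema of all iterated partial derivatives of order at most \<open>n\<close>.
  Mixed derivatives are counted once for every order of differentiation, which gives a norm equivalent
  to the usual one. The suprema are finite for periodic \<open>g\<close> with \<open>Ck n g\<close>.
\<close>

primrec Ck_norm :: "nat \<Rightarrow> ('a::euclidean_space \<Rightarrow> 'b::real_normed_vector) \<Rightarrow> real" where
  "Ck_norm 0 g = (SUP x. norm (g x))"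
| "Ck_norm (Suc n) g = (SUP x. norm (g x)) +
     (\<Sum>b\<in>Basis. Ck_norm n (\<lambda>x. frechet_derivative g (at x) b))"

definition C_space :: "nat \<Rightarrow> field_space" where
  "C_space n = \<lparr> Elems = {g. torus_periodic g \<and> Ck n g}, Norm = Ck_norm n\<rparr>"


section \<open>Weak derivatives in space\<close>

definition weak_pderiv :: "3 \<Rightarrow> field \<Rightarrow> field \<Rightarrow> bool" where
  "weak_pderiv i g h \<longleftrightarrow> g \<in> Elems L2_space \<and> h \<in> Elems L2_space \<and>
     (\<forall>\<phi> :: real^3 \<Rightarrow> real. torus_periodic \<phi> \<and> (\<forall>n. Ck n \<phi>) \<longrightarrow>
        (\<integral>x. frechet_derivative \<phi> (at x) (axis i 1) *\<^sub>R g x \<partial>torus)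
          = - (\<integral>x. \<phi> x *\<^sub>R h x \<partial>torus))"

definition weak_curl :: "field \<Rightarrow> field \<Rightarrow> bool" where
  "weak_curl g w \<longleftrightarrow> (\<exists>D. (\<forall>i. weak_pderiv i g (D i)) \<and>
     w = (\<lambda>x. vector [D 2 x $ 3 - D 3 x $ 2, D 3 x $ 1 - D 1 x $ 3, D 1 x $ 2 - D 2 x $ 1]))"

definition weak_laplacian :: "field \<Rightarrow> field \<Rightarrow> bool" where
  "weak_laplacian g l \<longleftrightarrow> (\<exists>D E. (\<forall>i. weak_pderiv i g (D i) \<and> weak_pderiv i (D i) (E i)) \<and>
     l = (\<lambda>x. \<Sum>i\<in>UNIV. E i x))"


section \<open>Functions of time with values in a space of fields\<close>

definition continuous_into :: "field_space \<Rightarrow> real set \<Rightarrow> (real \<Rightarrow> field) \<Rightarrow> bool" where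
  "continuous_into Y S u \<longleftrightarrow> (\<forall>t\<in>S. u t \<in> Elems Y) \<and>
     (\<forall>t\<in>S. ((\<lambda>s. Norm Y (\<lambda>x. u s x - u t x)) \<longlongrightarrow> 0) (at t within S))"

definition C1_into :: "field_space \<Rightarrow> real set \<Rightarrow> (real \<Rightarrow> field) \<Rightarrow> bool" where
  "C1_into Y S u \<longleftrightarrow> continuous_into Y S u \<and>
     (\<exists>w. continuous_into Y S w \<and>
        (\<forall>t\<in>S. ((\<lambda>s. Norm Y (\<lambda>x. (u s x - u t x) /\<^sub>R (s - t) - w t x)) \<longlongrightarrow> 0) (at t within S)))"

definition simple_into :: "field_space \<Rightarrow> real set \<Rightarrow> (real \<Rightarrow> field) \<Rightarrow> bool" where
  "simple_into Y S \<sigma> \<longleftrightarrow> simple_function (lebesgue_on S) \<sigma> \<and> \<sigma> ` S \<subseteq> Elems Y"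

definition simple_integral :: "real set \<Rightarrow> (real \<Rightarrow> field) \<Rightarrow> field" where
  "simple_integral S \<sigma> = (\<lambda>x. \<Sum>g\<in>\<sigma> ` S. measure lebesgue {t \<in> S. \<sigma> t = g} *\<^sub>R g x)"

definition strongly_measurable :: "field_space \<Rightarrow> real set \<Rightarrow> (real \<Rightarrow> field) \<Rightarrow> bool" where
  "strongly_measurable Y S u \<longleftrightarrow> (\<exists>\<sigma>. (\<forall>n. simple_into Y S (\<sigma> n)) \<and>
     (AE t in lebesgue_on S.
        u t \<in> Elems Y \<and> (\<lambda>n. Norm Y (\<lambda>x. \<sigma> n t x - u t x)) \<longlonglongrightarrow> 0))"

text \<open>Bochner integrals over sets \<open>S\<close> of finite measure.\<close>

definition has_field_integral ::
    "field_space \<Rightarrow> real set \<Rightarrow> (real \<Rightarrow> field) \<Rightarrow> field \<Rightarrow> bool" where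
  "has_field_integral Y S u I \<longleftrightarrow> strongly_measurable Y S u \<and> I \<in> Elems Y \<and>
     (\<exists>\<sigma>. (\<forall>n. simple_into Y S (\<sigma> n)) \<and>
        (\<lambda>n. \<integral>\<^sup>+t. ennreal (Norm Y (\<lambda>x. \<sigma> n t x - u t x)) \<partial>lebesgue_on S) \<longlonglongrightarrow> 0 \<and>
        (\<lambda>n. Norm Y (\<lambda>x. simple_integral S (\<sigma> n) x - I x)) \<longlonglongrightarrow> 0)"

definition L2_into :: "field_space \<Rightarrow> real \<Rightarrow> real \<Rightarrow> (real \<Rightarrow> field) \<Rightarrow> bool" where
  "L2_into Y a b u \<longleftrightarrow> strongly_measurable Y {a<..<b} u \<and>
     (\<integral>\<^sup>+t. ennreal ((Norm Y (u t))\<^sup>2) \<partial>lebesgue_on {a<..<b}) < \<infinity>"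

definition Linf_into :: "field_space \<Rightarrow> real \<Rightarrow> real \<Rightarrow> (real \<Rightarrow> field) \<Rightarrow> bool" where
  "Linf_into Y a b u \<longleftrightarrow> strongly_measurable Y {a<..<b} u \<and>
     (\<exists>C. AE t in lebesgue_on {a<..<b}. Norm Y (u t) \<le> C)"

definition time_test_function :: "real \<Rightarrow> real \<Rightarrow> (real \<Rightarrow> real) \<Rightarrow> bool" where
  "time_test_function a b \<phi> \<longleftrightarrow> (\<forall>n. Ck n \<phi>) \<and>
     (\<exists>c d. a < c \<and> d < b \<and> (\<forall>t. t \<notin> {c..d} \<longrightarrow> \<phi> t = 0))"

definition weak_time_deriv ::
    "field_space \<Rightarrow> real \<Rightarrow> real \<Rightarrow> (real \<Rightarrow> field) \<Rightarrow> (real \<Rightarrow> field) \<Rightarrow> bool" where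
  "weak_time_deriv Y a b u v \<longleftrightarrow> (\<forall>\<phi>. time_test_function a b \<phi> \<longrightarrow>
     (\<exists>I. has_field_integral Y {a<..<b} (\<lambda>t x. deriv \<phi> t *\<^sub>R u t x) I \<and>
          has_field_integral Y {a<..<b} (\<lambda>t x. \<phi> t *\<^sub>R v t x) (\<lambda>x. - I x)))"

primrec Hk_into :: "nat \<Rightarrow> field_space \<Rightarrow> real \<Rightarrow> real \<Rightarrow> (real \<Rightarrow> field) \<Rightarrow> bool" where
  "Hk_into 0 Y a b u \<longleftrightarrow> L2_into Y a b u"
| "Hk_into (Suc k) Y a b u \<longleftrightarrow> L2_into Y a b u \<and>
     (\<exists>v. weak_time_deriv Y a b u v \<and> Hk_into k Y a b v)"


section \<open>Solutions\<close>

definition strong_solution ::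
    "real \<Rightarrow> real \<Rightarrow> field \<Rightarrow> (real \<Rightarrow> field) \<Rightarrow> (real \<Rightarrow> field) \<Rightarrow> bool" where
  "strong_solution \<nu> T u0 f u \<longleftrightarrow>
     continuous_into (H_space 1) {0..T} u \<and>
     L2_into (H_space 2) 0 T u \<and>
     eq_field (u 0) u0 \<and>
     (\<exists>v. weak_time_deriv L2_space 0 T u v \<and> L2_into L2_space 0 T v \<and>
        (AE t in lebesgue_on {0<..<T}. \<exists>w l. weak_curl (u t) w \<and> weak_laplacian (u t) l \<and>
           eq_field (\<lambda>x. v t x + cross3 (w x) (u t x)) (\<lambda>x. \<nu> *\<^sub>R l x + f t x)))"

text \<open>
  The regularity of a classical solution on \<open>[a, b]\<close>; as \<open>u t\<close> is only determined almost everywhere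
  in space, it is required of a representative.
\<close>

definition classical_regularity :: "real \<Rightarrow> real \<Rightarrow> (real \<Rightarrow> field) \<Rightarrow> bool" where
  "classical_regularity a b u \<longleftrightarrow> (\<exists>v. (\<forall>t\<in>{a..b}. eq_field (v t) (u t)) \<and>
     continuous_into (C_space 2) {a..b} v \<and> C1_into (C_space 0) {a..b} v)"

end

theory Submission
  imports Defs "HOL-Library.Nat_Bijection"
begin

text \<open>
  Everything happens on the Fourier side. The coefficients of \<open>u\<close> are absolutely continuous in time and
  solve a system of ordinary differential equations whose nonlinear part is a convolution. Testing this
  system with the weight \<open>J k ^ (n + 1) * min (J k) R\<close>, where \<open>J k = 1 + |k|\<^sup>2\<close>, gives an energy estimate.
  The truncation makes the sums finite, but the weight \<open>J k ^ n * min (J k) R\<close> of the nonlinear term is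
  quasi-subadditive uniformly in \<open>R\<close>, so that Gronwall's inequality, with the integrable function
  \<open>\<parallel>u(t)\<parallel>\<^sup>2\<close> in \<open>H\<^sup>2\<close>, yields a bound which survives \<open>R \<rightarrow> \<infinity>\<close>. Each such step gains one derivative, and by the
  dissipation its initial value is finite at almost every time.

  The equation expresses \<open>\<partial>\<^sub>t u\<close> by quantities that are absolutely continuous in time, which gives
  \<open>\<partial>\<^sub>t\<^sup>2 u\<close> in \<open>L\<^sup>2 H\<^sup>2\<close>. Classical regularity follows because fields whose coefficients lie in
  a weighted \<open>l\<^sup>1\<close> may be differentiated term by term, and because absolute continuity in time of the
  coefficients with square integrable derivative makes the weighted norms Hoelder continuous in time.
\<close>

section \<open>Weighted sums over the lattice\<close>

text \<open>No cancellation in the nonlinear term is exploited; it is absorbed by size alone. The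
  assumption L^2 H^2 is just strong enough for that: in three dimensions the sum of J^(-2)
  converges, so H^2 controls the sum of all coefficients, and in the convolution estimate one factor
  is always measured in H^2 while the other is measured in the very energy under consideration. The
  differential inequality is therefore linear in the energy, with an integrable coefficient.

  A sharp frequency cut-off would not do as a weight. A mode k below the cut-off is fed by pairs j
  and k - j that both lie above it, where the cut-off weight vanishes, so the nonlinear term could
  not be bounded by the truncated energy. The weight with \<open>min (J k) R\<close> loses only one
  factor J to the truncation; finiteness of the truncated energy then follows from the regularity
  reached one step earlier.

  The Bochner spaces and weak time derivatives of the statement have to be translated into
  properties of single coefficients and back. Separability of H^s, in the form of an enumeration of
  trigonometric polynomials, and uniqueness of Fourier coefficients carry this translation.\<close>

abbreviation lattice :: "(int^3) measure" where
  "lattice \<equiv> count_space UNIV"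

definition J :: "int^3 \<Rightarrow> real" where
  "J k = 1 + (norm (wave_vector k))\<^sup>2"

text \<open>With \<open>w = J ^ s\<close> and the coefficients of a field for \<open>c\<close> this
  is the squared H^s norm. Values in \<open>ennreal\<close> make finiteness a separate statement, so
  sums and time integrals can be exchanged before anything is known to be finite.\<close>

definition wsum :: "(int^3 \<Rightarrow> real) \<Rightarrow> (int^3 \<Rightarrow> 'a::real_normed_vector) \<Rightarrow> ennreal" where
  "wsum w c = (\<integral>\<^sup>+k. ennreal (w k * (norm (c k))\<^sup>2) \<partial>lattice)"

lemma J_ge_1: "1 \<le> J k"
  by (simp add: J_def)

lemma J_pos [simp]: "0 < J k"
  using J_ge_1[of k] by linarith

lemma J_nonneg [simp]: "0 \<le> J k"
  using J_pos[of k] by linarith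

lemma J_nz [simp]: "J k \<noteq> 0"
  using J_pos[of k] by linarith

lemma wave_vector_add: "wave_vector (j + k) = wave_vector j + wave_vector k"
  by (simp add: wave_vector_def vec_eq_iff)

lemma wave_vector_minus: "wave_vector (- k) = - wave_vector k"
  by (simp add: wave_vector_def vec_eq_iff)

lemma wave_vector_zero [simp]: "wave_vector 0 = 0"
  by (simp add: wave_vector_def vec_eq_iff)

lemma J_minus [simp]: "J (- k) = J k"
  by (simp add: J_def wave_vector_minus)

lemma J_triangle: "J k \<le> 2 * J j + 2 * J (k - j)"
proof -
  have "norm (wave_vector k) \<le> norm (wave_vector j) + norm (wave_vector (k - j))"
    by (metis norm_triangle_ineq wave_vector_add add_diff_cancel_left' diff_add_cancel add.commute)
  then have "(norm (wave_vector k))\<^sup>2 \<le> (norm (wave_vector j) + norm (wave_vector (k - j)))\<^sup>2"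
    by (intro power_mono) auto
  also have "\<dots> \<le> 2 * ((norm (wave_vector j))\<^sup>2 + (norm (wave_vector (k - j)))\<^sup>2)"
    by (smt (verit) sum_squares_bound power2_sum)
  finally show ?thesis by (simp add: J_def)
qed

lemma norm_wave_le: "norm (wave_vector k) \<le> sqrt (J k)"
  by (rule real_le_rsqrt) (simp add: J_def)

lemma norm_wave_sq: "(norm (wave_vector k))\<^sup>2 = (\<Sum>i\<in>UNIV. (real_of_int (k $ i))\<^sup>2)"
  by (simp add: norm_vec_def L2_set_def wave_vector_def sum_nonneg)

section \<open>Exchange and translation of lattice sums, convergence of the sum of J^(-2)\<close>

lemma lattice_swap:
  fixes f :: "int^3 \<Rightarrow> int^3 \<Rightarrow> ennreal"
  shows "(\<integral>\<^sup>+k. \<integral>\<^sup>+j. f k j \<partial>lattice \<partial>lattice) = (\<integral>\<^sup>+j. \<integral>\<^sup>+k. f k j \<partial>lattice \<partial>lattice)"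
  by (rule nn_integral_count_space_nn_integral) auto

lemma lattice_shift: "(\<integral>\<^sup>+k. f (k - j) \<partial>lattice) = (\<integral>\<^sup>+k. f k \<partial>lattice)" for f :: "int^3 \<Rightarrow> ennreal"
  by (rule nn_integral_bij_count_space) (rule bij_betw_byWitness[where f'="\<lambda>k. k + j"], auto)

lemma lattice_reflect: "(\<integral>\<^sup>+j. f (k - j) \<partial>lattice) = (\<integral>\<^sup>+j. f j \<partial>lattice)" for f :: "int^3 \<Rightarrow> ennreal"
  by (rule nn_integral_bij_count_space) (rule bij_betw_byWitness[where f'="\<lambda>j. k - j"], auto)

text \<open>The exponent is chosen so that three such factors multiply to a bound for J^(-2), while
  the terms still decay like |n|^(-4/3). The integers are enumerated by \<open>int_decode\<close>,
  whose n-th value has modulus about n/2.\<close>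

lemma int_sum_finite:
  "(\<integral>\<^sup>+n. ennreal ((1 + (real_of_int n)\<^sup>2) powr (-2/3)) \<partial>count_space (UNIV::int set)) < \<infinity>"
proof -
  let ?g = "\<lambda>n::int. (1 + (real_of_int n)\<^sup>2) powr (-2/3)"
  have dec: "real n / 2 \<le> 1 + \<bar>real_of_int (int_decode n)\<bar>" for n
  proof -
    have "n \<le> 2 * nat \<bar>int_decode n\<bar> + 2"
    proof -
      have "int_encode (int_decode n) \<le> 2 * nat \<bar>int_decode n\<bar> + 2"
        by (auto simp: int_encode_def sum_encode_def)
      then show ?thesis by simp
    qed
    then have "real n \<le> 2 * real (nat \<bar>int_decode n\<bar>) + 2" by linarith
    then show ?thesis by simp
  qed
  have sq: "(1 + x)\<^sup>2 \<le> 2 * (1 + x\<^sup>2)" for x :: real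
    using sum_squares_bound[of 1 x] by (simp add: power2_sum)
  have bnd: "?g (int_decode (Suc n)) \<le> 8 powr (2/3) * (real (Suc n)) powr (-4/3)" for n
  proof -
    let ?x = "\<bar>real_of_int (int_decode (Suc n))\<bar>"
    have "(real (Suc n) / 2)\<^sup>2 \<le> (1 + ?x)\<^sup>2"
      by (intro power_mono dec) auto
    also have "\<dots> \<le> 2 * (1 + ?x\<^sup>2)" by (rule sq)
    finally have *: "(real (Suc n))\<^sup>2 / 8 \<le> 1 + ?x\<^sup>2" by (simp add: power2_eq_square)
    have "?g (int_decode (Suc n)) = (1 + ?x\<^sup>2) powr (-2/3)" by simp
    also have "\<dots> \<le> ((real (Suc n))\<^sup>2 / 8) powr (-2/3)"
      using * by (intro powr_mono2') auto
    also have "\<dots> = 8 powr (2/3) * ((real (Suc n)) powr 2) powr (-2/3)"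
      by (simp add: powr_divide powr_minus_divide field_simps del: of_nat_Suc)
    also have "\<dots> = 8 powr (2/3) * (real (Suc n)) powr (-4/3)"
      by (simp only: powr_powr) simp
    finally show ?thesis .
  qed
  have "summable (\<lambda>n. 8 powr (2/3) * (real (Suc n)) powr (-4/3))"
    by (intro summable_mult) (subst summable_Suc_iff, simp add: summable_real_powr_iff)
  then have "summable (\<lambda>n. ?g (int_decode (Suc n)))"
    by (rule summable_comparison_test'[where N=0]) (use bnd in auto)
  then have s: "summable (\<lambda>n. ?g (int_decode n))" by (subst (asm) summable_Suc_iff)
  have "(\<integral>\<^sup>+n. ennreal (?g n) \<partial>count_space UNIV) = (\<integral>\<^sup>+n. ennreal (?g (int_decode n)) \<partial>count_space UNIV)"
    by (rule nn_integral_bij_count_space[symmetric]) (simp add: bij_int_decode)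
  also have "\<dots> = (\<Sum>n. ennreal (?g (int_decode n)))"
    by (rule nn_integral_count_space_nat)
  also have "\<dots> = ennreal (\<Sum>n. ?g (int_decode n))"
    using s by (intro suminf_ennreal2) auto
  finally show ?thesis by simp
qed

definition Jsum :: real where "Jsum = enn2real (\<integral>\<^sup>+k. ennreal (1 / (J k)\<^sup>2) \<partial>lattice)"

text \<open>J dominates 1 plus the square of each single coordinate of k. Split into three equal
  powers, J^(-2) is therefore at most a product of one-dimensional weights, and the sum
  factorises.\<close>

lemma Jsum: "(\<integral>\<^sup>+k. ennreal (1 / (J k)\<^sup>2) \<partial>lattice) = ennreal Jsum"
proof -
  let ?g = "\<lambda>n::int. (1 + (real_of_int n)\<^sup>2) powr (-2/3)"
  let ?G = "\<integral>\<^sup>+n. ennreal (?g n) \<partial>count_space UNIV"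
  have bnd: "1 / (J k)\<^sup>2 \<le> ?g (k$1) * ?g (k$2) * ?g (k$3)" for k
  proof -
    have *: "J k powr (-2/3) \<le> ?g (k$i)" for i
    proof -
      have "(real_of_int (k$i))\<^sup>2 \<le> (\<Sum>i\<in>UNIV. (real_of_int (k $ i))\<^sup>2)"
        by (rule member_le_sum) auto
      then have "1 + (real_of_int (k$i))\<^sup>2 \<le> J k" by (simp add: J_def norm_wave_sq)
      then show ?thesis by (intro powr_mono2') (auto simp: add_pos_nonneg)
    qed
    have "1 / (J k)\<^sup>2 = J k powr (-2/3) * J k powr (-2/3) * J k powr (-2/3)"
      by (simp add: powr_add[symmetric] powr_minus_divide)
    also have "\<dots> \<le> ?g (k$1) * ?g (k$2) * ?g (k$3)"
      by (intro mult_mono *) auto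
    finally show ?thesis .
  qed
  let ?v = "\<lambda>(a::int, b::int, c::int). (vector [a,b,c] :: int^3)"
  have bij: "bij_betw ?v UNIV UNIV"
    by (rule bij_betw_byWitness[where f'="\<lambda>k. (k$1,k$2,k$3)"])
       (auto simp: vec_eq_iff forall_3)
  have "(\<integral>\<^sup>+k. ennreal (1 / (J k)\<^sup>2) \<partial>lattice) \<le> (\<integral>\<^sup>+k. ennreal (?g (k$1) * ?g (k$2) * ?g (k$3)) \<partial>lattice)"
    by (intro nn_integral_mono ennreal_leI bnd)
  also have "\<dots> = (\<integral>\<^sup>+p. ennreal (?g (?v p $1) * ?g (?v p $2) * ?g (?v p $3)) \<partial>count_space UNIV)"
    by (rule nn_integral_bij_count_space[OF bij, symmetric])
  also have "\<dots> = (\<integral>\<^sup>+a. \<integral>\<^sup>+b. \<integral>\<^sup>+c. ennreal (?g a * ?g b * ?g c) \<partial>count_space UNIV \<partial>count_space UNIV \<partial>count_space UNIV)"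
    by (simp add: nn_integral_fst_count_space[where f="\<lambda>(a,b). f a b" for f, simplified, symmetric]
        nn_integral_fst_count_space[symmetric])
  also have "\<dots> = (\<integral>\<^sup>+a. \<integral>\<^sup>+b. ennreal (?g a) * ennreal (?g b) * ?G \<partial>count_space UNIV \<partial>count_space UNIV)"
    by (simp add: ennreal_mult' nn_integral_cmult)
  also have "\<dots> = ?G * ?G * ?G"
    by (simp add: nn_integral_multc mult.assoc nn_integral_cmult)
  finally have "(\<integral>\<^sup>+k. ennreal (1 / (J k)\<^sup>2) \<partial>lattice) \<le> ?G * ?G * ?G" .
  also have "\<dots> < \<infinity>" using int_sum_finite by (simp add: ennreal_mult_less_top)
  finally show ?thesis by (simp add: Jsum_def)
qed

lemma Jsum_nonneg [simp]: "0 \<le> Jsum" by (simp add: Jsum_def)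

text \<open>Cauchy--Schwarz with the weight \<open>G\<close> below; in both resulting terms the sum over \<open>1/G\<close>
  reduces to the convergent sum of \<open>1/J\<^sup>2\<close>.\<close>

lemma weighted_convolution_bound:
  fixes p b :: "int^3 \<Rightarrow> real" and \<Omega> :: "int^3 \<Rightarrow> real" and K :: real
  assumes p: "\<And>k. 0 \<le> p k" and b: "\<And>k. 0 \<le> b k" and \<Omega>: "\<And>k. 0 < \<Omega> k" and K: "0 \<le> K"
    and sub: "\<And>k j. \<Omega> k \<le> K * (\<Omega> j + \<Omega> (k - j))"
  shows "(\<integral>\<^sup>+k. ennreal (\<Omega> k) * (\<integral>\<^sup>+j. ennreal (p j * b (k - j)) \<partial>lattice)\<^sup>2 \<partial>lattice)
    \<le> ennreal (2 * K * Jsum) * (wsum \<Omega> p * wsum (\<lambda>k. (J k)\<^sup>2) b + wsum J p * wsum (\<lambda>k. \<Omega> k * J k) b)"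
proof -
  \<comment> \<open>Summing \<open>(p j)\<^sup>2 * (b (k - j))\<^sup>2 * G k j\<close> over k and j
    yields exactly the two products of the claim, while \<open>\<Omega> j / G k j\<close> and
    \<open>\<Omega> (k - j) / G k j\<close> are at most inverse products of two values of J.\<close>
  define G where "G k j = (J (k - j))\<^sup>2 * \<Omega> j + J j * J (k - j) * \<Omega> (k - j)" for k j
  have G: "0 < G k j" for k j
    unfolding G_def by (intro add_pos_pos mult_pos_pos) (auto simp: \<Omega>)
  have split: "ennreal (K * (3/2 * x + 1/2 * y)) = ennreal K * (ennreal (3/2) * ennreal x + ennreal (1/2) * ennreal y)"
    if "0 \<le> x" "0 \<le> y" for x y
  proof -
    have "ennreal (K * (3/2 * x + 1/2 * y)) = ennreal K * ennreal (3/2 * x + 1/2 * y)"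
      using K that by (intro ennreal_mult) auto
    also have "ennreal (3/2 * x + 1/2 * y) = ennreal (3/2 * x) + ennreal (1/2 * y)"
      using that by (intro ennreal_plus) auto
    finally show ?thesis using that by (simp only: ennreal_mult)
  qed
  have one: "ennreal (\<Omega> k) * (\<integral>\<^sup>+j. ennreal (1 / G k j) \<partial>lattice) \<le> ennreal (2 * K * Jsum)" for k
  proof -
    \<comment> \<open>The mixed term 1 / (J j * J (k - j)) is split by the arithmetic-geometric mean
      inequality, whence 3/2 and 1/2. After summation over j both parts are multiples of
      \<open>Jsum\<close>, and 3/2 + 1/2 is the factor 2 of the claim.\<close>
    have *: "\<Omega> k * (1 / G k j) \<le> K * (3/2 * (1 / (J (k-j))\<^sup>2) + 1/2 * (1 / (J j)\<^sup>2))" for j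
    proof -
      have "\<Omega> j / G k j \<le> 1 / (J (k-j))\<^sup>2"
        using G[of k j] \<Omega>[of j] \<Omega>[of "k-j"] by (simp add: field_simps) (simp add: G_def field_simps)
      moreover have "\<Omega> (k-j) / G k j \<le> 1 / (J j * J (k-j))"
        using G[of k j] \<Omega>[of j] \<Omega>[of "k-j"] by (simp add: field_simps) (simp add: G_def field_simps power2_eq_square)
      moreover have "1 / (J j * J (k-j)) \<le> 1/2 * (1 / (J (k-j))\<^sup>2) + 1/2 * (1 / (J j)\<^sup>2)"
        using sum_squares_bound[of "1 / J j" "1 / J (k-j)"] by (simp add: power_divide)
      ultimately have "\<Omega> j / G k j + \<Omega> (k-j) / G k j \<le> 3/2 * (1 / (J (k-j))\<^sup>2) + 1/2 * (1 / (J j)\<^sup>2)"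
        by linarith
      then have "K * (\<Omega> j / G k j + \<Omega> (k-j) / G k j) \<le> K * (3/2 * (1 / (J (k-j))\<^sup>2) + 1/2 * (1 / (J j)\<^sup>2))"
        using K by (intro mult_left_mono)
      moreover have "\<Omega> k * (1 / G k j) \<le> K * (\<Omega> j + \<Omega> (k - j)) * (1 / G k j)"
        using G[of k j] by (intro mult_right_mono sub) auto
      ultimately show ?thesis by (simp add: add_divide_distrib algebra_simps)
    qed
    have "ennreal (\<Omega> k) * (\<integral>\<^sup>+j. ennreal (1 / G k j) \<partial>lattice) = (\<integral>\<^sup>+j. ennreal (\<Omega> k * (1 / G k j)) \<partial>lattice)"
      using \<Omega>[of k] G by (subst nn_integral_cmult[symmetric]) (auto simp: ennreal_mult'[symmetric] less_imp_le)
    also have "\<dots> \<le> (\<integral>\<^sup>+j. ennreal (K * (3/2 * (1 / (J (k-j))\<^sup>2) + 1/2 * (1 / (J j)\<^sup>2))) \<partial>lattice)"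
      by (intro nn_integral_mono ennreal_leI *)
    also have "\<dots> = (\<integral>\<^sup>+j. ennreal K * (ennreal (3/2) * ennreal (1 / (J (k-j))\<^sup>2) + ennreal (1/2) * ennreal (1 / (J j)\<^sup>2)) \<partial>lattice)"
    proof (rule nn_integral_cong)
      show "ennreal (K * (3/2 * (1 / (J (k-j))\<^sup>2) + 1/2 * (1 / (J j)\<^sup>2))) = ennreal K * (ennreal (3/2) * ennreal (1 / (J (k-j))\<^sup>2) + ennreal (1/2) * ennreal (1 / (J j)\<^sup>2))" for j
        by (rule split) auto
    qed
    also have "\<dots> = ennreal K * (ennreal (3/2) * (\<integral>\<^sup>+j. ennreal (1 / (J (k-j))\<^sup>2) \<partial>lattice) + ennreal (1/2) * (\<integral>\<^sup>+j. ennreal (1 / (J j)\<^sup>2) \<partial>lattice))"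
      by (simp add: nn_integral_cmult nn_integral_add)
    also have "\<dots> = ennreal K * (ennreal (3/2) * ennreal Jsum + ennreal (1/2) * ennreal Jsum)"
      by (subst lattice_reflect[where f="\<lambda>j. ennreal (1 / (J j)\<^sup>2)"]) (simp only: Jsum)
    also have "\<dots> = ennreal (2 * K * Jsum)"
      by (subst split[symmetric]) (auto simp: field_simps)
    finally show ?thesis .
  qed
  have two: "ennreal (\<Omega> k) * (\<integral>\<^sup>+j. ennreal (p j * b (k - j)) \<partial>lattice)\<^sup>2
     \<le> ennreal (2 * K * Jsum) * (\<integral>\<^sup>+j. ennreal ((p j)\<^sup>2 * (b (k-j))\<^sup>2 * G k j) \<partial>lattice)" for k
  proof -
    have "(\<integral>\<^sup>+j. ennreal (p j * b (k - j)) \<partial>lattice) = (\<integral>\<^sup>+j. ennreal (sqrt (1 / G k j)) * ennreal (p j * b (k - j) * sqrt (G k j)) \<partial>lattice)"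
    proof (rule nn_integral_cong)
      fix j
      have e: "sqrt (1 / G k j) * (p j * b (k - j) * sqrt (G k j)) = p j * b (k - j)"
        using G[of k j] by (simp add: real_sqrt_divide)
      have "ennreal (sqrt (1 / G k j)) * ennreal (p j * b (k - j) * sqrt (G k j))
          = ennreal (sqrt (1 / G k j) * (p j * b (k - j) * sqrt (G k j)))"
        using G[of k j] by (intro ennreal_mult'[symmetric]) (simp add: less_imp_le)
      then show "ennreal (p j * b (k - j)) = ennreal (sqrt (1 / G k j)) * ennreal (p j * b (k - j) * sqrt (G k j))"
        by (simp only: e)
    qed
    also have "(\<dots>)\<^sup>2 \<le> (\<integral>\<^sup>+j. (ennreal (sqrt (1 / G k j)))\<^sup>2 \<partial>lattice) * (\<integral>\<^sup>+j. (ennreal (p j * b (k - j) * sqrt (G k j)))\<^sup>2 \<partial>lattice)"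
      by (rule Cauchy_Schwarz_nn_integral) auto
    also have "\<dots> = (\<integral>\<^sup>+j. ennreal (1 / G k j) \<partial>lattice) * (\<integral>\<^sup>+j. ennreal ((p j)\<^sup>2 * (b (k-j))\<^sup>2 * G k j) \<partial>lattice)"
      using G p b by (simp add: ennreal_power less_imp_le power_mult_distrib)
    finally have "ennreal (\<Omega> k) * (\<integral>\<^sup>+j. ennreal (p j * b (k - j)) \<partial>lattice)\<^sup>2 \<le>
       ennreal (\<Omega> k) * ((\<integral>\<^sup>+j. ennreal (1 / G k j) \<partial>lattice) * (\<integral>\<^sup>+j. ennreal ((p j)\<^sup>2 * (b (k-j))\<^sup>2 * G k j) \<partial>lattice))"
      by (rule mult_left_mono) auto
    also have "\<dots> \<le> ennreal (2 * K * Jsum) * (\<integral>\<^sup>+j. ennreal ((p j)\<^sup>2 * (b (k-j))\<^sup>2 * G k j) \<partial>lattice)"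
      using one[of k] by (subst mult.assoc[symmetric], intro mult_right_mono) auto
    finally show ?thesis .
  qed
  have "(\<integral>\<^sup>+k. ennreal (\<Omega> k) * (\<integral>\<^sup>+j. ennreal (p j * b (k - j)) \<partial>lattice)\<^sup>2 \<partial>lattice)
    \<le> (\<integral>\<^sup>+k. ennreal (2 * K * Jsum) * (\<integral>\<^sup>+j. ennreal ((p j)\<^sup>2 * (b (k-j))\<^sup>2 * G k j) \<partial>lattice) \<partial>lattice)"
    by (intro nn_integral_mono two)
  also have "\<dots> = ennreal (2 * K * Jsum) * (\<integral>\<^sup>+j. \<integral>\<^sup>+k. ennreal ((p j)\<^sup>2 * (b (k-j))\<^sup>2 * G k j) \<partial>lattice \<partial>lattice)"
    by (subst lattice_swap[symmetric]) (simp add: nn_integral_cmult)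
  also have "(\<integral>\<^sup>+j. \<integral>\<^sup>+k. ennreal ((p j)\<^sup>2 * (b (k-j))\<^sup>2 * G k j) \<partial>lattice \<partial>lattice)
     = (\<integral>\<^sup>+j. (ennreal (\<Omega> j * (p j)\<^sup>2) * wsum (\<lambda>k. (J k)\<^sup>2) b + ennreal (J j * (p j)\<^sup>2) * wsum (\<lambda>k. \<Omega> k * J k) b) \<partial>lattice)"
  proof (rule nn_integral_cong)
    fix j
    have "(\<integral>\<^sup>+k. ennreal ((p j)\<^sup>2 * (b (k-j))\<^sup>2 * G k j) \<partial>lattice)
      = (\<integral>\<^sup>+k. ennreal (\<Omega> j * (p j)\<^sup>2) * ennreal ((J (k-j))\<^sup>2 * (norm (b (k-j)))\<^sup>2) + ennreal (J j * (p j)\<^sup>2) * ennreal (\<Omega> (k-j) * J (k-j) * (norm (b (k-j)))\<^sup>2) \<partial>lattice)"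
      unfolding G_def using \<Omega>
      by (intro nn_integral_cong, subst (1 2) ennreal_mult[symmetric])
         (auto simp: ennreal_plus[symmetric] less_imp_le algebra_simps simp del: ennreal_plus)
    also have "\<dots> = (\<integral>\<^sup>+k. ennreal (\<Omega> j * (p j)\<^sup>2) * ennreal ((J k)\<^sup>2 * (norm (b k))\<^sup>2) + ennreal (J j * (p j)\<^sup>2) * ennreal (\<Omega> k * J k * (norm (b k))\<^sup>2) \<partial>lattice)"
      by (rule lattice_shift)
    finally show "(\<integral>\<^sup>+k. ennreal ((p j)\<^sup>2 * (b (k-j))\<^sup>2 * G k j) \<partial>lattice)
      = ennreal (\<Omega> j * (p j)\<^sup>2) * wsum (\<lambda>k. (J k)\<^sup>2) b + ennreal (J j * (p j)\<^sup>2) * wsum (\<lambda>k. \<Omega> k * J k) b"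
      by (simp add: wsum_def nn_integral_add nn_integral_cmult)
  qed
  also have "\<dots> = wsum \<Omega> p * wsum (\<lambda>k. (J k)\<^sup>2) b + wsum J p * wsum (\<lambda>k. \<Omega> k * J k) b"
    by (simp add: wsum_def nn_integral_add nn_integral_multc)
  finally show ?thesis .
qed

text \<open>The sequence \<open>a\<close> is differentiated once, which is the factor
  \<open>sqrt (J j)\<close>; moved into the first factor of the convolution it adds one power of J
  to the squared sums. The bound on \<open>N\<close> is a hypothesis and not a definition because
  the energy estimate takes for \<open>N\<close> the residual of the coefficient equation, which
  equals the convolution only at almost every time.\<close>

lemma wsum_convolution:
  fixes a :: "int^3 \<Rightarrow> 'a::real_normed_vector" and b :: "int^3 \<Rightarrow> 'b::real_normed_vector"
    and N :: "int^3 \<Rightarrow> 'c::real_normed_vector"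
  assumes N: "\<And>k. ennreal (norm (N k)) \<le> ennreal C * (\<integral>\<^sup>+j. ennreal (sqrt (J j) * norm (a j) * norm (b (k - j))) \<partial>lattice)"
    and \<Omega>: "\<And>k. 0 < \<Omega> k" and K: "0 \<le> K" and sub: "\<And>k j. \<Omega> k \<le> K * (\<Omega> j + \<Omega> (k - j))"
    and C: "0 \<le> C"
  shows "wsum \<Omega> N \<le> ennreal (2 * K * Jsum * C\<^sup>2) *
     (wsum (\<lambda>k. \<Omega> k * J k) a * wsum (\<lambda>k. (J k)\<^sup>2) b + wsum (\<lambda>k. (J k)\<^sup>2) a * wsum (\<lambda>k. \<Omega> k * J k) b)"
proof -
  let ?p = "\<lambda>k. sqrt (J k) * norm (a k)" and ?b = "\<lambda>k. norm (b k)"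
  have "wsum \<Omega> N = (\<integral>\<^sup>+k. ennreal (\<Omega> k) * (ennreal (norm (N k)))\<^sup>2 \<partial>lattice)"
    unfolding wsum_def using \<Omega> by (intro nn_integral_cong) (simp add: ennreal_mult'' ennreal_power)
  also have "\<dots> \<le> (\<integral>\<^sup>+k. ennreal (\<Omega> k) * (ennreal C * (\<integral>\<^sup>+j. ennreal (?p j * ?b (k - j)) \<partial>lattice))\<^sup>2 \<partial>lattice)"
    by (intro nn_integral_mono mult_left_mono power_mono N) auto
  also have "\<dots> = ennreal (C\<^sup>2) * (\<integral>\<^sup>+k. ennreal (\<Omega> k) * (\<integral>\<^sup>+j. ennreal (?p j * ?b (k - j)) \<partial>lattice)\<^sup>2 \<partial>lattice)"
    using C by (subst nn_integral_cmult[symmetric], simp)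
       (intro nn_integral_cong, simp add: power_mult_distrib ennreal_power mult.left_commute)
  also have "\<dots> \<le> ennreal (C\<^sup>2) * (ennreal (2 * K * Jsum) * (wsum \<Omega> ?p * wsum (\<lambda>k. (J k)\<^sup>2) ?b + wsum J ?p * wsum (\<lambda>k. \<Omega> k * J k) ?b))"
    by (intro mult_left_mono weighted_convolution_bound \<Omega> K sub) auto
  also have "\<dots> = ennreal (2 * K * Jsum * C\<^sup>2) * (wsum \<Omega> ?p * wsum (\<lambda>k. (J k)\<^sup>2) ?b + wsum J ?p * wsum (\<lambda>k. \<Omega> k * J k) ?b)"
    using K by (subst mult.assoc[symmetric], subst ennreal_mult[symmetric]) (auto simp: mult.commute)
  also have "wsum \<Omega> ?p = wsum (\<lambda>k. \<Omega> k * J k) a" by (simp add: wsum_def power_mult_distrib mult.assoc)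
  also have "wsum J ?p = wsum (\<lambda>k. (J k)\<^sup>2) a" by (simp add: wsum_def power_mult_distrib mult.assoc[symmetric]) (simp add: power2_eq_square)
  also have "wsum (\<lambda>k. (J k)\<^sup>2) ?b = wsum (\<lambda>k. (J k)\<^sup>2) b" by (simp add: wsum_def)
  also have "wsum (\<lambda>k. \<Omega> k * J k) ?b = wsum (\<lambda>k. \<Omega> k * J k) b" by (simp add: wsum_def)
  finally show ?thesis .
qed

text \<open>By the triangle inequality \<open>J k\<close> is at most four times the larger one of \<open>J j\<close> and \<open>J (k - j)\<close>.\<close>

lemma truncated_weight:
  fixes R :: real
  assumes R: "1 \<le> R"
  shows "min (J k) R * J k ^ n \<le> 4 ^ Suc n * (min (J j) R * J j ^ n + min (J (k - j)) R * J (k - j) ^ n)"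
proof -
  have *: "min (J k) R * J k ^ n \<le> 4 ^ Suc n * (min (J l) R * J l ^ n)" if "J k \<le> 4 * J l" for l
  proof -
    have "min (J k) R * J k ^ n \<le> (4 * min (J l) R) * (4 * J l) ^ n"
      using that R by (intro mult_mono power_mono) (auto simp: min_def)
    then show ?thesis by (simp add: power_mult_distrib ac_simps)
  qed
  have nn: "0 \<le> min (J l) R * J l ^ n" for l using R by (simp add: min_def)
  show ?thesis
  proof (cases "J j \<le> J (k - j)")
    case True
    then have "J k \<le> 4 * J (k - j)" using J_triangle[of k j] by linarith
    from *[OF this] nn[of j] show ?thesis
      by (smt (verit, ccfv_SIG) distrib_left mult_nonneg_nonneg zero_le_power)
  next
    case False
    then have "J k \<le> 4 * J j" using J_triangle[of k j] by linarith
    from *[OF this] nn[of "k-j"] show ?thesis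
      by (smt (verit, ccfv_SIG) distrib_left mult_nonneg_nonneg zero_le_power)
  qed
qed

text \<open>The untruncated counterpart of the preceding inequality, for convolutions of sequences
  whose regularity is already established.\<close>

lemma power_weight: "J k ^ n \<le> 4 ^ n * (J j ^ n + J (k - j) ^ n)"
proof -
  have *: "J k ^ n \<le> 4 ^ n * J l ^ n" if "J k \<le> 4 * J l" for l
    using power_mono[OF that, of n] by (simp add: power_mult_distrib)
  show ?thesis
  proof (cases "J j \<le> J (k - j)")
    case True
    then have "J k \<le> 4 * J (k - j)" using J_triangle[of k j] by linarith
    from *[OF this] show ?thesis
      by (smt (verit, ccfv_SIG) distrib_left mult_nonneg_nonneg zero_le_power J_nonneg)
  next
    case False
    then have "J k \<le> 4 * J j" using J_triangle[of k j] by linarith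
    from *[OF this] show ?thesis
      by (smt (verit, ccfv_SIG) distrib_left mult_nonneg_nonneg zero_le_power J_nonneg)
  qed
qed

section \<open>Uniqueness of Fourier coefficients\<close>

definition char :: "int^3 \<Rightarrow> real^3 \<Rightarrow> complex" where
  "char k x = cis (wave_vector k \<bullet> x)"

lemma char_add: "char (j + k) x = char j x * char k x"
  by (simp add: char_def wave_vector_add inner_add_left cis_mult)

lemma char_zero [simp]: "char 0 x = 1" by (simp add: char_def)

lemma norm_char [simp]: "norm (char k x) = 1" by (simp add: char_def)

lemma cnj_char: "cnj (char k x) = char (- k) x"
  by (simp add: char_def wave_vector_minus cis_cnj)

lemma cis_minus_wave: "cis (- (wave_vector k \<bullet> x)) = char (- k) x"
  by (simp add: char_def wave_vector_minus)

lemma continuous_char [continuous_intros]: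
  "continuous_on S g \<Longrightarrow> continuous_on S (\<lambda>x. char k (g x))"
  unfolding char_def by (intro continuous_intros)

lemma char_borel [measurable]: "char k \<in> borel_measurable borel"
  by (intro borel_measurable_continuous_onI continuous_intros)

lemma wave_vector_axis: "wave_vector (axis i n) \<bullet> x = real_of_int n * x $ i"
proof -
  have "wave_vector (axis i n) = axis i (real_of_int n)"
    by (simp add: wave_vector_def axis_def vec_eq_iff)
  then show ?thesis by (simp add: inner_axis' )
qed

lemma char_axis: "char (axis i n) x = cis (real_of_int n * x $ i)"
  by (simp add: char_def wave_vector_axis)

lemma char_periodic: "char k (x + axis i (2 * pi)) = char k x"
proof -
  have "wave_vector k \<bullet> axis i (2 * pi) = 2 * pi * real_of_int (k $ i)"
    by (simp add: inner_axis wave_vector_def)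
  then show ?thesis by (simp add: char_def inner_add_right cis_mult[symmetric])
qed

section \<open>The torus as a finite measure space\<close>

lemma space_torus [simp]: "space torus = cbox 0 (\<chi> i. 2 * pi)"
  by (simp add: torus_def)

lemma emeasure_torus: "emeasure torus (space torus) = ennreal ((2 * pi) ^ 3)"
proof -
  have "emeasure torus (space torus) = emeasure lebesgue (cbox 0 (\<chi> i. 2 * pi) :: (real^3) set)"
    by (simp add: torus_def emeasure_restrict_space)
  also have "\<dots> = ennreal ((2 * pi) ^ 3)"
  proof -
    have "(\<Prod>b\<in>(Basis::(real^3) set). ((\<chi> i. 2 * pi) - 0) \<bullet> b) = (\<Prod>b\<in>(Basis::(real^3) set). 2 * pi)"
      by (rule prod.cong) (auto simp: Basis_vec_def inner_axis)
    also have "\<dots> = (2 * pi) ^ 3" by simp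
    finally show ?thesis
      by (subst emeasure_completion) (auto simp: emeasure_lborel_cbox_eq Basis_vec_def inner_axis)
  qed
  finally show ?thesis .
qed

lemma finite_measure_torus: "finite_measure torus"
  by (rule finite_measureI) (simp only: emeasure_torus, simp)

interpretation torus: finite_measure torus by (rule finite_measure_torus)

lemma measure_torus: "measure torus (space torus) = (2 * pi) ^ 3"
  using emeasure_torus by (simp add: measure_def)

lemma borel_torus [measurable (raw)]: "f \<in> borel_measurable borel \<Longrightarrow> f \<in> borel_measurable torus"
  unfolding torus_def by (intro measurable_restrict_space1) (simp add: measurable_completion)

section \<open>Completeness of the trigonometric system\<close>

lemma integrable_mult_char [simp]:
  fixes g :: "real^3 \<Rightarrow> complex"
  assumes "integrable torus g" shows "integrable torus (\<lambda>x. g x * char k x)"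
  by (rule Bochner_Integration.integrable_bound[OF assms]) (use assms in \<open>auto simp: norm_mult\<close>)

text \<open>Tested with \<open>char k\<close> instead of its conjugate, which is the same over all
  k. The point of singling out these functions is that they are stable under multiplication by
  characters.\<close>

definition fourier_null :: "(real^3 \<Rightarrow> complex) \<Rightarrow> bool" where
  "fourier_null g \<longleftrightarrow> integrable torus g \<and> (\<forall>k. (\<integral>x. g x * char k x \<partial>torus) = 0)"

lemma fourier_null_add:
  assumes "fourier_null g" "fourier_null h" shows "fourier_null (\<lambda>x. g x + h x)"
  using assms by (auto simp: fourier_null_def distrib_right)

lemma fourier_null_cmult:
  assumes "fourier_null g" shows "fourier_null (\<lambda>x. a * g x)"
  using assms by (auto simp: fourier_null_def mult.assoc)

lemma fourier_null_sum:
  assumes "\<And>i. i \<in> I \<Longrightarrow> fourier_null (g i)" shows "fourier_null (\<lambda>x. \<Sum>i\<in>I. g i x)"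
  using assms by (induction I rule: infinite_finite_induct) (auto intro: fourier_null_add, auto simp: fourier_null_def)

lemma fourier_null_char:
  assumes "fourier_null g" shows "fourier_null (\<lambda>x. g x * char k x)"
  using assms by (auto simp: fourier_null_def mult.assoc char_add[symmetric])

text \<open>Opposite faces of the cube are glued: the image is the torus as a compact subset of
  \<open>complex^3\<close>, and polynomials on it are trigonometric polynomials in x. This makes
  Stone-Weierstrass for polynomial functions applicable.\<close>

definition torus_point :: "real^3 \<Rightarrow> complex^3" where
  "torus_point x = (\<chi> i. cis (x $ i))"

lemma continuous_torus_point [continuous_intros]: "continuous_on S torus_point"
  unfolding torus_point_def by (intro continuous_intros)

lemma fourier_null_cos_sin:
  assumes "fourier_null g"
  shows "fourier_null (\<lambda>x. g x * complex_of_real (cos (x $ i)))"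
    and "fourier_null (\<lambda>x. g x * complex_of_real (sin (x $ i)))"
proof -
  have c: "complex_of_real (cos (x $ i)) = 1/2 * char (axis i 1) x + 1/2 * char (axis i (-1)) x" for x
    by (simp add: char_axis complex_eq_iff)
  have s: "complex_of_real (sin (x $ i)) = - \<i>/2 * char (axis i 1) x + \<i>/2 * char (axis i (-1)) x" for x
    by (simp add: char_axis complex_eq_iff)
  have "fourier_null (\<lambda>x. 1/2 * (g x * char (axis i 1) x) + 1/2 * (g x * char (axis i (-1)) x))"
    by (intro fourier_null_add fourier_null_cmult fourier_null_char assms)
  then show "fourier_null (\<lambda>x. g x * complex_of_real (cos (x $ i)))"
    unfolding c by (simp add: algebra_simps)
  have "fourier_null (\<lambda>x. - \<i>/2 * (g x * char (axis i 1) x) + \<i>/2 * (g x * char (axis i (-1)) x))"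
    by (intro fourier_null_add fourier_null_cmult fourier_null_char assms)
  then show "fourier_null (\<lambda>x. g x * complex_of_real (sin (x $ i)))"
    unfolding s by (simp add: algebra_simps)
qed

text \<open>A real-linear function of \<open>torus_point x\<close> is a combination of cosines and
  sines of the coordinates, hence of characters. \<open>g\<close> is left arbitrary in the induction
  so that a product of polynomials can be multiplied onto it one factor at a time.\<close>

lemma fourier_null_polynomial:
  assumes "real_polynomial_function p" "fourier_null g"
  shows "fourier_null (\<lambda>x. g x * complex_of_real (p (torus_point x)))"
  using assms
proof (induction p arbitrary: g rule: real_polynomial_function.induct)
  case (linear f)
  then interpret bounded_linear f by simp
  have *: "f (torus_point x) = (\<Sum>i\<in>UNIV. cos (x $ i) * f (axis i 1) + sin (x $ i) * f (axis i \<i>))" for x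
  proof -
    have "torus_point x = (\<Sum>i\<in>UNIV. cos (x $ i) *\<^sub>R axis i 1 + sin (x $ i) *\<^sub>R axis i \<i>)"
      by (simp add: torus_point_def vec_eq_iff axis_def complex_eq_iff if_distrib[where f="\<lambda>z. _ *\<^sub>R z"] if_distrib[where f=Re] if_distrib[where f=Im] cong: if_cong)
    then show ?thesis by (simp add: sum add scale)
  qed
  have "fourier_null (\<lambda>x. \<Sum>i\<in>UNIV. complex_of_real (f (axis i 1)) * (g x * complex_of_real (cos (x $ i)))
      + complex_of_real (f (axis i \<i>)) * (g x * complex_of_real (sin (x $ i))))"
    by (intro fourier_null_sum fourier_null_add fourier_null_cmult fourier_null_cos_sin linear.prems)
  then show ?case unfolding * by (simp add: sum_distrib_left algebra_simps)
next
  case (const c)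
  then show ?case using fourier_null_cmult[of g "complex_of_real c"] by (simp add: mult.commute)
next
  case (add p q)
  then show ?case using fourier_null_add[OF add.IH] by (simp add: algebra_simps)
next
  case (mult p q)
  show ?case using mult.IH(2)[OF mult.IH(1)[OF mult.prems]] by (simp add: mult.assoc)
qed

lemma compact_torus_points: "compact (torus_point ` cbox 0 (\<chi> i. 2 * pi))"
  by (intro compact_continuous_image continuous_intros compact_cbox)

text \<open>Polynomials approximate \<open>F\<close> uniformly on the compact image of the cube, and
  replacing \<open>F\<close> by such a polynomial changes the integral by at most e times the L^1
  norm of \<open>g\<close>.\<close>

lemma fourier_null_continuous:
  fixes F :: "complex^3 \<Rightarrow> real"
  assumes g: "fourier_null g" and F: "continuous_on UNIV F"
  shows "(\<integral>x. g x * complex_of_real (F (torus_point x)) \<partial>torus) = 0"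
proof -
  let ?S = "torus_point ` cbox 0 (\<chi> i. 2 * pi)"
  have gi: "integrable torus g" using g by (simp add: fourier_null_def)
  have tpm: "torus_point \<in> borel_measurable borel"
    by (intro borel_measurable_continuous_onI continuous_intros)
  have Fm: "(\<lambda>x. F (torus_point x)) \<in> borel_measurable torus"
    by (intro borel_torus measurable_compose[OF tpm] borel_measurable_continuous_onI F)
  have le: "norm (\<integral>x. g x * complex_of_real (F (torus_point x)) \<partial>torus) \<le> e * (\<integral>x. norm (g x) \<partial>torus)" if e: "e > 0" for e
  proof -
    obtain p where p: "polynomial_function p" "\<And>z. z \<in> ?S \<Longrightarrow> norm (F z - p z) < e"
      using Stone_Weierstrass_polynomial_function[OF compact_torus_points, of F e] F e
      by (metis continuous_on_subset subset_UNIV)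
    have n: "fourier_null (\<lambda>x. g x * complex_of_real (p (torus_point x)))"
      using p(1) g by (intro fourier_null_polynomial) (simp_all add: real_polynomial_function_eq)
    then have pi: "integrable torus (\<lambda>x. g x * complex_of_real (p (torus_point x)))"
      and p0: "(\<integral>x. g x * complex_of_real (p (torus_point x)) \<partial>torus) = 0"
      using spec[where x=0 and P="\<lambda>k. (\<integral>x. g x * complex_of_real (p (torus_point x)) * char k x \<partial>torus) = 0"]
      by (auto simp: fourier_null_def)
    have pm: "(\<lambda>x. p (torus_point x)) \<in> borel_measurable torus"
      by (intro borel_torus measurable_compose[OF tpm] borel_measurable_continuous_onI)
         (use p(1) in \<open>simp add: continuous_on_polymonial_function\<close>)
    have di: "integrable torus (\<lambda>x. g x * complex_of_real (F (torus_point x) - p (torus_point x)))"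
    proof (rule Bochner_Integration.integrable_bound)
      show "integrable torus (\<lambda>x. e *\<^sub>R g x)" using gi by simp
      show "(\<lambda>x. g x * complex_of_real (F (torus_point x) - p (torus_point x))) \<in> borel_measurable torus"
        using gi Fm pm by measurable
      show "AE x in torus. norm (g x * complex_of_real (F (torus_point x) - p (torus_point x))) \<le> norm (e *\<^sub>R g x)"
      proof (rule AE_I2)
        fix x assume "x \<in> space torus"
        then have "\<bar>F (torus_point x) - p (torus_point x)\<bar> \<le> e" using p(2)[of "torus_point x"] by force
        then show "norm (g x * complex_of_real (F (torus_point x) - p (torus_point x))) \<le> norm (e *\<^sub>R g x)"
          using e mult_right_mono[OF _ norm_ge_zero, of _ e "g x"] by (simp add: norm_mult mult.commute[of "norm (g x)"] del: of_real_diff)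
      qed
    qed
    have "(\<integral>x. g x * complex_of_real (F (torus_point x)) \<partial>torus)
       = (\<integral>x. g x * complex_of_real (F (torus_point x) - p (torus_point x)) + g x * complex_of_real (p (torus_point x)) \<partial>torus)"
      by (intro Bochner_Integration.integral_cong) (auto simp: algebra_simps)
    also have "\<dots> = (\<integral>x. g x * complex_of_real (F (torus_point x) - p (torus_point x)) \<partial>torus)"
      using di pi p0 by (subst Bochner_Integration.integral_add) auto
    finally have eq: "(\<integral>x. g x * complex_of_real (F (torus_point x)) \<partial>torus)
       = (\<integral>x. g x * complex_of_real (F (torus_point x) - p (torus_point x)) \<partial>torus)" .
    have "norm (\<integral>x. g x * complex_of_real (F (torus_point x)) \<partial>torus)
       \<le> (\<integral>x. norm (g x * complex_of_real (F (torus_point x) - p (torus_point x))) \<partial>torus)"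
      unfolding eq by (rule integral_norm_bound)
    also have "\<dots> \<le> (\<integral>x. e * norm (g x) \<partial>torus)"
    proof (rule integral_mono)
      fix x assume "x \<in> space torus"
      then have "\<bar>F (torus_point x) - p (torus_point x)\<bar> \<le> e" using p(2)[of "torus_point x"] by force
      then have "norm (g x) * \<bar>F (torus_point x) - p (torus_point x)\<bar> \<le> norm (g x) * e"
        by (intro mult_left_mono) auto
      then show "norm (g x * complex_of_real (F (torus_point x) - p (torus_point x))) \<le> e * norm (g x)"
        by (simp only: norm_mult norm_of_real mult.commute)
    qed (use di gi in auto)
    also have "\<dots> = e * (\<integral>x. norm (g x) \<partial>torus)" by simp
    finally show ?thesis .
  qed
  show ?thesis
  proof (rule ccontr)
    assume n: "\<not> ?thesis"
    let ?A = "norm (\<integral>x. g x * complex_of_real (F (torus_point x)) \<partial>torus)" and ?B = "\<integral>x. norm (g x) \<partial>torus"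
    have A: "?A > 0" using n by simp
    have B: "?B \<ge> 0" by simp
    have B1: "0 < ?B + 1" using B by linarith
    \<comment> \<open>This choice of e pushes the bound below half of its left side; the added 1
      covers the case of a vanishing L^1 norm.\<close>
    have "?A \<le> ?A / (2 * (?B + 1)) * ?B"
      by (intro le divide_pos_pos mult_pos_pos A B1) simp
    also have "\<dots> \<le> ?A / 2" using A B B1 by (simp add: divide_simps del: Bochner_Integration.integral_nonneg)
    finally show False using A by simp
  qed
qed

text \<open>One of the points has to lie in the open cube, since points on opposite faces have the
  same image. Then the coordinates differ by a multiple of 2 pi whose modulus is below 2 pi.\<close>

lemma torus_point_inj:
  assumes x: "x \<in> box 0 (\<chi> i. 2 * pi)" and y: "y \<in> cbox 0 (\<chi> i. 2 * pi)" and eq: "torus_point x = torus_point y"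
  shows "x = y"
proof -
  have "x $ i = y $ i" for i
  proof -
    have xi: "0 < x $ i" "x $ i < 2 * pi" using x by (auto simp: mem_box_cart)
    have yi: "0 \<le> y $ i" "y $ i \<le> 2 * pi" using y by (auto simp: mem_box_cart)
    have "cis (x $ i) = cis (y $ i)" using eq by (simp add: torus_point_def vec_eq_iff)
    then obtain n :: int where n: "x $ i = y $ i + 2 * pi * n"
      using sin_cos_eq_iff[of "x $ i" "y $ i"] by (auto simp: complex_eq_iff)
    have "2 * pi * \<bar>real_of_int n\<bar> < 2 * pi"
    proof -
      have "2 * pi * \<bar>real_of_int n\<bar> = \<bar>2 * pi * n\<bar>" by (simp add: abs_mult)
      also have "\<dots> = \<bar>x $ i - y $ i\<bar>" using n by simp
      also have "\<dots> < 2 * pi" using xi yi by linarith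
      finally show ?thesis .
    qed
    then have "\<bar>real_of_int n\<bar> < 1" by simp
    then have "n = 0" by linarith
    then show ?thesis using n by simp
  qed
  then show ?thesis by (simp add: vec_eq_iff)
qed

text \<open>The indicator of \<open>B\<close> is a pointwise limit of continuous functions on the
  image torus, namely multiples, cut off at 1, of the distance to the image of the complement. As
  \<open>B\<close> avoids the faces, none of its points is glued to a point outside
  \<open>B\<close>.\<close>

lemma fourier_null_open_set:
  assumes g: "fourier_null g" and B: "open B" "B \<subseteq> box 0 (\<chi> i. 2 * pi)"
  shows "(\<integral>x. indicator B x *\<^sub>R g x \<partial>torus) = 0"
proof -
  let ?C = "cbox 0 (\<chi> i. 2 * pi) :: (real^3) set"
  define K where "K = torus_point ` (?C - B)"
  have comp: "compact K" unfolding K_def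
    by (intro compact_continuous_image continuous_intros compact_diff compact_cbox B)
  \<comment> \<open>The distance to an empty set is 0 by convention, so \<open>K\<close> has to be
    nonempty; the corner 0 of the closed cube is not in \<open>B\<close>.\<close>
  have ne: "K \<noteq> {}"
  proof -
    have "0 \<in> ?C - B" using B(2) by (auto simp: mem_box_cart)
    then show ?thesis by (auto simp: K_def)
  qed
  define F where "F n z = min 1 (real n * infdist z K)" for n z
  have Fc: "continuous_on UNIV (F n)" for n unfolding F_def
    by (intro continuous_intros)
  have gi: "integrable torus g" using g by (simp add: fourier_null_def)
  have tpm: "torus_point \<in> borel_measurable borel"
    by (intro borel_measurable_continuous_onI continuous_intros)
  have Fm: "(\<lambda>x. F n (torus_point x)) \<in> borel_measurable torus" for n
    by (intro borel_torus measurable_compose[OF tpm] borel_measurable_continuous_onI Fc)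
  have Bm: "B \<in> sets borel" using B by simp
  have iB: "(\<lambda>x. indicator B x :: real) \<in> borel_measurable torus"
    by (intro borel_torus) (use Bm in measurable)
  have "(\<lambda>n. \<integral>x. g x * complex_of_real (F n (torus_point x)) \<partial>torus) \<longlonglongrightarrow> (\<integral>x. indicator B x *\<^sub>R g x \<partial>torus)"
  proof (rule integral_dominated_convergence[where w="\<lambda>x. norm (g x)"])
    show "AE x in torus. (\<lambda>n. g x * complex_of_real (F n (torus_point x))) \<longlonglongrightarrow> indicator B x *\<^sub>R g x"
    proof (rule AE_I2)
      fix x assume x: "x \<in> space torus"
      have "(\<lambda>n. F n (torus_point x)) \<longlonglongrightarrow> indicator B x"
      proof (cases "x \<in> B")
        case True
        have "torus_point x \<notin> K"
        proof
          assume "torus_point x \<in> K"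
          then obtain y where "y \<in> ?C - B" "torus_point x = torus_point y" by (auto simp: K_def)
          then have "x = y" using torus_point_inj[of x y] True B(2) by auto
          then show False using True \<open>y \<in> ?C - B\<close> by simp
        qed
        then have pos: "infdist (torus_point x) K > 0"
          using infdist_pos_not_in_closed[OF compact_imp_closed[OF comp] ne] by simp
        obtain N :: nat where N: "1 / infdist (torus_point x) K < N" using reals_Archimedean2 by blast
        have "F n (torus_point x) = 1" if "n \<ge> N" for n
        proof -
          have "1 \<le> real N * infdist (torus_point x) K" using N pos by (simp add: field_simps)
          also have "\<dots> \<le> real n * infdist (torus_point x) K" using that pos by simp
          finally show ?thesis by (simp add: F_def)
        qed
        then show ?thesis using True
          by (intro tendsto_eventually) (auto simp: eventually_sequentially)
      next
        case False
        then have "torus_point x \<in> K" using x by (auto simp: K_def)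
        then show ?thesis using False by (simp add: F_def)
      qed
      then have "(\<lambda>n. g x * complex_of_real (F n (torus_point x))) \<longlonglongrightarrow> g x * complex_of_real (indicator B x)"
        by (intro tendsto_intros)
      then show "(\<lambda>n. g x * complex_of_real (F n (torus_point x))) \<longlonglongrightarrow> indicator B x *\<^sub>R g x"
        by (simp add: scaleR_conv_of_real mult.commute)
    qed
    show "AE x in torus. norm (g x * complex_of_real (F n (torus_point x))) \<le> norm (g x)" for n
    proof (rule AE_I2)
      fix x
      have "\<bar>F n (torus_point x)\<bar> \<le> 1" by (simp add: F_def infdist_nonneg min_def)
      then show "norm (g x * complex_of_real (F n (torus_point x))) \<le> norm (g x)"
        by (simp add: norm_mult mult_left_le)
    qed
  qed (use gi Fm iB in \<open>auto intro: borel_measurable_scaleR\<close>)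
  moreover have "(\<integral>x. g x * complex_of_real (F n (torus_point x)) \<partial>torus) = 0" for n
    by (rule fourier_null_continuous[OF g Fc])
  ultimately show ?thesis by (simp add: LIMSEQ_const_iff)
qed

text \<open>Lebesgue differentiation: at almost every point the means over shrinking cubes with a
  corner there converge to the value of \<open>f\<close>, and inside \<open>U\<close> all these
  means vanish. The dimension is left open because the lemma serves the torus as well as time
  intervals.\<close>

lemma zero_cube_integrals:
  fixes f :: "'a::euclidean_space \<Rightarrow> 'b::euclidean_space"
  assumes f: "\<And>a b. f integrable_on cbox a b" and U: "open U"
    and z: "\<And>a b. cbox a b \<subseteq> U \<Longrightarrow> integral (cbox a b) f = 0"
  shows "negligible {x \<in> U. f x \<noteq> 0}"
proof -
  obtain N where N: "negligible N"
    and lim: "\<And>x e. \<lbrakk>x \<notin> N; 0 < e\<rbrakk> \<Longrightarrow>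
               \<exists>d>0. \<forall>h. 0 < h \<and> h < d \<longrightarrow>
                         norm(integral (cbox x (x + h *\<^sub>R One)) f /\<^sub>R h ^ DIM('a) - f x) < e"
    using integrable_ccontinuous_explicit[OF f] by blast
  have "{x \<in> U. f x \<noteq> 0} \<subseteq> N"
  proof (rule ccontr)
    assume "\<not> {x \<in> U. f x \<noteq> 0} \<subseteq> N"
    then obtain x where x: "x \<in> U" "f x \<noteq> 0" "x \<notin> N" by blast
    obtain d where d: "d > 0" "\<And>h. 0 < h \<Longrightarrow> h < d \<Longrightarrow> norm(integral (cbox x (x + h *\<^sub>R One)) f /\<^sub>R h ^ DIM('a) - f x) < norm (f x)"
      using lim[of x "norm (f x)"] x by auto
    obtain r where r: "r > 0" "ball x r \<subseteq> U" using U x(1) openE by blast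
    define h where "h = min (d/2) (r / (2 * norm (One::'a)))"
    have One: "norm (One::'a) > 0" by simp
    have h: "0 < h" "h < d" "h * norm (One::'a) < r"
      using d r One unfolding h_def by (auto simp: min_def field_simps)
    have "cbox x (x + h *\<^sub>R One) \<subseteq> ball x r"
    proof
      fix y assume y: "y \<in> cbox x (x + h *\<^sub>R One)"
      have "norm (y - x) \<le> norm (h *\<^sub>R (One::'a))"
        by (rule norm_le_componentwise) (use y h(1) in \<open>auto simp: mem_box inner_diff_left inner_add_left algebra_simps\<close>)
      then show "y \<in> ball x r" using h by (simp add: dist_norm norm_minus_commute)
    qed
    then have "integral (cbox x (x + h *\<^sub>R One)) f = 0" using r by (intro z) auto
    then show False using d(2)[OF h(1,2)] by simp
  qed
  then show ?thesis using N negligible_subset by blast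
qed

lemma fourier_uniqueness:
  assumes g: "fourier_null g" shows "AE x in torus. g x = 0"
proof -
  let ?C = "cbox 0 (\<chi> i. 2 * pi) :: (real^3) set"
  let ?U = "box 0 (\<chi> i. 2 * pi) :: (real^3) set"
  define f where "f x = indicator ?C x *\<^sub>R g x" for x
  have gi: "integrable torus g" using g by (simp add: fourier_null_def)
  then have fi: "integrable lebesgue f"
    unfolding f_def torus_def by (subst (asm) integrable_restrict_space) auto
  have fon: "f integrable_on cbox a b" for a b
    using fi integrable_on_lebesgue integrable_on_subcbox by blast
  have "integral (cbox a b) f = 0" if sub: "cbox a b \<subseteq> ?U" for a b
  proof -
    have "integral (cbox a b) f = integral (box a b) f" by (simp add: integral_open_interval)
    also have "\<dots> = integral UNIV (\<lambda>x. indicator (box a b) x *\<^sub>R f x)"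
      by (subst integral_restrict_UNIV[symmetric]) (auto intro!: integral_cong simp: indicator_def)
    also have "\<dots> = integral\<^sup>L lebesgue (\<lambda>x. indicator (box a b) x *\<^sub>R f x)"
      by (rule integral_lebesgue, rule integrable_mult_indicator) (use fi in auto)
    also have "\<dots> = (\<integral>x. indicator (box a b) x *\<^sub>R g x \<partial>torus)"
      unfolding f_def torus_def by (subst integral_restrict_space) (auto simp: mult.commute)
    also have "\<dots> = 0"
      by (intro fourier_null_open_set g) (use sub box_subset_cbox in blast)+
    finally show ?thesis .
  qed
  then have "negligible {x \<in> ?U. f x \<noteq> 0}"
    by (intro zero_cube_integrals fon) auto
  moreover have "negligible (?C - ?U)"
    by (rule negligible_frontier_interval)
  ultimately have "negligible ({x \<in> ?U. f x \<noteq> 0} \<union> (?C - ?U))" by (rule negligible_Un)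
  moreover have "{x \<in> ?C. g x \<noteq> 0} \<subseteq> {x \<in> ?U. f x \<noteq> 0} \<union> (?C - ?U)" by (auto simp: f_def)
  ultimately have "negligible {x \<in> ?C. g x \<noteq> 0}" using negligible_subset by blast
  then have "AE x in lebesgue. x \<in> ?C \<longrightarrow> g x = 0"
    by (intro AE_I'[where N="{x \<in> ?C. g x \<noteq> 0}"]) (auto simp: negligible_iff_null_sets)
  then show ?thesis unfolding torus_def by (subst AE_restrict_space_iff) auto
qed

section \<open>Fourier series of fields\<close>

lemma sigma_finite_lattice: "sigma_finite_measure lattice"
  by (rule sigma_finite_measure_count_space)

text \<open>On the countable lattice joint measurability is automatic, so Fubini's theorem reduces
  to summability of the L^1 norms.\<close>

lemma lattice_integral_swap:
  fixes F :: "int^3 \<Rightarrow> 'a \<Rightarrow> 'b::{banach, second_countable_topology}"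
  assumes M: "sigma_finite_measure M" and F: "\<And>k. integrable M (F k)"
    and s: "integrable lattice (\<lambda>k. \<integral>x. norm (F k x) \<partial>M)"
  shows "(\<integral>x. (\<integral>k. F k x \<partial>lattice) \<partial>M) = (\<integral>k. (\<integral>x. F k x \<partial>M) \<partial>lattice)"
    and "integrable M (\<lambda>x. \<integral>k. F k x \<partial>lattice)"
    and "AE x in M. integrable lattice (\<lambda>k. F k x)"
    and "integrable lattice (\<lambda>k. \<integral>x. F k x \<partial>M)"
proof -
  interpret M: sigma_finite_measure M by (rule M)
  interpret L: sigma_finite_measure lattice by (rule sigma_finite_lattice)
  interpret P: pair_sigma_finite lattice M ..
  have meas: "case_prod F \<in> borel_measurable (lattice \<Otimes>\<^sub>M M)"
    by (rule measurable_pair_measure_countable1) (use F in auto)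
  have int: "integrable (lattice \<Otimes>\<^sub>M M) (case_prod F)"
    by (rule P.Fubini_integrable[OF meas]) (use F s in auto)
  show "(\<integral>x. (\<integral>k. F k x \<partial>lattice) \<partial>M) = (\<integral>k. (\<integral>x. F k x \<partial>M) \<partial>lattice)"
    by (rule P.Fubini_integral[OF int])
  show "integrable M (\<lambda>x. \<integral>k. F k x \<partial>lattice)" using P.integrable_snd[OF int] by simp
  show "AE x in M. integrable lattice (\<lambda>k. F k x)" using P.AE_integrable_snd[OF int] by simp
  show "integrable lattice (\<lambda>k. \<integral>x. F k x \<partial>M)" using P.integrable_fst[OF int] by simp
qed

section \<open>Orthogonality of the characters\<close>

lemma integral_cis_interval:
  fixes n :: int
  shows "(\<integral>t. indicator {0..2*pi} t *\<^sub>R cis (real_of_int n * t) \<partial>lborel) = (if n = 0 then 2 * pi else 0)"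
    and "integrable lborel (\<lambda>t. indicator {0..2*pi} t *\<^sub>R cis (real_of_int n * t))"
proof -
  have c: "continuous_on {0..2*pi} (\<lambda>t. cis (real_of_int n * t))" by (intro continuous_intros)
  have i: "set_integrable lborel {0..2*pi} (\<lambda>t. cis (real_of_int n * t))"
    by (rule borel_integrable_atLeastAtMost') (rule c)
  then show "integrable lborel (\<lambda>t. indicator {0..2*pi} t *\<^sub>R cis (real_of_int n * t))"
    by (simp add: set_integrable_def)
  have "(\<integral>t. indicator {0..2*pi} t *\<^sub>R cis (real_of_int n * t) \<partial>lborel) = integral {0..2*pi} (\<lambda>t. cis (real_of_int n * t))"
    using set_borel_integral_eq_integral(2)[OF i] by (simp add: set_lebesgue_integral_def)
  also have "\<dots> = (if n = 0 then 2 * pi else 0)"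
  proof (cases "n = 0")
    case False
    have "((\<lambda>t. cis (real_of_int n * t)) has_integral
       (cis (real_of_int n * (2*pi)) / (\<i> * n) - cis (real_of_int n * 0) / (\<i> * n))) {0..2*pi}"
    proof (rule fundamental_theorem_of_calculus)
      fix t assume "t \<in> {0..2*pi}"
      have "((\<lambda>t. cis (real_of_int n * t)) has_vector_derivative of_int n * (\<i> * cis (real_of_int n * t))) (at t within {0..2*pi})"
      proof -
        have "((\<lambda>z. exp (\<i> * of_int n * z)) has_field_derivative of_int n * (\<i> * exp (\<i> * of_int n * complex_of_real t))) (at (complex_of_real t))"
          by (auto intro!: derivative_eq_intros)
        from has_vector_derivative_real_field[OF this, of "{0..2*pi}"] show ?thesis
          by (simp add: cis_conv_exp mult.assoc)
      qed
      from has_vector_derivative_divide[OF this, of "\<i> * n"]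
      show "((\<lambda>t. cis (real_of_int n * t) / (\<i> * n)) has_vector_derivative cis (real_of_int n * t)) (at t within {0..2*pi})"
        using False by (simp add: divide_simps mult.commute)
    qed simp
    moreover have "cis (real_of_int n * (2*pi)) = 1"
      using cis_multiple_2pi[of "real_of_int n"] by (simp add: mult.commute)
    ultimately show ?thesis using False by (simp add: integral_unique)
  qed (simp add: scaleR_conv_of_real)
  finally show "(\<integral>t. indicator {0..2*pi} t *\<^sub>R cis (real_of_int n * t) \<partial>lborel) = (if n = 0 then 2 * pi else 0)" .
qed

text \<open>Over the cube the integral factorises along the coordinates. If k has a nonzero entry,
  the corresponding one-dimensional factor runs over full periods and vanishes.\<close>

lemma integral_char: "(\<integral>x. char k x \<partial>torus) = (if k = 0 then complex_of_real ((2 * pi) ^ 3) else 0)"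
proof (cases "k = 0")
  case True
  then show ?thesis using measure_torus by (simp add: scaleR_conv_of_real)
next
  case False
  then obtain i where i: "k $ i \<noteq> 0" by (auto simp: vec_eq_iff)
  let ?C = "cbox 0 (\<chi> i. 2 * pi) :: (real^3) set"
  interpret product_sigma_finite "\<lambda>_. lborel :: real measure" ..
  let ?f = "\<lambda>b t. indicator {0..2*pi} t *\<^sub>R cis ((wave_vector k \<bullet> b) * t)"
  have w: "\<exists>n::int. wave_vector k \<bullet> b = real_of_int n" if "b \<in> Basis" for b
    using that by (auto simp: Basis_vec_def inner_axis wave_vector_def)
  have "(\<integral>x. char k x \<partial>torus) = (\<integral>x. indicator ?C x *\<^sub>R char k x \<partial>lebesgue)"
    unfolding torus_def by (subst integral_restrict_space) auto
  also have "\<dots> = (\<integral>x. indicator ?C x *\<^sub>R char k x \<partial>lborel)"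
    by (rule integral_completion) measurable
  also have "\<dots> = (\<integral>x. indicator ?C x *\<^sub>R char k x \<partial>(distr (\<Pi>\<^sub>M b\<in>Basis. lborel) borel (\<lambda>f. \<Sum>b\<in>Basis. f b *\<^sub>R b)))"
    by (subst lborel_eq) simp
  also have "\<dots> = (\<integral>f. indicator ?C (\<Sum>b\<in>Basis. f b *\<^sub>R b) *\<^sub>R char k (\<Sum>b\<in>Basis. f b *\<^sub>R b) \<partial>(\<Pi>\<^sub>M b\<in>Basis. lborel))"
    by (rule integral_distr) measurable
  also have "\<dots> = (\<integral>f. (\<Prod>b\<in>Basis. ?f b (f b)) \<partial>(\<Pi>\<^sub>M b\<in>(Basis::(real^3) set). lborel))"
  proof (intro Bochner_Integration.integral_cong refl)
    fix f :: "real^3 \<Rightarrow> real"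
    let ?x = "\<Sum>b\<in>Basis. f b *\<^sub>R b"
    have xb: "?x \<bullet> b = f b" if "b \<in> Basis" for b
      using that by (simp add: inner_sum_left inner_Basis if_distrib cong: if_cong)
    have "(\<chi> i. 2 * pi) \<bullet> b = 2 * pi" if "b \<in> (Basis::(real^3) set)" for b
      using that by (auto simp: Basis_vec_def inner_axis)
    then have "?x \<in> ?C \<longleftrightarrow> (\<forall>b\<in>Basis. f b \<in> {0..2*pi})"
      by (auto simp: mem_box xb)
    then have "indicator ?C ?x = (\<Prod>b\<in>Basis. indicator {0..2*pi} (f b) :: real)"
      by (auto simp: indicator_def intro!: prod_zero)
    moreover have "char k ?x = (\<Prod>b\<in>Basis. cis ((wave_vector k \<bullet> b) * f b))"
      by (simp add: char_def inner_sum_right cis_conv_exp exp_sum sum_distrib_left mult.commute)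
    ultimately show "indicator ?C ?x *\<^sub>R char k ?x = (\<Prod>b\<in>Basis. ?f b (f b))"
      by (simp add: prod.distrib scaleR_conv_of_real)
  qed
  also have "\<dots> = (\<Prod>b\<in>Basis. integral\<^sup>L lborel (?f b))"
  proof (rule product_integral_prod)
    fix b :: "real^3" assume "b \<in> Basis"
    then obtain n :: int where "wave_vector k \<bullet> b = real_of_int n" using w by blast
    then show "integrable lborel (?f b)" using integral_cis_interval(2)[of n] by simp
  qed simp
  also have "\<dots> = 0"
  proof (rule prod_zero)
    have "wave_vector k \<bullet> axis i 1 = real_of_int (k $ i)" by (simp add: inner_axis wave_vector_def)
    then show "\<exists>b\<in>Basis. integral\<^sup>L lborel (?f b) = 0"
      using integral_cis_interval(1)[of "k $ i"] i by (intro bexI[of _ "axis i 1"]) (auto simp: Basis_vec_def)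
  qed simp
  finally show ?thesis using False by simp
qed

lemma integral_char_series:
  fixes a :: "int^3 \<Rightarrow> complex"
  assumes a: "integrable lattice a"
  shows "(\<integral>x. (\<integral>k. a k * char k x \<partial>lattice) * char (- l) x \<partial>torus) = complex_of_real ((2 * pi) ^ 3) * a l"
proof -
  let ?F = "\<lambda>k x. a k * char (k - l) x"
  have F: "integrable torus (?F k)" for k
    by (intro integrable_mult_right torus.integrable_const_bound[where B=1]) auto
  have n: "(\<integral>x. norm (?F k x) \<partial>torus) = (2 * pi) ^ 3 * norm (a k)" for k
    using measure_torus by (simp add: norm_mult)
  have s: "integrable lattice (\<lambda>k. \<integral>x. norm (?F k x) \<partial>torus)"
    unfolding n using a by simp
  have "(\<integral>x. (\<integral>k. a k * char k x \<partial>lattice) * char (- l) x \<partial>torus) = (\<integral>x. (\<integral>k. ?F k x \<partial>lattice) \<partial>torus)"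
    by (intro Bochner_Integration.integral_cong refl, subst integral_mult_left_zero[symmetric])
       (simp add: mult.assoc char_add[symmetric])
  also have "\<dots> = (\<integral>k. (\<integral>x. ?F k x \<partial>torus) \<partial>lattice)"
    by (rule lattice_integral_swap(1)[OF torus.sigma_finite_measure_axioms F s])
  also have "\<dots> = (\<integral>k. (if k = l then complex_of_real ((2 * pi) ^ 3) * a l else 0) \<partial>lattice)"
    by (intro Bochner_Integration.integral_cong refl) (auto simp: integral_char)
  also have "\<dots> = complex_of_real ((2 * pi) ^ 3) * a l"
    by (subst lebesgue_integral_count_space_finite_support) (auto simp: if_distrib cong: if_cong)
  finally show ?thesis .
qed

section \<open>Fourier coefficients of square integrable fields\<close>

lemma fourier_coeff_component:
  "fourier_coeff g k $ j = (\<integral>x. complex_of_real (g x $ j) * char (- k) x \<partial>torus) / complex_of_real ((2 * pi) ^ 3)"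
  by (simp add: fourier_coeff_def cis_minus_wave)

lemma L2_integrable:
  assumes "g \<in> Elems L2_space" shows "integrable torus g"
proof -
  have m: "g \<in> borel_measurable torus" and i: "integrable torus (\<lambda>x. (norm (g x))\<^sup>2)"
    using assms by (auto simp: L2_space_def)
  have "integrable torus (\<lambda>x. norm (g x))"
    by (rule torus.square_integrable_imp_integrable) (use m i in auto)
  then show ?thesis using m by (simp add: integrable_norm_iff)
qed

lemma integrable_component:
  fixes g :: "'a \<Rightarrow> ('b::euclidean_space)^'n"
  assumes "integrable M g" shows "integrable M (\<lambda>x. g x $ j)"
  using integrable_bounded_linear[OF bounded_linear_vec_nth assms] by simp

lemma integral_component:
  fixes g :: "'a \<Rightarrow> ('b::euclidean_space)^'n"
  assumes "integrable M g" shows "(\<integral>x. g x \<partial>M) $ j = (\<integral>x. g x $ j \<partial>M)"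
  using integral_bounded_linear[OF bounded_linear_vec_nth assms] by simp

lemma integrable_of_real_component:
  assumes "integrable torus (g :: field)"
  shows "integrable torus (\<lambda>x. complex_of_real (g x $ j) * char k x)"
  by (intro integrable_mult_char integrable_of_real integrable_component assms)

lemma fourier_coeff_add:
  assumes "integrable torus g" "integrable torus h"
  shows "fourier_coeff (\<lambda>x. g x + h x) k = fourier_coeff g k + fourier_coeff h k"
  by (simp add: vec_eq_iff fourier_coeff_component distrib_right integrable_of_real_component assms add_divide_distrib)

lemma fourier_coeff_diff:
  assumes "integrable torus g" "integrable torus h"
  shows "fourier_coeff (\<lambda>x. g x - h x) k = fourier_coeff g k - fourier_coeff h k"
  by (simp add: vec_eq_iff fourier_coeff_component left_diff_distrib integrable_of_real_component assms diff_divide_distrib)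

lemma fourier_coeff_scaleR: "fourier_coeff (\<lambda>x. a *\<^sub>R g x) k = a *\<^sub>R fourier_coeff g k"
  by (simp add: vec_eq_iff fourier_coeff_component mult.assoc) (simp add: scaleR_conv_of_real)

lemma fourier_coeff_uminus: "fourier_coeff (\<lambda>x. - g x) k = - fourier_coeff g k"
  using fourier_coeff_scaleR[of "-1" g k] by simp

lemma fourier_coeff_zero [simp]: "fourier_coeff (\<lambda>x. 0) k = 0"
  using fourier_coeff_scaleR[of 0 "\<lambda>x. 0" k] by simp

lemma fourier_coeff_sum:
  assumes "\<And>i. i \<in> I \<Longrightarrow> integrable torus (g i)"
  shows "fourier_coeff (\<lambda>x. \<Sum>i\<in>I. g i x) k = (\<Sum>i\<in>I. fourier_coeff (g i) k)"
  using assms by (induction I rule: infinite_finite_induct) (auto simp: fourier_coeff_add)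

lemma borel_vec_nth [measurable]: "(\<lambda>v::('a::real_normed_vector)^'n. v $ j) \<in> borel_measurable borel"
  by (intro borel_measurable_continuous_onI continuous_intros)

lemma fourier_coeff_cong_AE:
  assumes "AE x in torus. g x = h x" "g \<in> borel_measurable torus" "h \<in> borel_measurable torus"
  shows "fourier_coeff g k = fourier_coeff h k"
proof -
  have "(\<integral>x. complex_of_real (g x $ j) * char (- k) x \<partial>torus) = (\<integral>x. complex_of_real (h x $ j) * char (- k) x \<partial>torus)" for j
  proof (rule integral_cong_AE)
    have "(\<lambda>x. g x $ j) \<in> borel_measurable torus" "(\<lambda>x. h x $ j) \<in> borel_measurable torus"
      using assms(2,3) by (auto intro: measurable_compose[OF _ borel_vec_nth])
    then show "(\<lambda>x. complex_of_real (g x $ j) * char (- k) x) \<in> borel_measurable torus"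
      "(\<lambda>x. complex_of_real (h x $ j) * char (- k) x) \<in> borel_measurable torus"
      by measurable
  qed (use assms(1) in auto)
  then show ?thesis by (simp add: vec_eq_iff fourier_coeff_component)
qed

text \<open>Cauchy-Schwarz against the constant 1. If \<open>f\<close> is not integrable, its
  Bochner integral is 0 by convention and the bound is trivial.\<close>

lemma norm_integral_square_le:
  fixes f :: "'a \<Rightarrow> 'b::{banach, second_countable_topology}"
  assumes [measurable]: "f \<in> borel_measurable M"
  shows "(ennreal (norm (\<integral>x. f x \<partial>M)))\<^sup>2 \<le> emeasure M (space M) * (\<integral>\<^sup>+x. ennreal ((norm (f x))\<^sup>2) \<partial>M)"
proof -
  have "ennreal (norm (\<integral>x. f x \<partial>M)) \<le> (\<integral>\<^sup>+x. ennreal (norm (f x)) \<partial>M)"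
    by (cases "integrable M f") (simp_all add: integral_norm_bound_ennreal not_integrable_integral_eq)
  then have "(ennreal (norm (\<integral>x. f x \<partial>M)))\<^sup>2 \<le> (\<integral>\<^sup>+x. 1 * ennreal (norm (f x)) \<partial>M)\<^sup>2"
    by (intro power_mono) auto
  also have "\<dots> \<le> (\<integral>\<^sup>+x. 1\<^sup>2 \<partial>M) * (\<integral>\<^sup>+x. (ennreal (norm (f x)))\<^sup>2 \<partial>M)"
    by (rule Cauchy_Schwarz_nn_integral) auto
  finally show ?thesis by (simp add: ennreal_power)
qed

text \<open>Cauchy-Schwarz bounds the integral of each component by sqrt(V) times the norm, and the
  normalisation divides by V. As the volume V exceeds 1 the quotient is at most 1; the factor 3
  counts the components.\<close>

lemma norm_fourier_coeff_le:
  assumes g: "g \<in> Elems L2_space"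
  shows "norm (fourier_coeff g k) \<le> 3 * Norm L2_space g"
proof -
  have m: "g \<in> borel_measurable torus" and i: "integrable torus (\<lambda>x. (norm (g x))\<^sup>2)"
    using g by (auto simp: L2_space_def)
  let ?V = "(2 * pi) ^ 3 :: real"
  have V: "1 \<le> ?V" using pi_gt3 by (intro one_le_power) auto
  have "norm (fourier_coeff g k $ j) \<le> Norm L2_space g" for j
  proof -
    let ?f = "\<lambda>x. complex_of_real (g x $ j) * char (- k) x"
    have fi: "integrable torus ?f" by (intro integrable_of_real_component L2_integrable g)
    have "(ennreal (norm (integral\<^sup>L torus ?f)))\<^sup>2 \<le> ennreal ?V * (\<integral>\<^sup>+x. ennreal ((norm (?f x))\<^sup>2) \<partial>torus)"
      unfolding emeasure_torus[symmetric] by (rule norm_integral_square_le) (use fi in auto)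
    also have "\<dots> \<le> ennreal ?V * (\<integral>\<^sup>+x. ennreal ((norm (g x))\<^sup>2) \<partial>torus)"
      by (intro mult_left_mono nn_integral_mono ennreal_leI power_mono)
         (auto simp: norm_mult component_le_norm_cart)
    also have "\<dots> = ennreal ?V * ennreal (\<integral>x. (norm (g x))\<^sup>2 \<partial>torus)"
      by (subst nn_integral_eq_integral[OF i]) auto
    finally have "(norm (integral\<^sup>L torus ?f))\<^sup>2 \<le> ?V * (\<integral>x. (norm (g x))\<^sup>2 \<partial>torus)"
      by (simp add: ennreal_power ennreal_mult'[symmetric] del: power_mult_distrib)
    also have "\<dots> \<le> ?V\<^sup>2 * (\<integral>x. (norm (g x))\<^sup>2 \<partial>torus)"
      using V by (intro mult_right_mono self_le_power) auto
    also have "\<dots> = (?V * Norm L2_space g)\<^sup>2" by (simp add: L2_space_def power_mult_distrib)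
    finally have "norm (integral\<^sup>L torus ?f) \<le> ?V * Norm L2_space g"
      by (rule power2_le_imp_le) (simp add: L2_space_def)
    then show ?thesis by (simp add: fourier_coeff_component norm_divide norm_power divide_le_eq mult.commute)
  qed
  then have "(\<Sum>j\<in>UNIV. norm (fourier_coeff g k $ j)) \<le> (\<Sum>j\<in>(UNIV::3 set). Norm L2_space g)"
    by (intro sum_mono)
  moreover have "norm (fourier_coeff g k) \<le> (\<Sum>j\<in>UNIV. norm (fourier_coeff g k $ j))"
    unfolding norm_vec_def by (rule L2_set_le_sum) auto
  ultimately show ?thesis by simp
qed

section \<open>Real fields from coefficient sequences\<close>

definition vcnj :: "complex^3 \<Rightarrow> complex^3" where "vcnj v = (\<chi> j. cnj (v $ j))"

lemma vcnj_component [simp]: "vcnj v $ j = cnj (v $ j)" by (simp add: vcnj_def)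

lemma norm_vcnj [simp]: "norm (vcnj v) = norm v" by (simp add: norm_vec_def)

lemma vcnj_add: "vcnj (v + w) = vcnj v + vcnj w" by (simp add: vec_eq_iff)
lemma vcnj_diff: "vcnj (v - w) = vcnj v - vcnj w" by (simp add: vec_eq_iff)
lemma vcnj_scaleR: "vcnj (a *\<^sub>R v) = a *\<^sub>R vcnj v" by (simp add: vec_eq_iff)
text \<open>The Hermitian part of a sequence. Coefficient sequences of real fields are fixed by it,
  and for summable \<open>c\<close> it is the coefficient sequence of
  \<open>synth c\<close>.\<close>

definition symm :: "(int^3 \<Rightarrow> complex^3) \<Rightarrow> int^3 \<Rightarrow> complex^3" where
  "symm c k = (1/2) *\<^sub>R (c k + vcnj (c (- k)))"

lemma symm_component: "symm c k $ j = (c k $ j + cnj (c (- k) $ j)) / 2"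
  by (simp add: symm_def complex_eq_iff)

text \<open>The real part yields a real field from any sequence, Hermitian or not; the price is the
  symmetrisation in its coefficients.\<close>

definition synth :: "(int^3 \<Rightarrow> complex^3) \<Rightarrow> field" where
  "synth c x = (\<chi> j. Re (\<integral>k. c k $ j * char k x \<partial>lattice))"

lemma fourier_coeff_hermitian: "vcnj (fourier_coeff g (- k)) = fourier_coeff g k"
proof -
  have "cnj (\<integral>x. complex_of_real (g x $ j) * char k x \<partial>torus) = (\<integral>x. complex_of_real (g x $ j) * char (- k) x \<partial>torus)" for j
    by (subst Bochner_Integration.integral_cnj[symmetric]) (simp add: cnj_char)
  then show ?thesis by (simp add: vec_eq_iff fourier_coeff_component)
qed

lemma symm_fourier_coeff: "symm (fourier_coeff g) = fourier_coeff g"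
  by (rule ext) (simp add: symm_def fourier_coeff_hermitian scaleR_2[symmetric])

lemma integrable_lattice_reflect:
  fixes a :: "int^3 \<Rightarrow> 'a::{banach,second_countable_topology}"
  shows "integrable lattice (\<lambda>k. a (l - k)) \<longleftrightarrow> integrable lattice a"
  by (rule integrable_bij_count_space) (rule bij_betw_byWitness[where f'="\<lambda>j. l - j"], auto)

lemma integral_lattice_reflect:
  fixes a :: "int^3 \<Rightarrow> 'a::{banach,second_countable_topology}"
  shows "(\<integral>k. a (l - k) \<partial>lattice) = (\<integral>k. a k \<partial>lattice)"
  by (rule integral_bij_count_space) (rule bij_betw_byWitness[where f'="\<lambda>j. l - j"], auto)

lemma integrable_vcnj:
  assumes "integrable lattice c" shows "integrable lattice (\<lambda>k. vcnj (c (- k)))"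
proof (rule Bochner_Integration.integrable_bound)
  show "integrable lattice (\<lambda>k. c (0 - k))" using assms by (subst integrable_lattice_reflect)
qed auto

lemma integrable_symm: "integrable lattice c \<Longrightarrow> integrable lattice (symm c)"
  unfolding symm_def using integrable_vcnj[of c] by simp

lemma integrable_series:
  fixes a :: "int^3 \<Rightarrow> complex"
  assumes "integrable lattice a" shows "integrable lattice (\<lambda>k. a k * char k x)"
  by (rule Bochner_Integration.integrable_bound[OF assms]) (auto simp: norm_mult)

lemma synth_component:
  assumes c: "integrable lattice c"
  shows "complex_of_real (synth c x $ j) = (\<integral>k. symm c k $ j * char k x \<partial>lattice)"
proof -
  have i1: "integrable lattice (\<lambda>k. c k $ j * char k x)"
    by (intro integrable_series integrable_component c)
  have i2: "integrable lattice (\<lambda>k. vcnj (c (- k)) $ j * char k x)"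
    by (intro integrable_series integrable_component integrable_vcnj c)
  have "cnj (\<integral>k. c k $ j * char k x \<partial>lattice) = (\<integral>k. cnj (c k $ j * char k x) \<partial>lattice)"
    by (rule Bochner_Integration.integral_cnj[symmetric])
  also have "\<dots> = (\<integral>k. cnj (c (0 - k) $ j * char (0 - k) x) \<partial>lattice)"
    by (rule integral_lattice_reflect[symmetric])
  also have "\<dots> = (\<integral>k. vcnj (c (- k)) $ j * char k x \<partial>lattice)"
    by (simp add: cnj_char)
  finally have cnj: "cnj (\<integral>k. c k $ j * char k x \<partial>lattice) = (\<integral>k. vcnj (c (- k)) $ j * char k x \<partial>lattice)" .
  have "2 * complex_of_real (synth c x $ j) = (\<integral>k. c k $ j * char k x \<partial>lattice) + cnj (\<integral>k. c k $ j * char k x \<partial>lattice)"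
    unfolding complex_add_cnj by (simp add: synth_def)
  also have "\<dots> = (\<integral>k. c k $ j * char k x \<partial>lattice) + (\<integral>k. vcnj (c (- k)) $ j * char k x \<partial>lattice)"
    by (simp only: cnj)
  also have "\<dots> = (\<integral>k. 2 * (symm c k $ j * char k x) \<partial>lattice)"
    unfolding Bochner_Integration.integral_add[OF i1 i2, symmetric]
    by (intro Bochner_Integration.integral_cong refl) (simp add: symm_component algebra_simps)
  finally show ?thesis by simp
qed

lemma norm_synth_component_le:
  assumes c: "integrable lattice c" shows "\<bar>synth c x $ j\<bar> \<le> (\<integral>k. norm (c k) \<partial>lattice)"
proof -
  have "\<bar>synth c x $ j\<bar> \<le> norm (\<integral>k. c k $ j * char k x \<partial>lattice)"
    by (simp add: synth_def abs_Re_le_cmod)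
  also have "\<dots> \<le> (\<integral>k. norm (c k $ j * char k x) \<partial>lattice)"
    by (rule integral_norm_bound)
  also have "\<dots> \<le> (\<integral>k. norm (c k) \<partial>lattice)"
  proof (rule integral_mono)
    show "norm (c k $ j * char k x) \<le> norm (c k)" for k
      by (simp add: norm_mult Finite_Cartesian_Product.norm_nth_le)
  qed (use c in \<open>auto intro!: integrable_norm integrable_series integrable_component simp del: norm_mult\<close>)
  finally show ?thesis .
qed

lemma norm_synth_le:
  assumes c: "integrable lattice c" shows "norm (synth c x) \<le> 3 * (\<integral>k. norm (c k) \<partial>lattice)"
proof -
  have "norm (synth c x) \<le> (\<Sum>j\<in>UNIV. \<bar>synth c x $ j\<bar>)" by (rule norm_le_l1_cart)
  also have "\<dots> \<le> (\<Sum>j\<in>(UNIV::3 set). (\<integral>k. norm (c k) \<partial>lattice))"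
    by (intro sum_mono norm_synth_component_le c)
  finally show ?thesis by simp
qed

lemma continuous_synth:
  assumes c: "integrable lattice c" shows "continuous_on UNIV (synth c)"
proof (rule continuous_on_sequentiallyI)
  fix s :: "nat \<Rightarrow> real^3" and a assume s: "s \<longlonglongrightarrow> a"
  have "(\<lambda>n. \<integral>k. c k $ j * char k (s n) \<partial>lattice) \<longlonglongrightarrow> (\<integral>k. c k $ j * char k a \<partial>lattice)" for j
  proof (rule integral_dominated_convergence[where w="\<lambda>k. norm (c k)"])
    show "AE k in lattice. (\<lambda>n. c k $ j * char k (s n)) \<longlonglongrightarrow> c k $ j * char k a"
      by (intro AE_I2 tendsto_intros) (use s in \<open>auto simp: char_def intro!: tendsto_intros\<close>)
    show "AE k in lattice. norm (c k $ j * char k (s n)) \<le> norm (c k)" for n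
      by (simp add: norm_mult Finite_Cartesian_Product.norm_nth_le)
  qed (use c in auto)
  then show "(\<lambda>n. synth c (s n)) \<longlonglongrightarrow> synth c a"
    unfolding synth_def by (intro tendsto_vec_lambda tendsto_Re)
qed

lemma synth_periodic: "torus_periodic (synth c)"
  by (simp add: torus_periodic_def synth_def char_periodic)

lemma bounded_L2:
  assumes "torus_periodic g" "g \<in> borel_measurable torus" "\<And>x. norm (g x) \<le> B"
  shows "g \<in> Elems L2_space"
proof -
  have "integrable torus (\<lambda>x. (norm (g x))\<^sup>2)"
    by (rule torus.integrable_const_bound[where B="B\<^sup>2"], rule AE_I2)
       (use assms in \<open>auto intro!: power_mono\<close>)
  then show ?thesis using assms by (simp add: L2_space_def)
qed

lemma synth_L2:
  assumes c: "integrable lattice c" shows "synth c \<in> Elems L2_space"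
  by (rule bounded_L2[OF synth_periodic _ norm_synth_le[OF c]])
     (intro borel_torus borel_measurable_continuous_onI continuous_synth c)

lemma fourier_coeff_synth:
  assumes c: "integrable lattice c" shows "fourier_coeff (synth c) k = symm c k"
  by (simp add: vec_eq_iff fourier_coeff_component synth_component[OF c]
      integral_char_series[OF integrable_component[OF integrable_symm[OF c]]])

lemma fourier_coeff_eq_imp_AE:
  assumes g: "integrable torus g" and h: "integrable torus h" and eq: "\<And>k. fourier_coeff g k = fourier_coeff h k"
  shows "AE x in torus. g x = h x"
proof -
  have "AE x in torus. complex_of_real (g x $ j - h x $ j) = 0" for j
  proof (rule fourier_uniqueness, unfold fourier_null_def, intro conjI allI)
    show "integrable torus (\<lambda>x. complex_of_real (g x $ j - h x $ j))"
      by (intro integrable_of_real Bochner_Integration.integrable_diff integrable_component g h)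
    fix k
    have "(\<integral>x. complex_of_real (g x $ j) * char (- (- k)) x \<partial>torus) = (\<integral>x. complex_of_real (h x $ j) * char (- (- k)) x \<partial>torus)"
      using eq[of "- k"] by (simp add: vec_eq_iff fourier_coeff_component)
    then show "(\<integral>x. complex_of_real (g x $ j - h x $ j) * char k x \<partial>torus) = 0"
      by (simp add: left_diff_distrib integrable_of_real_component g h)
  qed
  then have "AE x in torus. \<forall>j. g x $ j = h x $ j"
    by (subst AE_all_countable) simp
  then show ?thesis by (auto simp: vec_eq_iff)
qed

text \<open>Both fields have the same coefficients, because symmetrisation does nothing to the
  coefficients of a real field; uniqueness concludes.\<close>

lemma synth_fourier_coeff:
  assumes g: "g \<in> Elems L2_space" and c: "integrable lattice (fourier_coeff g)"
  shows "AE x in torus. g x = synth (fourier_coeff g) x"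
  by (rule fourier_coeff_eq_imp_AE)
     (auto intro: L2_integrable g synth_L2 c simp: fourier_coeff_synth[OF c] symm_fourier_coeff)

section \<open>Weak derivatives in terms of coefficients\<close>

lemma trig_has_derivative:
  "((\<lambda>x::real^3. a * cos (w \<bullet> x) + b * sin (w \<bullet> x)) has_derivative
     (\<lambda>h. (b * (w \<bullet> h)) * cos (w \<bullet> x) + (- a * (w \<bullet> h)) * sin (w \<bullet> x))) (at x)"
  by (auto intro!: derivative_eq_intros simp: algebra_simps)

lemma trig_frechet:
  "frechet_derivative (\<lambda>x::real^3. a * cos (w \<bullet> x) + b * sin (w \<bullet> x)) (at x) h
     = (b * (w \<bullet> h)) * cos (w \<bullet> x) + (- a * (w \<bullet> h)) * sin (w \<bullet> x)"
  by (simp only: frechet_derivative_at[OF trig_has_derivative[of a w b x], symmetric])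

text \<open>For fixed w the two-parameter family is closed under directional derivatives, so the
  induction runs over all \<open>a\<close> and \<open>b\<close> at once.\<close>

lemma Ck_trig: "Ck n (\<lambda>x::real^3. a * cos (w \<bullet> x) + b * sin (w \<bullet> x))"
proof (induction n arbitrary: a b)
  case 0
  show ?case by (simp, intro continuous_intros)
next
  case (Suc n)
  have "(\<lambda>x::real^3. a * cos (w \<bullet> x) + b * sin (w \<bullet> x)) differentiable (at x)" for x
    using trig_has_derivative differentiable_def by blast
  then show ?case using Suc[of "b * (w \<bullet> _)" "- a * (w \<bullet> _)"] by (simp only: Ck.simps trig_frechet) auto
qed

text \<open>Test functions in \<open>weak_pderiv\<close> are real, so a character itself is not
  admissible. Combinations of cosine and sine give access to its real and imaginary part
  separately.\<close>

lemma weak_pderiv_trig: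
  assumes d: "weak_pderiv i g h"
  shows "(\<integral>x. (b * wave_vector k $ i * cos (wave_vector k \<bullet> x) - a * wave_vector k $ i * sin (wave_vector k \<bullet> x)) * g x $ j \<partial>torus)
    = - (\<integral>x. (a * cos (wave_vector k \<bullet> x) + b * sin (wave_vector k \<bullet> x)) * h x $ j \<partial>torus)"
proof -
  let ?w = "wave_vector k"
  let ?\<phi> = "\<lambda>x. a * cos (?w \<bullet> x) + b * sin (?w \<bullet> x)"
  let ?\<psi> = "\<lambda>x. b * ?w $ i * cos (?w \<bullet> x) - a * ?w $ i * sin (?w \<bullet> x)"
  have per: "torus_periodic ?\<phi>"
  proof (unfold torus_periodic_def, intro allI)
    fix x i
    have "Re (char k (x + axis i (2 * pi))) = Re (char k x)" "Im (char k (x + axis i (2 * pi))) = Im (char k x)"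
      by (simp_all add: char_periodic)
    then show "?\<phi> (x + axis i (2 * pi)) = ?\<phi> x" by (simp add: char_def)
  qed
  have gi: "integrable torus g" and hi: "integrable torus h"
    using d by (auto simp: weak_pderiv_def intro: L2_integrable)
  have scale: "integrable torus (\<lambda>x. q x *\<^sub>R f x)" if f: "integrable torus f" and q: "continuous_on UNIV q" "\<And>x. \<bar>q x\<bar> \<le> B" for q :: "real^3 \<Rightarrow> real" and f :: field and B
  proof (rule Bochner_Integration.integrable_bound)
    show "integrable torus (\<lambda>x. B *\<^sub>R f x)" using f by simp
    have "q \<in> borel_measurable torus" by (intro borel_torus borel_measurable_continuous_onI q)
    then show "(\<lambda>x. q x *\<^sub>R f x) \<in> borel_measurable torus" using f by (intro borel_measurable_scaleR) auto
    have "\<bar>q x\<bar> * norm (f x) \<le> \<bar>B\<bar> * norm (f x)" for x using q(2)[of x] by (intro mult_right_mono) auto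
    then show "AE x in torus. norm (q x *\<^sub>R f x) \<le> norm (B *\<^sub>R f x)" by simp
  qed
  have trigb: "\<bar>p * cos t + q * sin t\<bar> \<le> \<bar>p\<bar> + \<bar>q\<bar>" for p q t :: real
  proof -
    have "\<bar>p * cos t + q * sin t\<bar> \<le> \<bar>p\<bar> * \<bar>cos t\<bar> + \<bar>q\<bar> * \<bar>sin t\<bar>"
      by (metis abs_mult abs_triangle_ineq)
    also have "\<dots> \<le> \<bar>p\<bar> * 1 + \<bar>q\<bar> * 1" by (intro add_mono mult_left_mono) auto
    finally show ?thesis by simp
  qed
  have "(\<integral>x. frechet_derivative ?\<phi> (at x) (axis i 1) *\<^sub>R g x \<partial>torus) = - (\<integral>x. ?\<phi> x *\<^sub>R h x \<partial>torus)"
    using d per Ck_trig unfolding weak_pderiv_def by blast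
  then have eq: "(\<integral>x. ?\<psi> x *\<^sub>R g x \<partial>torus) = - (\<integral>x. ?\<phi> x *\<^sub>R h x \<partial>torus)"
    by (simp add: trig_frechet inner_axis)
  have i1: "integrable torus (\<lambda>x. ?\<psi> x *\<^sub>R g x)"
    by (rule scale[OF gi, where B="\<bar>b * ?w $ i\<bar> + \<bar>- a * ?w $ i\<bar>"], intro continuous_intros)
       (use trigb[of "b * ?w $ i" _ "- a * ?w $ i"] in simp)
  have i2: "integrable torus (\<lambda>x. ?\<phi> x *\<^sub>R h x)"
    by (rule scale[OF hi, where B="\<bar>a\<bar> + \<bar>b\<bar>"], intro continuous_intros) (use trigb in simp)
  have "(\<integral>x. ?\<psi> x *\<^sub>R g x \<partial>torus) $ j = (- (\<integral>x. ?\<phi> x *\<^sub>R h x \<partial>torus)) $ j" using eq by simp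
  then show ?thesis by (simp add: integral_component[OF i1] integral_component[OF i2])
qed

lemma integral_char_split:
  assumes "integrable torus (g :: field)"
  shows "(\<integral>x. complex_of_real (g x $ j) * char (- k) x \<partial>torus)
    = Complex (\<integral>x. cos (wave_vector k \<bullet> x) * g x $ j \<partial>torus) (- (\<integral>x. sin (wave_vector k \<bullet> x) * g x $ j \<partial>torus))"
proof (rule complex_eqI)
  note i = integrable_of_real_component[OF assms, of j "- k"]
  show "Re (\<integral>x. complex_of_real (g x $ j) * char (- k) x \<partial>torus) = Re (Complex (\<integral>x. cos (wave_vector k \<bullet> x) * g x $ j \<partial>torus) (- (\<integral>x. sin (wave_vector k \<bullet> x) * g x $ j \<partial>torus)))"
    by (subst integral_Re[OF i, symmetric]) (simp add: char_def wave_vector_minus mult.commute)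
  show "Im (\<integral>x. complex_of_real (g x $ j) * char (- k) x \<partial>torus) = Im (Complex (\<integral>x. cos (wave_vector k \<bullet> x) * g x $ j \<partial>torus) (- (\<integral>x. sin (wave_vector k \<bullet> x) * g x $ j \<partial>torus)))"
    by (subst integral_Im[OF i, symmetric]) (simp add: char_def wave_vector_minus mult.commute)
qed

lemma fourier_coeff_weak_pderiv:
  assumes d: "weak_pderiv i g h"
  shows "fourier_coeff h k $ j = \<i> * of_int (k $ i) * fourier_coeff g k $ j"
proof -
  have gi: "integrable torus g" and hi: "integrable torus h"
    using d by (auto simp: weak_pderiv_def intro: L2_integrable)
  have 1: "(\<integral>x. cos (wave_vector k \<bullet> x) * h x $ j \<partial>torus) = wave_vector k $ i * (\<integral>x. sin (wave_vector k \<bullet> x) * g x $ j \<partial>torus)"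
    using weak_pderiv_trig[OF d, of 0 k 1 j] by (simp add: mult.assoc)
  have 2: "(\<integral>x. sin (wave_vector k \<bullet> x) * h x $ j \<partial>torus) = - wave_vector k $ i * (\<integral>x. cos (wave_vector k \<bullet> x) * g x $ j \<partial>torus)"
    using weak_pderiv_trig[OF d, of 1 k 0 j] by (simp add: mult.assoc)
  show ?thesis
    unfolding fourier_coeff_component integral_char_split[OF gi] integral_char_split[OF hi] 1 2
    by (simp add: wave_vector_def complex_eq_iff)
qed

definition ccross :: "complex^3 \<Rightarrow> complex^3 \<Rightarrow> complex^3" where
  "ccross a b = vector [a$2 * b$3 - a$3 * b$2, a$3 * b$1 - a$1 * b$3, a$1 * b$2 - a$2 * b$1]"

lemma ccross_component:
  "ccross a b $ 1 = a$2 * b$3 - a$3 * b$2"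
  "ccross a b $ 2 = a$3 * b$1 - a$1 * b$3"
  "ccross a b $ 3 = a$1 * b$2 - a$2 * b$1"
  by (simp_all add: ccross_def)

lemma bilinear_ccross: "bounded_bilinear ccross"
  by (subst bilinear_conv_bounded_bilinear[symmetric])
     (auto simp: bilinear_def vec_eq_iff forall_3 ccross_component complex_eq_iff algebra_simps intro!: linearI)

definition ikvec :: "int^3 \<Rightarrow> complex^3" where
  "ikvec k = (\<chi> i. \<i> * of_int (k $ i))"

lemma norm_ikvec: "norm (ikvec k) = norm (wave_vector k)"
  by (simp add: ikvec_def wave_vector_def norm_vec_def L2_set_def norm_mult)

lemma fourier_coeff_weak_curl:
  assumes w: "weak_curl g w"
  shows "integrable torus w" and "fourier_coeff w k = ccross (ikvec k) (fourier_coeff g k)"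
proof -
  obtain D where D: "\<And>i. weak_pderiv i g (D i)"
    and w_eq: "w = (\<lambda>x. vector [D 2 x $ 3 - D 3 x $ 2, D 3 x $ 1 - D 1 x $ 3, D 1 x $ 2 - D 2 x $ 1])"
    using w by (auto simp: weak_curl_def)
  have Di: "integrable torus (D i)" for i
    using D[of i] by (auto simp: weak_pderiv_def intro: L2_integrable)
  \<comment> \<open>Written with unit vectors, the curl inherits integrability from the components
    of the weak derivatives.\<close>
  have w_alt: "w = (\<lambda>x. (D 2 x $ 3 - D 3 x $ 2) *\<^sub>R axis 1 1 + (D 3 x $ 1 - D 1 x $ 3) *\<^sub>R axis 2 1 + (D 1 x $ 2 - D 2 x $ 1) *\<^sub>R axis 3 1)"
    unfolding w_eq by (rule ext) (simp add: vec_eq_iff forall_3 axis_def)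
  show "integrable torus w" unfolding w_alt
    by (intro Bochner_Integration.integrable_add integrable_scaleR_left Bochner_Integration.integrable_diff integrable_component Di)
  have c: "(\<integral>x. complex_of_real (D a x $ b - D c x $ d) * char (- k) x \<partial>torus) / complex_of_real ((2 * pi) ^ 3)
     = fourier_coeff (D a) k $ b - fourier_coeff (D c) k $ d" for a b c d
    by (simp add: left_diff_distrib integrable_of_real_component Di fourier_coeff_component diff_divide_distrib)
  show "fourier_coeff w k = ccross (ikvec k) (fourier_coeff g k)"
    unfolding vec_eq_iff forall_3 fourier_coeff_component[of w] ccross_component
    by (simp only: w_eq vector_3 c fourier_coeff_weak_pderiv[OF D]) (simp add: ikvec_def)
qed

lemma scaleR_complex_component: "(r *\<^sub>R (v :: complex^3)) $ i = complex_of_real r * v $ i"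
  by (simp add: complex_eq_iff)

lemma fourier_coeff_weak_laplacian:
  assumes l: "weak_laplacian g l"
  shows "integrable torus l" and "fourier_coeff l k = - (norm (wave_vector k))\<^sup>2 *\<^sub>R fourier_coeff g k"
proof -
  obtain D E where D: "\<And>i. weak_pderiv i g (D i)" and E: "\<And>i. weak_pderiv i (D i) (E i)"
    and l_eq: "l = (\<lambda>x. \<Sum>i\<in>UNIV. E i x)"
    using l by (auto simp: weak_laplacian_def)
  have Ei: "integrable torus (E i)" for i
    using E[of i] by (auto simp: weak_pderiv_def intro: L2_integrable)
  show "integrable torus l" unfolding l_eq by (intro Bochner_Integration.integrable_sum Ei)
  have "fourier_coeff l k = (\<Sum>i\<in>UNIV. fourier_coeff (E i) k)"
    unfolding l_eq by (rule fourier_coeff_sum) (rule Ei)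
  also have "\<dots> = - (norm (wave_vector k))\<^sup>2 *\<^sub>R fourier_coeff g k"
  proof (subst vec_eq_iff, rule allI)
    fix i
    have sq: "\<i> * of_int a * (\<i> * of_int a * c) = - (complex_of_real ((of_int a)\<^sup>2) * c)" for a c
      by (simp add: power2_eq_square complex_eq_iff algebra_simps)
    have "(\<Sum>i\<in>UNIV. fourier_coeff (E i) k) $ i = (\<Sum>j\<in>UNIV. - (complex_of_real ((of_int (k $ j))\<^sup>2) * fourier_coeff g k $ i))"
      by (simp only: sum_component fourier_coeff_weak_pderiv[OF E] fourier_coeff_weak_pderiv[OF D] sq)
    also have "\<dots> = complex_of_real (- (norm (wave_vector k))\<^sup>2) * fourier_coeff g k $ i"
      unfolding norm_wave_sq by (simp only: sum_negf sum_distrib_right[symmetric] of_real_sum of_real_minus mult_minus_left)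
    finally show "(\<Sum>i\<in>UNIV. fourier_coeff (E i) k) $ i = (- (norm (wave_vector k))\<^sup>2 *\<^sub>R fourier_coeff g k) $ i"
      by (simp only: scaleR_complex_component)
  qed
  finally show "fourier_coeff l k = - (norm (wave_vector k))\<^sup>2 *\<^sub>R fourier_coeff g k" .
qed

text \<open>Absolute summability of \<open>c\<close> lets the series for \<open>U\<close> be taken
  out of the integral against a merely integrable \<open>W\<close>. The asymmetry fits the nonlinear
  term: the vorticity enters as an integrable field, the velocity through its summable
  coefficients.\<close>

lemma fourier_product:
  fixes W U :: "real^3 \<Rightarrow> real" and c :: "int^3 \<Rightarrow> complex"
  assumes W: "integrable torus W" and c: "integrable lattice c" and Um: "U \<in> borel_measurable torus"
    and U: "AE x in torus. complex_of_real (U x) = (\<integral>l. c l * char l x \<partial>lattice)"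
  shows "integrable torus (\<lambda>x. W x * U x)"
    and "(\<integral>x. complex_of_real (W x * U x) * char (- k) x \<partial>torus)
      = (\<integral>j. (\<integral>x. complex_of_real (W x) * char (- j) x \<partial>torus) * c (k - j) \<partial>lattice)"
proof -
  have Wm: "W \<in> borel_measurable torus" using W by auto
  let ?F = "\<lambda>k l x. complex_of_real (W x) * c l * char (l - k) x"
  have F: "integrable torus (?F k l)" for k l
    using W by (intro integrable_mult_char Bochner_Integration.integrable_mult_left integrable_of_real)
  have s: "integrable lattice (\<lambda>l. \<integral>x. norm (?F k l x) \<partial>torus)" for k
    using c by (simp add: norm_mult)
  have eq: "AE x in torus. (\<integral>l. ?F k l x \<partial>lattice) = complex_of_real (W x * U x) * char (- k) x" for k
    using U
  proof eventually_elim
    case (elim x)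
    have "(\<integral>l. ?F k l x \<partial>lattice) = (\<integral>l. complex_of_real (W x) * (c l * char l x) * char (- k) x \<partial>lattice)"
      by (intro Bochner_Integration.integral_cong refl) (simp add: mult.assoc char_add[symmetric])
    then show ?case by (simp add: elim)
  qed
  have "integrable torus (\<lambda>x. \<integral>l. ?F 0 l x \<partial>lattice)"
    by (rule lattice_integral_swap(2)[OF torus.sigma_finite_measure_axioms F s])
  then have "integrable torus (\<lambda>x. complex_of_real (W x * U x) * char (- 0) x)"
    by (rule integrable_cong_AE_imp) (use eq[of 0] Wm Um in \<open>auto simp del: minus_zero diff_0_right elim: AE_mp\<close>)
  then show "integrable torus (\<lambda>x. W x * U x)"
    by (subst complex_of_real_integrable_eq[symmetric]) simp
  have "(\<integral>x. complex_of_real (W x * U x) * char (- k) x \<partial>torus) = (\<integral>x. (\<integral>l. ?F k l x \<partial>lattice) \<partial>torus)"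
    using eq[of k] Wm Um lattice_integral_swap(2)[OF torus.sigma_finite_measure_axioms F s[of k]]
    by (intro integral_cong_AE) auto
  also have "\<dots> = (\<integral>l. (\<integral>x. ?F k l x \<partial>torus) \<partial>lattice)"
    by (rule lattice_integral_swap(1)[OF torus.sigma_finite_measure_axioms F s])
  also have "\<dots> = (\<integral>j. (\<integral>x. ?F k (k - j) x \<partial>torus) \<partial>lattice)"
    by (rule integral_lattice_reflect[symmetric])
  also have "\<dots> = (\<integral>j. (\<integral>x. complex_of_real (W x) * char (- j) x \<partial>torus) * c (k - j) \<partial>lattice)"
  proof (intro Bochner_Integration.integral_cong refl)
    fix j
    have "?F k (k - j) x = complex_of_real (W x) * char (- j) x * c (k - j)" for x by simp
    then show "(\<integral>x. ?F k (k - j) x \<partial>torus) = (\<integral>x. complex_of_real (W x) * char (- j) x \<partial>torus) * c (k - j)"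
      by (simp only: integral_mult_left_zero)
  qed
  finally show "(\<integral>x. complex_of_real (W x * U x) * char (- k) x \<partial>torus)
      = (\<integral>j. (\<integral>x. complex_of_real (W x) * char (- j) x \<partial>torus) * c (k - j) \<partial>lattice)" .
qed

lemma fourier_coeff_cross:
  assumes w: "integrable torus w" and u: "u \<in> Elems L2_space" and c: "integrable lattice (fourier_coeff u)"
  shows "integrable torus (\<lambda>x. cross3 (w x) (u x))"
    and "fourier_coeff (\<lambda>x. cross3 (w x) (u x)) k = (\<integral>j. ccross (fourier_coeff w j) (fourier_coeff u (k - j)) \<partial>lattice)"
proof -
  let ?V = "complex_of_real ((2 * pi) ^ 3)"
  have V: "?V \<noteq> 0" by simp
  have um: "u \<in> borel_measurable torus" using u by (simp add: L2_space_def)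
  have ucm: "(\<lambda>x. u x $ b) \<in> borel_measurable torus" for b
    by (rule measurable_compose[OF um borel_vec_nth])
  have U: "AE x in torus. complex_of_real (u x $ b) = (\<integral>l. fourier_coeff u l $ b * char l x \<partial>lattice)" for b
    using synth_fourier_coeff[OF u c]
  proof eventually_elim
    case (elim x)
    then show ?case using synth_component[OF c, of x b] by (simp add: symm_fourier_coeff)
  qed
  note P = fourier_product[OF integrable_component[OF w] integrable_component[OF c] ucm U]
  have cross_alt: "(\<lambda>x. cross3 (w x) (u x)) = (\<lambda>x. (w x $ 2 * u x $ 3 - w x $ 3 * u x $ 2) *\<^sub>R axis 1 1
     + (w x $ 3 * u x $ 1 - w x $ 1 * u x $ 3) *\<^sub>R axis 2 1 + (w x $ 1 * u x $ 2 - w x $ 2 * u x $ 1) *\<^sub>R axis 3 1)"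
    by (rule ext) (simp add: cross3_def vec_eq_iff forall_3 axis_def)
  show "integrable torus (\<lambda>x. cross3 (w x) (u x))" unfolding cross_alt
    by (intro Bochner_Integration.integrable_add integrable_scaleR_left Bochner_Integration.integrable_diff P(1))
  let ?C = "\<integral>x. norm (w x) \<partial>torus"
  \<comment> \<open>Coefficients of an integrable function are bounded, which suffices for
    convergence against the summable coefficients of \<open>u\<close>.\<close>
  have wb: "norm (fourier_coeff w j $ a) \<le> ?C / (2 * pi) ^ 3" for j a
  proof -
    have "norm (\<integral>x. complex_of_real (w x $ a) * char (- j) x \<partial>torus) \<le> (\<integral>x. norm (complex_of_real (w x $ a) * char (- j) x) \<partial>torus)"
      by (rule integral_norm_bound)
    also have "\<dots> \<le> ?C"
      by (rule integral_mono)
         (use w in \<open>auto intro!: integrable_norm integrable_of_real_component simp: component_le_norm_cart norm_mult integrable_component\<close>)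
    finally show ?thesis by (simp add: fourier_coeff_component norm_divide norm_power norm_mult divide_right_mono)
  qed
  have pi': "integrable lattice (\<lambda>j. fourier_coeff w j $ a * fourier_coeff u (k - j) $ b)" for a b
  proof (rule Bochner_Integration.integrable_bound)
    show "integrable lattice (\<lambda>j. (?C / (2 * pi) ^ 3) *\<^sub>R fourier_coeff u (k - j))"
      using c by (simp add: integrable_lattice_reflect)
    have "norm (fourier_coeff w j $ a) * norm (fourier_coeff u (k - j) $ b) \<le> (?C / (2 * pi) ^ 3) * norm (fourier_coeff u (k - j))" for j
      by (intro mult_mono wb Finite_Cartesian_Product.norm_nth_le) auto
    then show "AE j in lattice. norm (fourier_coeff w j $ a * fourier_coeff u (k - j) $ b) \<le> norm ((?C / (2 * pi) ^ 3) *\<^sub>R fourier_coeff u (k - j))"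
      by (simp add: norm_mult)
  qed simp
  have ci: "integrable lattice (\<lambda>j. ccross (fourier_coeff w j) (fourier_coeff u (k - j)))"
  proof -
    have *: "(\<lambda>j. ccross (fourier_coeff w j) (fourier_coeff u (k - j))) = (\<lambda>j.
      let p = (\<lambda>a b. fourier_coeff w j $ a * fourier_coeff u (k - j) $ b) in
       axis 1 (p 2 3 - p 3 2) + axis 2 (p 3 1 - p 1 3) + axis 3 (p 1 2 - p 2 1))"
      by (rule ext) (simp add: vec_eq_iff forall_3 axis_def ccross_component Let_def)
    have ax: "integrable lattice (\<lambda>j. axis a (h j) :: complex^3)" if "integrable lattice h" for a and h :: "int^3 \<Rightarrow> complex"
      using that by (rule Bochner_Integration.integrable_bound)
        (auto simp: norm_vec_def axis_def L2_set_def if_distrib[where f=norm] if_distrib[where f="\<lambda>z. z ^ 2"] cong: if_cong)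
    show ?thesis unfolding * Let_def
      by (intro Bochner_Integration.integrable_add ax Bochner_Integration.integrable_diff pi')
  qed
  have q: "(\<integral>x. complex_of_real (w x $ a * u x $ b - w x $ a' * u x $ b') * char (- k) x \<partial>torus) / ?V
     = (\<integral>j. fourier_coeff w j $ a * fourier_coeff u (k - j) $ b - fourier_coeff w j $ a' * fourier_coeff u (k - j) $ b' \<partial>lattice)" for a b a' b'
  proof -
    have "(\<integral>x. complex_of_real (w x $ a * u x $ b - w x $ a' * u x $ b') * char (- k) x \<partial>torus)
       = (\<integral>x. complex_of_real (w x $ a * u x $ b) * char (- k) x \<partial>torus) - (\<integral>x. complex_of_real (w x $ a' * u x $ b') * char (- k) x \<partial>torus)"
      unfolding of_real_diff left_diff_distrib
      by (intro Bochner_Integration.integral_diff integrable_mult_char integrable_of_real P(1))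
    moreover have "(\<integral>x. complex_of_real (w x $ a * u x $ b) * char (- k) x \<partial>torus) / ?V = (\<integral>j. fourier_coeff w j $ a * fourier_coeff u (k - j) $ b \<partial>lattice)" for a b
      unfolding P(2) fourier_coeff_component[of w] times_divide_eq_left by (rule integral_divide_zero[symmetric])
    ultimately show ?thesis by (simp add: diff_divide_distrib pi')
  qed
  show "fourier_coeff (\<lambda>x. cross3 (w x) (u x)) k = (\<integral>j. ccross (fourier_coeff w j) (fourier_coeff u (k - j)) \<partial>lattice)"
    unfolding vec_eq_iff forall_3 integral_component[OF ci] fourier_coeff_component[of "\<lambda>x. cross3 (w x) (u x)"] ccross_component
    by (simp only: cross3_def vector_3 q)
qed

definition curl_mult :: "int^3 \<Rightarrow> complex^3 \<Rightarrow> complex^3 \<Rightarrow> complex^3" where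
  "curl_mult j a b = ccross (ccross (ikvec j) a) b"

text \<open>The Fourier coefficients of \<open>(\<nabla> \<times> a) \<times> b\<close>.\<close>

definition curl_conv :: "(int^3 \<Rightarrow> complex^3) \<Rightarrow> (int^3 \<Rightarrow> complex^3) \<Rightarrow> int^3 \<Rightarrow> complex^3" where
  "curl_conv a b k = (\<integral>j. curl_mult j (a j) (b (k - j)) \<partial>lattice)"

text \<open>Summability of the coefficients of \<open>u\<close> is what turns the product into a
  convolution; it is available at almost every time because \<open>u\<close> lies in L^2
  H^2.\<close>

lemma momentum_equation_coeff:
  assumes u: "u \<in> Elems L2_space" and c: "integrable lattice (fourier_coeff u)"
    and w: "weak_curl u w" and l: "weak_laplacian u l"
    and v: "v \<in> Elems L2_space" and f: "f \<in> Elems L2_space"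
    and eq: "eq_field (\<lambda>x. v x + cross3 (w x) (u x)) (\<lambda>x. \<nu> *\<^sub>R l x + f x)"
  shows "fourier_coeff v k = - (\<nu> * (norm (wave_vector k))\<^sup>2) *\<^sub>R fourier_coeff u k + fourier_coeff f k
     - curl_conv (fourier_coeff u) (fourier_coeff u) k"
proof -
  note wi = fourier_coeff_weak_curl(1)[OF w] and li = fourier_coeff_weak_laplacian(1)[OF l]
  note ci = fourier_coeff_cross[OF wi u c]
  have vi: "integrable torus v" and fi: "integrable torus f" using v f by (auto intro: L2_integrable)
  have "fourier_coeff (\<lambda>x. v x + cross3 (w x) (u x)) k = fourier_coeff (\<lambda>x. \<nu> *\<^sub>R l x + f x) k"
    using eq unfolding eq_field_def
    by (rule fourier_coeff_cong_AE) (use vi ci(1) li fi in \<open>auto intro!: borel_measurable_add borel_measurable_scaleR\<close>)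
  then have "fourier_coeff v k + fourier_coeff (\<lambda>x. cross3 (w x) (u x)) k = \<nu> *\<^sub>R fourier_coeff l k + fourier_coeff f k"
    by (simp add: fourier_coeff_add vi ci(1) li fi fourier_coeff_scaleR)
  then show ?thesis
    by (simp add: ci(2) fourier_coeff_weak_curl(2)[OF w] fourier_coeff_weak_laplacian(2)[OF l] curl_conv_def curl_mult_def algebra_simps)
qed

section \<open>Absolutely continuous functions and weak derivatives in time\<close>

text \<open>Absolute continuity in the integral form of the fundamental theorem. \<open>F\<close> is
  meant at every time, \<open>f\<close> matters only up to null sets, and no pointwise derivative of
  \<open>F\<close> occurs.\<close>

definition ac_on :: "real \<Rightarrow> real \<Rightarrow> (real \<Rightarrow> 'a::euclidean_space) \<Rightarrow> (real \<Rightarrow> 'a) \<Rightarrow> bool" where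
  "ac_on a b F f \<longleftrightarrow> f absolutely_integrable_on {a..b} \<and>
     (\<forall>s t. a \<le> s \<and> s \<le> t \<and> t \<le> b \<longrightarrow> F t - F s = integral {s..t} f)"

lemma ac_on_integrable:
  assumes "ac_on a b F f" "a \<le> s" "t \<le> b" shows "f absolutely_integrable_on {s..t}" "f integrable_on {s..t}"
proof -
  show "f absolutely_integrable_on {s..t}"
    by (rule absolutely_integrable_on_subinterval) (use assms in \<open>auto simp: ac_on_def\<close>)
  then show "f integrable_on {s..t}" using absolutely_integrable_on_def by blast
qed

lemma ac_onD:
  assumes "ac_on a b F f" "a \<le> s" "s \<le> t" "t \<le> b" shows "F t - F s = integral {s..t} f"
  using assms by (simp add: ac_on_def)

lemma ac_on_subset:
  assumes "ac_on a b F f" "a \<le> a'" "b' \<le> b" shows "ac_on a' b' F f"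
  using assms ac_on_integrable(1)[OF assms] by (auto simp: ac_on_def)

lemma ac_on_continuous:
  assumes "ac_on a b F f" shows "continuous_on {a..b} F"
proof -
  have "continuous_on {a..b} (\<lambda>x. F a + integral {a..x} f)"
    by (intro continuous_intros indefinite_integral_continuous_1 ac_on_integrable(2)[OF assms]) auto
  moreover have "F x = F a + integral {a..x} f" if "x \<in> {a..b}" for x
    using ac_onD[OF assms, of a x] that by (simp add: algebra_simps)
  ultimately show ?thesis by (rule continuous_on_eq[OF _ sym])
qed

lemma ac_on_indefinite:
  assumes "f absolutely_integrable_on {a..b}" shows "ac_on a b (\<lambda>x. c + integral {a..x} f) f"
  unfolding ac_on_def
proof (intro conjI allI impI assms)
  fix s t assume st: "a \<le> s \<and> s \<le> t \<and> t \<le> b"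
  have "f absolutely_integrable_on {a..t}"
    by (rule absolutely_integrable_on_subinterval[OF assms]) (use st in auto)
  then have "integral {a..s} f + integral {s..t} f = integral {a..t} f"
    using st by (intro Henstock_Kurzweil_Integration.integral_combine) (auto simp: absolutely_integrable_on_def)
  then show "c + integral {a..t} f - (c + integral {a..s} f) = integral {s..t} f"
    by (simp add: algebra_simps)
qed

lemma ac_on_cong_AE:
  assumes ac: "ac_on a b F f" and N: "negligible N" and eq: "\<And>t. t \<in> {a..b} - N \<Longrightarrow> f t = g t"
  shows "ac_on a b F g"
proof -
  have "g absolutely_integrable_on {a..b}"
    by (rule absolutely_integrable_spike[OF ac_on_integrable(1)[OF ac order_refl order_refl] N]) (simp add: eq)
  moreover have "integral {s..t} f = integral {s..t} g" if "a \<le> s" "t \<le> b" for s t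
    by (rule integral_spike[OF N]) (use that eq in auto)
  ultimately show ?thesis using ac by (auto simp: ac_on_def)
qed

lemma ac_on_add:
  assumes "ac_on a b F f" "ac_on a b G g" shows "ac_on a b (\<lambda>t. F t + G t) (\<lambda>t. f t + g t)"
proof -
  have "integral {s..t} (\<lambda>t. f t + g t) = integral {s..t} f + integral {s..t} g" if "a \<le> s" "t \<le> b" for s t
    by (rule Henstock_Kurzweil_Integration.integral_add) (use assms that ac_on_integrable(2) in blast)+
  then show ?thesis using assms by (auto simp: ac_on_def algebra_simps)
qed

lemma ac_on_linear:
  assumes h: "bounded_linear h" and F: "ac_on a b F f" shows "ac_on a b (\<lambda>t. h (F t)) (\<lambda>t. h (f t))"
proof -
  interpret bounded_linear h by (rule h)
  have "h (F t) - h (F s) = integral {s..t} (\<lambda>t. h (f t))" if "a \<le> s" "s \<le> t" "t \<le> b" for s t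
  proof -
    have "h (F t) - h (F s) = h (integral {s..t} f)" using ac_onD[OF F that] by (simp add: diff[symmetric])
    also have "\<dots> = integral {s..t} (\<lambda>t. h (f t))"
      using integral_linear[OF ac_on_integrable(2)[OF F that(1,3)] h] by (simp add: o_def)
    finally show ?thesis .
  qed
  moreover have "(\<lambda>t. h (f t)) absolutely_integrable_on {a..b}"
    using absolutely_integrable_linear[OF ac_on_integrable(1)[OF F order_refl order_refl] h] by (simp add: o_def)
  ultimately show ?thesis by (auto simp: ac_on_def)
qed

text \<open>\<open>H\<close> and the increments of \<open>\<Phi>\<close> are both additive over
  adjacent intervals, so a bound valid on intervals of length at most \<open>d\<close> extends by
  cutting off one piece of that length after the other.\<close>

lemma additive_interval_bound:
  fixes H :: "real \<Rightarrow> real \<Rightarrow> 'a::real_normed_vector" and \<Phi> :: "real \<Rightarrow> real"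
  assumes add: "\<And>r s t. a \<le> r \<Longrightarrow> r \<le> s \<Longrightarrow> s \<le> t \<Longrightarrow> t \<le> b \<Longrightarrow> H r t = H r s + H s t"
    and d: "d > 0"
    and small: "\<And>s t. a \<le> s \<Longrightarrow> s \<le> t \<Longrightarrow> t \<le> b \<Longrightarrow> t - s \<le> d \<Longrightarrow> norm (H s t) \<le> e * (\<Phi> t - \<Phi> s)"
    and st: "a \<le> s" "s \<le> t" "t \<le> b"
  shows "norm (H s t) \<le> e * (\<Phi> t - \<Phi> s)"
proof -
  have "norm (H s t) \<le> e * (\<Phi> t - \<Phi> s)" if "t - s \<le> real n * d" "a \<le> s" "s \<le> t" "t \<le> b" for n s t
    using that
  proof (induction n arbitrary: s)
    case 0
    then have "t - s \<le> d" using d by auto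
    then show ?case using small 0 by blast
  next
    case (Suc n)
    show ?case
    proof (cases "t - s \<le> d")
      case True
      then show ?thesis using small Suc by blast
    next
      case False
      let ?r = "s + d"
      have r: "s \<le> ?r" "?r \<le> t" "t - ?r \<le> real n * d" using False d Suc.prems(1) by (auto simp: algebra_simps)
      have "norm (H s t) \<le> norm (H s ?r) + norm (H ?r t)"
        using add[of s ?r t] r Suc.prems norm_triangle_ineq by metis
      also have "\<dots> \<le> e * (\<Phi> ?r - \<Phi> s) + e * (\<Phi> t - \<Phi> ?r)"
        using r Suc.prems by (intro add_mono small Suc.IH) auto
      finally show ?thesis by (simp add: algebra_simps)
    qed
  qed
  moreover obtain n :: nat where "t - s \<le> real n * d"
    using reals_Archimedean3[OF d] less_imp_le by blast
  ultimately show ?thesis using st by blast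
qed

lemma abs_integrable_continuous_product:
  fixes p :: "'a::euclidean_space \<Rightarrow> 'b::euclidean_space \<Rightarrow> 'c::euclidean_space"
  assumes p: "bounded_bilinear p" and F: "continuous_on {a..b} F" and g: "g absolutely_integrable_on {a..b::real}"
  shows "(\<lambda>t. p (F t) (g t)) absolutely_integrable_on {a..b}"
proof (rule absolutely_integrable_bounded_measurable_product[where h=p and f=F and g=g])
  show "bilinear p" using p by (simp add: bilinear_conv_bounded_bilinear)
  show "bounded (F ` {a..b})" using F by (intro compact_imp_bounded compact_continuous_image) auto
  show "F \<in> borel_measurable (lebesgue_on {a..b})"
    by (rule continuous_imp_measurable_on_sets_lebesgue[OF F]) auto
qed (use g in auto)

text \<open>The defect of the product formula is additive over intervals. On short intervals it is
  at most a constant times e times the integral of |f| + |g|, because \<open>F\<close> and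
  \<open>G\<close> are uniformly continuous. Additivity carries this bound to all intervals, and e
  is arbitrary.\<close>

lemma ac_on_bilinear:
  fixes p :: "'a::euclidean_space \<Rightarrow> 'b::euclidean_space \<Rightarrow> 'c::euclidean_space"
  assumes p: "bounded_bilinear p" and F: "ac_on a b F f" and G: "ac_on a b G g"
  shows "ac_on a b (\<lambda>t. p (F t) (G t)) (\<lambda>t. p (f t) (G t) + p (F t) (g t))"
proof -
  interpret p: bounded_bilinear p by (rule p)
  note Fc = ac_on_continuous[OF F] and Gc = ac_on_continuous[OF G]
  let ?h = "\<lambda>t. p (f t) (G t) + p (F t) (g t)"
  have fi: "f absolutely_integrable_on {a..b}" and gi: "g absolutely_integrable_on {a..b}"
    using F G by (auto simp: ac_on_def)
  have p1: "(\<lambda>t. p (f t) (G t)) absolutely_integrable_on {a..b}"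
    using abs_integrable_continuous_product[OF p.flip Gc fi] by simp
  have p2: "(\<lambda>t. p (F t) (g t)) absolutely_integrable_on {a..b}"
    using abs_integrable_continuous_product[OF p Fc gi] by simp
  have hi: "?h absolutely_integrable_on {a..b}" using p1 p2 by (rule set_integral_add)
  have hsub: "?h integrable_on {s..t}" if "a \<le> s" "t \<le> b" for s t
    using absolutely_integrable_on_subinterval[OF hi, of s t] that by (auto simp: absolutely_integrable_on_def)
  let ?n = "\<lambda>t. norm (f t) + norm (g t)"
  have ni: "?n absolutely_integrable_on {a..b}"
    using absolutely_integrable_norm[OF fi] absolutely_integrable_norm[OF gi] by (auto simp: o_def)
  define \<Phi> where "\<Phi> t = 0 + integral {a..t} ?n" for t
  have \<Phi>: "ac_on a b \<Phi> ?n" unfolding \<Phi>_def by (rule ac_on_indefinite[OF ni])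
  define H where "H s t = p (F t) (G t) - p (F s) (G s) - integral {s..t} ?h" for s t
  obtain K where K: "K > 0" "\<And>x y. norm (p x y) \<le> norm x * norm y * K"
    using p.pos_bounded by blast
  have Hadd: "H r t = H r s + H s t" if "a \<le> r" "r \<le> s" "s \<le> t" "t \<le> b" for r s t
    using Henstock_Kurzweil_Integration.integral_combine[OF that(2,3) hsub[OF that(1,4)]]
    by (simp add: H_def algebra_simps)
  have uF: "uniformly_continuous_on {a..b} F" and uG: "uniformly_continuous_on {a..b} G"
    using Fc Gc by (auto intro: compact_uniformly_continuous)
  have bound: "norm (H s t) \<le> K * e * (\<Phi> t - \<Phi> s)" if e: "e > 0" and st: "a \<le> s" "s \<le> t" "t \<le> b" for e s t
  proof -
    obtain d1 where d1: "d1 > 0" "\<And>x y. x \<in> {a..b} \<Longrightarrow> y \<in> {a..b} \<Longrightarrow> dist x y < d1 \<Longrightarrow> dist (F x) (F y) < e"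
      using uF e unfolding uniformly_continuous_on_def by metis
    obtain d2 where d2: "d2 > 0" "\<And>x y. x \<in> {a..b} \<Longrightarrow> y \<in> {a..b} \<Longrightarrow> dist x y < d2 \<Longrightarrow> dist (G x) (G y) < e"
      using uG e unfolding uniformly_continuous_on_def by metis
    define d where "d = min d1 d2 / 2"
    have d: "d > 0" "d < d1" "d < d2" using d1 d2 by (auto simp: d_def)
    show ?thesis
    proof (rule additive_interval_bound[where a=a and b=b and d=d, OF Hadd d(1) _ st])
      fix s t assume st: "a \<le> s" "s \<le> t" "t \<le> b" "t - s \<le> d"
      have fst: "f integrable_on {s..t}" "g integrable_on {s..t}"
        using ac_on_integrable(2)[OF F st(1,3)] ac_on_integrable(2)[OF G st(1,3)] by auto
      have i1: "(\<lambda>\<tau>. p (f \<tau>) (G t)) integrable_on {s..t}" "(\<lambda>\<tau>. p (F s) (g \<tau>)) integrable_on {s..t}"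
        using integrable_linear[OF fst(1) p.bounded_linear_left] integrable_linear[OF fst(2) p.bounded_linear_right]
        by (auto simp: o_def)
      \<comment> \<open>\<open>G\<close> is frozen at the right end and \<open>F\<close> at the left
        end, so that each increment becomes an integral under a fixed linear map.\<close>
      have "p (F t) (G t) - p (F s) (G s) = p (F t - F s) (G t) + p (F s) (G t - G s)"
        by (simp add: p.diff_left p.diff_right)
      also have "\<dots> = p (integral {s..t} f) (G t) + p (F s) (integral {s..t} g)"
        by (simp only: ac_onD[OF F st(1,2,3)] ac_onD[OF G st(1,2,3)])
      also have "\<dots> = integral {s..t} (\<lambda>\<tau>. p (f \<tau>) (G t)) + integral {s..t} (\<lambda>\<tau>. p (F s) (g \<tau>))"
        using integral_linear[OF fst(1) p.bounded_linear_left] integral_linear[OF fst(2) p.bounded_linear_right]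
        by (simp add: o_def)
      also have "\<dots> = integral {s..t} (\<lambda>\<tau>. p (f \<tau>) (G t) + p (F s) (g \<tau>))"
        by (rule Henstock_Kurzweil_Integration.integral_add[symmetric]) (use i1 in auto)
      finally have "H s t = integral {s..t} (\<lambda>\<tau>. p (f \<tau>) (G t) + p (F s) (g \<tau>)) - integral {s..t} ?h"
        by (simp add: H_def)
      also have "\<dots> = integral {s..t} (\<lambda>\<tau>. p (f \<tau>) (G t) + p (F s) (g \<tau>) - ?h \<tau>)"
        by (rule Henstock_Kurzweil_Integration.integral_diff[symmetric, OF integrable_add[OF i1] hsub[OF st(1,3)]])
      finally have "norm (H s t) = norm (integral {s..t} (\<lambda>\<tau>. p (f \<tau>) (G t) + p (F s) (g \<tau>) - ?h \<tau>))" by simp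
      also have "\<dots> \<le> integral {s..t} (\<lambda>\<tau>. K * e * ?n \<tau>)"
      proof (rule Henstock_Kurzweil_Integration.integral_norm_bound_integral)
        show "(\<lambda>\<tau>. p (f \<tau>) (G t) + p (F s) (g \<tau>) - ?h \<tau>) integrable_on {s..t}"
          by (rule integrable_diff[OF integrable_add[OF i1] hsub[OF st(1,3)]])
        show "(\<lambda>\<tau>. K * e * ?n \<tau>) integrable_on {s..t}"
          using ac_on_integrable(2)[OF \<Phi> st(1,3)] by (rule integrable_on_mult_right)
        fix \<tau> assume \<tau>: "\<tau> \<in> {s..t}"
        have "norm (G t - G \<tau>) \<le> e" using d2(2)[of t \<tau>] \<tau> st d by (auto simp: dist_norm intro!: less_imp_le)
        moreover have "norm (F s - F \<tau>) \<le> e" using d1(2)[of s \<tau>] \<tau> st d by (auto simp: dist_norm intro!: less_imp_le)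
        ultimately have "norm (p (f \<tau>) (G t - G \<tau>)) + norm (p (F s - F \<tau>) (g \<tau>)) \<le> norm (f \<tau>) * e * K + e * norm (g \<tau>) * K"
          by (intro add_mono order.trans[OF K(2)] mult_right_mono mult_left_mono) (use K(1) in auto)
        moreover have "p (f \<tau>) (G t) + p (F s) (g \<tau>) - ?h \<tau> = p (f \<tau>) (G t - G \<tau>) + p (F s - F \<tau>) (g \<tau>)"
          by (simp add: p.diff_left p.diff_right)
        ultimately show "norm (p (f \<tau>) (G t) + p (F s) (g \<tau>) - ?h \<tau>) \<le> K * e * ?n \<tau>"
          using norm_triangle_ineq[of "p (f \<tau>) (G t - G \<tau>)" "p (F s - F \<tau>) (g \<tau>)"] by (simp add: algebra_simps)
      qed
      also have "\<dots> = K * e * (\<Phi> t - \<Phi> s)"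
        using ac_onD[OF \<Phi> st(1,2,3)] by simp
      finally show "norm (H s t) \<le> K * e * (\<Phi> t - \<Phi> s)" .
    qed
  qed
  have "H s t = 0" if st: "a \<le> s" "s \<le> t" "t \<le> b" for s t
  proof -
    have M: "0 \<le> \<Phi> t - \<Phi> s" unfolding ac_onD[OF \<Phi> st]
      by (rule Henstock_Kurzweil_Integration.integral_nonneg) (use ac_on_integrable(2)[OF \<Phi> st(1,3)] in auto)
    have "norm (H s t) \<le> 0"
    proof (rule field_le_epsilon)
      fix e :: real assume e: "e > 0"
      let ?e = "e / (K * (\<Phi> t - \<Phi> s + 1))"
      have pos: "0 < K * (\<Phi> t - \<Phi> s + 1)" using K M by simp
      then have "norm (H s t) \<le> K * ?e * (\<Phi> t - \<Phi> s)" using e by (intro bound st) auto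
      also have "\<dots> \<le> e" using e M K pos by (simp add: field_simps)
      finally show "norm (H s t) \<le> 0 + e" by simp
    qed
    then show ?thesis by simp
  qed
  then show ?thesis using hi by (auto simp: ac_on_def H_def)
qed

text \<open>\<open>K\<close> is fixed before \<open>g\<close>, \<open>A\<close> and
  \<open>M\<close>, and depends on \<open>h\<close> only; this uniformity bounds all truncated
  energies by one constant. The bound \<open>M\<close> keeps the suprema finite and does not enter
  \<open>K\<close>. The interval is cut into pieces on which \<open>h\<close> has integral at most
  1/2, so that on each of them the supremum of \<open>g\<close> can be absorbed on the left.\<close>

lemma gronwall_integral:
  fixes h :: "real \<Rightarrow> real"
  assumes h: "h integrable_on {a..b}" and h0: "\<And>t. t \<in> {a..b} \<Longrightarrow> 0 \<le> h t"
  shows "\<exists>K\<ge>0. \<forall>g A M. 0 \<le> A \<longrightarrow> (\<forall>t\<in>{a..b}. 0 \<le> g t \<and> g t \<le> M) \<longrightarrow> (\<lambda>t. h t * g t) integrable_on {a..b} \<longrightarrow>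
     (\<forall>t\<in>{a..b}. g t \<le> A + integral {a..t} (\<lambda>t. h t * g t)) \<longrightarrow> (\<forall>t\<in>{a..b}. g t \<le> K * A)"
proof (cases "a \<le> b")
  case True
  note hsub = integrable_on_subinterval[OF h]
  let ?H = "\<lambda>t. integral {a..t} h"
  have "uniformly_continuous_on {a..b} ?H"
    using indefinite_integral_continuous_1[OF h] by (intro compact_uniformly_continuous) auto
  then obtain d0 where d0: "d0 > 0" "\<And>x y. x \<in> {a..b} \<Longrightarrow> y \<in> {a..b} \<Longrightarrow> dist x y < d0 \<Longrightarrow> dist (?H x) (?H y) < 1/2"
    unfolding uniformly_continuous_on_def by (metis zero_less_divide_1_iff zero_less_numeral)
  define d where "d = d0 / 2"
  have d: "0 < d" "d < d0" using d0 by (auto simp: d_def)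
  have half: "integral {s..t} h \<le> 1/2" if "a \<le> s" "s \<le> t" "t \<le> b" "t - s \<le> d" for s t
  proof -
    have "integral {a..s} h + integral {s..t} h = integral {a..t} h"
      by (rule Henstock_Kurzweil_Integration.integral_combine) (use that hsub in auto)
    moreover have "dist (integral {a..s} h) (integral {a..t} h) < 1/2"
      using d0(2)[of s t] that d by (auto simp: dist_real_def)
    ultimately show ?thesis unfolding dist_real_def by linarith
  qed
  have step: "\<exists>K\<ge>0. \<forall>g A M. 0 \<le> A \<longrightarrow> (\<forall>t\<in>{a..b}. 0 \<le> g t \<and> g t \<le> M) \<longrightarrow> (\<lambda>t. h t * g t) integrable_on {a..b} \<longrightarrow>
     (\<forall>t\<in>{a..b}. g t \<le> A + integral {a..t} (\<lambda>t. h t * g t)) \<longrightarrow> (\<forall>t\<in>{a..b}. t \<le> a + real n * d \<longrightarrow> g t \<le> K * A)" for n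
  proof (induction n)
    case 0
    show ?case
    proof (intro exI[of _ 1] conjI allI impI ballI)
      fix g A M t assume *: "\<forall>t\<in>{a..b}. g t \<le> A + integral {a..t} (\<lambda>t. h t * g t)" "t \<in> {a..b}" "t \<le> a + real 0 * d"
      then have "t = a" by auto
      then show "g t \<le> 1 * A" using *(1,2) by force
    qed auto
  next
    case (Suc n)
    then obtain K where K: "K \<ge> 0" and IH: "\<And>g A M t. 0 \<le> A \<Longrightarrow> (\<forall>t\<in>{a..b}. 0 \<le> g t \<and> g t \<le> M) \<Longrightarrow> (\<lambda>t. h t * g t) integrable_on {a..b} \<Longrightarrow>
     (\<forall>t\<in>{a..b}. g t \<le> A + integral {a..t} (\<lambda>t. h t * g t)) \<Longrightarrow> t\<in>{a..b} \<Longrightarrow> t \<le> a + real n * d \<Longrightarrow> g t \<le> K * A"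
      by blast
    let ?I = "integral {a..b} h"
    have I0: "0 \<le> ?I" using h h0 by (intro Henstock_Kurzweil_Integration.integral_nonneg) auto
    \<comment> \<open>Absorbing half of the supremum doubles the constant on the new piece; the
      summand \<open>K\<close> keeps the bound on the earlier ones.\<close>
    let ?K = "2 * (1 + K * ?I) + K"
    show ?case
    proof (intro exI[of _ ?K] conjI allI impI ballI)
      show "0 \<le> ?K" using K I0 by simp
      fix g A M t
      assume A: "0 \<le> A" and g: "\<forall>t\<in>{a..b}. 0 \<le> g t \<and> g t \<le> M" and gi: "(\<lambda>t. h t * g t) integrable_on {a..b}"
        and ineq: "\<forall>t\<in>{a..b}. g t \<le> A + integral {a..t} (\<lambda>t. h t * g t)"
        and t: "t \<in> {a..b}" "t \<le> a + real (Suc n) * d"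
      have low: "g \<tau> \<le> K * A" if "\<tau> \<in> {a..b}" "\<tau> \<le> a + real n * d" for \<tau>
        using IH[OF A g gi ineq that] .
      show "g t \<le> ?K * A"
      proof (cases "t \<le> a + real n * d")
        case True
        have "0 \<le> 2 * (1 + K * ?I) * A" using K I0 A by simp
        then show ?thesis using low[OF t(1) True] by (simp add: distrib_right)
      next
        case False
        let ?s = "a + real n * d"
        have s: "a \<le> ?s" "?s \<le> t" "?s \<le> b" using False t d by auto
        let ?S = "SUP \<tau>\<in>{?s..t}. g \<tau>"
        have bdd: "bdd_above (g ` {?s..t})"
          by (rule bdd_aboveI[where M=M]) (use g s t in auto)
        have Sup: "g \<tau> \<le> ?S" if "\<tau> \<in> {?s..t}" for \<tau> using cSUP_upper[OF that bdd] .
        have each: "g r \<le> A * (1 + K * ?I) + ?S / 2" if r: "r \<in> {?s..t}" for r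
        proof -
          have rab: "r \<in> {a..b}" using r s t by auto
          note gisub = integrable_on_subinterval[OF gi]
          have "g r \<le> A + integral {a..r} (\<lambda>t. h t * g t)" using ineq rab by blast
          also have "integral {a..r} (\<lambda>t. h t * g t) = integral {a..?s} (\<lambda>t. h t * g t) + integral {?s..r} (\<lambda>t. h t * g t)"
            by (rule Henstock_Kurzweil_Integration.integral_combine[symmetric]) (use r s rab gisub in auto)
          also have "integral {a..?s} (\<lambda>t. h t * g t) \<le> integral {a..?s} (\<lambda>t. h t * (K * A))"
            by (rule integral_le) (use low h0 s gisub hsub in \<open>auto intro!: mult_left_mono integrable_on_mult_left\<close>)
          also have "\<dots> = (K * A) * integral {a..?s} h" by simp
          also have "\<dots> \<le> (K * A) * ?I"
            by (intro mult_left_mono integral_subset_le) (use K A s hsub h h0 in auto)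
          also have "integral {?s..r} (\<lambda>t. h t * g t) \<le> integral {?s..r} (\<lambda>t. h t * ?S)"
            by (rule integral_le) (use Sup h0 s r rab gisub hsub in \<open>auto intro!: mult_left_mono integrable_on_mult_left\<close>)
          also have "\<dots> = ?S * integral {?s..r} h" by simp
          also have "\<dots> \<le> ?S * (1/2)"
          proof (intro mult_left_mono half)
            show "r - ?s \<le> d" using r t(2) by (simp add: algebra_simps)
            have "0 \<le> g r" using g rab by blast
            then show "0 \<le> ?S" using Sup[OF r] by linarith
          qed (use s r rab in auto)
          finally show ?thesis by (simp add: algebra_simps)
        qed
        have "?S \<le> A * (1 + K * ?I) + ?S / 2"
          by (rule cSUP_least) (use s each in auto)
        then have "?S \<le> 2 * (1 + K * ?I) * A" by (simp add: algebra_simps)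
        moreover have "0 \<le> K * A" using K A by simp
        ultimately show ?thesis using Sup[of t] s by (simp add: distrib_right)
      qed
    qed
  qed
  obtain n :: nat where n: "b - a \<le> real n * d"
    using reals_Archimedean3[OF d(1)] less_imp_le by blast
  obtain K where K: "K \<ge> 0" "\<And>g A M t. 0 \<le> A \<Longrightarrow> (\<forall>t\<in>{a..b}. 0 \<le> g t \<and> g t \<le> M) \<Longrightarrow> (\<lambda>t. h t * g t) integrable_on {a..b} \<Longrightarrow>
     (\<forall>t\<in>{a..b}. g t \<le> A + integral {a..t} (\<lambda>t. h t * g t)) \<Longrightarrow> t\<in>{a..b} \<Longrightarrow> t \<le> a + real n * d \<Longrightarrow> g t \<le> K * A"
    using step[of n] by blast
  show ?thesis
  proof (intro exI[of _ K] conjI allI impI ballI K(1))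
    fix g A M t
    assume *: "0 \<le> A" "\<forall>t\<in>{a..b}. 0 \<le> g t \<and> g t \<le> M" "(\<lambda>t. h t * g t) integrable_on {a..b}"
      "\<forall>t\<in>{a..b}. g t \<le> A + integral {a..t} (\<lambda>t. h t * g t)" "t \<in> {a..b}"
    show "g t \<le> K * A" by (rule K(2)[OF *]) (use *(5) n in auto)
  qed
qed (auto intro: exI[of _ 0])

section \<open>Smooth functions of one variable and cut-offs\<close>

lemma Ck_real_Suc:
  fixes g :: "real \<Rightarrow> real"
  assumes d: "\<And>x. (g has_real_derivative g' x) (at x)"
  shows "Ck (Suc n) g \<longleftrightarrow> Ck n g'"
proof -
  have "frechet_derivative g (at x) = (*) (g' x)" for x
    using frechet_derivative_at[OF d[of x, unfolded has_field_derivative_def]] by simp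
  moreover have "g differentiable (at x)" for x
    using d[of x] real_differentiable_def by blast
  ultimately show ?thesis by simp
qed

lemma Ck_real_SucE:
  fixes g :: "real \<Rightarrow> real"
  assumes "Ck (Suc n) g"
  obtains g' where "\<And>x. (g has_real_derivative g' x) (at x)" "Ck n g'"
proof -
  have "\<exists>D. (g has_real_derivative D) (at x)" for x
    using assms by (simp add: real_differentiable_def)
  then obtain g' where g': "\<And>x. (g has_real_derivative g' x) (at x)" by metis
  then show ?thesis using that Ck_real_Suc[OF g', of n] assms by blast
qed

lemma Ck_Suc_imp: "Ck (Suc n) g \<Longrightarrow> Ck n (g :: real \<Rightarrow> real)"
proof (induction n arbitrary: g)
  case 0
  then show ?case by (auto elim!: Ck_real_SucE simp del: Ck.simps(2) intro!: continuous_at_imp_continuous_on DERIV_isCont)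
next
  case (Suc n)
  obtain g' where g': "\<And>x. (g has_real_derivative g' x) (at x)" "Ck (Suc n) g'" by (rule Ck_real_SucE[OF Suc.prems]) blast
  then show ?case using Suc.IH by (subst Ck_real_Suc[OF g'(1)])
qed

lemma Ck_add: "Ck n f \<Longrightarrow> Ck n g \<Longrightarrow> Ck n (\<lambda>x. f x + g x :: real)" for f g :: "real \<Rightarrow> real"
proof (induction n arbitrary: f g)
  case (Suc n)
  obtain f' where f': "\<And>x. (f has_real_derivative f' x) (at x)" "Ck n f'" by (rule Ck_real_SucE[OF Suc.prems(1)]) blast
  obtain g' where g': "\<And>x. (g has_real_derivative g' x) (at x)" "Ck n g'" by (rule Ck_real_SucE[OF Suc.prems(2)]) blast
  have d: "((\<lambda>x. f x + g x) has_real_derivative f' x + g' x) (at x)" for x by (rule DERIV_add[OF f'(1) g'(1)])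
  show ?case unfolding Ck_real_Suc[OF d] by (rule Suc.IH[OF f'(2) g'(2)])
qed (auto intro: continuous_intros)

lemma Ck_mult: "Ck n f \<Longrightarrow> Ck n g \<Longrightarrow> Ck n (\<lambda>x. f x * g x :: real)" for f g :: "real \<Rightarrow> real"
proof (induction n arbitrary: f g)
  case (Suc n)
  obtain f' where f': "\<And>x. (f has_real_derivative f' x) (at x)" "Ck n f'" by (rule Ck_real_SucE[OF Suc.prems(1)]) blast
  obtain g' where g': "\<And>x. (g has_real_derivative g' x) (at x)" "Ck n g'" by (rule Ck_real_SucE[OF Suc.prems(2)]) blast
  have d: "((\<lambda>x. f x * g x) has_real_derivative f' x * g x + g' x * f x) (at x)" for x by (rule DERIV_mult[OF f'(1) g'(1)])
  show ?case unfolding Ck_real_Suc[OF d]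
    by (rule Ck_add[OF Suc.IH[OF f'(2) Ck_Suc_imp[OF Suc.prems(2)]] Suc.IH[OF g'(2) Ck_Suc_imp[OF Suc.prems(1)]]])
qed (auto intro: continuous_intros)

lemma Ck_const [simp]: "Ck n (\<lambda>x::real. c::real)"
proof (induction n arbitrary: c)
  case (Suc n)
  then show ?case by (subst Ck_real_Suc[where g'="\<lambda>x. 0"]) (auto simp del: Ck.simps)
qed auto

lemma Ck_affine: "Ck n f \<Longrightarrow> Ck n (\<lambda>x. f (c + d * x))" for f :: "real \<Rightarrow> real"
proof (induction n arbitrary: f)
  case 0
  then show ?case by (auto intro!: continuous_on_compose2[of UNIV f] continuous_intros)
next
  case (Suc n)
  obtain f' where f': "\<And>x. (f has_real_derivative f' x) (at x)" "Ck n f'" by (rule Ck_real_SucE[OF Suc.prems(1)]) blast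
  have "((\<lambda>x. f (c + d * x)) has_real_derivative f' (c + d * x) * d) (at x)" for x
    by (rule DERIV_chain2[OF f'(1)]) (auto intro!: derivative_eq_intros)
  then show ?case using Ck_mult[OF Suc.IH[OF f'(2)] Ck_const, of d] by (subst Ck_real_Suc)
qed

lemma Ck_inverse:
  fixes f :: "real \<Rightarrow> real"
  shows "Ck n f \<Longrightarrow> (\<And>x. f x \<noteq> 0) \<Longrightarrow> Ck n (\<lambda>x. 1 / f x)"
proof (induction n arbitrary: f)
  case 0
  then show ?case by (auto intro!: continuous_intros)
next
  case (Suc n)
  obtain f' where f': "\<And>x. (f has_real_derivative f' x) (at x)" "Ck n f'" by (rule Ck_real_SucE[OF Suc.prems(1)]) blast
  have d: "((\<lambda>x. 1 / f x) has_real_derivative (-1 * f' x) * ((1 / f x) * (1 / f x))) (at x)" for x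
    using Suc.prems(2)[of x] by (auto intro!: derivative_eq_intros f' simp: power2_eq_square)
  have i: "Ck n (\<lambda>x. 1 / f x)" by (rule Suc.IH[OF Ck_Suc_imp[OF Suc.prems(1)] Suc.prems(2)])
  show ?case unfolding Ck_real_Suc[OF d]
    by (rule Ck_mult[OF Ck_mult[OF Ck_const f'(2)] Ck_mult[OF i i]])
qed

text \<open>For k = 0 the classical function exp (-1/x), extended by 0. The powers of 1/x are
  included because the family is then closed under differentiation up to linear combinations, so
  that smoothness follows by an induction over all k at once.\<close>

definition flat :: "nat \<Rightarrow> real \<Rightarrow> real" where
  "flat k x = (if x > 0 then (1 / x) ^ k * exp (- (1 / x)) else 0)"

lemma power_times_exp_le:
  fixes y :: real
  assumes y: "0 \<le> y" shows "y ^ n * exp (- y) \<le> fact n"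
proof -
  have "(\<Sum>n\<in>{n}. y ^ n /\<^sub>R fact n) \<le> (\<Sum>n. y ^ n /\<^sub>R fact n)"
    by (rule sum_le_suminf[OF summable_exp_generic]) (use y in auto)
  then have "y ^ n / fact n \<le> exp y" by (simp add: exp_def divide_inverse mult.commute)
  then show ?thesis by (simp add: exp_minus field_simps)
qed

text \<open>With y = 1/x the bound y^n e^(-y) \<le> n! is applied for n = k + 2. The two additional
  powers give the quadratic decay from which differentiability at 0 is read off.\<close>

lemma flat_le: "\<bar>flat k x\<bar> \<le> fact (k + 2) * x\<^sup>2"
proof (cases "x > 0")
  case True
  let ?y = "1 / x"
  have y: "?y > 0" using True by simp
  have "?y ^ (k + 2) * exp (- ?y) \<le> fact (k + 2)" using y by (intro power_times_exp_le) simp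
  then have "?y ^ k * exp (- ?y) * ?y\<^sup>2 \<le> fact (k + 2)"
    by (simp only: power_add) (simp add: ac_simps)
  then have "?y ^ k * exp (- ?y) \<le> fact (k + 2) * x\<^sup>2"
    using True by (simp add: field_simps)
  then show ?thesis using True by (simp add: flat_def)
qed (simp add: flat_def)

lemma flat_derivative: "(flat k has_real_derivative - real k * flat (k + 1) x + flat (k + 2) x) (at x)"
proof -
  consider "x > 0" | "x < 0" | "x = 0" by linarith
  then show ?thesis
  proof cases
    case 1
    have "((\<lambda>x. (1 / x) ^ k * exp (- (1 / x))) has_real_derivative - real k * flat (k + 1) x + flat (k + 2) x) (at x)"
    proof -
      have a: "((\<lambda>x. 1 / x) has_real_derivative - (1 / x\<^sup>2)) (at x)"
        using 1 by (auto intro!: derivative_eq_intros simp: power2_eq_square)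
      have b: "((\<lambda>x. (1 / x) ^ k) has_real_derivative real k * (- (1 / x\<^sup>2) * (1 / x) ^ (k - Suc 0))) (at x)"
        using DERIV_power[OF a, of k] by (simp add: ac_simps)
      have c: "((\<lambda>x. exp (- (1 / x))) has_real_derivative exp (- (1 / x)) * (1 / x\<^sup>2)) (at x)"
        using DERIV_fun_exp[OF DERIV_minus[OF a]] by simp
      have k: "real k * (- (1 / x\<^sup>2) * (1 / x) ^ (k - Suc 0)) = - (real k * (1 / x) ^ (k + 1))"
        by (cases k) (simp_all add: power2_eq_square)
      have "- (real k * (1 / x) ^ (k + 1)) * exp (- (1 / x)) + exp (- (1 / x)) * (1 / x\<^sup>2) * (1 / x) ^ k = - real k * flat (k + 1) x + flat (k + 2) x"
        using 1 by (simp add: flat_def power_add power2_eq_square mult.commute mult.left_commute)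
      then show ?thesis using DERIV_mult[OF b c] unfolding k by simp
    qed
    then show ?thesis
      by (rule has_field_derivative_transform_within_open[where S="{0<..}"]) (use 1 in \<open>auto simp: flat_def\<close>)
  next
    case 2
    have "((\<lambda>x. 0::real) has_real_derivative 0) (at x)" by simp
    then have "(flat k has_real_derivative 0) (at x)"
      by (rule has_field_derivative_transform_within_open[where S="{..<0}"]) (use 2 in \<open>auto simp: flat_def\<close>)
    then show ?thesis using 2 by (simp add: flat_def)
  next
    case 3
    have "((\<lambda>h. flat k h / h) \<longlongrightarrow> 0) (at 0)"
    proof (rule Lim_null_comparison)
      show "\<forall>\<^sub>F h in at 0. norm (flat k h / h) \<le> fact (k + 2) * \<bar>h\<bar>"
      proof (rule eventually_at_filter[THEN iffD2], rule always_eventually, intro allI impI)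
        fix h :: real assume "h \<noteq> 0"
        then show "norm (flat k h / h) \<le> fact (k + 2) * \<bar>h\<bar>"
          using flat_le[of k h] by (simp add: abs_divide divide_le_eq power2_eq_square abs_mult mult.assoc)
      qed
      show "((\<lambda>h. fact (k + 2) * \<bar>h\<bar>) \<longlongrightarrow> (0::real)) (at 0)" by (auto intro!: tendsto_eq_intros)
    qed
    then show ?thesis using 3 by (simp add: DERIV_def flat_def)
  qed
qed

lemma Ck_flat: "Ck n (flat k)"
proof (induction n arbitrary: k)
  case 0
  show ?case by (auto intro!: continuous_at_imp_continuous_on DERIV_isCont flat_derivative)
next
  case (Suc n)
  show ?case
    by (subst Ck_real_Suc[OF flat_derivative]) (intro Ck_add Ck_mult[of n "\<lambda>x. - real k"] Suc Ck_const)
qed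

lemma flat_nonneg: "0 \<le> flat k x" by (simp add: flat_def)
lemma flat_pos: "0 < x \<Longrightarrow> 0 < flat k x" by (simp add: flat_def)
lemma flat_zero: "x \<le> 0 \<Longrightarrow> flat k x = 0" by (simp add: flat_def)

definition smooth_step :: "real \<Rightarrow> real" where
  "smooth_step x = flat 0 x * (1 / (flat 0 x + flat 0 (1 - x)))"

text \<open>\<open>x\<close> and \<open>1 - x\<close> cannot both be nonpositive.\<close>

lemma smooth_step_denominator: "0 < flat 0 x + flat 0 (1 - x)"
proof (cases "x > 0")
  case True
  then show ?thesis using flat_pos[of x 0] flat_nonneg[of 0 "1 - x"] by linarith
next
  case False
  then show ?thesis using flat_pos[of "1 - x" 0] flat_nonneg[of 0 x] by linarith
qed

lemma Ck_smooth_step: "Ck n smooth_step"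
proof -
  have "Ck n (\<lambda>x. flat 0 (1 + (-1) * x))" by (rule Ck_affine[OF Ck_flat])
  then have "Ck n (\<lambda>x. flat 0 (1 - x))" by simp
  then have "Ck n (\<lambda>x. flat 0 x * (1 / (flat 0 x + flat 0 (1 - x))))"
    by (intro Ck_mult Ck_inverse Ck_add Ck_flat less_imp_neq[OF smooth_step_denominator, symmetric])
  then show ?thesis by (simp add: smooth_step_def[abs_def])
qed

lemma smooth_step_zero: "x \<le> 0 \<Longrightarrow> smooth_step x = 0" by (simp add: smooth_step_def flat_zero)

lemma smooth_step_one: "1 \<le> x \<Longrightarrow> smooth_step x = 1"
  using smooth_step_denominator[of x] by (simp add: smooth_step_def flat_zero)

lemma smooth_step_bounds: "0 \<le> smooth_step x" "smooth_step x \<le> 1"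
  using smooth_step_denominator[of x] flat_nonneg[of 0 x] flat_nonneg[of 0 "1 - x"]
  by (auto simp: smooth_step_def divide_simps)

text \<open>The ramps have width 1/n and lie inside [s, t], so the functions vanish outside the same
  interval for every n and tend to the indicator of its interior.\<close>

definition plateau :: "real \<Rightarrow> real \<Rightarrow> nat \<Rightarrow> real \<Rightarrow> real" where
  "plateau s t n x = smooth_step (real n * (x - s)) * smooth_step (real n * (t - x))"

lemma Ck_plateau: "Ck m (plateau s t n)"
proof -
  have "Ck m (\<lambda>x. smooth_step (- real n * s + real n * x) * smooth_step (real n * t + - real n * x))"
    by (intro Ck_mult Ck_affine Ck_smooth_step)
  then show ?thesis by (simp add: plateau_def[abs_def] algebra_simps)
qed

lemma plateau_zero: "x \<notin> {s..t} \<Longrightarrow> plateau s t n x = 0"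
  by (auto simp: plateau_def not_le mult_le_0_iff intro!: smooth_step_zero)

lemma plateau_bounds: "0 \<le> plateau s t n x" "plateau s t n x \<le> 1"
  using smooth_step_bounds by (auto simp: plateau_def intro!: mult_le_one)

lemma plateau_tendsto: "(\<lambda>n. plateau s t n x) \<longlonglongrightarrow> indicator {s<..<t} x"
proof (cases "x \<in> {s<..<t}")
  case True
  obtain N1 :: nat where N1: "1 / (x - s) < N1" using reals_Archimedean2 by blast
  obtain N2 :: nat where N2: "1 / (t - x) < N2" using reals_Archimedean2 by blast
  have "plateau s t n x = 1" if n: "n \<ge> max N1 N2" for n
  proof -
    have "1 \<le> real n * (x - s)"
    proof -
      have "1 \<le> real N1 * (x - s)" using N1 True by (simp add: field_simps)
      also have "\<dots> \<le> real n * (x - s)" using n True by (intro mult_right_mono) auto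
      finally show ?thesis .
    qed
    moreover have "1 \<le> real n * (t - x)"
    proof -
      have "1 \<le> real N2 * (t - x)" using N2 True by (simp add: field_simps)
      also have "\<dots> \<le> real n * (t - x)" using n True by (intro mult_right_mono) auto
      finally show ?thesis .
    qed
    ultimately show ?thesis by (simp add: plateau_def smooth_step_one)
  qed
  then show ?thesis using True
    by (intro tendsto_eventually) (auto simp: eventually_sequentially intro!: exI[of _ "max N1 N2"])
next
  case False
  then have "x \<le> s \<or> t \<le> x" by auto
  then have "plateau s t n x = 0" for n by (auto simp: plateau_def mult_le_0_iff intro!: smooth_step_zero)
  then show ?thesis using False by simp
qed

section \<open>Test functions, weak derivatives and primitives in time\<close>

lemma test_function_plateau:
  assumes "a < s" "t < b" shows "time_test_function a b (plateau s t n)"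
  using assms Ck_plateau plateau_zero unfolding time_test_function_def by blast

lemma test_function_continuous:
  assumes "time_test_function a b \<phi>" shows "continuous_on S \<phi>"
proof -
  have "Ck 0 \<phi>" using assms unfolding time_test_function_def by blast
  then show ?thesis by (auto intro: continuous_on_subset)
qed

lemma test_function_ends:
  assumes "time_test_function a b \<phi>" shows "t \<le> a \<Longrightarrow> \<phi> t = 0" "b \<le> t \<Longrightarrow> \<phi> t = 0"
  using assms unfolding time_test_function_def by force+

lemma test_function_deriv:
  assumes "time_test_function a b \<phi>"
  shows "(\<phi> has_real_derivative deriv \<phi> t) (at t)" "continuous_on S (deriv \<phi>)"
proof -
  have "Ck (Suc 0) \<phi>" using assms unfolding time_test_function_def by blast
  then obtain g' where g': "\<And>x. (\<phi> has_real_derivative g' x) (at x)" "Ck 0 g'" by (rule Ck_real_SucE) blast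
  have "deriv \<phi> = g'" using g'(1) DERIV_imp_deriv by blast
  then show "(\<phi> has_real_derivative deriv \<phi> t) (at t)" "continuous_on S (deriv \<phi>)"
    using g' by (auto intro: continuous_on_subset)
qed

lemma test_function_ac:
  assumes "time_test_function a b \<phi>" shows "ac_on c d \<phi> (deriv \<phi>)"
  unfolding ac_on_def
proof (intro conjI allI impI)
  show "deriv \<phi> absolutely_integrable_on {c..d}"
    by (intro absolutely_integrable_continuous_real test_function_deriv[OF assms])
  fix s t assume "c \<le> s \<and> s \<le> t \<and> t \<le> d"
  then show "\<phi> t - \<phi> s = integral {s..t} (deriv \<phi>)"
    using test_function_deriv(1)[OF assms]
    by (intro integral_unique[symmetric] fundamental_theorem_of_calculus)
       (auto simp: has_real_derivative_iff_has_vector_derivative[symmetric] intro: has_field_derivative_at_within)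
qed

text \<open>The primitive starting at \<open>a\<close> vanishes to the left of the support; the
  vanishing of the total integral makes it vanish again to the right.\<close>

lemma test_function_antiderivative:
  assumes \<psi>: "time_test_function a b \<psi>" and ab: "a < b" and z: "integral {a..b} \<psi> = 0"
  obtains \<phi> where "time_test_function a b \<phi>" "deriv \<phi> = \<psi>"
proof -
  obtain c d where cd: "a < c" "d < b" "\<And>t. t \<notin> {c..d} \<Longrightarrow> \<psi> t = 0"
    using \<psi> unfolding time_test_function_def by blast
  define \<phi> where "\<phi> x = integral {a..x} \<psi>" for x
  have \<psi>c: "continuous_on S \<psi>" for S by (rule test_function_continuous[OF \<psi>])
  then have \<psi>i: "\<psi> integrable_on {s..t}" for s t by (intro integrable_continuous_interval)
  have left: "\<phi> x = 0" if "x < c" for x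
    unfolding \<phi>_def by (rule integral_unique, rule has_integral_is_0) (use cd that in auto)
  have right: "\<phi> x = 0" if "x > d" for x
  proof (cases "x < a")
    case False
    then have ax: "a \<le> x" by simp
    show ?thesis
    proof (cases "x \<le> b")
      case True
      have "\<phi> x + integral {x..b} \<psi> = 0" unfolding \<phi>_def z[symmetric]
        by (rule Henstock_Kurzweil_Integration.integral_combine[OF ax True \<psi>i])
      moreover have "integral {x..b} \<psi> = 0" by (rule integral_unique, rule has_integral_is_0) (use cd that in auto)
      ultimately show ?thesis by simp
    next
      case False
      have "integral {a..b} \<psi> + integral {b..x} \<psi> = \<phi> x" unfolding \<phi>_def
        by (rule Henstock_Kurzweil_Integration.integral_combine) (use ab False \<psi>i in auto)
      moreover have "integral {b..x} \<psi> = 0" by (rule integral_unique, rule has_integral_is_0) (use cd in auto)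
      ultimately show ?thesis using z by simp
    qed
  qed (simp add: \<phi>_def)
  have der: "(\<phi> has_real_derivative \<psi> x) (at x)" for x
  proof (cases "x < c")
    case True
    have "((\<lambda>x. 0::real) has_real_derivative 0) (at x)" by simp
    then have "(\<phi> has_real_derivative 0) (at x)"
      by (rule has_field_derivative_transform_within_open[where S="{..<c}"]) (use True left in auto)
    then show ?thesis using cd True by simp
  next
    case False
    have "(\<phi> has_real_derivative \<psi> x) (at x within {a..x+1})"
      unfolding \<phi>_def by (rule integral_has_real_derivative[OF \<psi>c]) (use False cd in auto)
    then show ?thesis
      using at_within_interior[of x "{a..x+1}"] False cd by (simp add: interior_atLeastAtMost_real)
  qed
  have "Ck n \<phi>" for n
  proof (cases n)
    case 0
    then show ?thesis by (auto intro!: continuous_at_imp_continuous_on DERIV_isCont der)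
  next
    case (Suc m)
    then show ?thesis using \<psi> Ck_real_Suc[OF der, of m] unfolding time_test_function_def by blast
  qed
  moreover have "\<exists>c d. a < c \<and> d < b \<and> (\<forall>t. t \<notin> {c..d} \<longrightarrow> \<phi> t = 0)"
    using cd left right by (intro exI[of _ c] exI[of _ d]) (auto simp: not_le)
  ultimately have "time_test_function a b \<phi>" unfolding time_test_function_def by blast
  moreover have "deriv \<phi> = \<psi>" using der DERIV_imp_deriv by blast
  ultimately show ?thesis by (rule that)
qed

lemma Ck_cmult: "Ck n f \<Longrightarrow> Ck n (\<lambda>x. c * f x :: real)" for f :: "real \<Rightarrow> real"
  using Ck_mult[of n "\<lambda>x. c" f] by simp

lemma scaled_integrable:
  fixes g :: "real \<Rightarrow> 'b::euclidean_space"
  assumes "continuous_on {a..b} \<phi>" "g absolutely_integrable_on {a..b}"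
  shows "(\<lambda>t. \<phi> t *\<^sub>R g t) absolutely_integrable_on {a..b}"
  by (rule abs_integrable_continuous_product[OF bounded_bilinear_scaleR assms])

lemma zero_interval_integrals:
  fixes g :: "real \<Rightarrow> 'b::euclidean_space"
  assumes g: "g absolutely_integrable_on {a..b}"
    and z: "\<And>s t. a < s \<Longrightarrow> s \<le> t \<Longrightarrow> t < b \<Longrightarrow> integral {s..t} g = 0"
  shows "negligible {t \<in> {a..b}. g t \<noteq> 0}"
proof -
  define f where "f t = (if t \<in> {a..b} then g t else 0)" for t
  have "f integrable_on UNIV"
    unfolding f_def using g by (subst integrable_restrict_UNIV) (auto simp: absolutely_integrable_on_def)
  then have "f integrable_on cbox c d" for c d using integrable_on_subcbox by blast
  moreover have "integral (cbox s t) f = 0" if sub: "cbox s t \<subseteq> {a<..<b}" for s t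
  proof (cases "s \<le> t")
    case True
    then have "a < s" "t < b" using sub by auto
    then have "integral {s..t} g = 0" using z True by blast
    moreover have "integral {s..t} f = integral {s..t} g"
      by (rule Henstock_Kurzweil_Integration.integral_cong) (use sub in \<open>auto simp: f_def\<close>)
    ultimately show ?thesis by simp
  qed simp
  ultimately have "negligible {t \<in> {a<..<b}. f t \<noteq> 0}"
    by (intro zero_cube_integrals) auto
  then have "negligible ({t \<in> {a<..<b}. f t \<noteq> 0} \<union> {a, b})" by (intro negligible_Un) auto
  then show ?thesis by (rule negligible_subset) (auto simp: f_def)
qed

lemma integral_indicator_Ioo:
  fixes h :: "real \<Rightarrow> 'b::euclidean_space"
  assumes "a \<le> s" "t \<le> b"
  shows "integral {a..b} (\<lambda>x. indicator {s<..<t} x *\<^sub>R h x) = integral {s..t} h"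
proof -
  have "integral {a..b} (\<lambda>x. indicator {s<..<t} x *\<^sub>R h x) = integral {a..b} (\<lambda>x. if x \<in> {s<..<t} then h x else 0)"
    by (rule Henstock_Kurzweil_Integration.integral_cong) auto
  also have "\<dots> = integral ({a..b} \<inter> {s<..<t}) h"
    by (subst Int_commute) (rule Henstock_Kurzweil_Integration.integral_restrict_Int)
  also have "{a..b} \<inter> {s<..<t} = {s<..<t}" using assms by auto
  also have "integral {s<..<t} h = integral {s..t} h" by (metis box_real(1) box_real(2) integral_open_interval)
  finally show ?thesis .
qed

text \<open>A test function minus its integral times a fixed one of integral 1 is the derivative of
  a test function. Hence \<open>g\<close> minus a weighted mean \<open>c\<close> is orthogonal to
  all test functions, and plateaus convert this into vanishing integrals over intervals.\<close>

lemma du_Bois_Reymond: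
  fixes g :: "real \<Rightarrow> 'b::euclidean_space"
  assumes ab: "a < b" and g: "g absolutely_integrable_on {a..b}"
    and zero: "\<And>\<phi>. time_test_function a b \<phi> \<Longrightarrow> integral {a..b} (\<lambda>t. deriv \<phi> t *\<^sub>R g t) = 0"
  shows "\<exists>c N. negligible N \<and> (\<forall>t\<in>{a..b} - N. g t = c)"
proof -
  have gi: "(\<lambda>t. \<psi> t *\<^sub>R h t) integrable_on {a..b}" if "time_test_function a b \<psi>" "h absolutely_integrable_on {a..b}" for \<psi> and h :: "real \<Rightarrow> 'b"
    using scaled_integrable[OF test_function_continuous[OF that(1)] that(2)] by (auto simp: absolutely_integrable_on_def)
  \<comment> \<open>The middle third leaves room for a support that stays away from both
    ends.\<close>
  define s0 where "s0 = (2 * a + b) / 3"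
  define t0 where "t0 = (a + 2 * b) / 3"
  have st0: "a < s0" "s0 < t0" "t0 < b" using ab by (auto simp: s0_def t0_def field_simps)
  \<comment> \<open>The integrals of the plateaus converge to the length of the middle third, so one
    of them is nonzero and can be normalised.\<close>
  obtain n0 where n0: "integral {a..b} (plateau s0 t0 n0) \<noteq> 0"
  proof -
    have "(\<lambda>n. integral {a..b} (plateau s0 t0 n)) \<longlonglongrightarrow> integral {a..b} (indicator {s0<..<t0} :: real \<Rightarrow> real)"
    proof (rule dominated_convergence(2)[where h="\<lambda>_. 1"])
      show "plateau s0 t0 k integrable_on {a..b}" for k
        by (intro integrable_continuous_interval test_function_continuous[OF test_function_plateau[of a s0 t0 b]] st0)
    qed (use plateau_bounds plateau_tendsto in auto)
    moreover have "integral {a..b} (indicator {s0<..<t0} :: real \<Rightarrow> real) = t0 - s0"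
    proof -
      have "integral {a..b} (\<lambda>x. indicator {s0<..<t0} x *\<^sub>R (1::real)) = integral {s0..t0} (\<lambda>x. 1::real)"
        by (rule integral_indicator_Ioo) (use st0 in auto)
      also have "\<dots> = t0 - s0" using st0 by simp
      finally show ?thesis by simp
    qed
    ultimately have "(\<lambda>n. integral {a..b} (plateau s0 t0 n)) \<longlonglongrightarrow> t0 - s0" by simp
    moreover have "t0 - s0 \<noteq> 0" using st0 by simp
    ultimately have "\<exists>n. integral {a..b} (plateau s0 t0 n) \<noteq> 0"
      by (rule_tac ccontr) (simp add: LIMSEQ_const_iff)
    then show ?thesis using that by blast
  qed
  define \<psi>0 where "\<psi>0 x = (1 / integral {a..b} (plateau s0 t0 n0)) * plateau s0 t0 n0 x" for x
  have \<psi>0: "time_test_function a b \<psi>0"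
    unfolding time_test_function_def
  proof (intro conjI allI)
    show "Ck n \<psi>0" for n unfolding \<psi>0_def[abs_def] by (rule Ck_cmult[OF Ck_plateau])
    show "\<exists>c d. a < c \<and> d < b \<and> (\<forall>t. t \<notin> {c..d} \<longrightarrow> \<psi>0 t = 0)"
      using plateau_zero st0 unfolding \<psi>0_def by (intro exI[of _ s0] exI[of _ t0]) auto
  qed
  have \<psi>01: "integral {a..b} \<psi>0 = 1"
    unfolding \<psi>0_def using n0 by simp
  define c where "c = integral {a..b} (\<lambda>t. \<psi>0 t *\<^sub>R g t)"
  have const: "integral {a..b} (\<lambda>t. \<psi> t *\<^sub>R (g t - c)) = 0" if \<psi>: "time_test_function a b \<psi>" for \<psi>
  proof -
    let ?I = "integral {a..b} \<psi>"
    let ?\<chi> = "\<lambda>t. \<psi> t + (- ?I) * \<psi>0 t"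
    obtain c1 d1 where 1: "a < c1" "d1 < b" "\<And>t. t \<notin> {c1..d1} \<Longrightarrow> \<psi> t = 0" using \<psi> unfolding time_test_function_def by blast
    obtain c2 d2 where 2: "a < c2" "d2 < b" "\<And>t. t \<notin> {c2..d2} \<Longrightarrow> \<psi>0 t = 0" using \<psi>0 unfolding time_test_function_def by blast
    have z: "?\<chi> t = 0" if "t \<notin> {min c1 c2..max d1 d2}" for t
    proof -
      have "t \<notin> {c1..d1}" "t \<notin> {c2..d2}" using that by auto
      then show ?thesis using 1(3) 2(3) by simp
    qed
    have "Ck n ?\<chi>" for n using \<psi> \<psi>0 unfolding time_test_function_def by (intro Ck_add Ck_cmult) auto
    moreover have "a < min c1 c2 \<and> max d1 d2 < b" using 1 2 by simp
    ultimately have "time_test_function a b ?\<chi>" unfolding time_test_function_def using z by blast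
    moreover have "integral {a..b} ?\<chi> = 0"
    proof -
      have "integral {a..b} ?\<chi> = ?I + integral {a..b} (\<lambda>t. (- ?I) * \<psi>0 t)"
        by (intro Henstock_Kurzweil_Integration.integral_add integrable_continuous_interval continuous_intros test_function_continuous[OF \<psi>] test_function_continuous[OF \<psi>0])
      then show ?thesis by (simp add: \<psi>01)
    qed
    ultimately obtain \<phi> where \<phi>: "time_test_function a b \<phi>" "deriv \<phi> = ?\<chi>"
      by (rule test_function_antiderivative[OF _ ab]) blast
    have "0 = integral {a..b} (\<lambda>t. ?\<chi> t *\<^sub>R g t)" using zero[OF \<phi>(1)] \<phi>(2) by simp
    also have "\<dots> = integral {a..b} (\<lambda>t. \<psi> t *\<^sub>R g t + (- ?I) *\<^sub>R (\<psi>0 t *\<^sub>R g t))"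
      by (simp only: scaleR_left_distrib scaleR_scaleR)
    also have "\<dots> = integral {a..b} (\<lambda>t. \<psi> t *\<^sub>R g t) + (- ?I) *\<^sub>R c"
      unfolding c_def using Henstock_Kurzweil_Integration.integral_add[OF gi[OF \<psi> g] integrable_cmul[OF gi[OF \<psi>0 g], of "- ?I"]]
      by (simp only: Henstock_Kurzweil_Integration.integral_cmul)
    finally have 1: "integral {a..b} (\<lambda>t. \<psi> t *\<^sub>R g t) = ?I *\<^sub>R c" by simp
    have \<psi>i: "\<psi> integrable_on {a..b}" by (intro integrable_continuous_interval test_function_continuous[OF \<psi>])
    have 2: "integral {a..b} (\<lambda>t. \<psi> t *\<^sub>R c) = ?I *\<^sub>R c"
      using integral_linear[OF \<psi>i bounded_linear_scaleR_left[of c]] by (simp add: o_def)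
    have ci: "(\<lambda>t. \<psi> t *\<^sub>R c) integrable_on {a..b}"
      using integrable_linear[OF \<psi>i bounded_linear_scaleR_left[of c]] by (simp add: o_def)
    show ?thesis
      unfolding scaleR_diff_right Henstock_Kurzweil_Integration.integral_diff[OF gi[OF \<psi> g] ci] 1 2 by simp
  qed
  have "negligible {t \<in> {a..b}. g t - c \<noteq> 0}"
  proof (rule zero_interval_integrals)
    show gc: "(\<lambda>t. g t - c) absolutely_integrable_on {a..b}"
      using g absolutely_integrable_continuous_real[of a b "\<lambda>_. c"] by auto
    fix s t assume st: "a < s" "s \<le> t" "t < b"
    have "(\<lambda>n. integral {a..b} (\<lambda>x. plateau s t n x *\<^sub>R (g x - c))) \<longlonglongrightarrow> integral {a..b} (\<lambda>x. indicator {s<..<t} x *\<^sub>R (g x - c))"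
    proof (rule dominated_convergence(2)[where h="\<lambda>x. norm (g x - c)"])
      show "(\<lambda>x. plateau s t k x *\<^sub>R (g x - c)) integrable_on {a..b}" for k
        by (intro gi gc test_function_plateau st)
      show "(\<lambda>x. norm (g x - c)) integrable_on {a..b}" using gc by (simp add: absolutely_integrable_on_def)
      show "norm (plateau s t k x *\<^sub>R (g x - c)) \<le> norm (g x - c)" for k x
        using plateau_bounds[of s t k x] by (simp add: mult_left_le_one_le)
      show "(\<lambda>k. plateau s t k x *\<^sub>R (g x - c)) \<longlonglongrightarrow> indicator {s<..<t} x *\<^sub>R (g x - c)" for x
        by (intro tendsto_intros plateau_tendsto)
    qed
    then have "integral {a..b} (\<lambda>x. indicator {s<..<t} x *\<^sub>R (g x - c)) = 0"
      using const[OF test_function_plateau[OF st(1,3)]] by (simp add: LIMSEQ_const_iff)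
    also have "integral {a..b} (\<lambda>x. indicator {s<..<t} x *\<^sub>R (g x - c)) = integral {s..t} (\<lambda>x. g x - c)"
      by (rule integral_indicator_Ioo) (use st in auto)
    finally show "integral {s..t} (\<lambda>x. g x - c) = 0" .
  qed
  then show ?thesis by (intro exI[of _ c] exI[of _ "{t \<in> {a..b}. g t - c \<noteq> 0}"]) auto
qed

text \<open>Subtracting a primitive of \<open>h\<close> leaves a function with vanishing weak
  derivative, which is constant almost everywhere.\<close>

lemma weak_derivative_imp_ac:
  fixes g h :: "real \<Rightarrow> 'b::euclidean_space"
  assumes ab: "a < b" and g: "g absolutely_integrable_on {a..b}" and h: "h absolutely_integrable_on {a..b}"
    and w: "\<And>\<phi>. time_test_function a b \<phi> \<Longrightarrow> integral {a..b} (\<lambda>t. deriv \<phi> t *\<^sub>R g t) = - integral {a..b} (\<lambda>t. \<phi> t *\<^sub>R h t)"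
  obtains G N where "ac_on a b G h" "negligible N" "\<And>t. t \<in> {a..b} - N \<Longrightarrow> g t = G t"
proof -
  define G0 where "G0 t = 0 + integral {a..t} h" for t
  have G0: "ac_on a b G0 h" unfolding G0_def by (rule ac_on_indefinite[OF h])
  have G0i: "G0 absolutely_integrable_on {a..b}"
    by (intro absolutely_integrable_continuous_real ac_on_continuous[OF G0])
  have di: "(\<lambda>t. g t - G0 t) absolutely_integrable_on {a..b}" using g G0i by auto
  have dz: "integral {a..b} (\<lambda>t. deriv \<phi> t *\<^sub>R (g t - G0 t)) = 0" if \<phi>: "time_test_function a b \<phi>" for \<phi>
  proof -
    have "ac_on a b (\<lambda>t. \<phi> t *\<^sub>R G0 t) (\<lambda>t. deriv \<phi> t *\<^sub>R G0 t + \<phi> t *\<^sub>R h t)"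
      by (rule ac_on_bilinear[OF bounded_bilinear_scaleR test_function_ac[OF \<phi>] G0])
    from ac_onD[OF this order_refl less_imp_le[OF ab] order_refl]
    have "integral {a..b} (\<lambda>t. deriv \<phi> t *\<^sub>R G0 t + \<phi> t *\<^sub>R h t) = 0"
      using test_function_ends[OF \<phi>] by simp
    moreover have i: "(\<lambda>t. deriv \<phi> t *\<^sub>R G0 t) integrable_on {a..b}" "(\<lambda>t. \<phi> t *\<^sub>R h t) integrable_on {a..b}" "(\<lambda>t. deriv \<phi> t *\<^sub>R g t) integrable_on {a..b}"
      using scaled_integrable[OF test_function_deriv(2)[OF \<phi>] G0i] scaled_integrable[OF test_function_continuous[OF \<phi>] h]
        scaled_integrable[OF test_function_deriv(2)[OF \<phi>] g]
      by (auto simp: absolutely_integrable_on_def)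
    ultimately have "integral {a..b} (\<lambda>t. deriv \<phi> t *\<^sub>R G0 t) = - integral {a..b} (\<lambda>t. \<phi> t *\<^sub>R h t)"
      by (simp add: Henstock_Kurzweil_Integration.integral_add eq_neg_iff_add_eq_0)
    then show ?thesis using w[OF \<phi>] i
      by (simp add: scaleR_diff_right Henstock_Kurzweil_Integration.integral_diff)
  qed
  obtain c N where N: "negligible N" "\<And>t. t \<in> {a..b} - N \<Longrightarrow> g t - G0 t = c"
    using du_Bois_Reymond[OF ab di dz] by blast
  show ?thesis
  proof (rule that[OF _ N(1)])
    show "ac_on a b (\<lambda>t. c + G0 t) h" using G0 by (auto simp: ac_on_def)
    show "g t = c + G0 t" if "t \<in> {a..b} - N" for t using N(2)[OF that] by (simp add: algebra_simps)
  qed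
qed

lemma ac_imp_weak_derivative:
  fixes g h :: "real \<Rightarrow> 'b::euclidean_space"
  assumes ac: "ac_on a b g h" and ab: "a \<le> b" and \<phi>: "time_test_function a b \<phi>"
  shows "integral {a..b} (\<lambda>t. deriv \<phi> t *\<^sub>R g t) = - integral {a..b} (\<lambda>t. \<phi> t *\<^sub>R h t)"
proof -
  have h: "h absolutely_integrable_on {a..b}" using ac by (simp add: ac_on_def)
  have g: "g absolutely_integrable_on {a..b}"
    by (intro absolutely_integrable_continuous_real ac_on_continuous[OF ac])
  have "ac_on a b (\<lambda>t. \<phi> t *\<^sub>R g t) (\<lambda>t. deriv \<phi> t *\<^sub>R g t + \<phi> t *\<^sub>R h t)"
    by (rule ac_on_bilinear[OF bounded_bilinear_scaleR test_function_ac[OF \<phi>] ac])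
  from ac_onD[OF this order_refl ab order_refl]
  have "integral {a..b} (\<lambda>t. deriv \<phi> t *\<^sub>R g t + \<phi> t *\<^sub>R h t) = 0"
    using test_function_ends[OF \<phi>] by simp
  moreover have "(\<lambda>t. deriv \<phi> t *\<^sub>R g t) integrable_on {a..b}" "(\<lambda>t. \<phi> t *\<^sub>R h t) integrable_on {a..b}"
    using scaled_integrable[OF test_function_deriv(2)[OF \<phi>] g] scaled_integrable[OF test_function_continuous[OF \<phi>] h]
    by (auto simp: absolutely_integrable_on_def)
  ultimately show ?thesis
    by (simp add: Henstock_Kurzweil_Integration.integral_add eq_neg_iff_add_eq_0)
qed

text \<open>The set in the open interval where two continuous functions differ is open, so if it is
  null it is empty; the end points follow by continuity. In this way the coefficients of
  \<open>u\<close> themselves, and not only representatives, become absolutely continuous.\<close>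

lemma ac_on_eq_continuous:
  fixes g :: "real \<Rightarrow> 'b::euclidean_space"
  assumes ac: "ac_on a b G h" and g: "continuous_on {a..b} g" and ab: "a < b"
    and N: "negligible N" "\<And>t. t \<in> {a..b} - N \<Longrightarrow> g t = G t"
  shows "ac_on a b g h"
proof -
  let ?d = "\<lambda>t. g t - G t"
  have dc: "continuous_on {a..b} ?d" by (intro continuous_intros g ac_on_continuous[OF ac])
  have op: "open ({a<..<b} \<inter> ?d -` (- {0}))"
    by (rule continuous_open_preimage) (auto intro: continuous_on_subset[OF dc])
  have "({a<..<b} \<inter> ?d -` (- {0})) = {}"
  proof (rule ccontr)
    assume "({a<..<b} \<inter> ?d -` (- {0})) \<noteq> {}"
    moreover have "negligible ({a<..<b} \<inter> ?d -` (- {0}))"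
      by (rule negligible_subset[OF N(1)]) (use N(2) in force)
    ultimately show False using op open_not_negligible by blast
  qed
  then have z: "?d t = 0" if "t \<in> {a<..<b}" for t using that by blast
  have "?d t = 0" if "t \<in> {a..b}" for t
    by (rule continuous_constant_on_closure[where S="{a<..<b}" and f="?d"]) (use dc z that ab in auto)
  then show ?thesis using ac by (auto simp: ac_on_def)
qed

section \<open>Sobolev spaces in terms of Fourier coefficients\<close>

lemma nonneg_summable_on_iff:
  fixes f :: "'a \<Rightarrow> real"
  assumes f: "\<And>k. 0 \<le> f k"
  shows "f summable_on UNIV \<longleftrightarrow> (\<integral>\<^sup>+k. ennreal (f k) \<partial>count_space UNIV) < \<infinity>"
proof -
  have "f summable_on UNIV \<longleftrightarrow> integrable (count_space UNIV) f"
    using summable_on_iff_abs_summable_on_real[of f UNIV] abs_summable_equivalent[of f UNIV]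
    by (simp add: abs_summable_on_def)
  then show ?thesis using f by (simp add: integrable_iff_bounded)
qed

lemma nonneg_infsum_eq:
  fixes f :: "'a \<Rightarrow> real"
  assumes f: "\<And>k. 0 \<le> f k" and s: "f summable_on UNIV"
  shows "ennreal (infsum f UNIV) = (\<integral>\<^sup>+k. ennreal (f k) \<partial>count_space UNIV)"
proof -
  have a: "Infinite_Set_Sum.abs_summable_on f UNIV"
    using s summable_on_iff_abs_summable_on_real[of f UNIV] abs_summable_equivalent[of f UNIV] by simp
  then have "infsum f UNIV = (\<integral>k. f k \<partial>count_space UNIV)"
    using infsetsum_infsum[OF a] by (simp add: infsetsum_def)
  then show ?thesis
    using a f by (subst nn_integral_eq_integral) (auto simp: abs_summable_on_def)
qed

lemma wsum_mono: "(\<And>k. w k \<le> w' k) \<Longrightarrow> wsum w c \<le> wsum w' c"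
  unfolding wsum_def by (intro nn_integral_mono ennreal_leI mult_right_mono) auto

lemma wsum_norm_cong: "(\<And>k. norm (a k) = norm (b k)) \<Longrightarrow> wsum w a = wsum w b"
  by (simp add: wsum_def)

lemma wsum_scaleR:
  assumes "\<And>k. 0 \<le> w k" shows "wsum w (\<lambda>k. a *\<^sub>R c k) = ennreal (a\<^sup>2) * wsum w c"
proof -
  have "ennreal (w k * (norm (a *\<^sub>R c k))\<^sup>2) = ennreal (a\<^sup>2) * ennreal (w k * (norm (c k))\<^sup>2)" for k
    by (subst ennreal_mult'[symmetric]) (auto simp: power_mult_distrib mult_ac)
  then show ?thesis by (simp add: wsum_def nn_integral_cmult)
qed

lemma norm_add_sq_le: "(norm (a + b))\<^sup>2 \<le> 2 * (norm a)\<^sup>2 + 2 * (norm (b::'a::real_normed_vector))\<^sup>2"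
proof -
  have "(norm (a + b))\<^sup>2 \<le> (norm a + norm b)\<^sup>2" by (intro power_mono norm_triangle_ineq) auto
  also have "\<dots> \<le> 2 * (norm a)\<^sup>2 + 2 * (norm b)\<^sup>2"
    using sum_squares_bound[of "norm a" "norm b"] by (simp add: power2_sum)
  finally show ?thesis .
qed

lemma wsum_add:
  assumes w: "\<And>k. 0 \<le> w k" shows "wsum w (\<lambda>k. a k + b k) \<le> 2 * wsum w a + 2 * wsum w b"
proof -
  have "wsum w (\<lambda>k. a k + b k) \<le> (\<integral>\<^sup>+k. 2 * ennreal (w k * (norm (a k))\<^sup>2) + 2 * ennreal (w k * (norm (b k))\<^sup>2) \<partial>lattice)"
    unfolding wsum_def
  proof (rule nn_integral_mono)
    fix k
    have "w k * (norm (a k + b k))\<^sup>2 \<le> w k * (2 * (norm (a k))\<^sup>2 + 2 * (norm (b k))\<^sup>2)"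
      by (intro mult_left_mono norm_add_sq_le w)
    then have "ennreal (w k * (norm (a k + b k))\<^sup>2) \<le> ennreal (2 * (w k * (norm (a k))\<^sup>2) + 2 * (w k * (norm (b k))\<^sup>2))"
      by (intro ennreal_leI) (simp add: algebra_simps)
    then show "ennreal (w k * (norm (a k + b k))\<^sup>2) \<le> 2 * ennreal (w k * (norm (a k))\<^sup>2) + 2 * ennreal (w k * (norm (b k))\<^sup>2)"
      using w[of k] by (simp add: ennreal_plus ennreal_mult')
  qed
  also have "\<dots> = 2 * wsum w a + 2 * wsum w b"
    by (simp add: wsum_def nn_integral_add nn_integral_cmult)
  finally show ?thesis .
qed

lemma wsum_single:
  assumes w: "\<And>k. 0 \<le> w k" shows "ennreal (w k * (norm (c k))\<^sup>2) \<le> wsum w c"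
proof -
  have "ennreal (w k * (norm (c k))\<^sup>2) = (\<integral>\<^sup>+l. ennreal (w l * (norm (c l))\<^sup>2) \<partial>count_space {k})"
    by (simp add: nn_integral_count_space_finite)
  also have "\<dots> = (\<integral>\<^sup>+l. ennreal (w l * (norm (c l))\<^sup>2) * indicator {k} l \<partial>lattice)"
    by (simp add: nn_integral_count_space_indicator)
  also have "\<dots> \<le> wsum w c" unfolding wsum_def
    by (intro nn_integral_mono) (auto split: split_indicator)
  finally show ?thesis .
qed

lemma sobolev_term_eq: "sobolev_term s g k = J k ^ s * (norm (fourier_coeff g k))\<^sup>2"
  by (simp add: sobolev_term_def J_def)

lemma wsum_sobolev: "wsum (\<lambda>k. J k ^ s) (fourier_coeff g) = (\<integral>\<^sup>+k. ennreal (sobolev_term s g k) \<partial>lattice)"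
  by (simp add: wsum_def sobolev_term_eq)

lemma sobolev_term_nonneg: "0 \<le> sobolev_term s g k" by (simp add: sobolev_term_eq)

lemma H_space_Elems: "g \<in> Elems (H_space s) \<longleftrightarrow> g \<in> Elems L2_space \<and> wsum (\<lambda>k. J k ^ s) (fourier_coeff g) < \<infinity>"
  by (simp add: H_space_def wsum_sobolev nonneg_summable_on_iff sobolev_term_nonneg)

lemma H_space_Norm:
  assumes "g \<in> Elems (H_space s)"
  shows "ennreal ((Norm (H_space s) g)\<^sup>2) = wsum (\<lambda>k. J k ^ s) (fourier_coeff g)"
proof -
  have s: "sobolev_term s g summable_on UNIV" using assms by (simp add: H_space_def)
  have "infsum (sobolev_term s g) UNIV \<ge> 0" by (intro infsum_nonneg) (simp add: sobolev_term_nonneg)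
  then show ?thesis
    using nonneg_infsum_eq[OF sobolev_term_nonneg s] by (simp add: H_space_def wsum_sobolev)
qed

lemma H_space_Norm_nonneg: "0 \<le> Norm (H_space s) g"
  by (auto simp: H_space_def intro!: infsum_nonneg sobolev_term_nonneg)

section \<open>Spaces with bounded coefficient functionals\<close>

lemma L2_add:
  assumes g: "g \<in> Elems L2_space" and h: "h \<in> Elems L2_space" shows "(\<lambda>x. g x + h x) \<in> Elems L2_space"
proof -
  have gm: "g \<in> borel_measurable torus" "h \<in> borel_measurable torus" and
    gi: "integrable torus (\<lambda>x. (norm (g x))\<^sup>2)" "integrable torus (\<lambda>x. (norm (h x))\<^sup>2)"
    using g h by (auto simp: L2_space_def)
  have "integrable torus (\<lambda>x. (norm (g x + h x))\<^sup>2)"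
  proof (rule Bochner_Integration.integrable_bound)
    show "integrable torus (\<lambda>x. 2 * (norm (g x))\<^sup>2 + 2 * (norm (h x))\<^sup>2)" using gi by simp
    show "(\<lambda>x. (norm (g x + h x))\<^sup>2) \<in> borel_measurable torus" using gm by measurable
    show "AE x in torus. norm ((norm (g x + h x))\<^sup>2) \<le> norm (2 * (norm (g x))\<^sup>2 + 2 * (norm (h x))\<^sup>2)"
      using norm_add_sq_le by (auto intro!: AE_I2)
  qed
  then show ?thesis using g h gm by (auto simp: L2_space_def torus_periodic_def)
qed

lemma L2_scaleR:
  assumes g: "g \<in> Elems L2_space" shows "(\<lambda>x. a *\<^sub>R g x) \<in> Elems L2_space"
  using g by (auto simp: L2_space_def torus_periodic_def power_mult_distrib)

lemma L2_zero: "(\<lambda>x. 0) \<in> Elems L2_space"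
  by (auto simp: L2_space_def torus_periodic_def)

text \<open>Common ground of L^2, H^s and the mean-free spaces: linear subspaces of L^2 on which
  every Fourier coefficient is a bounded functional. This is what carries Bochner measurability and
  integrals over to coefficients. The constant 3 is the one obtained for L^2.\<close>

definition fourier_space :: "field_space \<Rightarrow> bool" where
  "fourier_space Y \<longleftrightarrow> Elems Y \<subseteq> Elems L2_space \<and> (\<lambda>x. 0) \<in> Elems Y \<and>
     (\<forall>g\<in>Elems Y. \<forall>h\<in>Elems Y. (\<lambda>x. g x + h x) \<in> Elems Y) \<and>
     (\<forall>g\<in>Elems Y. \<forall>a. (\<lambda>x. a *\<^sub>R g x) \<in> Elems Y) \<and>
     (\<forall>g\<in>Elems Y. \<forall>k. norm (fourier_coeff g k) \<le> 3 * Norm Y g)"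

lemma fourier_spaceD:
  assumes "fourier_space Y"
  shows "g \<in> Elems Y \<Longrightarrow> g \<in> Elems L2_space" "(\<lambda>x. 0) \<in> Elems Y"
    and "g \<in> Elems Y \<Longrightarrow> h \<in> Elems Y \<Longrightarrow> (\<lambda>x. g x + h x) \<in> Elems Y"
    and "g \<in> Elems Y \<Longrightarrow> (\<lambda>x. a *\<^sub>R g x) \<in> Elems Y"
    and "g \<in> Elems Y \<Longrightarrow> norm (fourier_coeff g k) \<le> 3 * Norm Y g"
  using assms by (auto simp: fourier_space_def)

lemma fourier_space_diff:
  assumes Y: "fourier_space Y" and g: "g \<in> Elems Y" and h: "h \<in> Elems Y"
  shows "(\<lambda>x. g x - h x) \<in> Elems Y"
  using fourier_spaceD(3)[OF Y g fourier_spaceD(4)[OF Y h, of "-1"]] by simp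

lemma fourier_space_sum:
  assumes Y: "fourier_space Y" and g: "\<And>i. i \<in> I \<Longrightarrow> g i \<in> Elems Y"
  shows "(\<lambda>x. \<Sum>i\<in>I. a i *\<^sub>R g i x) \<in> Elems Y"
  using g
proof (induction I rule: infinite_finite_induct)
  case (insert i I)
  then have "(\<lambda>x. a i *\<^sub>R g i x + (\<Sum>i\<in>I. a i *\<^sub>R g i x)) \<in> Elems Y"
    by (intro fourier_spaceD(3)[OF Y] fourier_spaceD(4)[OF Y]) auto
  then show ?case using insert.hyps by simp
qed (auto intro: fourier_spaceD(2)[OF Y])

lemma fourier_space_L2: "fourier_space L2_space"
  unfolding fourier_space_def using L2_add L2_scaleR L2_zero norm_fourier_coeff_le by blast

lemma fourier_space_H: "fourier_space (H_space s)"
  unfolding fourier_space_def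
proof (intro conjI ballI allI)
  show "Elems (H_space s) \<subseteq> Elems L2_space" by (auto simp: H_space_Elems)
  show "(\<lambda>x. 0) \<in> Elems (H_space s)" by (simp add: H_space_Elems L2_zero wsum_def)
next
  fix g h assume g: "g \<in> Elems (H_space s)" and h: "h \<in> Elems (H_space s)"
  have "wsum (\<lambda>k. J k ^ s) (fourier_coeff (\<lambda>x. g x + h x)) = wsum (\<lambda>k. J k ^ s) (\<lambda>k. fourier_coeff g k + fourier_coeff h k)"
    using g h by (simp add: H_space_Elems fourier_coeff_add L2_integrable wsum_def)
  also have "\<dots> \<le> 2 * wsum (\<lambda>k. J k ^ s) (fourier_coeff g) + 2 * wsum (\<lambda>k. J k ^ s) (fourier_coeff h)"
    by (rule wsum_add) simp
  also have "\<dots> < \<infinity>" using g h by (simp add: H_space_Elems ennreal_mult_less_top)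
  finally show "(\<lambda>x. g x + h x) \<in> Elems (H_space s)"
    using g h by (simp add: H_space_Elems L2_add)
next
  fix g a assume g: "g \<in> Elems (H_space s)"
  have "wsum (\<lambda>k. J k ^ s) (fourier_coeff (\<lambda>x. a *\<^sub>R g x)) = ennreal (a\<^sup>2) * wsum (\<lambda>k. J k ^ s) (fourier_coeff g)"
    using wsum_scaleR[of "\<lambda>k. J k ^ s" a "fourier_coeff g"] by (simp add: wsum_def fourier_coeff_scaleR)
  then show "(\<lambda>x. a *\<^sub>R g x) \<in> Elems (H_space s)"
    using g by (simp add: H_space_Elems L2_scaleR ennreal_mult_less_top)
next
  fix g k assume g: "g \<in> Elems (H_space s)"
  have "ennreal (1 * (norm (fourier_coeff g k))\<^sup>2) \<le> ennreal (J k ^ s * (norm (fourier_coeff g k))\<^sup>2)"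
    by (intro ennreal_leI mult_right_mono one_le_power J_ge_1) auto
  also have "\<dots> \<le> wsum (\<lambda>k. J k ^ s) (fourier_coeff g)" by (rule wsum_single) simp
  finally have "(norm (fourier_coeff g k))\<^sup>2 \<le> (Norm (H_space s) g)\<^sup>2"
    by (simp add: H_space_Norm[OF g, symmetric])
  then have "norm (fourier_coeff g k) \<le> Norm (H_space s) g"
    by (rule power2_le_imp_le) (rule H_space_Norm_nonneg)
  then show "norm (fourier_coeff g k) \<le> 3 * Norm (H_space s) g" using H_space_Norm_nonneg[of s g] by linarith
qed

lemma fourier_space_Hdot: "fourier_space (Hdot_space s)"
proof -
  have i: "integrable torus g" if "g \<in> Elems (H_space s)" for g
    using that by (auto simp: H_space_Elems intro: L2_integrable)
  show ?thesis
    using fourier_space_H[of s] i unfolding fourier_space_def Hdot_space_def by (auto simp: subset_iff)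
qed

section \<open>From Bochner measurability and integrals to coefficients\<close>

lemma borel_measurable_AE_lebesgue_on:
  fixes f g :: "'a::euclidean_space \<Rightarrow> 'b::euclidean_space"
  assumes S: "S \<in> sets lebesgue" and f: "f \<in> borel_measurable (lebesgue_on S)" and ae: "AE x in lebesgue_on S. f x = g x"
  shows "g \<in> borel_measurable (lebesgue_on S)"
proof -
  have "(\<lambda>x. if x \<in> S then f x else 0) \<in> borel_measurable lebesgue"
    using f S by (simp add: borel_measurable_if)
  moreover have "AE x in lebesgue. (if x \<in> S then f x else 0) = (if x \<in> S then g x else 0)"
    using ae S by (simp add: AE_restrict_space_iff)
  ultimately have "(\<lambda>x. if x \<in> S then g x else 0) \<in> borel_measurable lebesgue"
    by (rule borel_measurable_AE)
  then show ?thesis using S by (simp add: borel_measurable_if)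
qed

lemma simple_into_elem: "simple_into Y S \<sigma> \<Longrightarrow> t \<in> S \<Longrightarrow> \<sigma> t \<in> Elems Y"
  by (auto simp: simple_into_def)

lemma coeff_norm_diff_le:
  assumes Y: "fourier_space Y" and g: "g \<in> Elems Y" and h: "h \<in> Elems Y"
  shows "norm (fourier_coeff g k - fourier_coeff h k) \<le> 3 * Norm Y (\<lambda>x. g x - h x)"
  using fourier_spaceD(5)[OF Y fourier_space_diff[OF Y g h], of k]
  by (simp add: fourier_coeff_diff L2_integrable fourier_spaceD(1)[OF Y] g h)

lemma coeff_tendsto:
  assumes Y: "fourier_space Y" and g: "\<And>n. g n \<in> Elems Y" and h: "h \<in> Elems Y"
    and lim: "(\<lambda>n. Norm Y (\<lambda>x. g n x - h x)) \<longlonglongrightarrow> 0"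
  shows "(\<lambda>n. fourier_coeff (g n) k) \<longlonglongrightarrow> fourier_coeff h k"
proof (rule LIM_zero_cancel, rule Lim_null_comparison)
  show "\<forall>\<^sub>F n in sequentially. norm (fourier_coeff (g n) k - fourier_coeff h k) \<le> 3 * Norm Y (\<lambda>x. g n x - h x)"
    using coeff_norm_diff_le[OF Y g h] by simp
  show "(\<lambda>n. 3 * Norm Y (\<lambda>x. g n x - h x)) \<longlonglongrightarrow> 0" using tendsto_mult_right_zero[OF lim] .
qed

text \<open>Simple functions have measurable coefficients, as they take finitely many values on
  measurable sets, and boundedness of the coefficient functional makes these converge at almost
  every time.\<close>

lemma strongly_measurable_coeff:
  assumes Y: "fourier_space Y" and S: "S \<in> sets lebesgue" and u: "strongly_measurable Y S u"
  shows "(\<lambda>t. fourier_coeff (u t) k) \<in> borel_measurable (lebesgue_on S)"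
    and "AE t in lebesgue_on S. u t \<in> Elems Y"
proof -
  obtain \<sigma> where \<sigma>: "\<And>n. simple_into Y S (\<sigma> n)"
    and lim: "AE t in lebesgue_on S. u t \<in> Elems Y \<and> (\<lambda>n. Norm Y (\<lambda>x. \<sigma> n t x - u t x)) \<longlonglongrightarrow> 0"
    using u by (auto simp: strongly_measurable_def)
  show "AE t in lebesgue_on S. u t \<in> Elems Y" using lim by eventually_elim simp
  have sm: "(\<lambda>t. fourier_coeff (\<sigma> n t) k) \<in> borel_measurable (lebesgue_on S)" for n
  proof -
    have "simple_function (lebesgue_on S) (\<sigma> n)" using \<sigma>[of n] by (simp add: simple_into_def)
    from simple_function_compose1[OF this, of "\<lambda>g. fourier_coeff g k"] show ?thesis
      by (rule borel_measurable_simple_function)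
  qed
  have conv: "AE t in lebesgue_on S. (\<lambda>n. fourier_coeff (\<sigma> n t) k) \<longlonglongrightarrow> fourier_coeff (u t) k"
    using lim AE_space
  proof eventually_elim
    case (elim t)
    then have "t \<in> S" using S by simp
    then show ?case using coeff_tendsto[OF Y, of "\<lambda>n. \<sigma> n t" "u t" k] elim simple_into_elem[OF \<sigma>] by blast
  qed
  let ?g = "\<lambda>t. lim (\<lambda>n. if convergent (\<lambda>n. fourier_coeff (\<sigma> n t) k) then fourier_coeff (\<sigma> n t) k else 0)"
  have "(\<lambda>t. lim (\<lambda>n. fourier_coeff (\<sigma> n t) k)) \<in> borel_measurable (lebesgue_on S)"
    by (rule borel_measurable_lim_metric[OF sm])
  moreover have "AE t in lebesgue_on S. lim (\<lambda>n. fourier_coeff (\<sigma> n t) k) = fourier_coeff (u t) k"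
    using conv by eventually_elim (rule limI)
  ultimately show "(\<lambda>t. fourier_coeff (u t) k) \<in> borel_measurable (lebesgue_on S)"
    by (rule borel_measurable_AE_lebesgue_on[OF S])
qed

lemma coeff_simple_integral:
  assumes Y: "fourier_space Y" and S: "S \<in> lmeasurable" and \<sigma>: "simple_into Y S \<sigma>"
  shows "integrable (lebesgue_on S) (\<lambda>t. fourier_coeff (\<sigma> t) k)"
    and "(\<integral>t. fourier_coeff (\<sigma> t) k \<partial>lebesgue_on S) = fourier_coeff (simple_integral S \<sigma>) k"
    and "simple_integral S \<sigma> \<in> Elems Y"
proof -
  have Sm: "S \<in> sets lebesgue" using S by (simp add: fmeasurable_def)
  have sf: "simple_function (lebesgue_on S) \<sigma>" and el: "\<sigma> ` S \<subseteq> Elems Y" using \<sigma> by (auto simp: simple_into_def)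
  have fin: "finite (\<sigma> ` S)" using sf Sm by (simp add: simple_function_def)
  let ?A = "\<lambda>g. {t \<in> S. \<sigma> t = g}"
  have A: "?A g \<in> sets (lebesgue_on S)" if "g \<in> \<sigma> ` S" for g
  proof -
    have "\<sigma> -` {g} \<inter> S \<in> sets (lebesgue_on S)" using sf that Sm by (auto simp: simple_function_def)
    moreover have "\<sigma> -` {g} \<inter> S = ?A g" by auto
    ultimately show ?thesis by simp
  qed
  have eS: "emeasure (lebesgue_on S) (?A g) < \<infinity>" if "g \<in> \<sigma> ` S" for g
  proof -
    have "emeasure (lebesgue_on S) (?A g) \<le> emeasure (lebesgue_on S) S"
      using A[OF that] by (intro emeasure_mono) (auto simp: Sm)
    also have "\<dots> < \<infinity>" using S Sm by (simp add: emeasure_restrict_space fmeasurable_def del: emeasure_completion)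
    finally show ?thesis .
  qed
  have eq: "fourier_coeff (\<sigma> t) k = (\<Sum>g\<in>\<sigma> ` S. indicator (?A g) t *\<^sub>R fourier_coeff g k)" if "t \<in> S" for t
  proof -
    have "(\<Sum>g\<in>\<sigma> ` S. indicator (?A g) t *\<^sub>R fourier_coeff g k) = (\<Sum>g\<in>\<sigma> ` S. if g = \<sigma> t then fourier_coeff g k else 0)"
      using that by (intro sum.cong) auto
    then show ?thesis using fin that by simp
  qed
  have ii: "integrable (lebesgue_on S) (\<lambda>t. indicator (?A g) t *\<^sub>R fourier_coeff g k)" if "g \<in> \<sigma> ` S" for g
    using A[OF that] eS[OF that] by (intro integrable_scaleR_left integrable_real_indicator)
  have "integrable (lebesgue_on S) (\<lambda>t. \<Sum>g\<in>\<sigma> ` S. indicator (?A g) t *\<^sub>R fourier_coeff g k)"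
    by (intro Bochner_Integration.integrable_sum ii)
  then show "integrable (lebesgue_on S) (\<lambda>t. fourier_coeff (\<sigma> t) k)"
    using eq Sm by (subst Bochner_Integration.integrable_cong[OF refl]) auto
  have "(\<integral>t. fourier_coeff (\<sigma> t) k \<partial>lebesgue_on S) = (\<integral>t. (\<Sum>g\<in>\<sigma> ` S. indicator (?A g) t *\<^sub>R fourier_coeff g k) \<partial>lebesgue_on S)"
    using eq Sm by (intro Bochner_Integration.integral_cong) auto
  also have "\<dots> = (\<Sum>g\<in>\<sigma> ` S. \<integral>t. indicator (?A g) t *\<^sub>R fourier_coeff g k \<partial>lebesgue_on S)"
    by (intro Bochner_Integration.integral_sum ii)
  also have "\<dots> = (\<Sum>g\<in>\<sigma> ` S. measure lebesgue (?A g) *\<^sub>R fourier_coeff g k)"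
  proof (rule sum.cong[OF refl])
    fix g assume g: "g \<in> \<sigma> ` S"
    have "measure (lebesgue_on S) (?A g) = measure lebesgue (?A g)"
      using Sm by (intro measure_restrict_space) auto
    moreover have "?A g \<inter> S = ?A g" by auto
    ultimately show "(\<integral>t. indicator (?A g) t *\<^sub>R fourier_coeff g k \<partial>lebesgue_on S) = measure lebesgue (?A g) *\<^sub>R fourier_coeff g k"
      using A[OF g] eS[OF g] Sm by (subst integral_scaleR_left) (auto intro: integrable_real_indicator)
  qed
  also have "\<dots> = fourier_coeff (simple_integral S \<sigma>) k"
    unfolding simple_integral_def using el
    by (subst fourier_coeff_sum) (auto simp: fourier_coeff_scaleR intro!: L2_integrable fourier_spaceD(1)[OF Y] integrable_scaleR_right)
  finally show "(\<integral>t. fourier_coeff (\<sigma> t) k \<partial>lebesgue_on S) = fourier_coeff (simple_integral S \<sigma>) k" .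
  show "simple_integral S \<sigma> \<in> Elems Y"
    unfolding simple_integral_def by (rule fourier_space_sum[OF Y]) (use el in auto)
qed

text \<open>Both convergences in the definition, of the simple functions in the mean and of their
  integrals in \<open>Y\<close>, pass through the bounded coefficient functional; there they
  identify an ordinary Lebesgue integral.\<close>

lemma has_field_integral_coeff:
  assumes Y: "fourier_space Y" and S: "S \<in> lmeasurable" and I: "has_field_integral Y S u I"
  shows "integrable (lebesgue_on S) (\<lambda>t. fourier_coeff (u t) k)"
    and "(\<integral>t. fourier_coeff (u t) k \<partial>lebesgue_on S) = fourier_coeff I k"
proof -
  have Sm: "S \<in> sets lebesgue" using S by (simp add: fmeasurable_def)
  obtain \<sigma> where sm: "strongly_measurable Y S u" and IY: "I \<in> Elems Y" and \<sigma>: "\<And>n. simple_into Y S (\<sigma> n)"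
    and l1: "(\<lambda>n. \<integral>\<^sup>+t. ennreal (Norm Y (\<lambda>x. \<sigma> n t x - u t x)) \<partial>lebesgue_on S) \<longlonglongrightarrow> 0"
    and l2: "(\<lambda>n. Norm Y (\<lambda>x. simple_integral S (\<sigma> n) x - I x)) \<longlonglongrightarrow> 0"
    using I by (auto simp: has_field_integral_def)
  note um = strongly_measurable_coeff(1)[OF Y Sm sm, of k] and ae = strongly_measurable_coeff(2)[OF Y Sm sm]
  note si = coeff_simple_integral[OF Y S \<sigma>]
  have le: "(\<integral>\<^sup>+t. ennreal (norm (fourier_coeff (\<sigma> n t) k - fourier_coeff (u t) k)) \<partial>lebesgue_on S)
     \<le> ennreal 3 * (\<integral>\<^sup>+t. ennreal (Norm Y (\<lambda>x. \<sigma> n t x - u t x)) \<partial>lebesgue_on S)" for n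
  proof -
    \<comment> \<open>The factor 3 is moved to the side of the coefficients, whose measurability is
      known, before it is taken out of the integral; for the norm in a general \<open>Y\<close>
      measurability in time is not at hand.\<close>
    let ?m = "\<lambda>t. ennreal (norm (fourier_coeff (\<sigma> n t) k - fourier_coeff (u t) k) / 3)"
    have mm: "?m \<in> borel_measurable (lebesgue_on S)" using um si(1)[of n k] by measurable
    have "(\<integral>\<^sup>+t. ennreal (norm (fourier_coeff (\<sigma> n t) k - fourier_coeff (u t) k)) \<partial>lebesgue_on S) = (\<integral>\<^sup>+t. ennreal 3 * ?m t \<partial>lebesgue_on S)"
      by (intro nn_integral_cong) (simp add: ennreal_mult'[symmetric] del: ennreal_numeral)
    also have "\<dots> = ennreal 3 * (\<integral>\<^sup>+t. ?m t \<partial>lebesgue_on S)" by (rule nn_integral_cmult[OF mm])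
    also have "(\<integral>\<^sup>+t. ?m t \<partial>lebesgue_on S) \<le> (\<integral>\<^sup>+t. ennreal (Norm Y (\<lambda>x. \<sigma> n t x - u t x)) \<partial>lebesgue_on S)"
    proof (rule nn_integral_mono_AE)
      show "AE t in lebesgue_on S. ?m t \<le> ennreal (Norm Y (\<lambda>x. \<sigma> n t x - u t x))"
        using ae AE_space
      proof eventually_elim
        case (elim t)
        then have "\<sigma> n t \<in> Elems Y" using simple_into_elem[OF \<sigma>] Sm by simp
        then show ?case using coeff_norm_diff_le[OF Y, of "\<sigma> n t" "u t" k] elim by (intro ennreal_leI) simp
      qed
    qed
    finally show ?thesis by (simp add: mult_left_mono)
  qed
  have l1': "(\<lambda>n. \<integral>\<^sup>+t. ennreal (norm (fourier_coeff (\<sigma> n t) k - fourier_coeff (u t) k)) \<partial>lebesgue_on S) \<longlonglongrightarrow> 0"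
  proof (rule tendsto_sandwich[OF _ _ tendsto_const])
    show "(\<lambda>n. ennreal 3 * (\<integral>\<^sup>+t. ennreal (Norm Y (\<lambda>x. \<sigma> n t x - u t x)) \<partial>lebesgue_on S)) \<longlonglongrightarrow> 0"
      using ennreal_tendsto_cmult[OF _ l1, of "ennreal 3"] by simp
  qed (use le in auto)
  then have "\<forall>\<^sub>F n in sequentially. (\<integral>\<^sup>+t. ennreal (norm (fourier_coeff (\<sigma> n t) k - fourier_coeff (u t) k)) \<partial>lebesgue_on S) < 1"
    by (rule order_tendstoD(2)) simp
  then obtain n where n: "(\<integral>\<^sup>+t. ennreal (norm (fourier_coeff (\<sigma> n t) k - fourier_coeff (u t) k)) \<partial>lebesgue_on S) < 1"
    by (auto simp: eventually_sequentially)
  have "integrable (lebesgue_on S) (\<lambda>t. fourier_coeff (\<sigma> n t) k - fourier_coeff (u t) k)"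
    by (rule integrableI_bounded) (use n um si(1)[of n k] in \<open>auto intro: order.strict_trans\<close>)
  from Bochner_Integration.integrable_diff[OF si(1)[of n k] this]
  show ui: "integrable (lebesgue_on S) (\<lambda>t. fourier_coeff (u t) k)" by simp
  have "(\<lambda>n. \<integral>t. fourier_coeff (\<sigma> n t) k \<partial>lebesgue_on S) \<longlonglongrightarrow> (\<integral>t. fourier_coeff (u t) k \<partial>lebesgue_on S)"
    by (rule tendsto_L1_int[OF si(1) ui l1'])
  moreover have "(\<lambda>n. fourier_coeff (simple_integral S (\<sigma> n)) k) \<longlonglongrightarrow> fourier_coeff I k"
    by (rule coeff_tendsto[OF Y si(3) IY l2])
  ultimately show "(\<integral>t. fourier_coeff (u t) k \<partial>lebesgue_on S) = fourier_coeff I k"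
    unfolding si(2) by (rule LIMSEQ_unique)
qed

section \<open>A countable dense family of trigonometric polynomials\<close>

lemma integrable_finite_support:
  fixes c :: "'a \<Rightarrow> 'b::{banach,second_countable_topology}"
  assumes "finite {k. c k \<noteq> 0}" shows "integrable (count_space UNIV) c"
proof -
  have "integrable (count_space UNIV) (\<lambda>k. \<Sum>j\<in>{k. c k \<noteq> 0}. indicator {j} k *\<^sub>R c j)"
    by (intro Bochner_Integration.integrable_sum integrable_scaleR_left integrable_real_indicator) auto
  moreover have "(\<Sum>j\<in>{k. c k \<noteq> 0}. indicator {j} k *\<^sub>R c j) = c k" for k
  proof -
    have "(\<Sum>j\<in>{k. c k \<noteq> 0}. indicator {j} k *\<^sub>R c j) = (\<Sum>j\<in>{k. c k \<noteq> 0}. if j = k then c j else 0)"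
      by (intro sum.cong) (auto simp: indicator_def)
    then show ?thesis using assms by auto
  qed
  ultimately show ?thesis by simp
qed

text \<open>Symmetrisation averages the value at k with the conjugate value at -k, where the weights
  agree, and the squared norm is convex.\<close>

lemma wsum_symm:
  assumes w: "\<And>k. 0 \<le> w k" "\<And>k. w (- k) = w k" shows "wsum w (symm a) \<le> wsum w a"
proof -
  let ?f = "\<lambda>k. ennreal (w k * (norm (a k))\<^sup>2)"
  have "wsum w (symm a) \<le> (\<integral>\<^sup>+k. ennreal (1/2) * ?f k + ennreal (1/2) * ?f (0 - k) \<partial>lattice)"
    unfolding wsum_def
  proof (rule nn_integral_mono)
    fix k
    have "(norm (symm a k))\<^sup>2 = (1/4) * (norm (a k + vcnj (a (- k))))\<^sup>2"
      by (simp add: symm_def power_mult_distrib power2_eq_square)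
    also have "\<dots> \<le> 1/2 * (norm (a k))\<^sup>2 + 1/2 * (norm (a (- k)))\<^sup>2"
      using norm_add_sq_le[of "a k" "vcnj (a (- k))"] by simp
    finally have "w k * (norm (symm a k))\<^sup>2 \<le> w k * (1/2 * (norm (a k))\<^sup>2 + 1/2 * (norm (a (- k)))\<^sup>2)"
      by (intro mult_left_mono w)
    also have "\<dots> = 1/2 * (w k * (norm (a k))\<^sup>2) + 1/2 * (w (- k) * (norm (a (- k)))\<^sup>2)"
      by (simp add: w algebra_simps)
    finally have "ennreal (w k * (norm (symm a k))\<^sup>2) \<le> ennreal (1/2 * (w k * (norm (a k))\<^sup>2) + 1/2 * (w (- k) * (norm (a (- k)))\<^sup>2))"
      by (rule ennreal_leI)
    also have "\<dots> = ennreal (1/2 * (w k * (norm (a k))\<^sup>2)) + ennreal (1/2 * (w (- k) * (norm (a (- k)))\<^sup>2))"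
      by (rule ennreal_plus) (use w(1) in auto)
    finally show "ennreal (w k * (norm (symm a k))\<^sup>2) \<le> ennreal (1/2) * ?f k + ennreal (1/2) * ?f (0 - k)"
      by (simp only: ennreal_mult'[of "1/2"] diff_0 order_refl zero_le_divide_1_iff zero_le_numeral)
  qed
  also have "\<dots> = ennreal (1/2) * wsum w a + ennreal (1/2) * wsum w a"
    using lattice_reflect[of ?f 0] by (simp add: nn_integral_add nn_integral_cmult wsum_def del: diff_0)
  also have "\<dots> = wsum w a"
  proof -
    have "ennreal (1/2) + ennreal (1/2) = 1" by (subst ennreal_plus[symmetric]) auto
    then show ?thesis by (metis distrib_right mult_1)
  qed
  finally show ?thesis .
qed

definition dense_point :: "nat \<Rightarrow> complex^3" where
  "dense_point = (SOME q. \<forall>x. \<forall>e>0. \<exists>n. dist (q n) x < e)"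

lemma dense_point:
  assumes "e > 0" shows "\<exists>n. dist (dense_point n) x < e"
proof -
  have "\<exists>q :: nat \<Rightarrow> complex^3. \<forall>x. \<forall>e>0. \<exists>n. dist (q n) x < e"
  proof -
    obtain D :: "(complex^3) set" where D: "countable D" "\<And>X. open X \<Longrightarrow> X \<noteq> {} \<Longrightarrow> \<exists>d\<in>D. d \<in> X"
      by (erule countable_dense_setE)
    have "\<exists>n. dist (from_nat_into D n) x < e" if "e > 0" for x e
    proof -
      obtain d where "d \<in> D" "d \<in> ball x e" using D(2)[of "ball x e"] \<open>e > 0\<close> by auto
      moreover obtain n where "from_nat_into D n = d" using from_nat_into_surj[OF D(1) \<open>d \<in> D\<close>] by blast
      ultimately show ?thesis by (auto simp: dist_commute)
    qed
    then show ?thesis by blast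
  qed
  then have "\<forall>x. \<forall>e>0. \<exists>n. dist (dense_point n) x < e" unfolding dense_point_def by (rule someI_ex)
  then show ?thesis using assms by blast
qed

text \<open>Lists of frequencies paired with indices into a dense sequence of values form a
  countable type, so that the resulting trigonometric polynomials can be enumerated.\<close>

definition trig_coeff :: "((int^3) \<times> nat) list \<Rightarrow> int^3 \<Rightarrow> complex^3" where
  "trig_coeff l k = (case map_of l k of None \<Rightarrow> 0 | Some n \<Rightarrow> dense_point n)"

text \<open>Index 0 is reserved for the zero field. The best approximation among the first members
  is then never worse than 0, and this provides the dominating function for the limit
  theorems.\<close>

definition trig_enum :: "nat \<Rightarrow> field" where
  "trig_enum n = synth (trig_coeff (if n = 0 then [] else from_nat (n - 1)))"

lemma trig_coeff_support: "finite {k. trig_coeff l k \<noteq> 0}"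
  by (rule finite_subset[OF _ finite_dom_map_of[of l]]) (auto simp: trig_coeff_def split: option.splits)

lemma trig_enum_coeff: "fourier_coeff (trig_enum n) = symm (trig_coeff (if n = 0 then [] else from_nat (n - 1)))"
  by (rule ext) (simp add: trig_enum_def fourier_coeff_synth integrable_finite_support trig_coeff_support)

lemma trig_enum_0: "fourier_coeff (trig_enum 0) k = 0"
  by (simp add: trig_enum_coeff symm_def trig_coeff_def vec_eq_iff)

lemma trig_enum_H: "trig_enum n \<in> Elems (H_space s)"
proof -
  let ?c = "trig_coeff (if n = 0 then [] else from_nat (n - 1))"
  have "wsum (\<lambda>k. J k ^ s) (symm ?c) \<le> wsum (\<lambda>k. J k ^ s) ?c" by (rule wsum_symm) auto
  also have "\<dots> = (\<Sum>k\<in>{k. ?c k \<noteq> 0}. ennreal (J k ^ s * (norm (?c k))\<^sup>2))"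
    unfolding wsum_def by (rule nn_integral_count_space') (auto simp: trig_coeff_support)
  also have "\<dots> < \<infinity>" by (simp add: trig_coeff_support)
  finally show ?thesis
    by (auto simp: H_space_Elems trig_enum_coeff)
       (auto simp: trig_enum_def intro!: synth_L2 integrable_finite_support trig_coeff_support)
qed

text \<open>Outside a finite set of modes less than e/2 of the weighted sum remains. On that set the
  coefficients are replaced by members of the dense sequence, the permitted error being shared
  equally among the modes.\<close>

lemma trig_enum_dense:
  assumes g: "wsum (\<lambda>k. J k ^ s) (fourier_coeff g) < \<infinity>" and e: "e > 0"
  shows "\<exists>n. wsum (\<lambda>k. J k ^ s) (\<lambda>k. fourier_coeff (trig_enum n) k - fourier_coeff g k) < ennreal e"
proof -
  let ?c = "fourier_coeff g"
  let ?f = "\<lambda>k. ennreal (J k ^ s * (norm (?c k))\<^sup>2)"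
  let ?A = "\<lambda>n. {k::int^3. to_nat k < n}"
  have finA: "finite (?A n)" for n
  proof -
    have "?A n = to_nat -` {..<n}" by auto
    then show ?thesis by (simp add: finite_vimageI)
  qed
  have "(\<lambda>n. \<integral>\<^sup>+k. ?f k * indicator (- ?A n) k \<partial>lattice) \<longlonglongrightarrow> (\<integral>\<^sup>+k. 0 \<partial>lattice)"
  proof (rule nn_integral_dominated_convergence[where w="?f"])
    show "AE k in lattice. (\<lambda>n. ?f k * indicator (- ?A n) k) \<longlonglongrightarrow> 0"
    proof (rule AE_I2)
      fix k
      show "(\<lambda>n. ?f k * indicator (- ?A n) k) \<longlonglongrightarrow> 0"
        by (rule tendsto_eventually) (auto simp: eventually_sequentially intro!: exI[of _ "Suc (to_nat k)"])
    qed
    show "(\<integral>\<^sup>+k. ?f k \<partial>lattice) < \<infinity>" using g by (simp add: wsum_def)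
  qed (auto split: split_indicator)
  then have "\<forall>\<^sub>F n in sequentially. (\<integral>\<^sup>+k. ?f k * indicator (- ?A n) k \<partial>lattice) < ennreal (e / 2)"
    by (rule order_tendstoD(2)) (use e in auto)
  then obtain N where N: "(\<integral>\<^sup>+k. ?f k * indicator (- ?A N) k \<partial>lattice) < ennreal (e / 2)"
    by (auto simp: eventually_sequentially)
  \<comment> \<open>The added 1 keeps the divisor positive when the finite set is empty.\<close>
  let ?M = "real (card (?A N)) + 1"
  have "\<exists>n. J k ^ s * (norm (dense_point n - ?c k))\<^sup>2 \<le> e / (2 * ?M)" for k
  proof -
    let ?\<delta> = "sqrt (e / (2 * ?M * J k ^ s))"
    have "?\<delta> > 0" using e by simp
    then obtain n where "dist (dense_point n) (?c k) < ?\<delta>" using dense_point by blast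
    then have "(norm (dense_point n - ?c k))\<^sup>2 \<le> ?\<delta>\<^sup>2"
      by (intro power_mono) (auto simp: dist_norm)
    also have "\<dots> = e / (2 * ?M * J k ^ s)" using e by simp
    finally have "J k ^ s * (norm (dense_point n - ?c k))\<^sup>2 \<le> J k ^ s * (e / (2 * ?M * J k ^ s))"
      by (intro mult_left_mono) auto
    also have "\<dots> = e / (2 * ?M)" by simp
    finally show ?thesis by blast
  qed
  then obtain i where i: "\<And>k. J k ^ s * (norm (dense_point (i k) - ?c k))\<^sup>2 \<le> e / (2 * ?M)" by metis
  obtain xs where xs: "set xs = ?A N" using finite_list[OF finA] by blast
  define l where "l = map (\<lambda>k. (k, i k)) xs"
  have tl: "trig_coeff l k = (if k \<in> ?A N then dense_point (i k) else 0)" for k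
    by (simp add: trig_coeff_def l_def map_of_map_restrict xs restrict_map_def del: mem_Collect_eq)
  define n where "n = Suc (to_nat l)"
  have ncoeff: "fourier_coeff (trig_enum n) = symm (trig_coeff l)"
    by (simp add: trig_enum_coeff n_def)
  \<comment> \<open>The enumeration symmetrises the chosen values. As the coefficients of
    \<open>g\<close> are Hermitian, the true error is the symmetrisation of the error before it, and
    symmetrising does not increase the sum.\<close>
  have "wsum (\<lambda>k. J k ^ s) (\<lambda>k. fourier_coeff (trig_enum n) k - ?c k) = wsum (\<lambda>k. J k ^ s) (symm (\<lambda>k. trig_coeff l k - ?c k))"
  proof -
    have "fourier_coeff (trig_enum n) k - ?c k = symm (\<lambda>k. trig_coeff l k - ?c k) k" for k
    proof -
      have "symm (\<lambda>k. trig_coeff l k - ?c k) k = symm (trig_coeff l) k - symm ?c k"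
        by (simp add: symm_def vcnj_diff scaleR_diff_right scaleR_add_right)
      then show ?thesis by (simp add: ncoeff symm_fourier_coeff)
    qed
    then show ?thesis by (simp only: wsum_def)
  qed
  also have "\<dots> \<le> wsum (\<lambda>k. J k ^ s) (\<lambda>k. trig_coeff l k - ?c k)" by (rule wsum_symm) auto
  also have "\<dots> \<le> (\<integral>\<^sup>+k. ennreal (e / (2 * ?M)) * indicator (?A N) k + ?f k * indicator (- ?A N) k \<partial>lattice)"
    unfolding wsum_def using i by (intro nn_integral_mono) (auto simp: tl split: split_indicator intro!: ennreal_leI)
  also have "\<dots> = ennreal (e / (2 * ?M)) * emeasure lattice (?A N) + (\<integral>\<^sup>+k. ?f k * indicator (- ?A N) k \<partial>lattice)"
    by (subst nn_integral_add) (auto simp: nn_integral_cmult_indicator)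
  also have "\<dots> = ennreal (e / (2 * ?M) * real (card (?A N))) + (\<integral>\<^sup>+k. ?f k * indicator (- ?A N) k \<partial>lattice)"
    by (subst ennreal_mult'') (use finA in \<open>simp_all add: emeasure_count_space_finite ennreal_of_nat_eq_real_of_nat\<close>)
  also have "\<dots> < ennreal (e / 2) + ennreal (e / 2)"
  proof -
    have "e / (2 * ?M) * real (card (?A N)) \<le> e / 2" using e by (simp add: field_simps)
    then have "ennreal (e / (2 * ?M) * real (card (?A N))) \<le> ennreal (e / 2)" by (rule ennreal_leI)
    then have "ennreal (e / (2 * ?M) * real (card (?A N))) + (\<integral>\<^sup>+k. ?f k * indicator (- ?A N) k \<partial>lattice)
       \<le> ennreal (e / 2) + (\<integral>\<^sup>+k. ?f k * indicator (- ?A N) k \<partial>lattice)" by (rule add_right_mono)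
    also have "\<dots> < ennreal (e / 2) + ennreal (e / 2)"
      using N by (simp add: ennreal_add_left_cancel_less)
    finally show ?thesis .
  qed
  also have "\<dots> = ennreal e" using e by (subst ennreal_plus[symmetric]) auto
  finally show ?thesis by blast
qed

section \<open>From coefficients back to Bochner measurability and integrals\<close>

lemma lattice_nn_measurable:
  assumes f: "\<And>k. f k \<in> borel_measurable M"
  shows "(\<lambda>x. \<integral>\<^sup>+k. f k x \<partial>lattice) \<in> borel_measurable M"
proof -
  interpret L: sigma_finite_measure lattice by (rule sigma_finite_lattice)
  have "case_prod f \<in> borel_measurable (lattice \<Otimes>\<^sub>M M)"
    by (rule measurable_pair_measure_countable1) (use f in auto)
  from measurable_compose[OF measurable_pair_swap' this]
  have "(\<lambda>(x, k). f k x) \<in> borel_measurable (M \<Otimes>\<^sub>M lattice)" by (simp add: case_prod_beta')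
  then show ?thesis by (rule L.borel_measurable_nn_integral)
qed

lemma wsum_measurable:
  fixes c :: "'a \<Rightarrow> int^3 \<Rightarrow> complex^3"
  assumes "\<And>k. (\<lambda>t. c t k) \<in> borel_measurable M"
  shows "(\<lambda>t. wsum w (c t)) \<in> borel_measurable M"
  unfolding wsum_def using assms by (intro lattice_nn_measurable) measurable

lemma norm_tendsto_zero:
  assumes x: "\<And>n. 0 \<le> x n" and l: "(\<lambda>n. ennreal ((x n)\<^sup>2)) \<longlonglongrightarrow> 0" shows "x \<longlonglongrightarrow> 0"
proof -
  have "(\<lambda>n. (x n)\<^sup>2) \<longlonglongrightarrow> 0" using tendsto_ennrealD[of "\<lambda>n. (x n)\<^sup>2" 0] l by simp
  then have "(\<lambda>n. sqrt ((x n)\<^sup>2)) \<longlonglongrightarrow> sqrt 0" by (rule tendsto_real_sqrt)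
  then show ?thesis using x by simp
qed

lemma H_norm_diff:
  assumes "g \<in> Elems (H_space s)" "h \<in> Elems (H_space s)"
  shows "ennreal ((Norm (H_space s) (\<lambda>x. g x - h x))\<^sup>2) = wsum (\<lambda>k. J k ^ s) (\<lambda>k. fourier_coeff g k - fourier_coeff h k)"
  using H_space_Norm[OF fourier_space_diff[OF fourier_space_H assms]] assms
  by (simp add: wsum_def fourier_coeff_diff L2_integrable H_space_Elems)

text \<open>The approximating simple functions take the value among the first \<open>n\<close> elements of the dense
  sequence that is closest to \<open>F t\<close>.\<close>

lemma simple_approximation:
  assumes S: "S \<in> sets lebesgue" and m: "\<And>k. (\<lambda>t. fourier_coeff (F t) k) \<in> borel_measurable (lebesgue_on S)"
  shows "\<exists>\<sigma>. (\<forall>n. simple_into (H_space s) S (\<sigma> n)) \<and>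
     (\<forall>t. wsum (\<lambda>k. J k ^ s) (fourier_coeff (F t)) < \<infinity> \<longrightarrow>
        (\<lambda>n. wsum (\<lambda>k. J k ^ s) (\<lambda>k. fourier_coeff (\<sigma> n t) k - fourier_coeff (F t) k)) \<longlonglongrightarrow> 0) \<and>
     (\<forall>n t. wsum (\<lambda>k. J k ^ s) (\<lambda>k. fourier_coeff (\<sigma> n t) k - fourier_coeff (F t) k) \<le> wsum (\<lambda>k. J k ^ s) (fourier_coeff (F t)))"
proof -
  let ?M = "lebesgue_on S"
  define d where "d i t = wsum (\<lambda>k. J k ^ s) (\<lambda>k. fourier_coeff (trig_enum i) k - fourier_coeff (F t) k)" for i t
  have dm[measurable]: "d i \<in> borel_measurable ?M" for i
    unfolding d_def using m by (intro wsum_measurable) measurable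
  define P where "P n i t \<longleftrightarrow> i \<le> n \<and> (\<forall>j\<in>{..n}. d i t \<le> d j t)" for n i t
  \<comment> \<open>Among several minimisers the least index is taken, which makes the selection
    measurable in time.\<close>
  define \<iota> where "\<iota> n t = (LEAST i. P n i t)" for n t
  have exP: "\<exists>i. P n i t" for n t
  proof -
    have "finite ((\<lambda>i. d i t) ` {..n})" "(\<lambda>i. d i t) ` {..n} \<noteq> {}" by auto
    from Min_in[OF this] obtain i where "i \<in> {..n}" "Min ((\<lambda>i. d i t) ` {..n}) = d i t" by (rule imageE) blast
    then have "i \<le> n" "d i t = Min ((\<lambda>i. d i t) ` {..n})" by auto
    then show ?thesis unfolding P_def by auto
  qed
  have Pi: "P n (\<iota> n t) t" for n t unfolding \<iota>_def using exP by (rule LeastI_ex)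
  have dmin: "d (\<iota> n t) t \<le> d j t" if "j \<le> n" for n j t using Pi[of n t] that by (auto simp: P_def)
  have Pm[measurable]: "Measurable.pred ?M (\<lambda>t. P n i t)" for n i
    unfolding P_def by measurable
  have \<iota>m: "\<iota> n \<in> measurable ?M (count_space UNIV)" for n
    unfolding \<iota>_def by measurable
  have \<iota>s: "simple_function ?M (\<iota> n)" for n
  proof (unfold simple_function_def, intro conjI ballI)
    have "\<iota> n ` space ?M \<subseteq> {..n}" using Pi by (auto simp: P_def)
    then show "finite (\<iota> n ` space ?M)" by (rule finite_subset) simp
    show "\<iota> n -` {x} \<inter> space ?M \<in> sets ?M" for x
      by (rule measurable_sets[OF \<iota>m]) simp
  qed
  define \<sigma> where "\<sigma> n t = trig_enum (\<iota> n t)" for n t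
  have deq: "wsum (\<lambda>k. J k ^ s) (\<lambda>k. fourier_coeff (\<sigma> n t) k - fourier_coeff (F t) k) = d (\<iota> n t) t" for n t
    by (simp add: d_def \<sigma>_def)
  show ?thesis
  proof (intro exI[of _ \<sigma>] conjI allI impI)
    show "simple_into (H_space s) S (\<sigma> n)" for n
      unfolding simple_into_def \<sigma>_def using \<iota>s trig_enum_H by (auto intro: simple_function_compose1)
    show "wsum (\<lambda>k. J k ^ s) (\<lambda>k. fourier_coeff (\<sigma> n t) k - fourier_coeff (F t) k) \<le> wsum (\<lambda>k. J k ^ s) (fourier_coeff (F t))" for n t
    proof -
      have "d (\<iota> n t) t \<le> d 0 t" by (rule dmin) simp
      also have "d 0 t = wsum (\<lambda>k. J k ^ s) (fourier_coeff (F t))" by (simp add: d_def trig_enum_0 wsum_def)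
      finally show ?thesis by (simp only: deq)
    qed
    fix t assume fin: "wsum (\<lambda>k. J k ^ s) (fourier_coeff (F t)) < \<infinity>"
    show "(\<lambda>n. wsum (\<lambda>k. J k ^ s) (\<lambda>k. fourier_coeff (\<sigma> n t) k - fourier_coeff (F t) k)) \<longlonglongrightarrow> 0"
      unfolding deq
    proof (rule order_tendstoI)
      fix a :: ennreal assume "0 < a"
      then obtain e where e: "e > 0" "ennreal e \<le> a"
        by (metis ennreal_cases ennreal_less_zero_iff ennreal_zero_less_one order_refl top_greatest ennreal_1 zero_less_one)
      obtain i where i: "d i t < ennreal e" using trig_enum_dense[OF fin e(1)] unfolding d_def by blast
      have "d (\<iota> n t) t < a" if "n \<ge> i" for n
        using dmin[OF that, of t] i e(2) by (metis order.strict_trans1 order.strict_trans2)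
      then show "\<forall>\<^sub>F n in sequentially. d (\<iota> n t) t < a" by (auto simp: eventually_sequentially)
    qed simp
  qed
qed

text \<open>The nearest members of a countable dense set provide the simple functions, and distances
  to them are measurable as soon as the coefficients are: Pettis' theorem in the present
  setting.\<close>

lemma strongly_measurable_H:
  assumes S: "S \<in> sets lebesgue" and m: "\<And>k. (\<lambda>t. fourier_coeff (F t) k) \<in> borel_measurable (lebesgue_on S)"
    and el: "AE t in lebesgue_on S. F t \<in> Elems (H_space s)"
  shows "strongly_measurable (H_space s) S F"
proof -
  obtain \<sigma> where \<sigma>: "\<And>n. simple_into (H_space s) S (\<sigma> n)"
    and lim: "\<And>t. wsum (\<lambda>k. J k ^ s) (fourier_coeff (F t)) < \<infinity> \<Longrightarrow>
        (\<lambda>n. wsum (\<lambda>k. J k ^ s) (\<lambda>k. fourier_coeff (\<sigma> n t) k - fourier_coeff (F t) k)) \<longlonglongrightarrow> 0"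
    using simple_approximation[OF S m] by blast
  show ?thesis unfolding strongly_measurable_def
  proof (intro exI[of _ \<sigma>] conjI allI \<sigma>)
    show "AE t in lebesgue_on S. F t \<in> Elems (H_space s) \<and> (\<lambda>n. Norm (H_space s) (\<lambda>x. \<sigma> n t x - F t x)) \<longlonglongrightarrow> 0"
      using el AE_space
    proof eventually_elim
      case (elim t)
      have \<sigma>t: "\<sigma> n t \<in> Elems (H_space s)" for n using simple_into_elem[OF \<sigma>] elim S by simp
      have "(\<lambda>n. Norm (H_space s) (\<lambda>x. \<sigma> n t x - F t x)) \<longlonglongrightarrow> 0"
        by (rule norm_tendsto_zero[OF H_space_Norm_nonneg])
           (use lim[of t] elim \<sigma>t in \<open>simp add: H_norm_diff H_space_Elems\<close>)
      then show ?case using elim by simp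
    qed
  qed
qed

text \<open>Cauchy-Schwarz in time for each coefficient, followed by an exchange of the sum with the
  integral.\<close>

lemma wsum_integral_le:
  fixes c :: "'a \<Rightarrow> int^3 \<Rightarrow> complex^3"
  assumes c: "\<And>k. (\<lambda>t. c t k) \<in> borel_measurable M" and w: "\<And>k. 0 \<le> w k"
  shows "wsum w (\<lambda>k. \<integral>t. c t k \<partial>M) \<le> emeasure M (space M) * (\<integral>\<^sup>+t. wsum w (c t) \<partial>M)"
proof -
  have "wsum w (\<lambda>k. \<integral>t. c t k \<partial>M) \<le> (\<integral>\<^sup>+k. emeasure M (space M) * (\<integral>\<^sup>+t. ennreal (w k * (norm (c t k))\<^sup>2) \<partial>M) \<partial>lattice)"
    unfolding wsum_def
  proof (rule nn_integral_mono)
    fix k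
    have "ennreal (w k * (norm (\<integral>t. c t k \<partial>M))\<^sup>2) = ennreal (w k) * (ennreal (norm (\<integral>t. c t k \<partial>M)))\<^sup>2"
      using w by (simp add: ennreal_mult' ennreal_power)
    also have "\<dots> \<le> ennreal (w k) * (emeasure M (space M) * (\<integral>\<^sup>+t. ennreal ((norm (c t k))\<^sup>2) \<partial>M))"
      by (intro mult_left_mono norm_integral_square_le c) auto
    also have "\<dots> = emeasure M (space M) * (\<integral>\<^sup>+t. ennreal (w k) * ennreal ((norm (c t k))\<^sup>2) \<partial>M)"
      using c by (subst nn_integral_cmult) (auto simp: mult.left_commute)
    finally show "ennreal (w k * (norm (\<integral>t. c t k \<partial>M))\<^sup>2) \<le> emeasure M (space M) * (\<integral>\<^sup>+t. ennreal (w k * (norm (c t k))\<^sup>2) \<partial>M)"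
      using w by (simp add: ennreal_mult')
  qed
  also have "\<dots> = emeasure M (space M) * (\<integral>\<^sup>+k. \<integral>\<^sup>+t. ennreal (w k * (norm (c t k))\<^sup>2) \<partial>M \<partial>lattice)"
    by (rule nn_integral_cmult) simp
  also have "(\<integral>\<^sup>+k. \<integral>\<^sup>+t. ennreal (w k * (norm (c t k))\<^sup>2) \<partial>M \<partial>lattice) = (\<integral>\<^sup>+t. wsum w (c t) \<partial>M)"
    unfolding wsum_def using c by (intro nn_integral_count_space_nn_integral[symmetric]) auto
  finally show ?thesis .
qed

text \<open>Dominated by the weighted sum of \<open>F t\<close> itself, the approximating simple
  functions converge in mean square, and on a set of finite measure also in the mean. The value
  \<open>I\<close> is recognised by its coefficients.\<close>

lemma has_field_integral_H:
  assumes S: "S \<in> lmeasurable" and m: "\<And>k. (\<lambda>t. fourier_coeff (F t) k) \<in> borel_measurable (lebesgue_on S)"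
    and el: "AE t in lebesgue_on S. F t \<in> Elems L2_space"
    and fin: "(\<integral>\<^sup>+t. wsum (\<lambda>k. J k ^ s) (fourier_coeff (F t)) \<partial>lebesgue_on S) < \<infinity>"
    and I: "I \<in> Elems L2_space" and Ic: "\<And>k. fourier_coeff I k = (\<integral>t. fourier_coeff (F t) k \<partial>lebesgue_on S)"
  shows "has_field_integral (H_space s) S F I"
proof -
  let ?M = "lebesgue_on S"
  let ?w = "\<lambda>k. J k ^ s"
  have Sm: "S \<in> sets lebesgue" using S by (simp add: fmeasurable_def)
  have eS: "emeasure ?M (space ?M) < \<infinity>" using S Sm
    by (simp add: emeasure_restrict_space fmeasurable_def del: emeasure_completion)
  have wm[measurable]: "(\<lambda>t. wsum ?w (fourier_coeff (F t))) \<in> borel_measurable ?M"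
    by (rule wsum_measurable) (rule m)
  have finAE: "AE t in ?M. wsum ?w (fourier_coeff (F t)) < \<infinity>"
    using nn_integral_PInf_AE[OF wm] fin by (auto simp: top.not_eq_extremum)
  have elH: "AE t in ?M. F t \<in> Elems (H_space s)"
    using el finAE by eventually_elim (simp add: H_space_Elems)
  obtain \<sigma> where \<sigma>: "\<And>n. simple_into (H_space s) S (\<sigma> n)"
    and lim: "\<And>t. wsum ?w (fourier_coeff (F t)) < \<infinity> \<Longrightarrow>
        (\<lambda>n. wsum ?w (\<lambda>k. fourier_coeff (\<sigma> n t) k - fourier_coeff (F t) k)) \<longlonglongrightarrow> 0"
    and dom: "\<And>n t. wsum ?w (\<lambda>k. fourier_coeff (\<sigma> n t) k - fourier_coeff (F t) k) \<le> wsum ?w (fourier_coeff (F t))"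
    using simple_approximation[OF Sm m] by blast
  note si = coeff_simple_integral[OF fourier_space_H S \<sigma>]
  let ?D = "\<lambda>n t k. fourier_coeff (\<sigma> n t) k - fourier_coeff (F t) k"
  have Dm: "(\<lambda>t. ?D n t k) \<in> borel_measurable ?M" for n k
    using m si(1)[of n k] by measurable
  have Wm[measurable]: "(\<lambda>t. wsum ?w (?D n t)) \<in> borel_measurable ?M" for n
    by (rule wsum_measurable) (rule Dm)
  have W0: "(\<lambda>n. \<integral>\<^sup>+t. wsum ?w (?D n t) \<partial>?M) \<longlonglongrightarrow> 0"
  proof -
    have "(\<lambda>n. \<integral>\<^sup>+t. wsum ?w (?D n t) \<partial>?M) \<longlonglongrightarrow> (\<integral>\<^sup>+t. 0 \<partial>?M)"
    proof (rule nn_integral_dominated_convergence[OF Wm _ wm _ fin])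
      show "AE t in ?M. wsum ?w (?D j t) \<le> wsum ?w (fourier_coeff (F t))" for j by (simp add: dom)
      show "AE t in ?M. (\<lambda>n. wsum ?w (?D n t)) \<longlonglongrightarrow> 0" using finAE by eventually_elim (rule lim)
    qed simp
    then show ?thesis by simp
  qed
  have W0': "(\<lambda>n. emeasure ?M (space ?M) * (\<integral>\<^sup>+t. wsum ?w (?D n t) \<partial>?M)) \<longlonglongrightarrow> 0"
    using ennreal_tendsto_cmult[OF eS[unfolded infinity_ennreal_def] W0] by simp
  have IH: "I \<in> Elems (H_space s)"
  proof -
    have "wsum ?w (fourier_coeff I) = wsum ?w (\<lambda>k. \<integral>t. fourier_coeff (F t) k \<partial>?M)" by (simp add: wsum_def Ic)
    also have "\<dots> \<le> emeasure ?M (space ?M) * (\<integral>\<^sup>+t. wsum ?w (fourier_coeff (F t)) \<partial>?M)"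
      by (rule wsum_integral_le[OF m]) simp
    also have "\<dots> < \<infinity>" using eS fin by (simp add: ennreal_mult_less_top)
    finally show ?thesis using I by (simp add: H_space_Elems)
  qed
  show ?thesis unfolding has_field_integral_def
  proof (intro conjI exI[of _ \<sigma>] allI \<sigma> IH)
    show "strongly_measurable (H_space s) S F" by (rule strongly_measurable_H[OF Sm m elH])
    show "(\<lambda>n. \<integral>\<^sup>+t. ennreal (Norm (H_space s) (\<lambda>x. \<sigma> n t x - F t x)) \<partial>?M) \<longlonglongrightarrow> 0"
    proof -
      let ?N = "\<lambda>n. \<integral>\<^sup>+t. ennreal (Norm (H_space s) (\<lambda>x. \<sigma> n t x - F t x)) \<partial>?M"
      \<comment> \<open>A stand-in for the norm that is visibly measurable in time; the two agree at
        almost every time.\<close>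
      let ?R = "\<lambda>n t. ennreal (sqrt (enn2real (wsum ?w (?D n t))))"
      have R: "?N n = (\<integral>\<^sup>+t. 1 * ?R n t \<partial>?M)" "(\<integral>\<^sup>+t. (?R n t)\<^sup>2 \<partial>?M) = (\<integral>\<^sup>+t. wsum ?w (?D n t) \<partial>?M)" for n
      proof -
        have ae: "AE t in ?M. ennreal ((Norm (H_space s) (\<lambda>x. \<sigma> n t x - F t x))\<^sup>2) = wsum ?w (?D n t)"
          using elH AE_space by eventually_elim (use H_norm_diff simple_into_elem[OF \<sigma>] Sm in auto)
        then have "AE t in ?M. ennreal (Norm (H_space s) (\<lambda>x. \<sigma> n t x - F t x)) = 1 * ?R n t"
        proof eventually_elim
          case (elim t)
          show ?case unfolding elim[symmetric] using H_space_Norm_nonneg by simp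
        qed
        then show "?N n = (\<integral>\<^sup>+t. 1 * ?R n t \<partial>?M)" by (rule nn_integral_cong_AE)
        from ae have "AE t in ?M. (?R n t)\<^sup>2 = wsum ?w (?D n t)"
        proof eventually_elim
          case (elim t)
          show ?case unfolding elim[symmetric] using H_space_Norm_nonneg by (simp add: ennreal_power)
        qed
        then show "(\<integral>\<^sup>+t. (?R n t)\<^sup>2 \<partial>?M) = (\<integral>\<^sup>+t. wsum ?w (?D n t) \<partial>?M)" by (rule nn_integral_cong_AE)
      qed
      have le: "(?N n)\<^sup>2 \<le> emeasure ?M (space ?M) * (\<integral>\<^sup>+t. wsum ?w (?D n t) \<partial>?M)" for n
      proof -
        have "(?N n)\<^sup>2 \<le> (\<integral>\<^sup>+t. 1\<^sup>2 \<partial>?M) * (\<integral>\<^sup>+t. (?R n t)\<^sup>2 \<partial>?M)"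
          unfolding R(1) by (rule Cauchy_Schwarz_nn_integral) measurable
        then show ?thesis unfolding R(2) by simp
      qed
      have sq: "(\<lambda>n. (?N n)\<^sup>2) \<longlonglongrightarrow> 0"
        by (rule tendsto_sandwich[OF _ _ tendsto_const W0']) (use le in auto)
      show ?thesis
      proof (rule order_tendstoI)
        fix a :: ennreal assume a: "0 < a"
        then have "0 < a\<^sup>2" by (simp add: power2_eq_square ennreal_zero_less_mult_iff)
        with sq have "\<forall>\<^sub>F n in sequentially. (?N n)\<^sup>2 < a\<^sup>2" by (rule order_tendstoD(2))
        then show "\<forall>\<^sub>F n in sequentially. ?N n < a"
        proof eventually_elim
          case (elim n)
          show ?case
          proof (rule ccontr)
            assume "\<not> ?N n < a"
            then have "a\<^sup>2 \<le> (?N n)\<^sup>2" by (intro power_mono) (auto simp: not_less)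
            then show False using elim leD by blast
          qed
        qed
      qed simp
    qed
    show "(\<lambda>n. Norm (H_space s) (\<lambda>x. simple_integral S (\<sigma> n) x - I x)) \<longlonglongrightarrow> 0"
    proof (rule norm_tendsto_zero[OF H_space_Norm_nonneg], rule tendsto_sandwich[OF _ _ tendsto_const W0'])
      have "ennreal ((Norm (H_space s) (\<lambda>x. simple_integral S (\<sigma> n) x - I x))\<^sup>2) \<le> emeasure ?M (space ?M) * (\<integral>\<^sup>+t. wsum ?w (?D n t) \<partial>?M)" for n
      proof -
        have Fi: "integrable ?M (\<lambda>t. fourier_coeff (F t) k)" for k
        proof -
          interpret finite_measure ?M by (rule finite_measureI) (use eS in auto)
          have "(\<integral>\<^sup>+t. ennreal (norm ((norm (fourier_coeff (F t) k))\<^sup>2)) \<partial>?M) \<le> (\<integral>\<^sup>+t. wsum ?w (fourier_coeff (F t)) \<partial>?M)"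
          proof (rule nn_integral_mono)
            fix t
            have "ennreal (1 * (norm (fourier_coeff (F t) k))\<^sup>2) \<le> ennreal (J k ^ s * (norm (fourier_coeff (F t) k))\<^sup>2)"
              by (intro ennreal_leI mult_right_mono one_le_power J_ge_1) auto
            also have "\<dots> \<le> wsum ?w (fourier_coeff (F t))" by (rule wsum_single) simp
            finally show "ennreal (norm ((norm (fourier_coeff (F t) k))\<^sup>2)) \<le> wsum ?w (fourier_coeff (F t))" by simp
          qed
          then have "(\<integral>\<^sup>+t. ennreal (norm ((norm (fourier_coeff (F t) k))\<^sup>2)) \<partial>?M) < \<infinity>"
            using fin by (rule le_less_trans)
          moreover have "(\<lambda>t. (norm (fourier_coeff (F t) k))\<^sup>2) \<in> borel_measurable ?M"
            using m[of k] by measurable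
          ultimately have "integrable ?M (\<lambda>t. (norm (fourier_coeff (F t) k))\<^sup>2)"
            by (rule integrableI_bounded[rotated])
          then have "integrable ?M (\<lambda>t. norm (fourier_coeff (F t) k))"
            by (rule square_integrable_imp_integrable[rotated]) (use m[of k] in measurable)
          then show ?thesis using m[of k] by (simp add: integrable_norm_iff)
        qed
        have "ennreal ((Norm (H_space s) (\<lambda>x. simple_integral S (\<sigma> n) x - I x))\<^sup>2)
          = wsum ?w (\<lambda>k. fourier_coeff (simple_integral S (\<sigma> n)) k - fourier_coeff I k)"
          by (rule H_norm_diff[OF si(3) IH])
        also have "\<dots> = wsum ?w (\<lambda>k. \<integral>t. ?D n t k \<partial>?M)"
          by (simp add: si(2)[symmetric] Ic Bochner_Integration.integral_diff[OF si(1) Fi])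
        also have "\<dots> \<le> emeasure ?M (space ?M) * (\<integral>\<^sup>+t. wsum ?w (?D n t) \<partial>?M)"
          by (rule wsum_integral_le[OF Dm]) simp
        finally show ?thesis .
      qed
      then show "\<forall>\<^sub>F n in sequentially. ennreal ((Norm (H_space s) (\<lambda>x. simple_integral S (\<sigma> n) x - I x))\<^sup>2) \<le> emeasure ?M (space ?M) * (\<integral>\<^sup>+t. wsum ?w (?D n t) \<partial>?M)"
        by simp
    qed simp
  qed
qed

text \<open>The passage between the L^2 H^s spaces of the statement and the coefficient calculus,
  needed in both directions: hypotheses are unpacked by it and conclusions assembled.\<close>

lemma L2_into_H_iff:
  "L2_into (H_space s) a b u \<longleftrightarrow> (AE t in lebesgue_on {a<..<b}. u t \<in> Elems L2_space) \<and>
     (\<forall>k. (\<lambda>t. fourier_coeff (u t) k) \<in> borel_measurable (lebesgue_on {a<..<b})) \<and>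
     (\<integral>\<^sup>+t. wsum (\<lambda>k. J k ^ s) (fourier_coeff (u t)) \<partial>lebesgue_on {a<..<b}) < \<infinity>"
proof -
  let ?M = "lebesgue_on {a<..<b}"
  let ?w = "\<lambda>k. J k ^ s"
  have S: "{a<..<b} \<in> sets lebesgue" by simp
  have eq: "(\<integral>\<^sup>+t. ennreal ((Norm (H_space s) (u t))\<^sup>2) \<partial>?M) = (\<integral>\<^sup>+t. wsum ?w (fourier_coeff (u t)) \<partial>?M)"
    if "AE t in ?M. u t \<in> Elems (H_space s)"
    by (rule nn_integral_cong_AE) (use that in eventually_elim, simp add: H_space_Norm)
  show ?thesis
  proof (intro iffI conjI allI; (elim conjE)?)
    assume u: "L2_into (H_space s) a b u"
    then have sm: "strongly_measurable (H_space s) {a<..<b} u" by (simp add: L2_into_def)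
    note ae = strongly_measurable_coeff(2)[OF fourier_space_H S sm]
    show "AE t in ?M. u t \<in> Elems L2_space" using ae by eventually_elim (simp add: H_space_Elems)
    show "(\<lambda>t. fourier_coeff (u t) k) \<in> borel_measurable ?M" for k
      by (rule strongly_measurable_coeff(1)[OF fourier_space_H S sm])
    show "(\<integral>\<^sup>+t. wsum ?w (fourier_coeff (u t)) \<partial>?M) < \<infinity>"
      using u eq[OF ae] by (simp add: L2_into_def)
  next
    assume el: "AE t in ?M. u t \<in> Elems L2_space" and m: "\<forall>k. (\<lambda>t. fourier_coeff (u t) k) \<in> borel_measurable ?M"
      and fin: "(\<integral>\<^sup>+t. wsum ?w (fourier_coeff (u t)) \<partial>?M) < \<infinity>"
    have wm: "(\<lambda>t. wsum ?w (fourier_coeff (u t))) \<in> borel_measurable ?M"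
      by (rule wsum_measurable) (use m in blast)
    have "AE t in ?M. wsum ?w (fourier_coeff (u t)) < \<infinity>"
      using nn_integral_PInf_AE[OF wm] fin by (auto simp: top.not_eq_extremum)
    then have elH: "AE t in ?M. u t \<in> Elems (H_space s)"
      using el by eventually_elim (simp add: H_space_Elems)
    show "L2_into (H_space s) a b u" unfolding L2_into_def
      using strongly_measurable_H[OF S _ elH] m fin eq[OF elH] by simp
  qed
qed

section \<open>Energy estimates\<close>

abbreviation Ws :: "nat \<Rightarrow> (int^3 \<Rightarrow> complex^3) \<Rightarrow> ennreal" where
  "Ws s c \<equiv> wsum (\<lambda>k. J k ^ s) c"

lemma Ws_mono: "r \<le> s \<Longrightarrow> Ws r c \<le> Ws s c"
  by (intro wsum_mono power_increasing J_ge_1)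

text \<open>Writing J^s as J^(-1) times J^(s+1) leaves the convergent sum of J^(-2) in
  Cauchy-Schwarz. This is the three-dimensional Sobolev embedding at the level of absolutely
  summable coefficients.\<close>

lemma wsum_weighted_l1:
  "(\<integral>\<^sup>+k. ennreal (J k ^ s * norm (c k)) \<partial>lattice)\<^sup>2 \<le> ennreal Jsum * Ws (2 * s + 2) c"
proof -
  have "(\<integral>\<^sup>+k. ennreal (J k ^ s * norm (c k)) \<partial>lattice) = (\<integral>\<^sup>+k. ennreal (1 / J k) * ennreal (J k ^ (s + 1) * norm (c k)) \<partial>lattice)"
    by (intro nn_integral_cong) (simp add: ennreal_mult''[symmetric])
  also have "(\<dots>)\<^sup>2 \<le> (\<integral>\<^sup>+k. (ennreal (1 / J k))\<^sup>2 \<partial>lattice) * (\<integral>\<^sup>+k. (ennreal (J k ^ (s + 1) * norm (c k)))\<^sup>2 \<partial>lattice)"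
    by (rule Cauchy_Schwarz_nn_integral) auto
  also have "(\<integral>\<^sup>+k. (ennreal (1 / J k))\<^sup>2 \<partial>lattice) = ennreal Jsum"
    unfolding Jsum[symmetric] by (intro nn_integral_cong) (simp add: ennreal_power power_divide)
  also have "(\<integral>\<^sup>+k. (ennreal (J k ^ (s + 1) * norm (c k)))\<^sup>2 \<partial>lattice) = Ws (2 * s + 2) c"
    unfolding wsum_def
  proof (rule nn_integral_cong)
    fix k
    have "(J k ^ (s + 1) * norm (c k))\<^sup>2 = J k ^ (2 * s + 2) * (norm (c k))\<^sup>2"
    proof -
      have "(s + 1) * 2 = 2 * s + 2" by simp
      then show ?thesis by (simp only: power_mult_distrib power_mult[symmetric])
    qed
    then show "(ennreal (J k ^ (s + 1) * norm (c k)))\<^sup>2 = ennreal (J k ^ (2 * s + 2) * (norm (c k))\<^sup>2)"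
      by (simp add: ennreal_power)
  qed
  finally show ?thesis .
qed

lemma Ws_summable:
  assumes "Ws (2 * s + 2) c < \<infinity>" shows "integrable lattice (\<lambda>k. J k ^ s *\<^sub>R c k)"
proof (rule integrableI_bounded)
  have "ennreal Jsum * Ws (2 * s + 2) c < \<infinity>" using assms by (simp add: ennreal_mult_less_top)
  with wsum_weighted_l1[of s c] have "(\<integral>\<^sup>+k. ennreal (J k ^ s * norm (c k)) \<partial>lattice)\<^sup>2 < \<infinity>"
    by (rule le_less_trans)
  then have "(\<integral>\<^sup>+k. ennreal (J k ^ s * norm (c k)) \<partial>lattice) < \<infinity>"
    by (cases "(\<integral>\<^sup>+k. ennreal (J k ^ s * norm (c k)) \<partial>lattice) = \<infinity>") (auto simp: less_top power2_eq_square)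
  then show "(\<integral>\<^sup>+k. ennreal (norm (J k ^ s *\<^sub>R c k)) \<partial>lattice) < \<infinity>" by simp
qed simp

lemma Ws2_summable: "Ws 2 c < \<infinity> \<Longrightarrow> integrable lattice c"
  using Ws_summable[of 0 c] by (simp only: mult_0_right add_0 power_0 scaleR_one)

lemma integral_l1_le:
  assumes "Ws (2 * s + 2) c < \<infinity>"
  shows "ennreal ((\<integral>k. J k ^ s * norm (c k) \<partial>lattice)\<^sup>2) \<le> ennreal Jsum * Ws (2 * s + 2) c"
proof -
  have i: "integrable lattice (\<lambda>k. norm (J k ^ s *\<^sub>R c k))" using Ws_summable[OF assms] by (rule integrable_norm)
  then have "(\<integral>\<^sup>+k. ennreal (J k ^ s * norm (c k)) \<partial>lattice) = ennreal (\<integral>k. J k ^ s * norm (c k) \<partial>lattice)"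
    by (subst nn_integral_eq_integral) auto
  then show ?thesis using wsum_weighted_l1[of s c] by (simp add: ennreal_power)
qed

text \<open>Serves to remove the truncation: at each fixed k the truncated weight is eventually the
  full one, and Fatou's lemma preserves the uniform bound.\<close>

lemma lattice_fatou:
  assumes "\<And>n. (\<integral>\<^sup>+k. f n k \<partial>lattice) \<le> B" and ev: "\<And>k. \<forall>\<^sub>F n in sequentially. f n k = g k"
  shows "(\<integral>\<^sup>+k. g k \<partial>lattice) \<le> (B :: ennreal)"
proof -
  have "liminf (\<lambda>n. f n k) = g k" for k
    using lim_imp_Liminf[OF _ tendsto_eventually[OF ev[of k]]] by simp
  then have "(\<integral>\<^sup>+k. g k \<partial>lattice) = (\<integral>\<^sup>+k. liminf (\<lambda>n. f n k) \<partial>lattice)" by simp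
  also have "\<dots> \<le> liminf (\<lambda>n. \<integral>\<^sup>+k. f n k \<partial>lattice)" by (rule nn_integral_liminf) simp
  also have "\<dots> \<le> B" using assms(1) by (intro Liminf_le) auto
  finally show ?thesis .
qed

section \<open>Size of the nonlinear term\<close>

lemma curl_mult_bound: "\<exists>C\<ge>0. \<forall>j a b. norm (curl_mult j a b) \<le> C * (sqrt (J j) * norm a * norm b)"
proof -
  interpret bounded_bilinear ccross by (rule bilinear_ccross)
  obtain K where K: "K > 0" "\<And>x y. norm (ccross x y) \<le> norm x * norm y * K" using pos_bounded by blast
  have "norm (curl_mult j a b) \<le> K * K * (sqrt (J j) * norm a * norm b)" for j a b
  proof -
    have "norm (curl_mult j a b) \<le> norm (ccross (ikvec j) a) * norm b * K" unfolding curl_mult_def by (rule K(2))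
    also have "\<dots> \<le> (norm (ikvec j) * norm a * K) * norm b * K"
      using K by (intro mult_right_mono K(2)) auto
    also have "\<dots> \<le> (sqrt (J j) * norm a * K) * norm b * K"
      using K norm_wave_le[of j] by (intro mult_right_mono) (auto simp: norm_ikvec)
    finally show ?thesis by (simp add: mult_ac)
  qed
  then show ?thesis using K by (intro exI[of _ "K * K"]) auto
qed

definition curl_const :: real where
  "curl_const = (SOME C. 0 \<le> C \<and> (\<forall>j a b. norm (curl_mult j a b) \<le> C * (sqrt (J j) * norm a * norm b)))"

lemma curl_const: "0 \<le> curl_const" "norm (curl_mult j a b) \<le> curl_const * (sqrt (J j) * norm a * norm b)"
  using someI_ex[of "\<lambda>C. 0 \<le> C \<and> (\<forall>j a b. norm (curl_mult j a b) \<le> C * (sqrt (J j) * norm a * norm b))"] curl_mult_bound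
  unfolding curl_const_def by auto

lemma curl_mult_nn_bound:
  "(\<integral>\<^sup>+j. ennreal (norm (curl_mult j (a j) (b (k - j)))) \<partial>lattice)
     \<le> ennreal curl_const * (\<integral>\<^sup>+j. ennreal (sqrt (J j) * norm (a j) * norm (b (k - j))) \<partial>lattice)"
proof -
  have "(\<integral>\<^sup>+j. ennreal (norm (curl_mult j (a j) (b (k - j)))) \<partial>lattice)
     \<le> (\<integral>\<^sup>+j. ennreal curl_const * ennreal (sqrt (J j) * norm (a j) * norm (b (k - j))) \<partial>lattice)"
    by (intro nn_integral_mono, subst ennreal_mult'[symmetric]) (auto intro!: ennreal_leI curl_const simp: less_imp_le)
  then show ?thesis by (simp add: nn_integral_cmult)
qed

text \<open>If the defining series is not absolutely convergent, \<open>curl_conv\<close> is 0 by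
  convention and the bound is trivial.\<close>

lemma curl_conv_bound:
  "ennreal (norm (curl_conv a b k)) \<le> ennreal curl_const * (\<integral>\<^sup>+j. ennreal (sqrt (J j) * norm (a j) * norm (b (k - j))) \<partial>lattice)"
proof -
  have "ennreal (norm (curl_conv a b k)) \<le> (\<integral>\<^sup>+j. ennreal (norm (curl_mult j (a j) (b (k - j)))) \<partial>lattice)"
    unfolding curl_conv_def
    by (cases "integrable lattice (\<lambda>j. curl_mult j (a j) (b (k - j)))")
       (simp_all add: integral_norm_bound_ennreal not_integrable_integral_eq)
  then show ?thesis using curl_mult_nn_bound[of a b k] by (rule order.trans)
qed

section \<open>Restriction to smaller time intervals and treatment of end points\<close>

lemma AE_lebesgue_on_subset:
  assumes "AE t in lebesgue_on S. P t" "S' \<subseteq> S" "S \<in> sets lebesgue" "S' \<in> sets lebesgue"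
  shows "AE t in lebesgue_on S'. P t"
proof -
  have "AE t in lebesgue. t \<in> S \<longrightarrow> P t" using assms(1,3) by (simp add: AE_restrict_space_iff)
  then have "AE t in lebesgue. t \<in> S' \<longrightarrow> P t" by eventually_elim (use assms(2) in auto)
  then show ?thesis using assms(4) by (simp add: AE_restrict_space_iff)
qed

lemma nn_integral_lebesgue_on_mono:
  assumes "S' \<subseteq> S" "S \<in> sets lebesgue" "S' \<in> sets lebesgue"
  shows "(\<integral>\<^sup>+t. f t \<partial>lebesgue_on S') \<le> (\<integral>\<^sup>+t. f t \<partial>lebesgue_on S)"
  using assms by (subst (1 2) nn_integral_restrict_space) (auto intro!: nn_integral_mono split: split_indicator)

lemma AE_not_endpoint: "AE t in lebesgue. t \<notin> {a, b::real}"
  by (rule AE_not_in) (simp add: negligible_iff_null_sets[symmetric])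

lemma nn_integral_Icc_Ioo:
  "(\<integral>\<^sup>+t. f t \<partial>lebesgue_on {a..b}) = (\<integral>\<^sup>+t. f t \<partial>lebesgue_on {a<..<b::real})"
proof -
  have "AE t in lebesgue. f t * indicator {a..b} t = f t * indicator {a<..<b} t"
    using AE_not_endpoint[of a b] by eventually_elim (auto split: split_indicator)
  then have "(\<integral>\<^sup>+t. f t * indicator {a..b} t \<partial>lebesgue) = (\<integral>\<^sup>+t. f t * indicator {a<..<b} t \<partial>lebesgue)"
    by (rule nn_integral_cong_AE)
  then show ?thesis by (subst (1 2) nn_integral_restrict_space) auto
qed

lemma AE_Icc_Ioo: "(AE t in lebesgue_on {a..b}. P t) \<longleftrightarrow> (AE t in lebesgue_on {a<..<b::real}. P t)"
proof
  assume "AE t in lebesgue_on {a<..<b}. P t"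
  then have "AE t in lebesgue. t \<in> {a<..<b} \<longrightarrow> P t" by (simp add: AE_restrict_space_iff)
  with AE_not_endpoint[of a b] have "AE t in lebesgue. t \<in> {a..b} \<longrightarrow> P t" by eventually_elim auto
  then show "AE t in lebesgue_on {a..b}. P t" by (simp add: AE_restrict_space_iff)
qed (rule AE_lebesgue_on_subset, auto)

lemma measurable_Icc_Ioo:
  fixes f :: "real \<Rightarrow> 'b::euclidean_space"
  assumes "f \<in> borel_measurable (lebesgue_on {a<..<b})"
  shows "f \<in> borel_measurable (lebesgue_on {a..b})"
proof -
  have "(\<lambda>x. if x \<in> {a<..<b} then f x else 0) \<in> borel_measurable lebesgue"
    using assms by (simp add: borel_measurable_if del: greaterThanLessThan_iff)
  moreover have "AE x in lebesgue. (if x \<in> {a<..<b} then f x else 0) = (if x \<in> {a..b} then f x else 0)"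
    using AE_not_endpoint[of a b] by eventually_elim auto
  ultimately have "(\<lambda>x. if x \<in> {a..b} then f x else 0) \<in> borel_measurable lebesgue"
    by (rule borel_measurable_AE)
  then show ?thesis by (simp add: borel_measurable_if del: atLeastAtMost_iff)
qed

lemma integrable_lebesgue_on_iff:
  fixes f :: "real \<Rightarrow> 'b::euclidean_space"
  shows "integrable (lebesgue_on {a..b}) f \<longleftrightarrow> f absolutely_integrable_on {a..b}"
  by (simp add: set_integrable_def integrable_restrict_space)

section \<open>Energy inequalities for weighted sums\<close>

lemma ac_on_measurable:
  assumes "ac_on a b F f"
  shows "F \<in> borel_measurable (lebesgue_on {a..b})" "f \<in> borel_measurable (lebesgue_on {a..b})"
proof -
  show "F \<in> borel_measurable (lebesgue_on {a..b})"
    by (rule continuous_imp_measurable_on_sets_lebesgue[OF ac_on_continuous[OF assms]]) simp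
  have "integrable (lebesgue_on {a..b}) f" using assms by (simp add: integrable_lebesgue_on_iff ac_on_def)
  then show "f \<in> borel_measurable (lebesgue_on {a..b})" by simp
qed

text \<open>If the integral of \<open>q\<close> is infinite there is nothing to show. Otherwise
  \<open>p\<close> lies between 0 and the integrable function q - \<phi>', and the inequality can be
  integrated in the reals.\<close>

lemma ac_on_inequality:
  fixes \<phi> :: "real \<Rightarrow> real"
  assumes ac: "ac_on s t \<phi> \<phi>'" and st: "s \<le> t" and \<phi>: "0 \<le> \<phi> s" "0 \<le> \<phi> t"
    and pm: "p \<in> borel_measurable (lebesgue_on {s..t})" and qm: "q \<in> borel_measurable (lebesgue_on {s..t})"
    and p: "\<And>\<tau>. 0 \<le> p \<tau>" and q: "\<And>\<tau>. 0 \<le> q \<tau>"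
    and le: "\<And>\<tau>. \<phi>' \<tau> + p \<tau> \<le> q \<tau>"
  shows "ennreal (\<phi> t) + (\<integral>\<^sup>+\<tau>. ennreal (p \<tau>) \<partial>lebesgue_on {s..t}) \<le> ennreal (\<phi> s) + (\<integral>\<^sup>+\<tau>. ennreal (q \<tau>) \<partial>lebesgue_on {s..t})"
proof (cases "(\<integral>\<^sup>+\<tau>. ennreal (q \<tau>) \<partial>lebesgue_on {s..t}) = \<infinity>")
  case False
  let ?M = "lebesgue_on {s..t}"
  have qi: "integrable ?M q" using False q qm by (intro integrableI_bounded) (auto simp: less_top)
  have \<phi>i: "integrable ?M \<phi>'" using ac by (simp add: integrable_lebesgue_on_iff ac_on_def)
  have pi: "integrable ?M p"
  proof (rule Bochner_Integration.integrable_bound)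
    show "integrable ?M (\<lambda>\<tau>. q \<tau> - \<phi>' \<tau>)" using qi \<phi>i by simp
    have "norm (p \<tau>) \<le> norm (q \<tau> - \<phi>' \<tau>)" for \<tau>
      using le[of \<tau>] p[of \<tau>] unfolding real_norm_def by linarith
    then show "AE \<tau> in ?M. norm (p \<tau>) \<le> norm (q \<tau> - \<phi>' \<tau>)" by simp
  qed (rule pm)
  have "\<phi> t - \<phi> s = integral {s..t} \<phi>'" by (rule ac_onD[OF ac order_refl st order_refl])
  also have "\<dots> = (\<integral>\<tau>. \<phi>' \<tau> \<partial>?M)" by (rule lebesgue_integral_eq_integral[symmetric, OF \<phi>i]) simp
  finally have "\<phi> t - \<phi> s + (\<integral>\<tau>. p \<tau> \<partial>?M) = (\<integral>\<tau>. \<phi>' \<tau> + p \<tau> \<partial>?M)"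
    using \<phi>i pi by simp
  also have "\<dots> \<le> (\<integral>\<tau>. q \<tau> \<partial>?M)" using \<phi>i pi qi le by (intro integral_mono) auto
  finally have "\<phi> t + (\<integral>\<tau>. p \<tau> \<partial>?M) \<le> \<phi> s + (\<integral>\<tau>. q \<tau> \<partial>?M)" by simp
  then have "ennreal (\<phi> t + (\<integral>\<tau>. p \<tau> \<partial>?M)) \<le> ennreal (\<phi> s + (\<integral>\<tau>. q \<tau> \<partial>?M))" by (rule ennreal_leI)
  then show ?thesis
    using p q pi qi \<phi> by (simp add: nn_integral_eq_integral ennreal_plus)
qed simp

text \<open>The damping -2\<nu>|k|^2 equals -2\<nu>J + 2\<nu>, and the second part is moved to the
  right-hand side. Of the first, one half is kept on the left; the other half is shared equally
  between \<open>f\<close> and \<open>N\<close> by Young's inequality, which produces the constant 2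
  / \<nu>.\<close>

lemma energy_pointwise:
  fixes c f N :: "complex^3"
  assumes \<nu>: "0 < \<nu>" and d: "d = - (\<nu> * (norm (wave_vector k))\<^sup>2) *\<^sub>R c + f - N"
  shows "2 * (c \<bullet> d) + \<nu> * J k * (norm c)\<^sup>2 \<le> 2 * \<nu> * (norm c)\<^sup>2 + (2 / \<nu>) * ((1 / J k) * ((norm f)\<^sup>2 + (norm N)\<^sup>2))"
proof -
  have cd: "c \<bullet> d = - \<nu> * (J k - 1) * (norm c)\<^sup>2 + c \<bullet> f - c \<bullet> N"
    by (simp add: d inner_diff_right inner_add_right J_def power2_norm_eq_inner)
  have young: "2 * \<bar>c \<bullet> x\<bar> \<le> 1 / 2 * (\<nu> * J k * (norm c)\<^sup>2) + (2 / \<nu>) * ((1 / J k) * (norm x)\<^sup>2)" for x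
  proof -
    have "2 * \<bar>c \<bullet> x\<bar> \<le> 2 * (norm c * norm x)" using Cauchy_Schwarz_ineq2[of c x] by simp
    also have "\<dots> = 2 * (sqrt (\<nu> * J k / 2) * norm c) * (norm x / sqrt (\<nu> * J k / 2))" using \<nu> by simp
    also have "\<dots> \<le> (sqrt (\<nu> * J k / 2) * norm c)\<^sup>2 + (norm x / sqrt (\<nu> * J k / 2))\<^sup>2"
      by (rule sum_squares_bound)
    also have "\<dots> = 1 / 2 * (\<nu> * J k * (norm c)\<^sup>2) + (2 / \<nu>) * ((1 / J k) * (norm x)\<^sup>2)"
      using \<nu> by (simp add: power_mult_distrib power_divide less_imp_le)
    finally show ?thesis .
  qed
  have "2 * (c \<bullet> d) + \<nu> * J k * (norm c)\<^sup>2 = 2 * \<nu> * (norm c)\<^sup>2 - \<nu> * J k * (norm c)\<^sup>2 + 2 * (c \<bullet> f) - 2 * (c \<bullet> N)"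
    unfolding cd by (simp add: algebra_simps)
  also have "\<dots> \<le> 2 * \<nu> * (norm c)\<^sup>2 - \<nu> * J k * (norm c)\<^sup>2 + 2 * \<bar>c \<bullet> f\<bar> + 2 * \<bar>c \<bullet> N\<bar>"
    by linarith
  also have "\<dots> \<le> 2 * \<nu> * (norm c)\<^sup>2 + ((2 / \<nu>) * ((1 / J k) * (norm f)\<^sup>2) + (2 / \<nu>) * ((1 / J k) * (norm N)\<^sup>2))"
    using young[of f] young[of N] by linarith
  finally show ?thesis by (simp only: distrib_left)
qed

text \<open>The inequalities for single modes are multiplied by \<Omega> J and summed; all terms are
  nonnegative, so sums and time integrals commute even when infinite. The factor 1/J that the
  dissipation grants to \<open>f\<close> and \<open>N\<close> cancels the J in this weight, so both
  are measured one derivative below the energy.\<close>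

lemma energy_inequality:
  fixes c d f :: "real \<Rightarrow> int^3 \<Rightarrow> complex^3"
  assumes \<nu>: "0 < \<nu>" and ac: "\<And>k. ac_on s t (\<lambda>\<tau>. c \<tau> k) (\<lambda>\<tau>. d \<tau> k)" and st: "s \<le> t"
    and fm: "\<And>k. (\<lambda>\<tau>. f \<tau> k) \<in> borel_measurable (lebesgue_on {s..t})"
    and N: "\<And>\<tau> k. N \<tau> k = - (\<nu> * (norm (wave_vector k))\<^sup>2) *\<^sub>R c \<tau> k + f \<tau> k - d \<tau> k"
    and \<Omega>: "\<And>k. 0 < \<Omega> k"
  shows "wsum (\<lambda>k. \<Omega> k * J k) (c t) + ennreal \<nu> * (\<integral>\<^sup>+\<tau>. wsum (\<lambda>k. \<Omega> k * J k * J k) (c \<tau>) \<partial>lebesgue_on {s..t})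
    \<le> wsum (\<lambda>k. \<Omega> k * J k) (c s) + (\<integral>\<^sup>+\<tau>. ennreal (2 * \<nu>) * wsum (\<lambda>k. \<Omega> k * J k) (c \<tau>) + ennreal (2 / \<nu>) * (wsum \<Omega> (f \<tau>) + wsum \<Omega> (N \<tau>)) \<partial>lebesgue_on {s..t})"
proof -
  let ?M = "lebesgue_on {s..t}"
  note cm = ac_on_measurable(1)[OF ac] and dm = ac_on_measurable(2)[OF ac]
  have Nm: "(\<lambda>\<tau>. N \<tau> k) \<in> borel_measurable ?M" for k
    unfolding N using cm[of k] dm[of k] fm[of k] by measurable
  let ?p = "\<lambda>k \<tau>. \<nu> * J k * (norm (c \<tau> k))\<^sup>2"
  let ?q = "\<lambda>k \<tau>. 2 * \<nu> * (norm (c \<tau> k))\<^sup>2 + (2 / \<nu>) * ((1 / J k) * ((norm (f \<tau> k))\<^sup>2 + (norm (N \<tau> k))\<^sup>2))"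
  have pm: "?p k \<in> borel_measurable ?M" and qm: "?q k \<in> borel_measurable ?M" for k
    using cm[of k] fm[of k] Nm[of k] by measurable
  have pm': "(\<lambda>\<tau>. ennreal (?p k \<tau>)) \<in> borel_measurable ?M" and qm': "(\<lambda>\<tau>. ennreal (?q k \<tau>)) \<in> borel_measurable ?M" for k
    by (rule measurable_compose[OF pm measurable_ennreal], rule measurable_compose[OF qm measurable_ennreal])
  have one: "ennreal ((norm (c t k))\<^sup>2) + (\<integral>\<^sup>+\<tau>. ennreal (?p k \<tau>) \<partial>?M) \<le> ennreal ((norm (c s k))\<^sup>2) + (\<integral>\<^sup>+\<tau>. ennreal (?q k \<tau>) \<partial>?M)" for k
  proof (rule ac_on_inequality[where \<phi>="\<lambda>\<tau>. (norm (c \<tau> k))\<^sup>2" and \<phi>'="\<lambda>\<tau>. 2 * (c \<tau> k \<bullet> d \<tau> k)"])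
    have "ac_on s t (\<lambda>\<tau>. c \<tau> k \<bullet> c \<tau> k) (\<lambda>\<tau>. d \<tau> k \<bullet> c \<tau> k + c \<tau> k \<bullet> d \<tau> k)"
      by (rule ac_on_bilinear[OF bounded_bilinear_inner ac ac])
    then show "ac_on s t (\<lambda>\<tau>. (norm (c \<tau> k))\<^sup>2) (\<lambda>\<tau>. 2 * (c \<tau> k \<bullet> d \<tau> k))"
      by (simp add: power2_norm_eq_inner inner_commute)
    show "2 * (c \<tau> k \<bullet> d \<tau> k) + ?p k \<tau> \<le> ?q k \<tau>" for \<tau>
      by (rule energy_pointwise[OF \<nu>]) (simp add: N)
  qed (use st pm qm \<nu> in auto)
  let ?V = "\<lambda>k. ennreal (\<Omega> k * J k)"
  have V: "wsum (\<lambda>k. \<Omega> k * J k) x = (\<integral>\<^sup>+k. ?V k * ennreal ((norm (x k))\<^sup>2) \<partial>lattice)" for x :: "int^3 \<Rightarrow> complex^3"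
    unfolding wsum_def using \<Omega> by (intro nn_integral_cong) (simp add: ennreal_mult less_imp_le)
  have swap: "(\<integral>\<^sup>+k. ?V k * (\<integral>\<^sup>+\<tau>. ennreal (g k \<tau>) \<partial>?M) \<partial>lattice) = (\<integral>\<^sup>+\<tau>. \<integral>\<^sup>+k. ?V k * ennreal (g k \<tau>) \<partial>lattice \<partial>?M)"
    if g: "\<And>k. (\<lambda>\<tau>. ennreal (g k \<tau>)) \<in> borel_measurable ?M" for g
  proof -
    have "(\<integral>\<^sup>+k. ?V k * (\<integral>\<^sup>+\<tau>. ennreal (g k \<tau>) \<partial>?M) \<partial>lattice) = (\<integral>\<^sup>+k. \<integral>\<^sup>+\<tau>. ?V k * ennreal (g k \<tau>) \<partial>?M \<partial>lattice)"
      by (intro nn_integral_cong nn_integral_cmult[symmetric] g)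
    also have "\<dots> = (\<integral>\<^sup>+\<tau>. \<integral>\<^sup>+k. ?V k * ennreal (g k \<tau>) \<partial>lattice \<partial>?M)"
      by (rule nn_integral_count_space_nn_integral[symmetric]) (use g in auto)
    finally show ?thesis .
  qed
  have P: "(\<integral>\<^sup>+k. ?V k * (\<integral>\<^sup>+\<tau>. ennreal (?p k \<tau>) \<partial>?M) \<partial>lattice) = ennreal \<nu> * (\<integral>\<^sup>+\<tau>. wsum (\<lambda>k. \<Omega> k * J k * J k) (c \<tau>) \<partial>?M)"
  proof -
    have "(\<integral>\<^sup>+k. ?V k * ennreal (?p k \<tau>) \<partial>lattice) = ennreal \<nu> * wsum (\<lambda>k. \<Omega> k * J k * J k) (c \<tau>)" for \<tau>
    proof -
      have "?V k * ennreal (?p k \<tau>) = ennreal \<nu> * ennreal (\<Omega> k * J k * J k * (norm (c \<tau> k))\<^sup>2)" for k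
        using \<Omega>[of k] \<nu> by (subst (1 2) ennreal_mult[symmetric]) (auto simp: less_imp_le mult_ac)
      then show ?thesis by (simp only: wsum_def nn_integral_cmult borel_measurable_count_space)
    qed
    then show ?thesis unfolding swap[OF pm']
      using nn_integral_cmult[OF wsum_measurable[OF cm], of "ennreal \<nu>"] by simp
  qed
  have Q: "(\<integral>\<^sup>+k. ?V k * (\<integral>\<^sup>+\<tau>. ennreal (?q k \<tau>) \<partial>?M) \<partial>lattice)
     = (\<integral>\<^sup>+\<tau>. ennreal (2 * \<nu>) * wsum (\<lambda>k. \<Omega> k * J k) (c \<tau>) + ennreal (2 / \<nu>) * (wsum \<Omega> (f \<tau>) + wsum \<Omega> (N \<tau>)) \<partial>?M)"
  proof -
    have "(\<integral>\<^sup>+k. ?V k * ennreal (?q k \<tau>) \<partial>lattice)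
        = ennreal (2 * \<nu>) * wsum (\<lambda>k. \<Omega> k * J k) (c \<tau>) + ennreal (2 / \<nu>) * (wsum \<Omega> (f \<tau>) + wsum \<Omega> (N \<tau>))" for \<tau>
    proof -
      have "?V k * ennreal (?q k \<tau>) = ennreal (2 * \<nu>) * ennreal (\<Omega> k * J k * (norm (c \<tau> k))\<^sup>2)
         + ennreal (2 / \<nu>) * (ennreal (\<Omega> k * (norm (f \<tau> k))\<^sup>2) + ennreal (\<Omega> k * (norm (N \<tau> k))\<^sup>2))" for k
      proof -
        have nn: "0 \<le> \<Omega> k" using \<Omega>[of k] by simp
        have "?V k * ennreal (?q k \<tau>) = ennreal (\<Omega> k * J k * ?q k \<tau>)"
          using nn by (intro ennreal_mult'[symmetric]) simp
        also have "\<Omega> k * J k * ?q k \<tau> = 2 * \<nu> * (\<Omega> k * J k * (norm (c \<tau> k))\<^sup>2) + 2 / \<nu> * (\<Omega> k * (norm (f \<tau> k))\<^sup>2 + \<Omega> k * (norm (N \<tau> k))\<^sup>2)"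
          using \<nu> by (simp add: field_simps)
        also have "ennreal \<dots> = ennreal (2 * \<nu> * (\<Omega> k * J k * (norm (c \<tau> k))\<^sup>2)) + ennreal (2 / \<nu> * (\<Omega> k * (norm (f \<tau> k))\<^sup>2 + \<Omega> k * (norm (N \<tau> k))\<^sup>2))"
          using nn \<nu> by (intro ennreal_plus) auto
        also have "ennreal (2 * \<nu> * (\<Omega> k * J k * (norm (c \<tau> k))\<^sup>2)) = ennreal (2 * \<nu>) * ennreal (\<Omega> k * J k * (norm (c \<tau> k))\<^sup>2)"
          using \<nu> by (intro ennreal_mult') auto
        also have "ennreal (2 / \<nu> * (\<Omega> k * (norm (f \<tau> k))\<^sup>2 + \<Omega> k * (norm (N \<tau> k))\<^sup>2)) = ennreal (2 / \<nu>) * ennreal (\<Omega> k * (norm (f \<tau> k))\<^sup>2 + \<Omega> k * (norm (N \<tau> k))\<^sup>2)"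
          using \<nu> by (intro ennreal_mult') auto
        also have "ennreal (\<Omega> k * (norm (f \<tau> k))\<^sup>2 + \<Omega> k * (norm (N \<tau> k))\<^sup>2) = ennreal (\<Omega> k * (norm (f \<tau> k))\<^sup>2) + ennreal (\<Omega> k * (norm (N \<tau> k))\<^sup>2)"
          using nn by (intro ennreal_plus) auto
        finally show ?thesis .
      qed
      then show ?thesis by (simp only: wsum_def nn_integral_add nn_integral_cmult borel_measurable_count_space)
    qed
    then show ?thesis unfolding swap[OF qm'] by simp
  qed
  have "wsum (\<lambda>k. \<Omega> k * J k) (c t) + ennreal \<nu> * (\<integral>\<^sup>+\<tau>. wsum (\<lambda>k. \<Omega> k * J k * J k) (c \<tau>) \<partial>?M)
     = (\<integral>\<^sup>+k. ?V k * (ennreal ((norm (c t k))\<^sup>2) + (\<integral>\<^sup>+\<tau>. ennreal (?p k \<tau>) \<partial>?M)) \<partial>lattice)"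
    unfolding V[of "c t"] P[symmetric] by (simp only: distrib_left nn_integral_add borel_measurable_count_space)
  also have "\<dots> \<le> (\<integral>\<^sup>+k. ?V k * (ennreal ((norm (c s k))\<^sup>2) + (\<integral>\<^sup>+\<tau>. ennreal (?q k \<tau>) \<partial>?M)) \<partial>lattice)"
    by (intro nn_integral_mono mult_left_mono one) auto
  also have "\<dots> = wsum (\<lambda>k. \<Omega> k * J k) (c s) + (\<integral>\<^sup>+\<tau>. ennreal (2 * \<nu>) * wsum (\<lambda>k. \<Omega> k * J k) (c \<tau>) + ennreal (2 / \<nu>) * (wsum \<Omega> (f \<tau>) + wsum \<Omega> (N \<tau>)) \<partial>?M)"
    unfolding V[of "c s"] Q[symmetric] by (simp only: distrib_left nn_integral_add borel_measurable_count_space)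
  finally show ?thesis .
qed

lemma wsum_time_swap:
  fixes c :: "'a \<Rightarrow> int^3 \<Rightarrow> complex^3"
  assumes c: "\<And>k. (\<lambda>t. c t k) \<in> borel_measurable M" and w: "\<And>k. 0 \<le> w k"
  shows "(\<integral>\<^sup>+t. wsum w (c t) \<partial>M) = (\<integral>\<^sup>+k. ennreal (w k) * (\<integral>\<^sup>+t. ennreal ((norm (c t k))\<^sup>2) \<partial>M) \<partial>lattice)"
proof -
  have "(\<integral>\<^sup>+t. wsum w (c t) \<partial>M) = (\<integral>\<^sup>+k. \<integral>\<^sup>+t. ennreal (w k * (norm (c t k))\<^sup>2) \<partial>M \<partial>lattice)"
    unfolding wsum_def using c by (intro nn_integral_count_space_nn_integral) auto
  also have "\<dots> = (\<integral>\<^sup>+k. ennreal (w k) * (\<integral>\<^sup>+t. ennreal ((norm (c t k))\<^sup>2) \<partial>M) \<partial>lattice)"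
    using c w by (intro nn_integral_cong) (simp add: ennreal_mult' nn_integral_cmult)
  finally show ?thesis .
qed

lemma borel_measurable_lebesgue_on_subset:
  "f \<in> borel_measurable (lebesgue_on S) \<Longrightarrow> S' \<subseteq> S \<Longrightarrow> f \<in> borel_measurable (lebesgue_on S')"
  by (rule measurable_restrict_mono)

lemma wsum_cmult:
  assumes "0 \<le> a" shows "wsum (\<lambda>k. a * w k) c = ennreal a * wsum w c"
proof -
  have "ennreal (a * w k * (norm (c k))\<^sup>2) = ennreal a * ennreal (w k * (norm (c k))\<^sup>2)" for k
    using assms by (simp add: ennreal_mult' mult.assoc)
  then show ?thesis by (simp add: wsum_def nn_integral_cmult)
qed

text \<open>The bound \<open>bnd\<close>, one derivative below the energy to be estimated, is used
  qualitatively: it makes every truncated energy finite and bounded in time, as Gronwall requires.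
  The resulting constant depends on the initial value, the forcing and the time integral of
  \<open>Ws 2 (c \<tau>)\<close>, but neither on \<open>B\<close> nor on the truncation.\<close>

lemma energy_step:
  fixes c d f N :: "real \<Rightarrow> int^3 \<Rightarrow> complex^3"
  assumes \<nu>: "0 < \<nu>" and ac: "\<And>k. ac_on s T (\<lambda>\<tau>. c \<tau> k) (\<lambda>\<tau>. d \<tau> k)" and sT: "s \<le> T"
    and fm: "\<And>k. (\<lambda>\<tau>. f \<tau> k) \<in> borel_measurable (lebesgue_on {s..T})"
    and N: "\<And>\<tau> k. N \<tau> k = - (\<nu> * (norm (wave_vector k))\<^sup>2) *\<^sub>R c \<tau> k + f \<tau> k - d \<tau> k"
    and C: "0 \<le> C"
    and Nb: "AE \<tau> in lebesgue_on {s..T}. \<forall>k. ennreal (norm (N \<tau> k)) \<le> ennreal C * (\<integral>\<^sup>+j. ennreal (sqrt (J j) * norm (c \<tau> j) * norm (c \<tau> (k - j))) \<partial>lattice)"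
    and bnd: "\<And>t. t \<in> {s..T} \<Longrightarrow> Ws (Suc n) (c t) \<le> ennreal B"
    and l2: "(\<integral>\<^sup>+\<tau>. Ws 2 (c \<tau>) \<partial>lebesgue_on {s..T}) < \<infinity>"
    and ff: "(\<integral>\<^sup>+\<tau>. Ws (Suc n) (f \<tau>) \<partial>lebesgue_on {s..T}) < \<infinity>"
    and init: "Ws (n + 2) (c s) < \<infinity>"
  shows "(\<exists>B'. \<forall>t\<in>{s..T}. Ws (n + 2) (c t) \<le> ennreal B') \<and> (\<integral>\<^sup>+\<tau>. Ws (n + 3) (c \<tau>) \<partial>lebesgue_on {s..T}) < \<infinity>"
proof -
  let ?M = "lebesgue_on {s..T}"
  note cm = ac_on_measurable(1)[OF ac] and dm = ac_on_measurable(2)[OF ac]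
  have W2m: "(\<lambda>\<tau>. Ws 2 (c \<tau>)) \<in> borel_measurable ?M" by (rule wsum_measurable[OF cm])
  have Wfm: "(\<lambda>\<tau>. Ws (Suc n) (f \<tau>)) \<in> borel_measurable ?M" by (rule wsum_measurable[OF fm])
  define B0 where "B0 = max B 0"
  have B0: "0 \<le> B0" "\<And>t. t \<in> {s..T} \<Longrightarrow> Ws (Suc n) (c t) \<le> ennreal B0"
    by (simp add: B0_def) (rule order.trans[OF bnd ennreal_leI], auto simp: B0_def)
  define K :: real where "K = 4 ^ Suc n"
  define CN where "CN = 2 * K * Jsum * C\<^sup>2"
  have CN: "0 \<le> CN" by (simp add: CN_def K_def)
  \<comment> \<open>The inner factor 2 collects the two equal products of the convolution estimate
    with \<open>c \<tau>\<close> in both places.\<close>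
  define h where "h \<tau> = ennreal (2 * \<nu>) + ennreal (2 / \<nu>) * (ennreal CN * (2 * Ws 2 (c \<tau>)))" for \<tau>
  have hm: "h \<in> borel_measurable ?M" unfolding h_def using W2m by measurable
  have eM: "emeasure ?M (space ?M) < \<infinity>"
    by (simp add: emeasure_restrict_space emeasure_lborel_Icc_eq)
  have hfin: "(\<integral>\<^sup>+\<tau>. h \<tau> \<partial>?M) < \<infinity>"
  proof -
    have "(\<integral>\<^sup>+\<tau>. h \<tau> \<partial>?M) = ennreal (2 * \<nu>) * emeasure ?M (space ?M) + ennreal (2 / \<nu>) * (ennreal CN * (2 * (\<integral>\<^sup>+\<tau>. Ws 2 (c \<tau>) \<partial>?M)))"
      unfolding h_def using W2m by (simp add: nn_integral_add nn_integral_cmult)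
    also have "\<dots> < \<infinity>" using eM l2 by (simp add: ennreal_mult_less_top)
    finally show ?thesis .
  qed
  define hr where "hr \<tau> = enn2real (h \<tau>)" for \<tau>
  have hr0: "0 \<le> hr \<tau>" for \<tau> by (simp add: hr_def)
  have hrm: "hr \<in> borel_measurable ?M" unfolding hr_def using hm by measurable
  have hr: "AE \<tau> in ?M. h \<tau> = ennreal (hr \<tau>)"
  proof -
    have "AE \<tau> in ?M. h \<tau> \<noteq> \<infinity>" using nn_integral_PInf_AE[OF hm] hfin by auto
    then show ?thesis by eventually_elim (simp add: hr_def less_top)
  qed
  have hri: "integrable ?M hr"
  proof (rule integrableI_bounded[OF hrm])
    have "(\<integral>\<^sup>+\<tau>. ennreal (norm (hr \<tau>)) \<partial>?M) = (\<integral>\<^sup>+\<tau>. h \<tau> \<partial>?M)"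
      by (rule nn_integral_cong_AE) (use hr in eventually_elim, simp add: hr0)
    then show "(\<integral>\<^sup>+\<tau>. ennreal (norm (hr \<tau>)) \<partial>?M) < \<infinity>" using hfin by simp
  qed
  define A where "A = Ws (n + 2) (c s) + ennreal (2 / \<nu>) * (\<integral>\<^sup>+\<tau>. Ws (Suc n) (f \<tau>) \<partial>?M)"
  have Afin: "A < \<infinity>" unfolding A_def using init ff by (simp add: ennreal_mult_less_top)
  define Ar where "Ar = enn2real A"
  have Ar: "A = ennreal Ar" "0 \<le> Ar" using Afin by (auto simp: Ar_def)
  obtain K0 where K0: "K0 \<ge> 0" and gron: "\<And>g M t. (\<forall>t\<in>{s..T}. 0 \<le> g t \<and> g t \<le> M) \<Longrightarrow> (\<lambda>t. hr t * g t) integrable_on {s..T} \<Longrightarrow>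
     (\<forall>t\<in>{s..T}. g t \<le> Ar + integral {s..t} (\<lambda>t. hr t * g t)) \<Longrightarrow> t\<in>{s..T} \<Longrightarrow> g t \<le> K0 * Ar"
    using gronwall_integral[of hr s T] hri hr0 Ar(2) integrable_on_lebesgue_on[OF hri] by force
  \<comment> \<open>\<open>real r + 1\<close> is the truncation level; the 1 provides the lower
    bound on it that \<open>truncated_weight\<close> requires.\<close>
  define \<Omega> where "\<Omega> r k = min (J k) (real r + 1) * J k ^ n" for r k
  have \<Omega>pos: "0 < \<Omega> r k" for r k by (simp add: \<Omega>_def)
  have \<Omega>sub: "\<Omega> r k \<le> K * (\<Omega> r j + \<Omega> r (k - j))" for r k j
    unfolding \<Omega>_def K_def by (rule truncated_weight) simp
  have \<Omega>le: "\<Omega> r k \<le> J k ^ Suc n" for r k by (simp add: \<Omega>_def mult_right_mono)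
  have \<Omega>J: "\<Omega> r k * J k \<le> (real r + 1) * J k ^ Suc n" for r k
  proof -
    have "min (J k) (real r + 1) * (J k ^ n * J k) \<le> (real r + 1) * (J k ^ n * J k)"
      by (intro mult_right_mono) auto
    then show ?thesis by (simp add: \<Omega>_def mult_ac)
  qed
  define E where "E r t = wsum (\<lambda>k. \<Omega> r k * J k) (c t)" for r t
  \<comment> \<open>This bound grows with r and serves finiteness only.\<close>
  have Ebd: "E r t \<le> ennreal ((real r + 1) * B0)" if "t \<in> {s..T}" for r t
  proof -
    have "E r t \<le> wsum (\<lambda>k. (real r + 1) * J k ^ Suc n) (c t)" unfolding E_def by (rule wsum_mono[OF \<Omega>J])
    also have "\<dots> = ennreal (real r + 1) * Ws (Suc n) (c t)"
      by (rule wsum_cmult) simp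
    also have "\<dots> \<le> ennreal (real r + 1) * ennreal B0" by (intro mult_left_mono B0(2) that) simp
    also have "\<dots> = ennreal ((real r + 1) * B0)" by (rule ennreal_mult'[symmetric]) simp
    finally show ?thesis .
  qed
  have Em: "E r \<in> borel_measurable ?M" for r unfolding E_def by (rule wsum_measurable[OF cm])
  have ineq: "E r t + ennreal \<nu> * (\<integral>\<^sup>+\<tau>. wsum (\<lambda>k. \<Omega> r k * J k * J k) (c \<tau>) \<partial>lebesgue_on {s..t}) \<le> A + (\<integral>\<^sup>+\<tau>. h \<tau> * E r \<tau> \<partial>lebesgue_on {s..t})"
    if t: "t \<in> {s..T}" for r t
  proof -
    let ?Mt = "lebesgue_on {s..t}"
    have sub: "{s..t} \<subseteq> {s..T}" using t by auto
    note sm = borel_measurable_lebesgue_on_subset[OF _ sub]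
    have Nbt: "AE \<tau> in ?Mt. \<forall>k. ennreal (norm (N \<tau> k)) \<le> ennreal C * (\<integral>\<^sup>+j. ennreal (sqrt (J j) * norm (c \<tau> j) * norm (c \<tau> (k - j))) \<partial>lattice)"
      by (rule AE_lebesgue_on_subset[OF Nb sub]) auto
    have "E r t + ennreal \<nu> * (\<integral>\<^sup>+\<tau>. wsum (\<lambda>k. \<Omega> r k * J k * J k) (c \<tau>) \<partial>?Mt)
      \<le> E r s + (\<integral>\<^sup>+\<tau>. ennreal (2 * \<nu>) * E r \<tau> + ennreal (2 / \<nu>) * (wsum (\<Omega> r) (f \<tau>) + wsum (\<Omega> r) (N \<tau>)) \<partial>?Mt)"
      unfolding E_def
      by (rule energy_inequality[OF \<nu> _ _ _ N \<Omega>pos]) (use t sm[OF fm] ac_on_subset[OF ac] in auto)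
    also have "(\<integral>\<^sup>+\<tau>. ennreal (2 * \<nu>) * E r \<tau> + ennreal (2 / \<nu>) * (wsum (\<Omega> r) (f \<tau>) + wsum (\<Omega> r) (N \<tau>)) \<partial>?Mt)
      \<le> (\<integral>\<^sup>+\<tau>. h \<tau> * E r \<tau> + ennreal (2 / \<nu>) * Ws (Suc n) (f \<tau>) \<partial>?Mt)"
    proof (rule nn_integral_mono_AE)
      show "AE \<tau> in ?Mt. ennreal (2 * \<nu>) * E r \<tau> + ennreal (2 / \<nu>) * (wsum (\<Omega> r) (f \<tau>) + wsum (\<Omega> r) (N \<tau>))
         \<le> h \<tau> * E r \<tau> + ennreal (2 / \<nu>) * Ws (Suc n) (f \<tau>)"
        using Nbt
      proof eventually_elim
        case (elim \<tau>)
        have "wsum (\<Omega> r) (N \<tau>) \<le> ennreal (2 * K * Jsum * C\<^sup>2) *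
          (wsum (\<lambda>k. \<Omega> r k * J k) (c \<tau>) * wsum (\<lambda>k. (J k)\<^sup>2) (c \<tau>) + wsum (\<lambda>k. (J k)\<^sup>2) (c \<tau>) * wsum (\<lambda>k. \<Omega> r k * J k) (c \<tau>))"
          by (rule wsum_convolution[OF _ \<Omega>pos _ \<Omega>sub C]) (use elim K_def in auto)
        also have "\<dots> = ennreal CN * (2 * Ws 2 (c \<tau>)) * E r \<tau>"
        proof -
          have "x * (e * w + w * e) = x * (2 * w) * e" for x e w :: ennreal
            by (simp only: mult.commute[of w e] mult_2[symmetric]) (simp only: mult_ac)
          then show ?thesis unfolding CN_def E_def .
        qed
        finally have "wsum (\<Omega> r) (f \<tau>) + wsum (\<Omega> r) (N \<tau>) \<le> Ws (Suc n) (f \<tau>) + ennreal CN * (2 * Ws 2 (c \<tau>)) * E r \<tau>"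
          by (intro add_mono wsum_mono \<Omega>le)
        then have "ennreal (2 * \<nu>) * E r \<tau> + ennreal (2 / \<nu>) * (wsum (\<Omega> r) (f \<tau>) + wsum (\<Omega> r) (N \<tau>))
          \<le> ennreal (2 * \<nu>) * E r \<tau> + ennreal (2 / \<nu>) * (Ws (Suc n) (f \<tau>) + ennreal CN * (2 * Ws 2 (c \<tau>)) * E r \<tau>)"
          by (intro add_left_mono mult_left_mono) auto
        also have "\<dots> = h \<tau> * E r \<tau> + ennreal (2 / \<nu>) * Ws (Suc n) (f \<tau>)"
        proof -
          have "x * e + y * (w + z * e) = (x + y * z) * e + y * w" for x e w y z :: ennreal
            by (simp add: distrib_left distrib_right mult_ac add_ac)
          then show ?thesis unfolding h_def .
        qed
        finally show ?case .
      qed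
    qed
    also have "\<dots> = (\<integral>\<^sup>+\<tau>. h \<tau> * E r \<tau> \<partial>?Mt) + ennreal (2 / \<nu>) * (\<integral>\<^sup>+\<tau>. Ws (Suc n) (f \<tau>) \<partial>?Mt)"
      using sm[OF hm] sm[OF Em[of r]] sm[OF Wfm] by (simp add: nn_integral_add nn_integral_cmult)
    also have "(\<integral>\<^sup>+\<tau>. Ws (Suc n) (f \<tau>) \<partial>?Mt) \<le> (\<integral>\<^sup>+\<tau>. Ws (Suc n) (f \<tau>) \<partial>?M)"
      by (rule nn_integral_lebesgue_on_mono[OF sub]) auto
    also have "E r s \<le> Ws (n + 2) (c s)" unfolding E_def
    proof (rule wsum_mono)
      show "\<Omega> r k * J k \<le> J k ^ (n + 2)" for k
        using mult_right_mono[OF \<Omega>le[of r k], of "J k"] by (simp add: mult_ac)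
    qed
    finally show ?thesis by (simp add: A_def add_left_mono add_right_mono mult_left_mono add_ac)
  qed
  have Ele: "E r t \<le> ennreal (K0 * Ar)" if t: "t \<in> {s..T}" for r t
  proof -
    \<comment> \<open>\<open>enn2real\<close> sends infinity to 0, but by \<open>Ebd\<close> the
      energy is finite on the whole interval, so nothing is lost.\<close>
    define g where "g t = enn2real (E r t)" for t
    have gE: "E r t = ennreal (g t)" if "t \<in> {s..T}" for t
      using Ebd[OF that, of r] by (simp add: g_def less_top[symmetric] top_unique) (metis ennreal_enn2real_if ennreal_neq_top top.extremum_uniqueI)
    have g0: "0 \<le> g t" for t by (simp add: g_def)
    have gb: "g t \<le> (real r + 1) * B0" if "t \<in> {s..T}" for t
      using Ebd[OF that, of r] B0(1) unfolding gE[OF that] by simp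
    have gm: "g \<in> borel_measurable ?M" unfolding g_def using Em[of r] by measurable
    have hgi: "integrable ?M (\<lambda>t. hr t * g t)"
    proof (rule Bochner_Integration.integrable_bound)
      show "integrable ?M (\<lambda>t. hr t * ((real r + 1) * B0))" using hri by simp
      show "AE t in ?M. norm (hr t * g t) \<le> norm (hr t * ((real r + 1) * B0))"
        using gb g0 hr0 B0(1) by (intro AE_I2) (auto simp: abs_mult intro!: mult_left_mono)
    qed (use hrm gm in measurable)
    have "g t \<le> K0 * Ar"
    proof (rule gron[OF _ _ _ t])
      show "\<forall>t\<in>{s..T}. 0 \<le> g t \<and> g t \<le> (real r + 1) * B0" using gb g0 by auto
      show "(\<lambda>t. hr t * g t) integrable_on {s..T}" by (rule integrable_on_lebesgue_on[OF hgi]) simp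
      show "\<forall>t\<in>{s..T}. g t \<le> Ar + integral {s..t} (\<lambda>t. hr t * g t)"
      proof
        fix t assume t: "t \<in> {s..T}"
        let ?Mt = "lebesgue_on {s..t}"
        have sub: "{s..t} \<subseteq> {s..T}" using t by auto
        have hgit: "integrable ?Mt (\<lambda>t. hr t * g t)"
          using hgi unfolding integrable_lebesgue_on_iff by (rule absolutely_integrable_on_subinterval[OF _ sub])
        have "ennreal (g t) \<le> A + (\<integral>\<^sup>+\<tau>. h \<tau> * E r \<tau> \<partial>?Mt)"
          using ineq[OF t, of r] unfolding gE[OF t] by (rule order.trans[rotated]) simp
        also have "(\<integral>\<^sup>+\<tau>. h \<tau> * E r \<tau> \<partial>?Mt) = (\<integral>\<^sup>+\<tau>. ennreal (hr \<tau> * g \<tau>) \<partial>?Mt)"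
        proof (rule nn_integral_cong_AE)
          have "AE \<tau> in ?Mt. h \<tau> = ennreal (hr \<tau>)" by (rule AE_lebesgue_on_subset[OF hr sub]) auto
          then show "AE \<tau> in ?Mt. h \<tau> * E r \<tau> = ennreal (hr \<tau> * g \<tau>)"
            using AE_space
          proof eventually_elim
            case (elim \<tau>)
            then have "\<tau> \<in> {s..T}" using sub by auto
            then show ?case using elim gE hr0 by (simp add: ennreal_mult')
          qed
        qed
        also have "\<dots> = ennreal (\<integral>\<tau>. hr \<tau> * g \<tau> \<partial>?Mt)"
          by (rule nn_integral_eq_integral[OF hgit]) (use hr0 g0 in auto)
        also have "(\<integral>\<tau>. hr \<tau> * g \<tau> \<partial>?Mt) = integral {s..t} (\<lambda>t. hr t * g t)"
          by (rule lebesgue_integral_eq_integral[OF hgit]) simp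
        also have "A + ennreal (integral {s..t} (\<lambda>t. hr t * g t)) = ennreal (Ar + integral {s..t} (\<lambda>t. hr t * g t))"
          unfolding Ar(1) using Ar(2) hr0 g0 by (intro ennreal_plus[symmetric]) (auto intro!: Henstock_Kurzweil_Integration.integral_nonneg integrable_on_lebesgue_on[OF hgit])
        finally show "g t \<le> Ar + integral {s..t} (\<lambda>t. hr t * g t)"
          using Ar(2) hr0 g0 by (subst (asm) ennreal_le_iff) (auto intro!: add_nonneg_nonneg Henstock_Kurzweil_Integration.integral_nonneg integrable_on_lebesgue_on[OF hgit])
      qed
    qed
    then show ?thesis using gE[OF t] by (simp add: ennreal_leI)
  qed
  have eventually_big: "\<forall>\<^sub>F r in sequentially. min (J k) (real r + 1) = J k" for k
  proof -
    obtain r0 :: nat where "J k \<le> real r0" using real_arch_simple by blast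
    then show ?thesis by (auto simp: eventually_sequentially min_def intro!: exI[of _ r0])
  qed
  have first: "Ws (n + 2) (c t) \<le> ennreal (K0 * Ar)" if t: "t \<in> {s..T}" for t
    unfolding wsum_def
  proof (rule lattice_fatou[where f="\<lambda>r k. ennreal (\<Omega> r k * J k * (norm (c t k))\<^sup>2)"])
    show "(\<integral>\<^sup>+k. ennreal (\<Omega> r k * J k * (norm (c t k))\<^sup>2) \<partial>lattice) \<le> ennreal (K0 * Ar)" for r
      using Ele[OF t, of r] by (simp add: E_def wsum_def)
    show "\<forall>\<^sub>F r in sequentially. ennreal (\<Omega> r k * J k * (norm (c t k))\<^sup>2) = ennreal (J k ^ (n + 2) * (norm (c t k))\<^sup>2)" for k
      using eventually_big[of k] by eventually_elim (simp add: \<Omega>_def power_add power2_eq_square mult_ac)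
  qed
  \<comment> \<open>With the energy bounded uniformly in r, the energy inequality at the final time
    bounds the integrated dissipation; 1 / \<nu> removes the viscosity in front of it.\<close>
  define D where "D = ennreal (1 / \<nu>) * (A + ennreal (K0 * Ar) * (\<integral>\<^sup>+\<tau>. h \<tau> \<partial>?M))"
  have Dfin: "D < \<infinity>" unfolding D_def using Afin hfin by (simp add: ennreal_mult_less_top)
  have Dle: "(\<integral>\<^sup>+\<tau>. wsum (\<lambda>k. \<Omega> r k * J k * J k) (c \<tau>) \<partial>?M) \<le> D" for r
  proof -
    have T: "T \<in> {s..T}" using sT by simp
    have "ennreal \<nu> * (\<integral>\<^sup>+\<tau>. wsum (\<lambda>k. \<Omega> r k * J k * J k) (c \<tau>) \<partial>?M) \<le> A + (\<integral>\<^sup>+\<tau>. h \<tau> * E r \<tau> \<partial>?M)"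
      using ineq[OF T, of r] by (rule order.trans[rotated]) simp
    also have "(\<integral>\<^sup>+\<tau>. h \<tau> * E r \<tau> \<partial>?M) \<le> (\<integral>\<^sup>+\<tau>. h \<tau> * ennreal (K0 * Ar) \<partial>?M)"
      by (intro nn_integral_mono mult_left_mono Ele) auto
    also have "\<dots> = ennreal (K0 * Ar) * (\<integral>\<^sup>+\<tau>. h \<tau> \<partial>?M)"
      using hm by (simp add: nn_integral_multc mult.commute)
    finally have "ennreal (1 / \<nu>) * (ennreal \<nu> * (\<integral>\<^sup>+\<tau>. wsum (\<lambda>k. \<Omega> r k * J k * J k) (c \<tau>) \<partial>?M)) \<le> D"
      unfolding D_def by (intro mult_left_mono) (auto simp: add_left_mono)
    moreover have "ennreal (1 / \<nu>) * ennreal \<nu> = 1"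
      using \<nu> by (subst ennreal_mult'[symmetric]) auto
    ultimately show ?thesis by (simp add: mult.assoc[symmetric])
  qed
  have "(\<integral>\<^sup>+\<tau>. Ws (n + 3) (c \<tau>) \<partial>?M) \<le> D"
    unfolding wsum_time_swap[OF cm, of "\<lambda>k. J k ^ (n + 3)", simplified]
  proof (rule lattice_fatou[where f="\<lambda>r k. ennreal (\<Omega> r k * J k * J k) * (\<integral>\<^sup>+t. ennreal ((norm (c t k))\<^sup>2) \<partial>?M)"])
    show "(\<integral>\<^sup>+k. ennreal (\<Omega> r k * J k * J k) * (\<integral>\<^sup>+t. ennreal ((norm (c t k))\<^sup>2) \<partial>?M) \<partial>lattice) \<le> D" for r
      using Dle[of r] by (subst (asm) wsum_time_swap[OF cm]) (auto simp: \<Omega>pos less_imp_le)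
    show "\<forall>\<^sub>F r in sequentially. ennreal (\<Omega> r k * J k * J k) * (\<integral>\<^sup>+t. ennreal ((norm (c t k))\<^sup>2) \<partial>?M) = ennreal (J k ^ (n + 3)) * (\<integral>\<^sup>+t. ennreal ((norm (c t k))\<^sup>2) \<partial>?M)" for k
      using eventually_big[of k] by eventually_elim (simp add: \<Omega>_def power_add power3_eq_cube mult_ac)
  qed
  then have "(\<integral>\<^sup>+\<tau>. Ws (n + 3) (c \<tau>) \<partial>?M) < \<infinity>" using Dfin by (rule le_less_trans)
  then show ?thesis using first by (intro conjI exI[of _ "K0 * Ar"] ballI)
qed

section \<open>The nonlinear term as a function of time\<close>

lemma bilinear_curl_mult: "bounded_bilinear (curl_mult j)"
proof -
  interpret bounded_bilinear ccross by (rule bilinear_ccross)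
  have "bounded_linear (\<lambda>a. ccross (ikvec j) a)" by (rule bounded_linear_right)
  from comp1[OF this] show ?thesis by (simp add: curl_mult_def[abs_def])
qed

text \<open>A crude estimate, but uniform in k and additive in the two sequences, so that its time
  integral is controlled by the time integrals of the two squared norms separately.\<close>

lemma convolution_young:
  fixes x :: "int^3 \<Rightarrow> complex^3" and y :: "int^3 \<Rightarrow> complex^3"
  shows "(\<integral>\<^sup>+j. ennreal (sqrt (J j) * norm (x j) * norm (y (k - j))) \<partial>lattice) \<le> Ws 1 x + Ws 0 y"
proof -
  have "(\<integral>\<^sup>+j. ennreal (sqrt (J j) * norm (x j) * norm (y (k - j))) \<partial>lattice)
    \<le> (\<integral>\<^sup>+j. ennreal (J j ^ 1 * (norm (x j))\<^sup>2) + ennreal (J (k - j) ^ 0 * (norm (y (k - j)))\<^sup>2) \<partial>lattice)"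
  proof (rule nn_integral_mono)
    fix j
    have "2 * (sqrt (J j) * norm (x j)) * norm (y (k - j)) \<le> (sqrt (J j) * norm (x j))\<^sup>2 + (norm (y (k - j)))\<^sup>2"
      by (rule sum_squares_bound)
    moreover have "(sqrt (J j) * norm (x j))\<^sup>2 = J j * (norm (x j))\<^sup>2" by (simp add: power_mult_distrib)
    moreover have "0 \<le> sqrt (J j) * norm (x j) * norm (y (k - j))" by simp
    ultimately have "sqrt (J j) * norm (x j) * norm (y (k - j)) \<le> J j * (norm (x j))\<^sup>2 + (norm (y (k - j)))\<^sup>2" by linarith
    then have "ennreal (sqrt (J j) * norm (x j) * norm (y (k - j))) \<le> ennreal (J j * (norm (x j))\<^sup>2 + (norm (y (k - j)))\<^sup>2)" by (rule ennreal_leI)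
    also have "\<dots> = ennreal (J j * (norm (x j))\<^sup>2) + ennreal ((norm (y (k - j)))\<^sup>2)" by (rule ennreal_plus) auto
    finally show "ennreal (sqrt (J j) * norm (x j) * norm (y (k - j))) \<le> ennreal (J j ^ 1 * (norm (x j))\<^sup>2) + ennreal (J (k - j) ^ 0 * (norm (y (k - j)))\<^sup>2)" by simp
  qed
  also have "\<dots> = Ws 1 x + Ws 0 y"
    using lattice_reflect[of "\<lambda>j. ennreal (J j ^ 0 * (norm (y j))\<^sup>2)" k] by (simp add: nn_integral_add wsum_def)
  finally show ?thesis .
qed

lemma curl_mult_young:
  "(\<integral>\<^sup>+j. ennreal (norm (curl_mult j (x j) (y (k - j)))) \<partial>lattice) \<le> ennreal curl_const * (Ws 1 x + Ws 0 y)"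
  using curl_mult_nn_bound[of x y k] mult_left_mono[OF convolution_young[of x y k], of "ennreal curl_const"]
  by (auto intro: order.trans)

lemma curl_mult_integrable:
  assumes "Ws 1 x < \<infinity>" "Ws 0 y < \<infinity>"
  shows "integrable lattice (\<lambda>j. curl_mult j (x j) (y (k - j)))"
proof (rule integrableI_bounded)
  have "ennreal curl_const * (Ws 1 x + Ws 0 y) < \<infinity>" using assms by (simp add: ennreal_mult_less_top)
  with curl_mult_young[of x y k]
  show "(\<integral>\<^sup>+j. ennreal (norm (curl_mult j (x j) (y (k - j)))) \<partial>lattice) < \<infinity>" by (rule le_less_trans)
qed simp

lemma AE_lebesgue_on_negligible:
  assumes "AE t in lebesgue_on S. P t" "S \<in> sets lebesgue"
  obtains Z where "negligible Z" "\<And>t. t \<in> S - Z \<Longrightarrow> P t"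
proof -
  have "AE t in lebesgue. t \<in> S \<longrightarrow> P t" using assms by (simp add: AE_restrict_space_iff)
  then obtain Z where "Z \<in> null_sets lebesgue" "{t. \<not> (t \<in> S \<longrightarrow> P t)} \<subseteq> Z"
    by (auto simp: eventually_ae_filter)
  then show ?thesis using that[of Z] by (auto simp: negligible_iff_null_sets)
qed

text \<open>Finiteness of one iterated integral yields, by Tonelli, what
  \<open>lattice_integral_swap\<close> asks for.\<close>

lemma swap_conditions:
  fixes F :: "int^3 \<Rightarrow> 'a \<Rightarrow> 'b::{banach, second_countable_topology}"
  assumes F: "\<And>j. F j \<in> borel_measurable M" and fin: "(\<integral>\<^sup>+t. \<integral>\<^sup>+j. ennreal (norm (F j t)) \<partial>lattice \<partial>M) < \<infinity>"
  shows "\<And>j. integrable M (F j)" and "integrable lattice (\<lambda>j. \<integral>t. norm (F j t) \<partial>M)"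
proof -
  have sw: "(\<integral>\<^sup>+j. \<integral>\<^sup>+t. ennreal (norm (F j t)) \<partial>M \<partial>lattice) < \<infinity>"
    using fin by (subst nn_integral_count_space_nn_integral[symmetric]) (use F in auto)
  have each: "(\<integral>\<^sup>+t. ennreal (norm (F j t)) \<partial>M) < \<infinity>" for j
  proof -
    have "(\<integral>\<^sup>+t. ennreal (norm (F j t)) \<partial>M) \<le> (\<integral>\<^sup>+t. \<integral>\<^sup>+j. ennreal (norm (F j t)) \<partial>lattice \<partial>M)"
    proof (rule nn_integral_mono)
      fix t
      have "ennreal (norm (F j t)) = (\<integral>\<^sup>+l. ennreal (norm (F l t)) * indicator {j} l \<partial>lattice)"
        by (simp add: nn_integral_count_space_indicator[symmetric] nn_integral_count_space_finite)
      also have "\<dots> \<le> (\<integral>\<^sup>+l. ennreal (norm (F l t)) \<partial>lattice)"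
        by (intro nn_integral_mono) (auto split: split_indicator)
      finally show "ennreal (norm (F j t)) \<le> (\<integral>\<^sup>+l. ennreal (norm (F l t)) \<partial>lattice)" .
    qed
    then show ?thesis using fin by (rule le_less_trans)
  qed
  show int: "integrable M (F j)" for j by (rule integrableI_bounded[OF F each])
  show "integrable lattice (\<lambda>j. \<integral>t. norm (F j t) \<partial>M)"
  proof (rule integrableI_bounded)
    have "(\<integral>\<^sup>+j. ennreal (norm (\<integral>t. norm (F j t) \<partial>M)) \<partial>lattice) = (\<integral>\<^sup>+j. \<integral>\<^sup>+t. ennreal (norm (F j t)) \<partial>M \<partial>lattice)"
      by (intro nn_integral_cong) (simp add: nn_integral_eq_integral[OF integrable_norm[OF int]])
    then show "(\<integral>\<^sup>+j. ennreal (norm (\<integral>t. norm (F j t) \<partial>M)) \<partial>lattice) < \<infinity>" using sw by simp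
  qed simp
qed

text \<open>Each product in the convolution obeys the product rule, and the lattice sum is exchanged
  with the time integral. Finiteness at every time makes the series converge at both ends of an
  increment; finiteness of the time integrals makes the series of derivatives integrable.\<close>

lemma ac_on_curl_conv:
  fixes a a' b b' :: "real \<Rightarrow> int^3 \<Rightarrow> complex^3"
  assumes a: "\<And>k. ac_on s T (\<lambda>t. a t k) (\<lambda>t. a' t k)" and b: "\<And>k. ac_on s T (\<lambda>t. b t k) (\<lambda>t. b' t k)"
    and fa: "\<And>t. t \<in> {s..T} \<Longrightarrow> Ws 1 (a t) < \<infinity>" and fb: "\<And>t. t \<in> {s..T} \<Longrightarrow> Ws 0 (b t) < \<infinity>"
    and ia: "(\<integral>\<^sup>+t. Ws 1 (a t) \<partial>lebesgue_on {s..T}) < \<infinity>" and ib: "(\<integral>\<^sup>+t. Ws 0 (b t) \<partial>lebesgue_on {s..T}) < \<infinity>"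
    and ia': "(\<integral>\<^sup>+t. Ws 1 (a' t) \<partial>lebesgue_on {s..T}) < \<infinity>" and ib': "(\<integral>\<^sup>+t. Ws 0 (b' t) \<partial>lebesgue_on {s..T}) < \<infinity>"
  shows "ac_on s T (\<lambda>t. curl_conv (a t) (b t) k) (\<lambda>t. curl_conv (a' t) (b t) k + curl_conv (a t) (b' t) k)"
proof -
  let ?M = "lebesgue_on {s..T}"
  define e1 where "e1 j t = curl_mult j (a' t j) (b t (k - j))" for j t
  define e2 where "e2 j t = curl_mult j (a t j) (b' t (k - j))" for j t
  define F where "F j t = curl_mult j (a t j) (b t (k - j))" for j t
  note am = ac_on_measurable[OF a] and bm = ac_on_measurable[OF b]
  have cmm: "(\<lambda>t. curl_mult j (x t) (y t)) \<in> borel_measurable M"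
    if "x \<in> borel_measurable M" "y \<in> borel_measurable M" for j x y and M :: "real measure"
  proof -
    interpret bounded_bilinear "curl_mult j" by (rule bilinear_curl_mult)
    show ?thesis by (rule borel_measurable_continuous_Pair[OF that]) (intro continuous_intros continuous_on)
  qed
  have fin: "(\<integral>\<^sup>+t. \<integral>\<^sup>+j. ennreal (norm (curl_mult j (x t j) (y t (k - j)))) \<partial>lattice \<partial>?M) < \<infinity>"
    if "(\<integral>\<^sup>+t. Ws 1 (x t) \<partial>?M) < \<infinity>" "(\<integral>\<^sup>+t. Ws 0 (y t) \<partial>?M) < \<infinity>"
      "\<And>k. (\<lambda>t. x t k) \<in> borel_measurable ?M" "\<And>k. (\<lambda>t. y t k) \<in> borel_measurable ?M" for x y
  proof -
    have "(\<integral>\<^sup>+t. \<integral>\<^sup>+j. ennreal (norm (curl_mult j (x t j) (y t (k - j)))) \<partial>lattice \<partial>?M) \<le> (\<integral>\<^sup>+t. ennreal curl_const * (Ws 1 (x t) + Ws 0 (y t)) \<partial>?M)"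
      by (intro nn_integral_mono curl_mult_young)
    also have "\<dots> = ennreal curl_const * ((\<integral>\<^sup>+t. Ws 1 (x t) \<partial>?M) + (\<integral>\<^sup>+t. Ws 0 (y t) \<partial>?M))"
      using wsum_measurable[of x ?M "\<lambda>k. J k ^ 1", OF that(3)] wsum_measurable[of y ?M "\<lambda>k. J k ^ 0", OF that(4)]
      by (subst nn_integral_cmult) (auto simp: nn_integral_add)
    also have "\<dots> < \<infinity>" using that(1,2) by (simp add: ennreal_mult_less_top)
    finally show ?thesis .
  qed
  have m1: "e1 j \<in> borel_measurable ?M" and m2: "e2 j \<in> borel_measurable ?M" for j
    unfolding e1_def e2_def by (intro cmm am bm)+
  have "(\<integral>\<^sup>+t. \<integral>\<^sup>+j. ennreal (norm (e1 j t)) \<partial>lattice \<partial>?M) < \<infinity>"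
    unfolding e1_def by (rule fin[OF ia' ib am(2) bm(1)])
  note s1 = swap_conditions[OF m1 this]
  have "(\<integral>\<^sup>+t. \<integral>\<^sup>+j. ennreal (norm (e2 j t)) \<partial>lattice \<partial>?M) < \<infinity>"
    unfolding e2_def by (rule fin[OF ia ib' am(1) bm(2)])
  note s2 = swap_conditions[OF m2 this]
  have sf: "sigma_finite_measure (lebesgue_on {x..y::real})" for x y
    by (rule finite_measure.axioms(1), rule finite_measureI) (simp add: emeasure_restrict_space emeasure_lborel_Icc_eq)
  note sw1 = lattice_integral_swap[OF sf s1] and sw2 = lattice_integral_swap[OF sf s2]
  have Fac: "ac_on s T (F j) (\<lambda>t. e1 j t + e2 j t)" for j
    unfolding F_def e1_def e2_def by (rule ac_on_bilinear[OF bilinear_curl_mult a b])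
  let ?e = "\<lambda>t. curl_conv (a' t) (b t) k + curl_conv (a t) (b' t) k"
  have e_eq: "?e t = (\<integral>j. e1 j t \<partial>lattice) + (\<integral>j. e2 j t \<partial>lattice)" for t
    by (simp add: curl_conv_def e1_def e2_def)
  have ei: "integrable ?M ?e" unfolding e_eq by (intro Bochner_Integration.integrable_add sw1(2) sw2(2))
  show ?thesis unfolding ac_on_def
  proof (intro conjI allI impI)
    show "?e absolutely_integrable_on {s..T}" using ei by (simp add: integrable_lebesgue_on_iff)
    fix p q assume pq: "s \<le> p \<and> p \<le> q \<and> q \<le> T"
    let ?Mp = "lebesgue_on {p..q}"
    have Fi: "integrable lattice (\<lambda>j. F j t)" if "t \<in> {s..T}" for t
      unfolding F_def by (intro curl_mult_integrable fa fb that)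
    have sub: "{p..q} \<subseteq> {s..T}" using pq by auto
    \<comment> \<open>The conditions for the exchange pass from the whole interval to the
      subinterval by comparison.\<close>
    have part: "\<And>j. integrable ?Mp (g j)" "integrable lattice (\<lambda>j. \<integral>t. norm (g j t) \<partial>?Mp)"
      if g: "\<And>j. integrable ?M (g j)" "integrable lattice (\<lambda>j. \<integral>t. norm (g j t) \<partial>?M)" for g :: "int^3 \<Rightarrow> real \<Rightarrow> complex^3"
    proof -
      show i: "integrable ?Mp (g j)" for j
        using g(1)[of j] unfolding integrable_lebesgue_on_iff by (rule absolutely_integrable_on_subinterval[OF _ sub])
      show "integrable lattice (\<lambda>j. \<integral>t. norm (g j t) \<partial>?Mp)"
      proof (rule Bochner_Integration.integrable_bound[OF g(2)])
        have "(\<integral>t. norm (g j t) \<partial>?Mp) \<le> (\<integral>t. norm (g j t) \<partial>?M)" for j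
        proof -
          have "(\<integral>t. norm (g j t) \<partial>?Mp) = integral {p..q} (\<lambda>t. norm (g j t))"
            by (rule lebesgue_integral_eq_integral[OF integrable_norm[OF i]]) simp
          also have "\<dots> \<le> integral {s..T} (\<lambda>t. norm (g j t))"
            by (rule integral_subset_le[OF sub]) (auto intro!: integrable_on_lebesgue_on integrable_norm i g(1))
          also have "\<dots> = (\<integral>t. norm (g j t) \<partial>?M)"
            by (rule lebesgue_integral_eq_integral[OF integrable_norm[OF g(1)], symmetric]) simp
          finally show ?thesis .
        qed
        then show "AE j in lattice. norm (\<integral>t. norm (g j t) \<partial>?Mp) \<le> norm (\<integral>t. norm (g j t) \<partial>?M)" by simp
      qed simp
    qed
    note p1 = part[OF s1] and p2 = part[OF s2]
    note q1 = lattice_integral_swap[OF sf p1] and q2 = lattice_integral_swap[OF sf p2]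
    have "curl_conv (a q) (b q) k - curl_conv (a p) (b p) k = (\<integral>j. F j q - F j p \<partial>lattice)"
      unfolding curl_conv_def F_def[symmetric]
      by (rule Bochner_Integration.integral_diff[symmetric]) (use Fi pq in auto)
    also have "\<dots> = (\<integral>j. (\<integral>t. e1 j t \<partial>?Mp) + (\<integral>t. e2 j t \<partial>?Mp) \<partial>lattice)"
    proof (rule Bochner_Integration.integral_cong[OF refl])
      fix j
      have "F j q - F j p = integral {p..q} (\<lambda>t. e1 j t + e2 j t)" using ac_onD[OF Fac] pq by blast
      also have "\<dots> = (\<integral>t. e1 j t + e2 j t \<partial>?Mp)"
        by (rule lebesgue_integral_eq_integral[symmetric]) (use p1(1) p2(1) in auto)
      also have "\<dots> = (\<integral>t. e1 j t \<partial>?Mp) + (\<integral>t. e2 j t \<partial>?Mp)"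
        by (rule Bochner_Integration.integral_add[OF p1(1) p2(1)])
      finally show "F j q - F j p = (\<integral>t. e1 j t \<partial>?Mp) + (\<integral>t. e2 j t \<partial>?Mp)" .
    qed
    also have "\<dots> = (\<integral>j. (\<integral>t. e1 j t \<partial>?Mp) \<partial>lattice) + (\<integral>j. (\<integral>t. e2 j t \<partial>?Mp) \<partial>lattice)"
      by (rule Bochner_Integration.integral_add[OF q1(4) q2(4)])
    also have "\<dots> = (\<integral>t. (\<integral>j. e1 j t \<partial>lattice) \<partial>?Mp) + (\<integral>t. (\<integral>j. e2 j t \<partial>lattice) \<partial>?Mp)"
      by (simp only: q1(1) q2(1))
    also have "\<dots> = (\<integral>t. ?e t \<partial>?Mp)"
      unfolding e_eq by (rule Bochner_Integration.integral_add[OF q1(2) q2(2), symmetric])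
    also have "\<dots> = integral {p..q} ?e"
      by (rule lebesgue_integral_eq_integral) (use q1(2) q2(2) in \<open>auto simp: e_eq\<close>)
    finally show "curl_conv (a q) (b q) k - curl_conv (a p) (b p) k = integral {p..q} ?e" .
  qed
qed

section \<open>From the strong solution to the system of coefficients\<close>

lemma L2_into_coeff_integrable:
  assumes Y: "fourier_space Y" and v: "L2_into Y a b v"
  shows "integrable (lebesgue_on {a<..<b}) (\<lambda>t. fourier_coeff (v t) k)"
proof -
  let ?M = "lebesgue_on {a<..<b}"
  have sm: "strongly_measurable Y {a<..<b} v" and fin: "(\<integral>\<^sup>+t. ennreal ((Norm Y (v t))\<^sup>2) \<partial>?M) < \<infinity>"
    using v by (auto simp: L2_into_def)
  note m = strongly_measurable_coeff(1)[OF Y _ sm, of k] and ae = strongly_measurable_coeff(2)[OF Y _ sm]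
  interpret finite_measure ?M
    by (rule finite_measureI) (use emeasure_bounded_finite[of "{a<..<b}"] in \<open>simp add: emeasure_restrict_space less_top\<close>)
  have m3: "(\<lambda>t. ennreal ((norm (fourier_coeff (v t) k) / 3)\<^sup>2)) \<in> borel_measurable ?M"
    using m by simp
  have "(\<integral>\<^sup>+t. ennreal ((norm (fourier_coeff (v t) k) / 3)\<^sup>2) \<partial>?M) \<le> (\<integral>\<^sup>+t. ennreal ((Norm Y (v t))\<^sup>2) \<partial>?M)"
  proof (rule nn_integral_mono_AE)
    have "AE t in ?M. v t \<in> Elems Y" using ae by simp
    then show "AE t in ?M. ennreal ((norm (fourier_coeff (v t) k) / 3)\<^sup>2) \<le> ennreal ((Norm Y (v t))\<^sup>2)"
    proof eventually_elim
      case (elim t)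
      show ?case using fourier_spaceD(5)[OF Y elim, of k] by (intro ennreal_leI power_mono) auto
    qed
  qed
  then have "(\<integral>\<^sup>+t. ennreal (norm ((norm (fourier_coeff (v t) k) / 3)\<^sup>2)) \<partial>?M) < \<infinity>"
    using fin by simp
  then have "integrable ?M (\<lambda>t. (norm (fourier_coeff (v t) k) / 3)\<^sup>2)"
    by (rule integrableI_bounded[rotated]) (use m in simp)
  then have "integrable ?M (\<lambda>t. norm (fourier_coeff (v t) k) / 3)"
    by (rule square_integrable_imp_integrable[rotated]) (use m in simp)
  from integrable_mult_right[OF this, of 3] have "integrable ?M (\<lambda>t. norm (fourier_coeff (v t) k))" by simp
  then show ?thesis using m by (simp add: integrable_norm_iff)
qed

lemma integrable_Ioo_iff:
  fixes f :: "real \<Rightarrow> 'b::euclidean_space"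
  shows "integrable (lebesgue_on {a<..<b}) f \<longleftrightarrow> f absolutely_integrable_on {a..b}"
  by (simp only: absolutely_integrable_on_Icc_iff_Ioo) (simp add: set_integrable_def integrable_restrict_space)

lemma integral_Ioo_eq:
  fixes f :: "real \<Rightarrow> 'b::euclidean_space"
  assumes "integrable (lebesgue_on {a<..<b}) f"
  shows "(\<integral>t. f t \<partial>lebesgue_on {a<..<b}) = integral {a..b} f"
proof -
  have "(\<integral>t. f t \<partial>lebesgue_on {a<..<b}) = integral {a<..<b} f"
    by (rule lebesgue_integral_eq_integral[OF assms]) simp
  also have "\<dots> = integral {a..b} f" by (metis box_real(1) box_real(2) integral_open_interval)
  finally show ?thesis .
qed

lemma weak_time_deriv_coeff:
  assumes Y: "fourier_space Y" and w: "weak_time_deriv Y a b u v" and \<phi>: "time_test_function a b \<phi>"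
  shows "integral {a..b} (\<lambda>t. deriv \<phi> t *\<^sub>R fourier_coeff (u t) k) = - integral {a..b} (\<lambda>t. \<phi> t *\<^sub>R fourier_coeff (v t) k)"
proof -
  obtain I where I: "has_field_integral Y {a<..<b} (\<lambda>t x. deriv \<phi> t *\<^sub>R u t x) I"
    and I': "has_field_integral Y {a<..<b} (\<lambda>t x. \<phi> t *\<^sub>R v t x) (\<lambda>x. - I x)"
    using w \<phi> unfolding weak_time_deriv_def by blast
  have S: "{a<..<b} \<in> lmeasurable" by simp
  note h = has_field_integral_coeff[OF Y S I, of k] and h' = has_field_integral_coeff[OF Y S I', of k]
  have "integral {a..b} (\<lambda>t. deriv \<phi> t *\<^sub>R fourier_coeff (u t) k) = fourier_coeff I k"
    using integral_Ioo_eq[OF h(1)] h(2) by (simp add: fourier_coeff_scaleR)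
  moreover have "integral {a..b} (\<lambda>t. \<phi> t *\<^sub>R fourier_coeff (v t) k) = - fourier_coeff I k"
    using integral_Ioo_eq[OF h'(1)] h'(2) by (simp add: fourier_coeff_scaleR fourier_coeff_uminus)
  ultimately show ?thesis by simp
qed

lemma continuous_into_coeff:
  assumes Y: "fourier_space Y" and u: "continuous_into Y S u"
  shows "continuous_on S (\<lambda>t. fourier_coeff (u t) k)"
  unfolding continuous_on_def
proof (intro ballI, rule LIM_zero_cancel, rule Lim_null_comparison)
  fix t assume t: "t \<in> S"
  have el: "u s \<in> Elems Y" if "s \<in> S" for s using u that by (auto simp: continuous_into_def)
  have lim: "((\<lambda>s. Norm Y (\<lambda>x. u s x - u t x)) \<longlongrightarrow> 0) (at t within S)"
    using u t by (auto simp: continuous_into_def)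
  show "\<forall>\<^sub>F s in at t within S. norm (fourier_coeff (u s) k - fourier_coeff (u t) k) \<le> 3 * Norm Y (\<lambda>x. u s x - u t x)"
    unfolding eventually_at_filter
    by (rule always_eventually) (use coeff_norm_diff_le[OF Y] el t in blast)
  show "((\<lambda>s. 3 * Norm Y (\<lambda>x. u s x - u t x)) \<longlongrightarrow> 0) (at t within S)"
    using tendsto_mult_right_zero[OF lim] .
qed

text \<open>Near each time the quasi-triangle inequality \<open>wsum_add\<close> bounds the weighted
  sum by its value there, and finitely many such neighbourhoods cover the compact set.\<close>

lemma continuous_into_H_bounded:
  assumes u: "continuous_into (H_space s) S u" and S: "compact S"
  shows "\<exists>B. \<forall>t\<in>S. Ws s (fourier_coeff (u t)) \<le> ennreal B"
proof -
  let ?W = "\<lambda>t. Ws s (fourier_coeff (u t))"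
  have el: "u t \<in> Elems (H_space s)" if "t \<in> S" for t using u that by (auto simp: continuous_into_def)
  have fin: "?W t < \<infinity>" if "t \<in> S" for t using el[OF that] by (simp add: H_space_Elems)
  have loc: "\<exists>\<delta>>0. \<forall>r\<in>S. dist r t < \<delta> \<longrightarrow> ?W r \<le> 2 + 2 * ?W t" if t: "t \<in> S" for t
  proof -
    have "((\<lambda>r. Norm (H_space s) (\<lambda>x. u r x - u t x)) \<longlongrightarrow> 0) (at t within S)"
      using u t by (auto simp: continuous_into_def)
    then have "\<forall>\<^sub>F r in at t within S. Norm (H_space s) (\<lambda>x. u r x - u t x) < 1"
      by (rule order_tendstoD) simp
    then obtain \<delta> where \<delta>: "\<delta> > 0" "\<And>r. r \<in> S \<Longrightarrow> r \<noteq> t \<Longrightarrow> dist r t < \<delta> \<Longrightarrow> Norm (H_space s) (\<lambda>x. u r x - u t x) < 1"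
      unfolding eventually_at by blast
    have "?W r \<le> 2 + 2 * ?W t" if r: "r \<in> S" "dist r t < \<delta>" for r
    proof (cases "r = t")
      case True
      have "1 * ?W t \<le> 2 * ?W t" by (intro mult_right_mono) auto
      also have "\<dots> \<le> 2 + 2 * ?W t" by simp
      finally show ?thesis using True by simp
    next
      case False
      have "(Norm (H_space s) (\<lambda>x. u r x - u t x))\<^sup>2 \<le> 1"
        using \<delta>(2)[OF r(1) False r(2)] H_space_Norm_nonneg by (intro power_le_one) (auto simp: less_imp_le)
      then have "Ws s (\<lambda>k. fourier_coeff (u r) k - fourier_coeff (u t) k) \<le> 1"
        using H_norm_diff[OF el[OF r(1)] el[OF t]] by (metis ennreal_1 ennreal_leI)
      moreover have "?W r \<le> 2 * Ws s (\<lambda>k. fourier_coeff (u r) k - fourier_coeff (u t) k) + 2 * ?W t"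
        using wsum_add[of "\<lambda>k. J k ^ s" "\<lambda>k. fourier_coeff (u r) k - fourier_coeff (u t) k" "fourier_coeff (u t)"]
        by simp
      ultimately show ?thesis
        by (meson add_right_mono mult_left_mono order.trans zero_le mult_left_le)
    qed
    then show ?thesis using \<delta>(1) by blast
  qed
  then obtain \<delta> where \<delta>: "\<And>t. t \<in> S \<Longrightarrow> \<delta> t > 0" "\<And>t r. t \<in> S \<Longrightarrow> r \<in> S \<Longrightarrow> dist r t < \<delta> t \<Longrightarrow> ?W r \<le> 2 + 2 * ?W t"
    by metis
  obtain C where C: "C \<subseteq> S" "finite C" "S \<subseteq> (\<Union>t\<in>C. ball t (\<delta> t))"
    by (rule compactE_image[OF S, of S "\<lambda>t. ball t (\<delta> t)"]) (use \<delta>(1) in auto)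
  let ?B = "\<Sum>t\<in>C. 2 + 2 * ?W t"
  have Bfin: "?B < \<infinity>" using fin C by (auto simp: ennreal_mult_less_top less_top)
  have "?W r \<le> ?B" if r: "r \<in> S" for r
  proof -
    obtain t where t: "t \<in> C" "dist r t < \<delta> t" using C(3) r by (auto simp: dist_commute)
    have "?W r \<le> 2 + 2 * ?W t" using \<delta>(2) t C(1) r by blast
    also have "\<dots> \<le> ?B" by (rule member_le_sum) (use t C in auto)
    finally show ?thesis .
  qed
  moreover have "?B = ennreal (enn2real ?B)" using Bfin by simp
  ultimately show ?thesis by metis
qed

lemma AE_interval_ex:
  fixes a b :: real
  assumes "AE t in lebesgue_on {a..b}. P t" "a < b" shows "\<exists>t\<in>{a..b}. P t"
proof (rule ccontr)
  assume n: "\<not> ?thesis"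
  obtain Z where Z: "negligible Z" "\<And>t. t \<in> {a..b} - Z \<Longrightarrow> P t"
    using AE_lebesgue_on_negligible[OF assms(1)] by auto
  have "{a..b} \<subseteq> Z" using Z(2) n by blast
  then have "negligible (cbox a b)" using Z(1) negligible_subset by auto
  then have "box a b = {}" by (simp only: negligible_interval)
  then show False using assms(2) by (simp add: box_real)
qed

text \<open>At each step the solution already lies in \<open>H^(n + 2)\<close> at almost every time, and the energy
  estimate is started at such a time before \<open>\<epsilon>\<close>.\<close>

lemma bootstrap:
  fixes c d f :: "real \<Rightarrow> int^3 \<Rightarrow> complex^3"
  assumes \<nu>: "0 < \<nu>" and ac: "\<And>k. ac_on 0 T (\<lambda>\<tau>. c \<tau> k) (\<lambda>\<tau>. d \<tau> k)"
    and fm: "\<And>k. (\<lambda>\<tau>. f \<tau> k) \<in> borel_measurable (lebesgue_on {0..T})"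
    and eq: "AE \<tau> in lebesgue_on {0..T}. \<forall>k. d \<tau> k = - (\<nu> * (norm (wave_vector k))\<^sup>2) *\<^sub>R c \<tau> k + f \<tau> k - curl_conv (c \<tau>) (c \<tau>) k"
    and bnd: "\<And>t. t \<in> {0..T} \<Longrightarrow> Ws 1 (c t) \<le> ennreal B"
    and l2: "(\<integral>\<^sup>+\<tau>. Ws 2 (c \<tau>) \<partial>lebesgue_on {0..T}) < \<infinity>"
    and ff: "(\<integral>\<^sup>+\<tau>. Ws m (f \<tau>) \<partial>lebesgue_on {0..T}) < \<infinity>"
    and n: "n \<le> m" and \<epsilon>: "0 < \<epsilon>" "\<epsilon> < T"
  shows "(\<exists>B'. \<forall>t\<in>{\<epsilon>..T}. Ws (n + 1) (c t) \<le> ennreal B') \<and> (\<integral>\<^sup>+\<tau>. Ws (n + 2) (c \<tau>) \<partial>lebesgue_on {\<epsilon>..T}) < \<infinity>"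
  using n \<epsilon>
proof (induction n arbitrary: \<epsilon>)
  case 0
  have "(\<integral>\<^sup>+\<tau>. Ws 2 (c \<tau>) \<partial>lebesgue_on {\<epsilon>..T}) \<le> (\<integral>\<^sup>+\<tau>. Ws 2 (c \<tau>) \<partial>lebesgue_on {0..T})"
    by (rule nn_integral_lebesgue_on_mono) (use 0 in auto)
  then have "(\<integral>\<^sup>+\<tau>. Ws (0 + 2) (c \<tau>) \<partial>lebesgue_on {\<epsilon>..T}) < \<infinity>" unfolding add_0 using l2 by (rule le_less_trans)
  moreover have "\<forall>t\<in>{\<epsilon>..T}. Ws (0 + 1) (c t) \<le> ennreal B"
    unfolding add_0 using bnd 0 by auto
  ultimately show ?case by blast
next
  case (Suc n)
  have h: "0 < \<epsilon> / 2" "\<epsilon> / 2 < \<epsilon>" "\<epsilon> / 2 < T" using Suc.prems by auto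
  obtain B' where B': "\<And>t. t \<in> {\<epsilon>/2..T} \<Longrightarrow> Ws (n + 1) (c t) \<le> ennreal B'"
    and fin: "(\<integral>\<^sup>+\<tau>. Ws (n + 2) (c \<tau>) \<partial>lebesgue_on {\<epsilon>/2..T}) < \<infinity>"
    using Suc.IH[OF _ h(1,3)] Suc.prems(1) by force
  have sub: "{\<epsilon>/2..T} \<subseteq> {0..T}" using h by auto
  have cm: "(\<lambda>t. c t k) \<in> borel_measurable (lebesgue_on {\<epsilon>/2..T})" for k
    by (rule borel_measurable_lebesgue_on_subset[OF ac_on_measurable(1)[OF ac] sub])
  have "AE t in lebesgue_on {\<epsilon>/2..T}. Ws (n + 2) (c t) \<noteq> \<infinity>"
    by (rule nn_integral_PInf_AE[OF wsum_measurable[OF cm]]) (use fin in auto)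
  then have "AE t in lebesgue_on {\<epsilon>/2..\<epsilon>}. Ws (n + 2) (c t) \<noteq> \<infinity>"
    by (rule AE_lebesgue_on_subset) (use Suc.prems in auto)
  from AE_interval_ex[OF this h(2)] obtain s where s: "s \<in> {\<epsilon>/2..\<epsilon>}" "Ws (n + 2) (c s) \<noteq> \<infinity>" by blast
  have s0: "0 < s" "s < T" "s \<le> \<epsilon>" using s(1) h Suc.prems by auto
  have sub': "{s..T} \<subseteq> {0..T}" "{s..T} \<subseteq> {\<epsilon>/2..T}" using s0 s(1) by auto
  \<comment> \<open>The residual is defined at every time; that it is the convolution is known at
    almost every time, which suffices for its bound.\<close>
  let ?N = "\<lambda>\<tau> k. - (\<nu> * (norm (wave_vector k))\<^sup>2) *\<^sub>R c \<tau> k + f \<tau> k - d \<tau> k"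
  have "(\<exists>B'. \<forall>t\<in>{s..T}. Ws (n + 2) (c t) \<le> ennreal B') \<and> (\<integral>\<^sup>+\<tau>. Ws (n + 3) (c \<tau>) \<partial>lebesgue_on {s..T}) < \<infinity>"
  proof (rule energy_step[where d=d and f=f and N="?N" and C=curl_const and B=B', OF \<nu>])
    show "ac_on s T (\<lambda>\<tau>. c \<tau> k) (\<lambda>\<tau>. d \<tau> k)" for k by (rule ac_on_subset[OF ac]) (use s0 in auto)
    show "s \<le> T" using s0 by simp
    show "(\<lambda>\<tau>. f \<tau> k) \<in> borel_measurable (lebesgue_on {s..T})" for k
      by (rule borel_measurable_lebesgue_on_subset[OF fm sub'(1)])
    show "?N \<tau> k = ?N \<tau> k" for \<tau> k by (rule refl)
    show "0 \<le> curl_const" by (rule curl_const)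
    have "AE \<tau> in lebesgue_on {s..T}. \<forall>k. d \<tau> k = - (\<nu> * (norm (wave_vector k))\<^sup>2) *\<^sub>R c \<tau> k + f \<tau> k - curl_conv (c \<tau>) (c \<tau>) k"
      by (rule AE_lebesgue_on_subset[OF eq sub'(1)]) auto
    then show "AE \<tau> in lebesgue_on {s..T}. \<forall>k. ennreal (norm (?N \<tau> k)) \<le> ennreal curl_const * (\<integral>\<^sup>+j. ennreal (sqrt (J j) * norm (c \<tau> j) * norm (c \<tau> (k - j))) \<partial>lattice)"
    proof eventually_elim
      case (elim \<tau>)
      then have "?N \<tau> k = curl_conv (c \<tau>) (c \<tau>) k" for k by simp
      then show ?case using curl_conv_bound by simp
    qed
    show "Ws (Suc n) (c t) \<le> ennreal B'" if "t \<in> {s..T}" for t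
      using B'[of t] that sub'(2) by auto
    show "(\<integral>\<^sup>+\<tau>. Ws 2 (c \<tau>) \<partial>lebesgue_on {s..T}) < \<infinity>"
      by (rule le_less_trans[OF nn_integral_lebesgue_on_mono[OF sub'(1)] l2]) auto
    have "(\<integral>\<^sup>+\<tau>. Ws (Suc n) (f \<tau>) \<partial>lebesgue_on {s..T}) \<le> (\<integral>\<^sup>+\<tau>. Ws m (f \<tau>) \<partial>lebesgue_on {s..T})"
      by (intro nn_integral_mono Ws_mono Suc.prems)
    also have "\<dots> \<le> (\<integral>\<^sup>+\<tau>. Ws m (f \<tau>) \<partial>lebesgue_on {0..T})"
      by (rule nn_integral_lebesgue_on_mono[OF sub'(1)]) auto
    finally show "(\<integral>\<^sup>+\<tau>. Ws (Suc n) (f \<tau>) \<partial>lebesgue_on {s..T}) < \<infinity>" using ff by (rule le_less_trans)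
    show "Ws (n + 2) (c s) < \<infinity>" using s(2) by (simp add: less_top)
  qed
  then obtain B'' where B'': "\<And>t. t \<in> {s..T} \<Longrightarrow> Ws (n + 2) (c t) \<le> ennreal B''"
    and fin'': "(\<integral>\<^sup>+\<tau>. Ws (n + 3) (c \<tau>) \<partial>lebesgue_on {s..T}) < \<infinity>" by blast
  have "(\<integral>\<^sup>+\<tau>. Ws (n + 3) (c \<tau>) \<partial>lebesgue_on {\<epsilon>..T}) \<le> (\<integral>\<^sup>+\<tau>. Ws (n + 3) (c \<tau>) \<partial>lebesgue_on {s..T})"
    by (rule nn_integral_lebesgue_on_mono) (use s0 in auto)
  then have "(\<integral>\<^sup>+\<tau>. Ws (n + 3) (c \<tau>) \<partial>lebesgue_on {\<epsilon>..T}) < \<infinity>" using fin'' by (rule le_less_trans)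
  moreover have "\<forall>t\<in>{\<epsilon>..T}. Ws (n + 2) (c t) \<le> ennreal B''" using B'' s0(3) by auto
  moreover have "Suc n + 1 = n + 2" "Suc n + 2 = n + 3" by auto
  ultimately show ?case by (simp only:) blast
qed

lemma weak_time_deriv_ac:
  assumes Y: "fourier_space Y" "fourier_space X" and ab: "a < b" and w: "weak_time_deriv Y a b u v"
    and ui: "(\<lambda>t. fourier_coeff (u t) k) absolutely_integrable_on {a..b}" and v: "L2_into X a b v"
  obtains G Z where "ac_on a b G (\<lambda>t. fourier_coeff (v t) k)" "negligible Z" "\<And>t. t \<in> {a..b} - Z \<Longrightarrow> fourier_coeff (u t) k = G t"
proof -
  have vi: "(\<lambda>t. fourier_coeff (v t) k) absolutely_integrable_on {a..b}"
    using L2_into_coeff_integrable[OF Y(2) v] by (simp only: integrable_Ioo_iff)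
  show ?thesis
    by (rule weak_derivative_imp_ac[OF ab ui vi weak_time_deriv_coeff[OF Y(1) w]]) (use that in blast)+
qed

text \<open>The weak time derivative provides an absolutely continuous representative of each
  coefficient, and continuity of \<open>u\<close> into H^1 identifies it with the coefficient
  itself. The equation is obtained at almost every time, where \<open>u t\<close> lies in H^2 and
  the product therefore becomes a convolution.\<close>

lemma strong_solution_coeff:
  assumes T: "0 < T" and sol: "strong_solution \<nu> T u0 f u"
    and Y: "fourier_space Y" and f: "L2_into Y 0 T f"
  obtains v B where
    "\<And>t. t \<in> {0..T} \<Longrightarrow> u t \<in> Elems L2_space"
    "AE t in lebesgue_on {0<..<T}. v t \<in> Elems L2_space"
    "\<And>k. ac_on 0 T (\<lambda>t. fourier_coeff (u t) k) (\<lambda>t. fourier_coeff (v t) k)"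
    "AE t in lebesgue_on {0..T}. \<forall>k. fourier_coeff (v t) k = - (\<nu> * (norm (wave_vector k))\<^sup>2) *\<^sub>R fourier_coeff (u t) k
        + fourier_coeff (f t) k - curl_conv (fourier_coeff (u t)) (fourier_coeff (u t)) k"
    "\<And>t. t \<in> {0..T} \<Longrightarrow> Ws 1 (fourier_coeff (u t)) \<le> ennreal B"
    "(\<integral>\<^sup>+t. Ws 2 (fourier_coeff (u t)) \<partial>lebesgue_on {0..T}) < \<infinity>"
proof -
  have uc: "continuous_into (H_space 1) {0..T} u" and u2: "L2_into (H_space 2) 0 T u"
    using sol by (auto simp: strong_solution_def)
  obtain v where w: "weak_time_deriv L2_space 0 T u v" and v2: "L2_into L2_space 0 T v"
    and eq: "AE t in lebesgue_on {0<..<T}. \<exists>w l. weak_curl (u t) w \<and> weak_laplacian (u t) l \<and>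
           eq_field (\<lambda>x. v t x + cross3 (w x) (u t x)) (\<lambda>x. \<nu> *\<^sub>R l x + f t x)"
    using sol by (auto simp: strong_solution_def)
  obtain B where B: "\<And>t. t \<in> {0..T} \<Longrightarrow> Ws 1 (fourier_coeff (u t)) \<le> ennreal B"
    using continuous_into_H_bounded[OF uc compact_Icc] by blast
  have uL: "u t \<in> Elems L2_space" if "t \<in> {0..T}" for t
    using uc that by (auto simp: continuous_into_def H_space_Elems)
  have cc: "continuous_on {0..T} (\<lambda>t. fourier_coeff (u t) k)" for k
    by (rule continuous_into_coeff[OF fourier_space_H uc])
  have vL: "AE t in lebesgue_on {0<..<T}. v t \<in> Elems L2_space"
    using strongly_measurable_coeff(2)[OF fourier_space_L2, of "{0<..<T}" v] v2 by (simp add: L2_into_def)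
  have fL: "AE t in lebesgue_on {0<..<T}. f t \<in> Elems L2_space"
    using strongly_measurable_coeff(2)[OF Y, of "{0<..<T}" f] f fourier_spaceD(1)[OF Y] by (auto simp: L2_into_def)
  have ac: "ac_on 0 T (\<lambda>t. fourier_coeff (u t) k) (\<lambda>t. fourier_coeff (v t) k)" for k
  proof -
    obtain G Z where "ac_on 0 T G (\<lambda>t. fourier_coeff (v t) k)" "negligible Z" "\<And>t. t \<in> {0..T} - Z \<Longrightarrow> fourier_coeff (u t) k = G t"
      by (rule weak_time_deriv_ac[OF fourier_space_L2 fourier_space_L2 T w absolutely_integrable_continuous_real[OF cc] v2]) blast
    then show ?thesis by (intro ac_on_eq_continuous[OF _ cc T])
  qed
  have u2': "(\<integral>\<^sup>+t. Ws 2 (fourier_coeff (u t)) \<partial>lebesgue_on {0<..<T}) < \<infinity>"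
    and um: "\<And>k. (\<lambda>t. fourier_coeff (u t) k) \<in> borel_measurable (lebesgue_on {0<..<T})"
    using u2 by (auto simp: L2_into_H_iff)
  have "AE t in lebesgue_on {0<..<T}. Ws 2 (fourier_coeff (u t)) \<noteq> \<infinity>"
    by (rule nn_integral_PInf_AE[OF wsum_measurable[OF um]]) (use u2' in auto)
  then have "AE t in lebesgue_on {0<..<T}. \<forall>k. fourier_coeff (v t) k = - (\<nu> * (norm (wave_vector k))\<^sup>2) *\<^sub>R fourier_coeff (u t) k
        + fourier_coeff (f t) k - curl_conv (fourier_coeff (u t)) (fourier_coeff (u t)) k"
    using eq vL fL AE_space
  proof eventually_elim
    case (elim t)
    then have uLt: "u t \<in> Elems L2_space" by (intro uL) auto
    obtain w l where "weak_curl (u t) w" "weak_laplacian (u t) l" "eq_field (\<lambda>x. v t x + cross3 (w x) (u t x)) (\<lambda>x. \<nu> *\<^sub>R l x + f t x)"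
      using elim by blast
    moreover have "integrable lattice (fourier_coeff (u t))" using elim by (intro Ws2_summable) (simp add: less_top)
    ultimately show ?case using momentum_equation_coeff[OF uLt] elim by blast
  qed
  then show ?thesis
    using that[of v B] uL vL ac B u2' by (simp only: AE_Icc_Ioo nn_integral_Icc_Ioo)
qed

section \<open>The second derivative in time\<close>

lemma Ws_laplacian: "Ws s (\<lambda>k. - (\<nu> * (norm (wave_vector k))\<^sup>2) *\<^sub>R x k) \<le> ennreal (\<nu>\<^sup>2) * Ws (s + 2) x"
proof -
  have "Ws s (\<lambda>k. - (\<nu> * (norm (wave_vector k))\<^sup>2) *\<^sub>R x k) \<le> wsum (\<lambda>k. \<nu>\<^sup>2 * J k ^ (s + 2)) x"
    unfolding wsum_def
  proof (intro nn_integral_mono ennreal_leI)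
    fix k
    have "(norm (wave_vector k))\<^sup>2 \<le> J k" by (simp add: J_def)
    then have "((norm (wave_vector k))\<^sup>2)\<^sup>2 \<le> (J k)\<^sup>2" by (intro power_mono) auto
    then have "J k ^ s * \<nu>\<^sup>2 * (norm (x k))\<^sup>2 * ((norm (wave_vector k))\<^sup>2)\<^sup>2 \<le> J k ^ s * \<nu>\<^sup>2 * (norm (x k))\<^sup>2 * (J k)\<^sup>2"
      by (intro mult_left_mono) auto
    moreover have "J k ^ s * (norm (- (\<nu> * (norm (wave_vector k))\<^sup>2) *\<^sub>R x k))\<^sup>2 = J k ^ s * \<nu>\<^sup>2 * (norm (x k))\<^sup>2 * ((norm (wave_vector k))\<^sup>2)\<^sup>2"
      by (simp add: power_mult_distrib mult_ac)
    moreover have "\<nu>\<^sup>2 * J k ^ (s + 2) * (norm (x k))\<^sup>2 = J k ^ s * \<nu>\<^sup>2 * (norm (x k))\<^sup>2 * (J k)\<^sup>2"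
      by (simp only: power_add mult_ac)
    ultimately show "J k ^ s * (norm (- (\<nu> * (norm (wave_vector k))\<^sup>2) *\<^sub>R x k))\<^sup>2 \<le> \<nu>\<^sup>2 * J k ^ (s + 2) * (norm (x k))\<^sup>2"
      by (simp only:)
  qed
  also have "\<dots> = ennreal (\<nu>\<^sup>2) * Ws (s + 2) x" by (rule wsum_cmult) simp
  finally show ?thesis .
qed

text \<open>The factor 4^s is the constant of \<open>power_weight\<close>.\<close>

lemma Ws_curl_conv:
  "Ws s (curl_conv a b) \<le> ennreal (2 * 4 ^ s * Jsum * curl_const\<^sup>2) * (Ws (s + 1) a * Ws 2 b + Ws 2 a * Ws (s + 1) b)"
  using wsum_convolution[where \<Omega>="\<lambda>k. J k ^ s" and K="4 ^ s", OF curl_conv_bound[of a b] _ _ power_weight curl_const(1)]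
  by (simp add: mult.commute[of "J _"])

lemma wsum_uminus: "wsum w (\<lambda>k. - c k) = wsum w c" by (simp add: wsum_def)

lemma wsum_add3:
  assumes "\<And>k. 0 \<le> w k"
  shows "wsum w (\<lambda>k. a k + b k - e k) \<le> 4 * wsum w a + 4 * wsum w b + 2 * wsum w e"
proof -
  have "wsum w (\<lambda>k. (a k + b k) + (- e k)) \<le> 2 * wsum w (\<lambda>k. a k + b k) + 2 * wsum w (\<lambda>k. - e k)"
    by (rule wsum_add[OF assms])
  also have "\<dots> \<le> 2 * (2 * wsum w a + 2 * wsum w b) + 2 * wsum w e"
    unfolding wsum_uminus by (intro add_right_mono mult_left_mono wsum_add assms) auto
  also have "\<dots> = 4 * wsum w a + 4 * wsum w b + 2 * wsum w e"
  proof -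
    have "2 * (2 * x) = 4 * (x::ennreal)" for x by (simp add: mult.assoc[symmetric])
    then show ?thesis by (simp add: distrib_left)
  qed
  finally show ?thesis by simp
qed

lemma finite_nn_integral_const: "(\<integral>\<^sup>+t. ennreal B \<partial>lebesgue_on {a..b::real}) < \<infinity>"
proof -
  have "emeasure (lebesgue_on {a..b}) (space (lebesgue_on {a..b})) < \<infinity>"
    by (simp add: emeasure_restrict_space emeasure_lborel_Icc_eq)
  then show ?thesis by (simp add: ennreal_mult_less_top)
qed

text \<open>The representative \<open>D\<close> is the right-hand side of the equation with \<open>f\<close> replaced by \<open>G\<close>.\<close>

lemma second_level:
  fixes c d f G f' :: "real \<Rightarrow> int^3 \<Rightarrow> complex^3"
  assumes ac: "\<And>k. ac_on s T (\<lambda>t. c t k) (\<lambda>t. d t k)"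
    and eq: "AE t in lebesgue_on {s..T}. \<forall>k. d t k = - (\<nu> * (norm (wave_vector k))\<^sup>2) *\<^sub>R c t k + f t k - curl_conv (c t) (c t) k"
    and bnd: "\<And>t. t \<in> {s..T} \<Longrightarrow> Ws 5 (c t) \<le> ennreal B"
    and c6: "(\<integral>\<^sup>+t. Ws 6 (c t) \<partial>lebesgue_on {s..T}) < \<infinity>"
    and fm: "\<And>k. (\<lambda>t. f t k) \<in> borel_measurable (lebesgue_on {s..T})"
    and f4: "(\<integral>\<^sup>+t. Ws 4 (f t) \<partial>lebesgue_on {s..T}) < \<infinity>"
    and G: "\<And>k. ac_on s T (\<lambda>t. G t k) (\<lambda>t. f' t k)"
    and fG: "AE t in lebesgue_on {s..T}. \<forall>k. f t k = G t k"
    and f'2: "(\<integral>\<^sup>+t. Ws 2 (f' t) \<partial>lebesgue_on {s..T}) < \<infinity>"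
  shows "(\<integral>\<^sup>+t. Ws 4 (d t) \<partial>lebesgue_on {s..T}) < \<infinity> \<and>
    (\<exists>D d2. (\<forall>k. ac_on s T (\<lambda>t. D t k) (\<lambda>t. d2 t k)) \<and> (AE t in lebesgue_on {s..T}. \<forall>k. d t k = D t k) \<and>
       (\<integral>\<^sup>+t. Ws 2 (d2 t) \<partial>lebesgue_on {s..T}) < \<infinity>)"
proof -
  let ?M = "lebesgue_on {s..T}"
  note cm = ac_on_measurable(1)[OF ac] and dm = ac_on_measurable(2)[OF ac] and f'm = ac_on_measurable(2)[OF G]
  define C4 where "C4 = 2 * 4 ^ 4 * Jsum * curl_const\<^sup>2"
  define C2 where "C2 = 2 * 4 ^ 2 * Jsum * curl_const\<^sup>2"
  have C: "0 \<le> C4" "0 \<le> C2" by (auto simp: C4_def C2_def)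
  define B0 where "B0 = max B 0"
  have B0: "0 \<le> B0" by (simp add: B0_def)
  have low: "Ws r (c t) \<le> ennreal B0" if "t \<in> {s..T}" "r \<le> 5" for r t
  proof -
    have "Ws r (c t) \<le> Ws 5 (c t)" by (rule Ws_mono[OF that(2)])
    also have "\<dots> \<le> ennreal B" by (rule bnd[OF that(1)])
    also have "\<dots> \<le> ennreal B0" by (rule ennreal_leI) (simp add: B0_def)
    finally show ?thesis .
  qed
  have lowfin: "Ws r (c t) < \<infinity>" if "t \<in> {s..T}" "r \<le> 5" for r t
    using low[OF that] by (auto intro: le_less_trans)
  have lowint: "(\<integral>\<^sup>+t. Ws r (c t) \<partial>?M) < \<infinity>" if "r \<le> 5" for r
  proof -
    have "(\<integral>\<^sup>+t. Ws r (c t) \<partial>?M) \<le> (\<integral>\<^sup>+t. ennreal B0 \<partial>?M)"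
      by (rule nn_integral_mono) (use low that in auto)
    then show ?thesis using finite_nn_integral_const by (rule le_less_trans)
  qed
  \<comment> \<open>The Laplacian costs two derivatives, hence L^2 H^6. The nonlinear term in H^4
    involves \<open>c\<close> in H^5 and H^2 only, where it is bounded in time.\<close>
  have d4: "(\<integral>\<^sup>+t. Ws 4 (d t) \<partial>?M) < \<infinity>"
  proof -
    let ?b = "\<lambda>t. 4 * (ennreal (\<nu>\<^sup>2) * Ws 6 (c t)) + 4 * Ws 4 (f t) + ennreal (2 * (C4 * (2 * (B0 * B0))))"
    have "(\<integral>\<^sup>+t. Ws 4 (d t) \<partial>?M) \<le> (\<integral>\<^sup>+t. ?b t \<partial>?M)"
    proof (rule nn_integral_mono_AE)
      show "AE t in ?M. Ws 4 (d t) \<le> ?b t"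
        using eq AE_space
      proof eventually_elim
        case (elim t)
        then have t: "t \<in> {s..T}" by simp
        have "Ws 4 (d t) = Ws 4 (\<lambda>k. - (\<nu> * (norm (wave_vector k))\<^sup>2) *\<^sub>R c t k + f t k - curl_conv (c t) (c t) k)"
          using elim(1) by (simp only: wsum_def)
        also have "\<dots> \<le> 4 * Ws 4 (\<lambda>k. - (\<nu> * (norm (wave_vector k))\<^sup>2) *\<^sub>R c t k) + 4 * Ws 4 (f t) + 2 * Ws 4 (curl_conv (c t) (c t))"
          by (rule wsum_add3) simp
        also have "\<dots> \<le> 4 * (ennreal (\<nu>\<^sup>2) * Ws 6 (c t)) + 4 * Ws 4 (f t) + 2 * ennreal (C4 * (2 * (B0 * B0)))"
        proof (intro add_mono mult_left_mono order_refl zero_le)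
          show "Ws 4 (\<lambda>k. - (\<nu> * (norm (wave_vector k))\<^sup>2) *\<^sub>R c t k) \<le> ennreal (\<nu>\<^sup>2) * Ws 6 (c t)"
            using Ws_laplacian[of 4 \<nu> "c t"] by simp
          have "Ws 4 (curl_conv (c t) (c t)) \<le> ennreal C4 * (Ws (4 + 1) (c t) * Ws 2 (c t) + Ws 2 (c t) * Ws (4 + 1) (c t))"
            unfolding C4_def by (rule Ws_curl_conv)
          also have "\<dots> \<le> ennreal C4 * (ennreal B0 * ennreal B0 + ennreal B0 * ennreal B0)"
            by (intro mult_left_mono add_mono mult_mono low t) auto
          also have "\<dots> = ennreal C4 * ennreal (2 * (B0 * B0))"
            by (simp only: ennreal_mult[OF B0 B0, symmetric] ennreal_plus[symmetric, OF mult_nonneg_nonneg[OF B0 B0] mult_nonneg_nonneg[OF B0 B0]] mult_2)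
          also have "\<dots> = ennreal (C4 * (2 * (B0 * B0)))" using B0 C by (intro ennreal_mult[symmetric]) auto
          finally show "Ws 4 (curl_conv (c t) (c t)) \<le> ennreal (C4 * (2 * (B0 * B0)))" .
        qed
        also have "2 * ennreal (C4 * (2 * (B0 * B0))) = ennreal (2 * (C4 * (2 * (B0 * B0))))"
          using C B0 by (subst ennreal_mult) auto
        finally show ?case .
      qed
    qed
    also have "\<dots> = 4 * (ennreal (\<nu>\<^sup>2) * (\<integral>\<^sup>+t. Ws 6 (c t) \<partial>?M)) + 4 * (\<integral>\<^sup>+t. Ws 4 (f t) \<partial>?M) + (\<integral>\<^sup>+t. ennreal (2 * (C4 * (2 * (B0 * B0)))) \<partial>?M)"
      using wsum_measurable[OF cm, of "\<lambda>k. J k ^ 6"] wsum_measurable[OF fm, of "\<lambda>k. J k ^ 4"]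
      by (simp add: nn_integral_add nn_integral_cmult del: nn_integral_const)
    also have "\<dots> < \<infinity>" using c6 f4 finite_nn_integral_const[of s T "2 * (C4 * (2 * (B0 * B0)))"]
      by (simp add: ennreal_mult_less_top del: nn_integral_const)
    finally show ?thesis .
  qed
  have dlow: "(\<integral>\<^sup>+t. Ws r (d t) \<partial>?M) < \<infinity>" if "r \<le> 4" for r
    by (rule le_less_trans[OF nn_integral_mono d4]) (rule Ws_mono[OF that])
  define D where "D t k = - (\<nu> * (norm (wave_vector k))\<^sup>2) *\<^sub>R c t k + G t k + (- 1) *\<^sub>R curl_conv (c t) (c t) k" for t k
  define d2 where "d2 t k = - (\<nu> * (norm (wave_vector k))\<^sup>2) *\<^sub>R d t k + f' t k
     + (- 1) *\<^sub>R (curl_conv (d t) (c t) k + curl_conv (c t) (d t) k)" for t k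
  have Dac: "ac_on s T (\<lambda>t. D t k) (\<lambda>t. d2 t k)" for k
    unfolding D_def d2_def
  proof (intro ac_on_add ac_on_linear[OF bounded_linear_scaleR_right] ac G)
    show "ac_on s T (\<lambda>t. curl_conv (c t) (c t) k) (\<lambda>t. curl_conv (d t) (c t) k + curl_conv (c t) (d t) k)"
      by (rule ac_on_curl_conv[OF ac ac lowfin lowfin lowint lowint dlow dlow]) simp_all
  qed
  have dD: "AE t in ?M. \<forall>k. d t k = D t k"
    using eq fG by eventually_elim (simp add: D_def)
  \<comment> \<open>Both nonlinear contributions are linear in \<open>d t\<close>, with factors
    bounded in time through \<open>c\<close>. The norms of \<open>d t\<close> in H^2 and H^3 are
    raised to H^4, so that the integral already estimated serves for all terms.\<close>
  have d22: "(\<integral>\<^sup>+t. Ws 2 (d2 t) \<partial>?M) < \<infinity>"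
  proof -
    let ?c = "ennreal (8 * (C2 * (2 * B0)))"
    have eight: "2 * (4 * (ennreal X * w)) = ennreal (8 * X) * w" if "0 \<le> X" for X w
      using that by (simp add: ennreal_mult mult.assoc[symmetric])
    let ?b = "\<lambda>t. 4 * (ennreal (\<nu>\<^sup>2) * Ws 4 (d t)) + 4 * Ws 2 (f' t) + ?c * Ws 4 (d t)"
    have "(\<integral>\<^sup>+t. Ws 2 (d2 t) \<partial>?M) \<le> (\<integral>\<^sup>+t. ?b t \<partial>?M)"
    proof (rule nn_integral_mono)
      fix t assume "t \<in> space ?M"
      then have t: "t \<in> {s..T}" by simp
      have cc: "Ws 2 (curl_conv (d t) (c t)) \<le> ennreal (C2 * (2 * B0)) * Ws 4 (d t)"
        "Ws 2 (curl_conv (c t) (d t)) \<le> ennreal (C2 * (2 * B0)) * Ws 4 (d t)"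
      proof -
        have e: "ennreal C2 * (Ws 4 (d t) * ennreal B0 + Ws 4 (d t) * ennreal B0) = ennreal (C2 * (2 * B0)) * Ws 4 (d t)"
          using C B0 by (simp add: ennreal_mult mult_2[symmetric] mult_ac)
        have "Ws 2 (curl_conv (d t) (c t)) \<le> ennreal C2 * (Ws (2 + 1) (d t) * Ws 2 (c t) + Ws 2 (d t) * Ws (2 + 1) (c t))"
          unfolding C2_def by (rule Ws_curl_conv)
        also have "\<dots> \<le> ennreal C2 * (Ws 4 (d t) * ennreal B0 + Ws 4 (d t) * ennreal B0)"
          by (intro mult_left_mono add_mono mult_mono low t Ws_mono) auto
        finally show "Ws 2 (curl_conv (d t) (c t)) \<le> ennreal (C2 * (2 * B0)) * Ws 4 (d t)" by (simp only: e)
        have "Ws 2 (curl_conv (c t) (d t)) \<le> ennreal C2 * (Ws (2 + 1) (c t) * Ws 2 (d t) + Ws 2 (c t) * Ws (2 + 1) (d t))"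
          unfolding C2_def by (rule Ws_curl_conv)
        also have "\<dots> \<le> ennreal C2 * (ennreal B0 * Ws 4 (d t) + ennreal B0 * Ws 4 (d t))"
          by (intro mult_left_mono add_mono mult_mono low t Ws_mono) auto
        finally show "Ws 2 (curl_conv (c t) (d t)) \<le> ennreal (C2 * (2 * B0)) * Ws 4 (d t)" by (simp only: mult.commute[of "ennreal B0"] e)
      qed
      have "Ws 2 (\<lambda>k. curl_conv (d t) (c t) k + curl_conv (c t) (d t) k) \<le> 2 * Ws 2 (curl_conv (d t) (c t)) + 2 * Ws 2 (curl_conv (c t) (d t))"
        by (rule wsum_add) simp
      also have "\<dots> \<le> 2 * (ennreal (C2 * (2 * B0)) * Ws 4 (d t)) + 2 * (ennreal (C2 * (2 * B0)) * Ws 4 (d t))"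
        by (intro add_mono mult_left_mono cc) auto
      finally have e: "Ws 2 (\<lambda>k. curl_conv (d t) (c t) k + curl_conv (c t) (d t) k) \<le> 4 * (ennreal (C2 * (2 * B0)) * Ws 4 (d t))"
        by (simp add: distrib_right[symmetric])
      have "Ws 2 (d2 t) = Ws 2 (\<lambda>k. - (\<nu> * (norm (wave_vector k))\<^sup>2) *\<^sub>R d t k + f' t k - (curl_conv (d t) (c t) k + curl_conv (c t) (d t) k))"
        by (rule arg_cong[where f="Ws 2"], rule ext) (simp add: d2_def algebra_simps)
      also have "\<dots> \<le> 4 * Ws 2 (\<lambda>k. - (\<nu> * (norm (wave_vector k))\<^sup>2) *\<^sub>R d t k) + 4 * Ws 2 (f' t) + 2 * Ws 2 (\<lambda>k. curl_conv (d t) (c t) k + curl_conv (c t) (d t) k)"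
        by (rule wsum_add3) simp
      also have "\<dots> \<le> 4 * (ennreal (\<nu>\<^sup>2) * Ws 4 (d t)) + 4 * Ws 2 (f' t) + 2 * (4 * (ennreal (C2 * (2 * B0)) * Ws 4 (d t)))"
        using Ws_laplacian[of 2 \<nu> "d t"] by (intro add_mono mult_left_mono order_refl zero_le e) simp
      also have "2 * (4 * (ennreal (C2 * (2 * B0)) * Ws 4 (d t))) = ?c * Ws 4 (d t)" using C B0 by (intro eight) simp
      finally show "Ws 2 (d2 t) \<le> ?b t" .
    qed
    also have "\<dots> = 4 * (ennreal (\<nu>\<^sup>2) * (\<integral>\<^sup>+t. Ws 4 (d t) \<partial>?M)) + 4 * (\<integral>\<^sup>+t. Ws 2 (f' t) \<partial>?M) + ?c * (\<integral>\<^sup>+t. Ws 4 (d t) \<partial>?M)"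
      using wsum_measurable[OF dm, of "\<lambda>k. J k ^ 4"] wsum_measurable[OF f'm, of "\<lambda>k. J k ^ 2"]
      by (simp add: nn_integral_add nn_integral_cmult)
    also have "\<dots> < \<infinity>" using d4 f'2 by (simp add: ennreal_mult_less_top)
    finally show ?thesis .
  qed
  show ?thesis using d4 Dac dD d22 by blast
qed

section \<open>Weak time derivatives with values in H^s\<close>

lemma bounded_linear_vcnj: "bounded_linear vcnj"
  by (rule bounded_linear_intro[where K=1]) (auto simp: vcnj_add vcnj_scaleR)

lemma symm_integral:
  assumes i: "\<And>k. integrable M (\<lambda>t. a t k)" and h: "\<And>t k. vcnj (a t (- k)) = a t k"
  shows "symm (\<lambda>k. \<integral>t. a t k \<partial>M) = (\<lambda>k. \<integral>t. a t k \<partial>M)"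
proof (rule ext)
  fix k
  have "vcnj (\<integral>t. a t (- k) \<partial>M) = (\<integral>t. a t k \<partial>M)"
    using integral_bounded_linear[OF bounded_linear_vcnj i[of "- k"]] by (simp add: h)
  then show "symm (\<lambda>k. \<integral>t. a t k \<partial>M) k = (\<integral>t. a t k \<partial>M)"
    by (simp add: symm_def scaleR_2[symmetric])
qed

lemma Ws_scaled_integral_finite:
  assumes m: "\<And>k. (\<lambda>t. a t k) \<in> borel_measurable (lebesgue_on {p<..<q})"
    and fin: "(\<integral>\<^sup>+t. Ws s (a t) \<partial>lebesgue_on {p<..<q}) < \<infinity>"
    and \<phi>: "\<And>t. t \<in> {p<..<q} \<Longrightarrow> \<bar>\<phi> t\<bar> \<le> B"
  shows "(\<integral>\<^sup>+t. Ws s (\<lambda>k. \<phi> t *\<^sub>R a t k) \<partial>lebesgue_on {p<..<q}) < \<infinity>"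
proof -
  let ?M = "lebesgue_on {p<..<q}"
  have "(\<integral>\<^sup>+t. Ws s (\<lambda>k. \<phi> t *\<^sub>R a t k) \<partial>?M) \<le> (\<integral>\<^sup>+t. ennreal (B\<^sup>2) * Ws s (a t) \<partial>?M)"
  proof (rule nn_integral_mono)
    fix t assume "t \<in> space ?M"
    then have "\<bar>\<phi> t\<bar> \<le> B" using \<phi> by simp
    then have "(\<phi> t)\<^sup>2 \<le> B\<^sup>2" using power_mono[of "\<bar>\<phi> t\<bar>" B 2] by simp
    then have "ennreal ((\<phi> t)\<^sup>2) * Ws s (a t) \<le> ennreal (B\<^sup>2) * Ws s (a t)"
      by (intro mult_right_mono ennreal_leI) auto
    then show "Ws s (\<lambda>k. \<phi> t *\<^sub>R a t k) \<le> ennreal (B\<^sup>2) * Ws s (a t)"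
      by (subst wsum_scaleR) auto
  qed
  also have "\<dots> = ennreal (B\<^sup>2) * (\<integral>\<^sup>+t. Ws s (a t) \<partial>?M)"
    by (rule nn_integral_cmult) (rule wsum_measurable[OF m])
  also have "\<dots> < \<infinity>" using fin by (simp add: ennreal_mult_less_top)
  finally show ?thesis .
qed

lemma test_function_bounded:
  assumes "continuous_on {a..b} (\<phi> :: real \<Rightarrow> real)"
  shows "\<exists>B. \<forall>t\<in>{a<..<b}. \<bar>\<phi> t\<bar> \<le> B"
proof -
  have "bounded (\<phi> ` {a..b})" using assms by (intro compact_imp_bounded compact_continuous_image) auto
  then obtain B where "\<forall>x\<in>\<phi> ` {a..b}. norm x \<le> B" by (auto simp: bounded_iff)
  then show ?thesis by (intro exI[of _ B]) auto
qed

text \<open>The definition asks for an actual field as value of the Bochner integral. It is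
  synthesised from the integrated coefficients: they are summable because s is at least 2, and
  Hermitian because the symmetry passes through the integral, so \<open>synth\<close> reproduces
  them.\<close>

lemma weak_time_deriv_H:
  fixes u v :: "real \<Rightarrow> field"
  assumes s: "2 \<le> s" and ab: "a < b"
    and G: "\<And>k. ac_on a b (\<lambda>t. G t k) (\<lambda>t. fourier_coeff (v t) k)"
    and uG: "AE t in lebesgue_on {a<..<b}. \<forall>k. fourier_coeff (u t) k = G t k"
    and uL: "AE t in lebesgue_on {a<..<b}. u t \<in> Elems L2_space" and vL: "AE t in lebesgue_on {a<..<b}. v t \<in> Elems L2_space"
    and us: "(\<integral>\<^sup>+t. Ws s (fourier_coeff (u t)) \<partial>lebesgue_on {a<..<b}) < \<infinity>"
    and vs: "(\<integral>\<^sup>+t. Ws s (fourier_coeff (v t)) \<partial>lebesgue_on {a<..<b}) < \<infinity>"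
  shows "weak_time_deriv (H_space s) a b u v"
  unfolding weak_time_deriv_def
proof (intro allI impI)
  fix \<phi> assume \<phi>: "time_test_function a b \<phi>"
  let ?M = "lebesgue_on {a<..<b}"
  have S: "{a<..<b} \<in> lmeasurable" by simp
  have Gm: "(\<lambda>t. G t k) \<in> borel_measurable ?M" for k
    by (rule borel_measurable_lebesgue_on_subset[OF ac_on_measurable(1)[OF G]]) auto
  have vm: "(\<lambda>t. fourier_coeff (v t) k) \<in> borel_measurable ?M" for k
    by (rule borel_measurable_lebesgue_on_subset[OF ac_on_measurable(2)[OF G]]) auto
  have um: "(\<lambda>t. fourier_coeff (u t) k) \<in> borel_measurable ?M" for k
    by (rule borel_measurable_AE_lebesgue_on[OF _ Gm]) (use uG in \<open>auto elim: AE_mp\<close>)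
  have cm: "q \<in> borel_measurable ?M" if "continuous_on UNIV q" for q :: "real \<Rightarrow> real"
    by (rule continuous_imp_measurable_on_sets_lebesgue[OF continuous_on_subset[OF that]]) auto
  note \<phi>m = cm[OF test_function_continuous[OF \<phi>]] and \<phi>'m = cm[OF test_function_deriv(2)[OF \<phi>]]
  obtain B1 where B1: "\<And>t. t \<in> {a<..<b} \<Longrightarrow> \<bar>\<phi> t\<bar> \<le> B1"
    using test_function_bounded[OF test_function_continuous[OF \<phi>]] by blast
  obtain B2 where B2: "\<And>t. t \<in> {a<..<b} \<Longrightarrow> \<bar>deriv \<phi> t\<bar> \<le> B2"
    using test_function_bounded[OF test_function_deriv(2)[OF \<phi>]] by blast
  let ?U = "\<lambda>t k. deriv \<phi> t *\<^sub>R fourier_coeff (u t) k" and ?V = "\<lambda>t k. \<phi> t *\<^sub>R fourier_coeff (v t) k"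
  have Um: "(\<lambda>t. ?U t k) \<in> borel_measurable ?M" and Vm: "(\<lambda>t. ?V t k) \<in> borel_measurable ?M" for k
    using um \<phi>'m vm \<phi>m by (auto intro: borel_measurable_scaleR)
  have Ufin: "(\<integral>\<^sup>+t. Ws s (?U t) \<partial>?M) < \<infinity>" by (rule Ws_scaled_integral_finite[OF um us B2])
  have Vfin: "(\<integral>\<^sup>+t. Ws s (?V t) \<partial>?M) < \<infinity>" by (rule Ws_scaled_integral_finite[OF vm vs B1])
  have Gi: "(\<lambda>t. G t k) absolutely_integrable_on {a..b}" for k
    by (intro absolutely_integrable_continuous_real ac_on_continuous[OF G])
  have U'i: "integrable ?M (\<lambda>t. deriv \<phi> t *\<^sub>R G t k)" for k
    unfolding integrable_Ioo_iff by (rule scaled_integrable[OF test_function_deriv(2)[OF \<phi>] Gi])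
  have UG: "AE t in ?M. deriv \<phi> t *\<^sub>R G t k = ?U t k" for k using uG by eventually_elim simp
  have Ui: "integrable ?M (\<lambda>t. ?U t k)" for k by (rule integrable_cong_AE_imp[OF U'i Um UG])
  have vi: "(\<lambda>t. fourier_coeff (v t) k) absolutely_integrable_on {a..b}" for k using G by (simp add: ac_on_def)
  have Vi: "integrable ?M (\<lambda>t. ?V t k)" for k
    unfolding integrable_Ioo_iff by (rule scaled_integrable[OF test_function_continuous[OF \<phi>] vi])
  have UV: "(\<integral>t. ?U t k \<partial>?M) = - (\<integral>t. ?V t k \<partial>?M)" for k
  proof -
    have "(\<integral>t. ?U t k \<partial>?M) = (\<integral>t. deriv \<phi> t *\<^sub>R G t k \<partial>?M)"
      by (rule integral_cong_AE[OF Um borel_measurable_integrable[OF U'i]]) (use UG[of k] in eventually_elim, auto)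
    also have "\<dots> = integral {a..b} (\<lambda>t. deriv \<phi> t *\<^sub>R G t k)" by (rule integral_Ioo_eq[OF U'i])
    also have "\<dots> = - integral {a..b} (\<lambda>t. ?V t k)" by (rule ac_imp_weak_derivative[OF G less_imp_le[OF ab] \<phi>])
    also have "integral {a..b} (\<lambda>t. ?V t k) = (\<integral>t. ?V t k \<partial>?M)" by (rule integral_Ioo_eq[OF Vi, symmetric])
    finally show ?thesis .
  qed
  define i where "i k = (\<integral>t. ?U t k \<partial>?M)" for k
  have eM: "emeasure ?M (space ?M) < \<infinity>"
    using emeasure_bounded_finite[of "{a<..<b}"] by (simp add: emeasure_restrict_space)
  have "Ws s i \<le> emeasure ?M (space ?M) * (\<integral>\<^sup>+t. Ws s (?U t) \<partial>?M)"
    unfolding i_def by (rule wsum_integral_le[OF Um]) simp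
  also have "\<dots> < \<infinity>" using eM Ufin by (simp add: ennreal_mult_less_top)
  finally have "Ws s i < \<infinity>" .
  then have "Ws 2 i < \<infinity>" by (rule le_less_trans[OF Ws_mono[OF s]])
  then have ii: "integrable lattice i" by (rule Ws2_summable)
  have "symm i = i" unfolding i_def
    by (rule symm_integral[OF Ui]) (simp add: vcnj_scaleR fourier_coeff_hermitian)
  then have ic: "fourier_coeff (synth i) k = i k" for k by (simp add: fourier_coeff_synth[OF ii])
  show "\<exists>I. has_field_integral (H_space s) {a<..<b} (\<lambda>t x. deriv \<phi> t *\<^sub>R u t x) I \<and>
          has_field_integral (H_space s) {a<..<b} (\<lambda>t x. \<phi> t *\<^sub>R v t x) (\<lambda>x. - I x)"
  proof (intro exI[of _ "synth i"] conjI)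
    show "has_field_integral (H_space s) {a<..<b} (\<lambda>t x. deriv \<phi> t *\<^sub>R u t x) (synth i)"
    proof (rule has_field_integral_H[OF S])
      show "AE t in ?M. (\<lambda>x. deriv \<phi> t *\<^sub>R u t x) \<in> Elems L2_space" using uL by eventually_elim (rule L2_scaleR)
    qed (use Um Ufin synth_L2[OF ii] in \<open>simp_all add: fourier_coeff_scaleR ic i_def wsum_def\<close>)
    show "has_field_integral (H_space s) {a<..<b} (\<lambda>t x. \<phi> t *\<^sub>R v t x) (\<lambda>x. - synth i x)"
    proof (rule has_field_integral_H[OF S])
      show "AE t in ?M. (\<lambda>x. \<phi> t *\<^sub>R v t x) \<in> Elems L2_space" using vL by eventually_elim (rule L2_scaleR)
      show "(\<lambda>x. - synth i x) \<in> Elems L2_space" using L2_scaleR[OF synth_L2[OF ii], of "-1"] by simp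
    qed (use Vm Vfin UV in \<open>simp_all add: fourier_coeff_scaleR fourier_coeff_uminus ic i_def wsum_def\<close>)
  qed
qed

section \<open>Classical regularity\<close>

lemma norm_cis_minus_one_le: "norm (cis y - 1) \<le> \<bar>y\<bar>"
proof -
  have e: "(1 - 2 * p\<^sup>2 - 1)\<^sup>2 + (2 * p * q)\<^sup>2 = 4 * p\<^sup>2 * (p\<^sup>2 + q\<^sup>2)" for p q :: real
    by (simp add: power2_eq_square algebra_simps)
  have "(norm (cis y - 1))\<^sup>2 = (cos (2 * (y / 2)) - 1)\<^sup>2 + (sin (2 * (y / 2)))\<^sup>2"
    by (simp add: cmod_power2)
  also have "\<dots> = 4 * (sin (y / 2))\<^sup>2 * ((sin (y / 2))\<^sup>2 + (cos (y / 2))\<^sup>2)"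
    unfolding cos_double_sin sin_double by (rule e)
  also have "\<dots> = (2 * \<bar>sin (y / 2)\<bar>)\<^sup>2" by (simp add: power_mult_distrib)
  also have "\<dots> \<le> (\<bar>y\<bar>)\<^sup>2"
    using abs_sin_x_le_abs_x[of "y / 2"] by (intro power_mono) auto
  finally show ?thesis by (rule power2_le_imp_le) simp
qed

lemma char_has_derivative: "(char k has_derivative (\<lambda>h. \<i> * of_real (wave_vector k \<bullet> h))) (at 0)"
  unfolding char_def by (auto intro!: derivative_eq_intros simp: scaleR_conv_of_real)

text \<open>For each mode the remainder divided by |h| tends to 0 and stays below 2 sqrt(J), so
  dominated convergence along sequences sums the remainders.\<close>

lemma series_has_derivative:
  fixes a :: "int^3 \<Rightarrow> complex"
  assumes a: "integrable lattice (\<lambda>k. sqrt (J k) *\<^sub>R a k)"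
  shows "((\<lambda>x. \<integral>k. a k * char k x \<partial>lattice) has_derivative
     (\<lambda>h. \<integral>k. a k * (\<i> * of_real (wave_vector k \<bullet> h)) * char k x \<partial>lattice)) (at x)"
proof -
  let ?D = "\<lambda>h k. a k * (\<i> * of_real (wave_vector k \<bullet> h)) * char k x"
  define A where "A k = norm (sqrt (J k) *\<^sub>R a k)" for k
  have A: "A k = sqrt (J k) * norm (a k)" for k by (simp add: A_def)
  have Ai: "integrable lattice A" unfolding A_def by (rule integrable_norm[OF a])
  have wa: "\<bar>wave_vector k \<bullet> h\<bar> \<le> sqrt (J k) * norm h" for k h
    using Cauchy_Schwarz_ineq2[of "wave_vector k" h] norm_wave_le[of k] mult_right_mono[of _ _ "norm h"]
    by (meson norm_ge_zero order_trans)
  have Db: "norm (?D h k) \<le> A k * norm h" for h k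
    using mult_left_mono[OF wa[of k h], of "norm (a k)"] by (simp add: norm_mult A mult_ac)
  have Di: "integrable lattice (?D h)" for h
    by (rule Bochner_Integration.integrable_bound[OF integrable_mult_left[OF Ai, of "norm h"]])
       (use Db in \<open>auto simp: A_def\<close>)
  have ai: "integrable lattice a"
  proof (rule Bochner_Integration.integrable_bound[OF Ai])
    have "norm (a k) \<le> A k" for k
      using mult_right_mono[of 1 "sqrt (J k)" "norm (a k)"] J_ge_1[of k] by (simp add: A)
    then show "AE k in lattice. norm (a k) \<le> norm (A k)" by (auto simp: A_def)
  qed simp
  have si: "integrable lattice (\<lambda>k. a k * char k y)" for y by (rule integrable_series[OF ai])
  show ?thesis
    unfolding has_derivative_iff_norm
  proof (intro conjI)
    show "bounded_linear (\<lambda>h. \<integral>k. ?D h k \<partial>lattice)"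
    proof (rule bounded_linear_intro[where K="\<integral>k. A k \<partial>lattice"])
      fix h g r
      have "(\<lambda>k. ?D (h + g) k) = (\<lambda>k. ?D h k + ?D g k)" by (simp add: inner_add_right algebra_simps)
      then show "(\<integral>k. ?D (h + g) k \<partial>lattice) = (\<integral>k. ?D h k \<partial>lattice) + (\<integral>k. ?D g k \<partial>lattice)"
        by (simp only: Bochner_Integration.integral_add[OF Di Di])
      have "(\<lambda>k. ?D (r *\<^sub>R h) k) = (\<lambda>k. r *\<^sub>R ?D h k)" by (simp add: scaleR_conv_of_real[where 'a=complex] mult_ac)
      then show "(\<integral>k. ?D (r *\<^sub>R h) k \<partial>lattice) = r *\<^sub>R (\<integral>k. ?D h k \<partial>lattice)"
        by (simp only: integral_scaleR_right)
      have "norm (\<integral>k. ?D h k \<partial>lattice) \<le> (\<integral>k. norm (?D h k) \<partial>lattice)" by (rule integral_norm_bound)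
      also have "\<dots> \<le> (\<integral>k. A k * norm h \<partial>lattice)"
        by (rule Bochner_Integration.integral_mono[OF integrable_norm[OF Di] integrable_mult_left[OF Ai] Db])
      also have "\<dots> = norm h * (\<integral>k. A k \<partial>lattice)" by simp
      finally show "norm (\<integral>k. ?D h k \<partial>lattice) \<le> norm h * (\<integral>k. A k \<partial>lattice)" .
    qed
    let ?f = "\<lambda>x. \<integral>k. a k * char k x \<partial>lattice"
    let ?r = "\<lambda>k h. norm (char k h - 1 - \<i> * of_real (wave_vector k \<bullet> h)) / norm h"
    have r0: "0 \<le> ?r k h" for k h by simp
    \<comment> \<open>The increment of the character and its linear part are each at most |k . h|,
      whence the factor 2.\<close>
    have r: "?r k h \<le> 2 * sqrt (J k)" if "h \<noteq> 0" for k h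
    proof -
      have "norm (char k h - 1 - \<i> * of_real (wave_vector k \<bullet> h)) \<le> norm (char k h - 1) + norm (\<i> * of_real (wave_vector k \<bullet> h))"
        by (rule norm_triangle_ineq4)
      also have "\<dots> \<le> 2 * \<bar>wave_vector k \<bullet> h\<bar>"
        using norm_cis_minus_one_le[of "wave_vector k \<bullet> h"] by (simp add: char_def norm_mult)
      also have "\<dots> \<le> 2 * (sqrt (J k) * norm h)" using wa by simp
      finally show ?thesis using that by (simp add: field_simps)
    qed
    have rlim: "((?r k) \<longlongrightarrow> 0) (at 0)" for k
      using char_has_derivative[of k] by (simp add: has_derivative_iff_norm char_def[of k 0])
    show "((\<lambda>y. norm (?f y - ?f x - (\<integral>k. ?D (y - x) k \<partial>lattice)) / norm (y - x)) \<longlongrightarrow> 0) (at x)"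
      unfolding tendsto_at_iff_sequentially comp_def
    proof (intro allI impI)
      fix Y assume Y: "\<forall>n. Y n \<in> UNIV - {x}" and Yx: "Y \<longlonglongrightarrow> x"
      define h where "h n = Y n - x" for n
      have h: "h n \<noteq> 0" for n using Y by (auto simp: h_def)
      have hl: "h \<longlonglongrightarrow> 0" unfolding h_def using Yx by (simp add: LIM_zero)
      have hat: "filterlim h (at 0) sequentially"
        by (rule filterlim_atI[OF hl]) (simp add: h)
      have lim: "(\<lambda>n. \<integral>k. norm (a k) * ?r k (h n) \<partial>lattice) \<longlonglongrightarrow> (\<integral>k. 0 \<partial>lattice)"
      proof (rule integral_dominated_convergence[where w="\<lambda>k. 2 * A k"])
        show "AE k in lattice. (\<lambda>n. norm (a k) * ?r k (h n)) \<longlonglongrightarrow> 0"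
          by (intro AE_I2 tendsto_mult_right_zero filterlim_compose[OF rlim hat])
        show "AE k in lattice. norm (norm (a k) * ?r k (h n)) \<le> 2 * A k" for n
        proof (rule AE_I2)
          fix k
          show "norm (norm (a k) * ?r k (h n)) \<le> 2 * A k"
            using mult_left_mono[OF r[OF h[of n], of k] norm_ge_zero[of "a k"]] by (simp add: A mult_ac)
        qed
        show "integrable lattice (\<lambda>k. 2 * A k)" using Ai by simp
      qed simp_all
      have le: "norm (?f (Y n) - ?f x - (\<integral>k. ?D (h n) k \<partial>lattice)) / norm (h n) \<le> (\<integral>k. norm (a k) * ?r k (h n) \<partial>lattice)" for n
      proof -
        let ?g = "\<lambda>k. a k * char k (Y n) - a k * char k x - ?D (h n) k"
        have gi: "integrable lattice ?g" using si Di by (intro Bochner_Integration.integrable_diff)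
        have "?f (Y n) - ?f x - (\<integral>k. ?D (h n) k \<partial>lattice) = (\<integral>k. ?g k \<partial>lattice)"
          using si Di by simp
        then have 1: "norm (?f (Y n) - ?f x - (\<integral>k. ?D (h n) k \<partial>lattice)) \<le> (\<integral>k. norm (?g k) \<partial>lattice)"
          by (simp only: integral_norm_bound)
        have "norm (?g k) / norm (h n) = norm (a k) * ?r k (h n)" for k
        proof -
          have "char k (Y n) = char k x * char k (h n)"
            by (simp add: char_def h_def cis_mult inner_diff_right)
          then have "?g k = a k * char k x * (char k (h n) - 1 - \<i> * of_real (wave_vector k \<bullet> h n))"
            by (simp add: algebra_simps)
          then show ?thesis by (simp add: norm_mult)
        qed
        then have 2: "(\<integral>k. norm (?g k) \<partial>lattice) / norm (h n) = (\<integral>k. norm (a k) * ?r k (h n) \<partial>lattice)"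
          by (simp only: integral_divide_zero[symmetric])
        show ?thesis using divide_right_mono[OF 1 norm_ge_zero[of "h n"]] unfolding 2 .
      qed
      show "(\<lambda>n. norm (?f (Y n) - ?f x - (\<integral>k. ?D (Y n - x) k \<partial>lattice)) / norm (Y n - x)) \<longlonglongrightarrow> 0"
        by (rule tendsto_sandwich[OF _ _ tendsto_const lim[simplified]])
           (use le in \<open>auto simp: h_def\<close>)
    qed
  qed
qed

definition pmul :: "3 \<Rightarrow> (int^3 \<Rightarrow> complex^3) \<Rightarrow> int^3 \<Rightarrow> complex^3" where
  "pmul i c k = (\<chi> j. \<i> * of_int (k $ i) * c k $ j)"

lemma norm_pmul_le: "norm (pmul i c k) \<le> sqrt (J k) * norm (c k)"
proof -
  have "norm (pmul i c k) = norm (real_of_int (k $ i) *\<^sub>R c k)"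
    unfolding norm_vec_def by (simp add: pmul_def norm_mult)
  also have "\<dots> = \<bar>wave_vector k $ i\<bar> * norm (c k)" by (simp add: wave_vector_def)
  also have "\<dots> \<le> sqrt (J k) * norm (c k)"
    using component_le_norm_cart[of "wave_vector k" i] norm_wave_le[of k] by (intro mult_right_mono) auto
  finally show ?thesis .
qed

lemma sqrt_J_ge_1: "1 \<le> sqrt (J k)" using J_ge_1[of k] by simp

lemma integrable_weight_mono:
  fixes c :: "int^3 \<Rightarrow> complex^3"
  assumes i: "integrable lattice (\<lambda>k. sqrt (J k) ^ n *\<^sub>R c k)"
    and le: "\<And>k. norm (g k) \<le> sqrt (J k) ^ n * norm (c k)"
  shows "integrable lattice (g :: int^3 \<Rightarrow> complex^3)"
    and "(\<integral>k. norm (g k) \<partial>lattice) \<le> (\<integral>k. sqrt (J k) ^ n * norm (c k) \<partial>lattice)"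
proof -
  have i': "integrable lattice (\<lambda>k. sqrt (J k) ^ n * norm (c k))"
    using integrable_norm[OF i] by (simp add: abs_mult)
  show g: "integrable lattice g"
    by (rule Bochner_Integration.integrable_bound[OF i]) (use le in \<open>auto simp: abs_mult\<close>)
  show "(\<integral>k. norm (g k) \<partial>lattice) \<le> (\<integral>k. sqrt (J k) ^ n * norm (c k) \<partial>lattice)"
    by (rule Bochner_Integration.integral_mono[OF integrable_norm[OF g] i' le])
qed

lemma weighted_pmul_le: "norm (sqrt (J k) ^ n *\<^sub>R pmul i c k) \<le> sqrt (J k) ^ Suc n * norm (c k)"
  using mult_left_mono[OF norm_pmul_le[of i c k], of "sqrt (J k) ^ n"] by (simp add: mult_ac abs_mult)

lemma weight_le: "norm (c k) \<le> sqrt (J k) ^ n * norm (c k)" for c :: "int^3 \<Rightarrow> complex^3"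
  using mult_right_mono[OF one_le_power[OF sqrt_J_ge_1[of k], of n], of "norm (c k)"] by simp

lemma synth_has_derivative:
  assumes c: "integrable lattice (\<lambda>k. sqrt (J k) *\<^sub>R c k)"
  shows "(synth c has_derivative (\<lambda>h. \<Sum>i\<in>UNIV. h $ i *\<^sub>R synth (pmul i c) x)) (at x)"
proof -
  have comp: "((\<lambda>y. synth c y $ j) has_derivative (\<lambda>h. \<Sum>i\<in>UNIV. h $ i * synth (pmul i c) x $ j)) (at x)" for j
  proof -
    have ci: "integrable lattice (\<lambda>k. sqrt (J k) *\<^sub>R c k $ j)"
      using integrable_component[OF c, of j] by (simp add: scaleR_complex_component scaleR_conv_of_real[where 'a=complex])
    have pi: "integrable lattice (\<lambda>k. pmul i c k $ j * char k x)" for i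
      by (rule integrable_series, rule integrable_component, rule integrable_weight_mono(1)[where n=1 and c=c])
         (use c norm_pmul_le in auto)
    have "(\<integral>k. c k $ j * (\<i> * of_real (wave_vector k \<bullet> h)) * char k x \<partial>lattice)
        = (\<Sum>i\<in>UNIV. of_real (h $ i) * (\<integral>k. pmul i c k $ j * char k x \<partial>lattice))" for h
    proof -
      have "(\<lambda>k. c k $ j * (\<i> * of_real (wave_vector k \<bullet> h)) * char k x)
          = (\<lambda>k. \<Sum>i\<in>UNIV. of_real (h $ i) * (pmul i c k $ j * char k x))"
        by (rule ext) (simp add: inner_vec_def wave_vector_def pmul_def sum_distrib_left sum_distrib_right mult_ac)
      then show ?thesis using pi by simp
    qed
    then have "Re (\<integral>k. c k $ j * (\<i> * of_real (wave_vector k \<bullet> h)) * char k x \<partial>lattice)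
        = (\<Sum>i\<in>UNIV. h $ i * synth (pmul i c) x $ j)" for h
      by (simp add: synth_def)
    then show ?thesis
      using bounded_linear.has_derivative[OF bounded_linear_Re series_has_derivative[OF ci, of x]]
      by (simp add: synth_def)
  qed
  show ?thesis
  proof (rule iffD2[OF has_derivative_componentwise_within], rule ballI)
    fix b :: "real^3" assume "b \<in> Basis"
    then obtain j where "b = axis j 1" by (auto simp: Basis_vec_def)
    then show "((\<lambda>y. synth c y \<bullet> b) has_derivative (\<lambda>h. (\<Sum>i\<in>UNIV. h $ i *\<^sub>R synth (pmul i c) x) \<bullet> b)) (at x)"
      using comp[of j] by (simp add: inner_axis inner_sum_left)
  qed
qed

lemma frechet_derivative_synth:
  assumes c: "integrable lattice (\<lambda>k. sqrt (J k) *\<^sub>R c k)"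
  shows "frechet_derivative (synth c) (at x) (axis i 1) = synth (pmul i c) x"
proof -
  have "frechet_derivative (synth c) (at x) = (\<lambda>h. \<Sum>i\<in>UNIV. h $ i *\<^sub>R synth (pmul i c) x)"
    by (rule frechet_derivative_at[OF synth_has_derivative[OF c], symmetric])
  then have "frechet_derivative (synth c) (at x) (axis i 1) = (\<Sum>l\<in>UNIV. (if l = i then synth (pmul l c) x else 0))"
    by (simp only: axis_def) (intro sum.cong, auto)
  then show ?thesis by simp
qed

text \<open>Each differentiation costs a factor \<open>sqrt (J k)\<close>, so half powers of J are
  the natural weights. Partial derivatives are again of the form \<open>synth\<close>, with
  coefficients \<open>pmul i c\<close>, which closes the induction.\<close>

lemma synth_Ck:
  assumes "integrable lattice (\<lambda>k. sqrt (J k) ^ n *\<^sub>R c k)" shows "Ck n (synth c)"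
  using assms
proof (induction n arbitrary: c)
  case 0
  then show ?case using continuous_synth[of c] by simp
next
  case (Suc n)
  have c: "integrable lattice (\<lambda>k. sqrt (J k) *\<^sub>R c k)"
    using Suc.prems
  proof (rule integrable_weight_mono(1))
    show "norm (sqrt (J k) *\<^sub>R c k) \<le> sqrt (J k) ^ Suc n * norm (c k)" for k
      using weight_le[of "\<lambda>k. sqrt (J k) *\<^sub>R c k" k n] by (simp add: mult_ac abs_mult)
  qed
  have "Ck n (\<lambda>x. frechet_derivative (synth c) (at x) b)" if "b \<in> Basis" for b
  proof -
    obtain i where b: "b = axis i 1" using \<open>b \<in> Basis\<close> by (auto simp: Basis_vec_def)
    have "Ck n (synth (pmul i c))"
      by (rule Suc.IH, rule integrable_weight_mono(1)[where n="Suc n" and c=c and g="\<lambda>k. sqrt (J k) ^ n *\<^sub>R pmul i c k", OF Suc.prems weighted_pmul_le])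
    then show ?thesis by (simp add: b frechet_derivative_synth[OF c])
  qed
  moreover have "synth c differentiable (at x)" for x
    using synth_has_derivative[OF c] by (auto simp: differentiable_def)
  ultimately show ?case by simp
qed

text \<open>In the recursion 3 + 3 * C the first 3 counts the components of the field and the second
  one the basis directions. Nonnegativity is carried along because an unbounded supremum has no
  definite sign.\<close>

lemma Ck_norm_synth:
  "\<exists>C\<ge>0. \<forall>c. integrable lattice (\<lambda>k. sqrt (J k) ^ n *\<^sub>R c k) \<longrightarrow>
     0 \<le> Ck_norm n (synth c) \<and> Ck_norm n (synth c) \<le> C * (\<integral>k. sqrt (J k) ^ n * norm (c k) \<partial>lattice)"
proof (induction n)
  case 0
  have "0 \<le> (SUP x. norm (synth c x)) \<and> (SUP x. norm (synth c x)) \<le> 3 * (\<integral>k. norm (c k) \<partial>lattice)"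
    if c: "integrable lattice c" for c :: "int^3 \<Rightarrow> complex^3"
  proof -
    have "bdd_above (range (\<lambda>x. norm (synth c x)))" using norm_synth_le[OF c] by (auto simp: bdd_above_def)
    then have "0 \<le> (SUP x. norm (synth c x))" by (rule cSUP_upper2[where x=0]) auto
    then show ?thesis using norm_synth_le[OF c] by (auto intro: cSUP_least)
  qed
  then show ?case by (intro exI[of _ 3]) simp
next
  case (Suc n)
  then obtain C where C: "0 \<le> C" and IH: "\<And>c. integrable lattice (\<lambda>k. sqrt (J k) ^ n *\<^sub>R c k) \<Longrightarrow>
     0 \<le> Ck_norm n (synth c) \<and> Ck_norm n (synth c) \<le> C * (\<integral>k. sqrt (J k) ^ n * norm (c k) \<partial>lattice)" by blast
  show ?case
  proof (intro exI[of _ "3 + 3 * C"] conjI allI impI)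
    show "0 \<le> 3 + 3 * C" using C by simp
    fix c :: "int^3 \<Rightarrow> complex^3" assume cs: "integrable lattice (\<lambda>k. sqrt (J k) ^ Suc n *\<^sub>R c k)"
    let ?I = "\<integral>k. sqrt (J k) ^ Suc n * norm (c k) \<partial>lattice"
    note c0 = integrable_weight_mono[where n="Suc n" and c=c and g=c, OF cs weight_le[of c]]
    have c1: "integrable lattice (\<lambda>k. sqrt (J k) *\<^sub>R c k)"
      using cs
    proof (rule integrable_weight_mono(1))
      show "norm (sqrt (J k) *\<^sub>R c k) \<le> sqrt (J k) ^ Suc n * norm (c k)" for k
        using weight_le[of "\<lambda>k. sqrt (J k) *\<^sub>R c k" k n] by (simp add: mult_ac abs_mult)
    qed
    have "bdd_above (range (\<lambda>x. norm (synth c x)))" using norm_synth_le[OF c0(1)] by (auto simp: bdd_above_def)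
    then have s0: "0 \<le> (SUP x. norm (synth c x))" by (rule cSUP_upper2[where x=0]) auto
    have "norm (synth c x) \<le> 3 * ?I" for x
      by (rule order_trans[OF norm_synth_le[OF c0(1)] mult_left_mono[OF c0(2)]]) simp
    then have s1: "(SUP x. norm (synth c x)) \<le> 3 * ?I" by (auto intro: cSUP_least)
    have d: "0 \<le> Ck_norm n (\<lambda>x. frechet_derivative (synth c) (at x) b) \<and>
        Ck_norm n (\<lambda>x. frechet_derivative (synth c) (at x) b) \<le> C * ?I" if "b \<in> Basis" for b
    proof -
      obtain i where b: "b = axis i 1" using \<open>b \<in> Basis\<close> by (auto simp: Basis_vec_def)
      note p = integrable_weight_mono[where n="Suc n" and c=c and g="\<lambda>k. sqrt (J k) ^ n *\<^sub>R pmul i c k", OF cs weighted_pmul_le]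
      have "C * (\<integral>k. sqrt (J k) ^ n * norm (pmul i c k) \<partial>lattice) \<le> C * ?I"
        using p(2) C by (intro mult_left_mono) (simp_all add: abs_mult)
      then show ?thesis using IH[OF p(1)] by (simp add: b frechet_derivative_synth[OF c1])
    qed
    have card: "card (Basis :: (real^3) set) = 3" by simp
    show "0 \<le> Ck_norm (Suc n) (synth c)" using s0 d by (auto intro!: add_nonneg_nonneg sum_nonneg)
    have fin: "p + q \<le> (3 + 3 * C) * I" if "p \<le> 3 * I" "q \<le> 3 * (C * I)" for p q I :: real
      using that by (simp add: algebra_simps)
    have "(\<Sum>b\<in>Basis. Ck_norm n (\<lambda>x. frechet_derivative (synth c) (at x) b)) \<le> of_nat (card (Basis :: (real^3) set)) * (C * ?I)"
      by (rule sum_bounded_above) (rule conjunct2[OF d])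
    then have "(\<Sum>b\<in>Basis. Ck_norm n (\<lambda>x. frechet_derivative (synth c) (at x) b)) \<le> 3 * (C * ?I)"
      by (simp only: card)
    then show "Ck_norm (Suc n) (synth c) \<le> (3 + 3 * C) * ?I"
      unfolding Ck_norm.simps by (rule fin[OF s1])
  qed
qed

lemma synth_diff:
  assumes "integrable lattice a" "integrable lattice b"
  shows "synth (\<lambda>k. a k - b k) x = synth a x - synth b x"
proof -
  have "integrable lattice (\<lambda>k. a k $ j * char k x)" "integrable lattice (\<lambda>k. b k $ j * char k x)" for j
    using assms by (auto intro: integrable_series integrable_component)
  then show ?thesis by (simp add: vec_eq_iff synth_def left_diff_distrib)
qed

lemma synth_scaleR: "synth (\<lambda>k. r *\<^sub>R a k) x = r *\<^sub>R synth a x"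
  by (simp add: vec_eq_iff synth_def scaleR_complex_component mult.assoc)

lemma sqrt_J_power: "sqrt (J k) ^ (2 * s) = J k ^ s" by (simp add: power_mult)

lemma synth_C_space:
  assumes "Ws (2 * s + 2) c < \<infinity>" shows "synth c \<in> Elems (C_space (2 * s))"
  using synth_Ck[of "2 * s" c] Ws_summable[OF assms] synth_periodic by (simp add: C_space_def sqrt_J_power)

text \<open>The Sobolev embedding of H^(2s+2) into C^(2s), squared to match \<open>Ws\<close>. The
  orders are even because the integer power J^s accounts for 2s derivatives; the cases s = 0 and s =
  1 give C^0 and C^2.\<close>

lemma C_space_norm_synth:
  "\<exists>K\<ge>0. \<forall>c. Ws (2 * s + 2) c < \<infinity> \<longrightarrow>
     0 \<le> Norm (C_space (2 * s)) (synth c) \<and> ennreal ((Norm (C_space (2 * s)) (synth c))\<^sup>2) \<le> ennreal K * Ws (2 * s + 2) c"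
proof -
  obtain C where C: "0 \<le> C" and n: "\<And>c. integrable lattice (\<lambda>k. sqrt (J k) ^ (2 * s) *\<^sub>R c k) \<Longrightarrow>
     0 \<le> Ck_norm (2 * s) (synth c) \<and> Ck_norm (2 * s) (synth c) \<le> C * (\<integral>k. sqrt (J k) ^ (2 * s) * norm (c k) \<partial>lattice)"
    using Ck_norm_synth[of "2 * s"] by blast
  show ?thesis
  proof (intro exI[of _ "C\<^sup>2 * Jsum"] conjI allI impI)
    show "0 \<le> C\<^sup>2 * Jsum" by simp
    fix c assume c: "Ws (2 * s + 2) c < \<infinity>"
    have b: "0 \<le> Ck_norm (2 * s) (synth c)" "Ck_norm (2 * s) (synth c) \<le> C * (\<integral>k. J k ^ s * norm (c k) \<partial>lattice)"
      using n[of c] Ws_summable[OF c] by (simp_all add: sqrt_J_power)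
    then show "0 \<le> Norm (C_space (2 * s)) (synth c)" by (simp add: C_space_def)
    have "ennreal ((Ck_norm (2 * s) (synth c))\<^sup>2) \<le> ennreal ((C * (\<integral>k. J k ^ s * norm (c k) \<partial>lattice))\<^sup>2)"
      by (intro ennreal_leI power_mono b)
    also have "\<dots> = ennreal (C\<^sup>2) * ennreal ((\<integral>k. J k ^ s * norm (c k) \<partial>lattice)\<^sup>2)"
      by (simp only: power_mult_distrib) (rule ennreal_mult, auto)
    also have "\<dots> \<le> ennreal (C\<^sup>2) * (ennreal Jsum * Ws (2 * s + 2) c)"
      by (rule mult_left_mono[OF integral_l1_le[OF c]]) simp
    also have "\<dots> = ennreal (C\<^sup>2 * Jsum) * Ws (2 * s + 2) c"
      by (simp only: mult.assoc[symmetric]) (simp add: ennreal_mult)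
    finally show "ennreal ((Norm (C_space (2 * s)) (synth c))\<^sup>2) \<le> ennreal (C\<^sup>2 * Jsum) * Ws (2 * s + 2) c"
      by (simp add: C_space_def)
  qed
qed

section \<open>Hoelder continuity in time\<close>

lemma ac_on_AE_derivative:
  assumes ac: "\<And>k. ac_on a b (\<lambda>t. F t k) (\<lambda>t. f t k)"
    and eq: "AE t in lebesgue_on {a..b}. \<forall>k. f t k = g t k"
  shows "ac_on a b (\<lambda>t. F t k) (\<lambda>t. g t k)"
proof -
  have "{a..b} \<in> sets lebesgue" by simp
  then obtain Z where Z: "negligible Z" "\<And>t. t \<in> {a..b} - Z \<Longrightarrow> \<forall>k. f t k = g t k"
    using AE_lebesgue_on_negligible[OF eq] by blast
  show ?thesis by (rule ac_on_cong_AE[OF ac Z(1)]) (use Z(2) in blast)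
qed

lemma integral_Ws_le:
  fixes a :: "real \<Rightarrow> int^3 \<Rightarrow> complex^3"
  assumes i: "\<And>k. (\<lambda>t. a t k) absolutely_integrable_on {p..q}" and pq: "p \<le> q"
  shows "Ws n (\<lambda>k. integral {p..q} (\<lambda>t. a t k)) \<le> ennreal (q - p) * (\<integral>\<^sup>+t. Ws n (a t) \<partial>lebesgue_on {p..q})"
proof -
  let ?M = "lebesgue_on {p<..<q}"
  have im: "integrable ?M (\<lambda>t. a t k)" for k using i by (simp only: integrable_Ioo_iff)
  have "Ws n (\<lambda>k. integral {p..q} (\<lambda>t. a t k)) = Ws n (\<lambda>k. \<integral>t. a t k \<partial>?M)"
    by (simp only: integral_Ioo_eq[OF im])
  also have "\<dots> \<le> emeasure ?M (space ?M) * (\<integral>\<^sup>+t. Ws n (a t) \<partial>?M)"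
    by (rule wsum_integral_le[OF borel_measurable_integrable[OF im]]) simp
  also have "emeasure ?M (space ?M) = ennreal (q - p)"
    using pq by (simp add: emeasure_restrict_space)
  finally show ?thesis by (simp only: nn_integral_Icc_Ioo)
qed

lemma Ws_uminus_diff: "Ws n (\<lambda>k. a k - b k) = Ws n (\<lambda>k. b k - a k)"
  by (rule wsum_norm_cong) (rule norm_minus_commute)

text \<open>Cauchy-Schwarz in time. Without the squares this is Hoelder continuity with exponent 1/2
  in H^n.\<close>

lemma ac_on_Ws_diff:
  fixes a a' :: "real \<Rightarrow> int^3 \<Rightarrow> complex^3"
  assumes ac: "\<And>k. ac_on s T (\<lambda>t. a t k) (\<lambda>t. a' t k)" and p: "p \<in> {s..T}" and q: "q \<in> {s..T}"
  shows "Ws n (\<lambda>k. a q k - a p k) \<le> ennreal \<bar>q - p\<bar> * (\<integral>\<^sup>+t. Ws n (a' t) \<partial>lebesgue_on {s..T})"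
  using p q
proof (induction p q rule: linorder_wlog)
  case (le p q)
  then have b: "s \<le> p" "q \<le> T" by auto
  have "Ws n (\<lambda>k. a q k - a p k) = Ws n (\<lambda>k. integral {p..q} (\<lambda>t. a' t k))"
    using ac_onD[OF ac b(1) le(1) b(2)] by simp
  also have "\<dots> \<le> ennreal (q - p) * (\<integral>\<^sup>+t. Ws n (a' t) \<partial>lebesgue_on {p..q})"
    by (rule integral_Ws_le[OF ac_on_integrable(1)[OF ac b] le(1)])
  also have "\<dots> \<le> ennreal (q - p) * (\<integral>\<^sup>+t. Ws n (a' t) \<partial>lebesgue_on {s..T})"
    by (intro mult_left_mono nn_integral_lebesgue_on_mono) (use b in auto)
  finally show ?case using le(1) by simp
next
  case (sym p q)
  then show ?case using Ws_uminus_diff[of n "a q" "a p"] by (simp add: abs_minus_commute)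
qed

text \<open>The difference quotient minus the derivative is the mean of \<open>D t - D x\<close>
  over the interval between x and y. In squared form one power of its length comes from
  Cauchy-Schwarz, one from integrating and one from the Hoelder bound on \<open>D\<close>; the
  squared reciprocal length removes two.\<close>

lemma ac_on_difference_quotient:
  fixes c D d2 :: "real \<Rightarrow> int^3 \<Rightarrow> complex^3"
  assumes c: "\<And>k. ac_on s T (\<lambda>t. c t k) (\<lambda>t. D t k)" and D: "\<And>k. ac_on s T (\<lambda>t. D t k) (\<lambda>t. d2 t k)"
    and x: "x \<in> {s..T}" and y: "y \<in> {s..T}" and xy: "x \<noteq> y"
  shows "Ws n (\<lambda>k. inverse (y - x) *\<^sub>R (c y k - c x k) - D x k) \<le> ennreal \<bar>y - x\<bar> * (\<integral>\<^sup>+t. Ws n (d2 t) \<partial>lebesgue_on {s..T})"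
proof -
  \<comment> \<open>Ordered end points, so that one integral serves the quotients from both
    sides.\<close>
  define p q M where "p = min x y" and "q = max x y" and "M = (\<integral>\<^sup>+t. Ws n (d2 t) \<partial>lebesgue_on {s..T})"
  have b: "s \<le> p" "q \<le> T" and pq: "p < q" using x y xy by (auto simp: p_def q_def)
  have qp: "q - p = \<bar>y - x\<bar>" by (auto simp: p_def q_def)
  have inv: "(inverse z)\<^sup>2 * z * z * z = z" if "z \<noteq> 0" for z :: real
    using that by (simp add: power2_eq_square field_simps)
  let ?a = "\<lambda>t k. D t k - D x k"
  have ai: "(\<lambda>t. ?a t k) absolutely_integrable_on {p..q}" for k
    by (intro set_integral_diff ac_on_integrable(1)[OF c b] absolutely_integrable_on_const) simp
  have "inverse (y - x) *\<^sub>R (v - w) = inverse (x - y) *\<^sub>R (w - v)" for v w :: "complex^3"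
    by (metis inverse_minus_eq minus_diff_eq minus_minus scaleR_minus_left scaleR_minus_right)
  then have "inverse (y - x) *\<^sub>R (c y k - c x k) = inverse (q - p) *\<^sub>R (c q k - c p k)" for k
    by (auto simp: p_def q_def min_def max_def)
  moreover have "c q k - c p k = integral {p..q} (\<lambda>t. ?a t k) + (q - p) *\<^sub>R D x k" for k
    using ac_onD[OF c b(1) less_imp_le[OF pq] b(2), of k] pq ac_on_integrable(2)[OF c b, of k]
    by (simp add: Henstock_Kurzweil_Integration.integral_diff integrable_const_ivl)
  ultimately have "Ws n (\<lambda>k. inverse (y - x) *\<^sub>R (c y k - c x k) - D x k) = Ws n (\<lambda>k. inverse (q - p) *\<^sub>R integral {p..q} (\<lambda>t. ?a t k))"
    using pq by (simp add: scaleR_add_right)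
  also have "\<dots> = ennreal ((inverse (q - p))\<^sup>2) * Ws n (\<lambda>k. integral {p..q} (\<lambda>t. ?a t k))"
    by (rule wsum_scaleR) simp
  also have "\<dots> \<le> ennreal ((inverse (q - p))\<^sup>2) * (ennreal (q - p) * (\<integral>\<^sup>+t. Ws n (?a t) \<partial>lebesgue_on {p..q}))"
    by (intro mult_left_mono integral_Ws_le[OF ai less_imp_le[OF pq]]) simp
  also have "\<dots> \<le> ennreal ((inverse (q - p))\<^sup>2) * (ennreal (q - p) * (\<integral>\<^sup>+t. ennreal (q - p) * M \<partial>lebesgue_on {p..q}))"
  proof (intro mult_left_mono nn_integral_mono)
    fix t assume "t \<in> space (lebesgue_on {p..q})"
    then have t: "t \<in> {s..T}" "\<bar>t - x\<bar> \<le> q - p" using b by (auto simp: p_def q_def)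
    have "Ws n (?a t) \<le> ennreal \<bar>t - x\<bar> * M" unfolding M_def by (rule ac_on_Ws_diff[OF D x t(1)])
    also have "\<dots> \<le> ennreal (q - p) * M" by (intro mult_right_mono ennreal_leI t(2)) simp
    finally show "Ws n (?a t) \<le> ennreal (q - p) * M" .
  qed simp_all
  also have "(\<integral>\<^sup>+t. ennreal (q - p) * M \<partial>lebesgue_on {p..q}) = ennreal (q - p) * M * ennreal (q - p)"
    using pq by (simp add: emeasure_restrict_space)
  also have "ennreal ((inverse (q - p))\<^sup>2) * (ennreal (q - p) * (ennreal (q - p) * M * ennreal (q - p)))
     = ennreal ((inverse (q - p))\<^sup>2 * (q - p) * (q - p) * (q - p)) * M"
    using pq by (simp add: ennreal_mult mult_ac)
  also have "(inverse (q - p))\<^sup>2 * (q - p) * (q - p) * (q - p) = q - p"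
    using inv[of "q - p"] pq by simp
  finally show ?thesis by (simp only: qp M_def)
qed

text \<open>By the embedding the norm is at most a constant times the square root of |s - t|.
  Increments of a field and remainders of its difference quotient both have this form.\<close>

lemma C_space_tendsto:
  assumes g: "\<And>s. s \<in> S \<Longrightarrow> s \<noteq> t \<Longrightarrow> Ws (2 * n + 2) (g s) \<le> ennreal \<bar>s - t\<bar> * M" and M: "M < \<infinity>"
  shows "((\<lambda>s. Norm (C_space (2 * n)) (synth (g s))) \<longlongrightarrow> 0) (at t within S)"
proof -
  obtain K where K: "0 \<le> K" and n: "\<And>c. Ws (2 * n + 2) c < \<infinity> \<Longrightarrow>
     0 \<le> Norm (C_space (2 * n)) (synth c) \<and> ennreal ((Norm (C_space (2 * n)) (synth c))\<^sup>2) \<le> ennreal K * Ws (2 * n + 2) c"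
    using C_space_norm_synth by blast
  obtain m where m: "0 \<le> m" "M = ennreal m" using M by (cases M) auto
  have b: "0 \<le> Norm (C_space (2 * n)) (synth (g s))" "Norm (C_space (2 * n)) (synth (g s)) \<le> sqrt (K * (\<bar>s - t\<bar> * m))"
    if "s \<in> S" "s \<noteq> t" for s
  proof -
    note gs = g[OF that]
    have "ennreal \<bar>s - t\<bar> * M < \<infinity>" using M by (simp add: ennreal_mult_less_top)
    then have fin: "Ws (2 * n + 2) (g s) < \<infinity>" using gs by (rule le_less_trans[rotated])
    show "0 \<le> Norm (C_space (2 * n)) (synth (g s))" using n[OF fin] by simp
    have "ennreal ((Norm (C_space (2 * n)) (synth (g s)))\<^sup>2) \<le> ennreal K * Ws (2 * n + 2) (g s)" using n[OF fin] by simp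
    also have "\<dots> \<le> ennreal K * (ennreal \<bar>s - t\<bar> * M)" by (intro mult_left_mono gs) simp
    also have "\<dots> = ennreal (K * (\<bar>s - t\<bar> * m))" using K m by (simp add: ennreal_mult)
    finally have "(Norm (C_space (2 * n)) (synth (g s)))\<^sup>2 \<le> K * (\<bar>s - t\<bar> * m)"
      using K m by (simp add: ennreal_le_iff)
    then show "Norm (C_space (2 * n)) (synth (g s)) \<le> sqrt (K * (\<bar>s - t\<bar> * m))" by (rule real_le_rsqrt)
  qed
  have "((\<lambda>s. sqrt (K * (\<bar>s - t\<bar> * m))) \<longlongrightarrow> sqrt (K * (\<bar>t - t\<bar> * m))) (at t within S)"
    by (intro tendsto_intros)
  then have l: "((\<lambda>s. sqrt (K * (\<bar>s - t\<bar> * m))) \<longlongrightarrow> 0) (at t within S)" by simp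
  show ?thesis
  proof (rule tendsto_sandwich[OF _ _ tendsto_const l])
    show "\<forall>\<^sub>F s in at t within S. 0 \<le> Norm (C_space (2 * n)) (synth (g s))"
      unfolding eventually_at_filter by (rule always_eventually) (use b(1) in blast)
    show "\<forall>\<^sub>F s in at t within S. Norm (C_space (2 * n)) (synth (g s)) \<le> sqrt (K * (\<bar>s - t\<bar> * m))"
      unfolding eventually_at_filter by (rule always_eventually) (use b(2) in blast)
  qed
qed

lemma continuous_into_synth:
  fixes c d :: "real \<Rightarrow> int^3 \<Rightarrow> complex^3"
  assumes ac: "\<And>k. ac_on a b (\<lambda>t. c t k) (\<lambda>t. d t k)"
    and c: "\<And>t. t \<in> {a..b} \<Longrightarrow> Ws (2 * n + 2) (c t) < \<infinity>"
    and d: "(\<integral>\<^sup>+t. Ws (2 * n + 2) (d t) \<partial>lebesgue_on {a..b}) < \<infinity>"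
  shows "continuous_into (C_space (2 * n)) {a..b} (\<lambda>t. synth (c t))"
  unfolding continuous_into_def
proof (intro conjI ballI)
  show "synth (c t) \<in> Elems (C_space (2 * n))" if "t \<in> {a..b}" for t by (rule synth_C_space[OF c[OF that]])
  fix t assume t: "t \<in> {a..b}"
  have ci: "integrable lattice (c s)" if "s \<in> {a..b}" for s
    by (rule Ws2_summable, rule le_less_trans[OF Ws_mono c[OF that]]) simp
  have "((\<lambda>s. Norm (C_space (2 * n)) (synth (\<lambda>k. c s k - c t k))) \<longlongrightarrow> 0) (at t within {a..b})"
    by (rule C_space_tendsto[OF ac_on_Ws_diff[OF ac t] d])
  moreover have "synth (\<lambda>k. c s k - c t k) = (\<lambda>x. synth (c s) x - synth (c t) x)" if "s \<in> {a..b}" for s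
    by (rule ext) (rule synth_diff[OF ci[OF that] ci[OF t]])
  ultimately show "((\<lambda>s. Norm (C_space (2 * n)) (\<lambda>x. synth (c s) x - synth (c t) x)) \<longlongrightarrow> 0) (at t within {a..b})"
    by (subst tendsto_cong[OF eventually_at_filter[THEN iffD2], rotated]) (auto intro!: always_eventually)
qed

text \<open>Continuity into C^2 uses \<open>D\<close> in L^2 H^4; continuity of the time derivative
  into C^0 uses \<open>d2\<close> in L^2 H^2. \<open>D t\<close> has to lie in H^2 at every time,
  since \<open>synth (D t)\<close> is to be the derivative at each of them.\<close>

lemma classical_regularity_synth:
  fixes D d2 :: "real \<Rightarrow> int^3 \<Rightarrow> complex^3"
  assumes c: "\<And>k. ac_on a b (\<lambda>t. fourier_coeff (u t) k) (\<lambda>t. D t k)" and D: "\<And>k. ac_on a b (\<lambda>t. D t k) (\<lambda>t. d2 t k)"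
    and uL: "\<And>t. t \<in> {a..b} \<Longrightarrow> u t \<in> Elems L2_space"
    and c4: "\<And>t. t \<in> {a..b} \<Longrightarrow> Ws 4 (fourier_coeff (u t)) < \<infinity>"
    and D2: "\<And>t. t \<in> {a..b} \<Longrightarrow> Ws 2 (D t) < \<infinity>"
    and D4: "(\<integral>\<^sup>+t. Ws 4 (D t) \<partial>lebesgue_on {a..b}) < \<infinity>" and d22: "(\<integral>\<^sup>+t. Ws 2 (d2 t) \<partial>lebesgue_on {a..b}) < \<infinity>"
  shows "classical_regularity a b u"
  unfolding classical_regularity_def
proof (intro exI[of _ "\<lambda>t. synth (fourier_coeff (u t))"] conjI ballI)
  let ?c = "\<lambda>t. fourier_coeff (u t)"
  have c2: "Ws 2 (?c t) < \<infinity>" if "t \<in> {a..b}" for t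
    by (rule le_less_trans[OF Ws_mono c4[OF that]]) simp
  have ci: "integrable lattice (?c t)" if "t \<in> {a..b}" for t by (rule Ws2_summable[OF c2[OF that]])
  have Di: "integrable lattice (D t)" if "t \<in> {a..b}" for t by (rule Ws2_summable[OF D2[OF that]])
  show "eq_field (synth (?c t)) (u t)" if t: "t \<in> {a..b}" for t
    unfolding eq_field_def using synth_fourier_coeff[OF uL[OF t] ci[OF t]] by eventually_elim (rule sym)
  show "continuous_into (C_space 2) {a..b} (\<lambda>t. synth (?c t))"
    using continuous_into_synth[where n=1, OF c] c4 D4 by simp
  have "(\<integral>\<^sup>+t. Ws 2 (D t) \<partial>lebesgue_on {a..b}) \<le> (\<integral>\<^sup>+t. Ws 4 (D t) \<partial>lebesgue_on {a..b})"
    by (intro nn_integral_mono Ws_mono) simp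
  then have D2': "(\<integral>\<^sup>+t. Ws 2 (D t) \<partial>lebesgue_on {a..b}) < \<infinity>" using D4 by (rule le_less_trans)
  show "C1_into (C_space 0) {a..b} (\<lambda>t. synth (?c t))"
    unfolding C1_into_def
  proof (intro conjI exI[of _ "\<lambda>t. synth (D t)"] ballI)
    show "continuous_into (C_space 0) {a..b} (\<lambda>t. synth (?c t))"
      by (rule continuous_into_synth[of a b ?c D 0, unfolded mult_0_right add_0, OF c c2 D2'])
    show "continuous_into (C_space 0) {a..b} (\<lambda>t. synth (D t))"
      by (rule continuous_into_synth[of a b D d2 0, unfolded mult_0_right add_0, OF D D2 d22])
    fix t assume t: "t \<in> {a..b}"
    let ?q = "\<lambda>s k. inverse (s - t) *\<^sub>R (?c s k - ?c t k) - D t k"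
    have "((\<lambda>s. Norm (C_space (2 * 0)) (synth (?q s))) \<longlongrightarrow> 0) (at t within {a..b})"
    proof (rule C_space_tendsto)
      fix s assume "s \<in> {a..b}" "s \<noteq> t"
      then show "Ws (2 * 0 + 2) (?q s) \<le> ennreal \<bar>s - t\<bar> * (\<integral>\<^sup>+t. Ws 2 (d2 t) \<partial>lebesgue_on {a..b})"
        unfolding mult_0_right add_0 by (intro ac_on_difference_quotient[of a b ?c D, OF c D t]) auto
    qed (rule d22)
    moreover have "synth (?q s) = (\<lambda>x. (synth (?c s) x - synth (?c t) x) /\<^sub>R (s - t) - synth (D t) x)" if "s \<in> {a..b}" for s
    proof (rule ext)
      fix x
      have "integrable lattice (\<lambda>k. ?c s k - ?c t k)" using ci[OF that] ci[OF t] by (rule Bochner_Integration.integrable_diff)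
      then have "synth (?q s) x = synth (\<lambda>k. inverse (s - t) *\<^sub>R (?c s k - ?c t k)) x - synth (D t) x"
        by (intro synth_diff Di[OF t]) simp
      then show "synth (?q s) x = (synth (?c s) x - synth (?c t) x) /\<^sub>R (s - t) - synth (D t) x"
        by (simp add: synth_scaleR synth_diff[OF ci[OF that] ci[OF t]])
    qed
    ultimately show "((\<lambda>s. Norm (C_space 0) (\<lambda>x. (synth (?c s) x - synth (?c t) x) /\<^sub>R (s - t) - synth (D t) x)) \<longlongrightarrow> 0) (at t within {a..b})"
      by (subst tendsto_cong[OF eventually_at_filter[THEN iffD2], rotated]) (auto intro!: always_eventually)
  qed
qed

section \<open>Return from coefficients to the spaces of the statement\<close>

lemma L2_into_Hdot:
  assumes "L2_into (Hdot_space s) a b f" shows "L2_into (H_space s) a b f"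
proof -
  have E: "Elems (Hdot_space s) \<subseteq> Elems (H_space s)" and N: "Norm (Hdot_space s) = Norm (H_space s)"
    by (auto simp: Hdot_space_def)
  obtain \<sigma> where \<sigma>: "\<And>n. simple_into (Hdot_space s) {a<..<b} (\<sigma> n)"
    and lim: "AE t in lebesgue_on {a<..<b}. f t \<in> Elems (Hdot_space s) \<and> (\<lambda>n. Norm (H_space s) (\<lambda>x. \<sigma> n t x - f t x)) \<longlonglongrightarrow> 0"
    and fin: "(\<integral>\<^sup>+t. ennreal ((Norm (H_space s) (f t))\<^sup>2) \<partial>lebesgue_on {a<..<b}) < \<infinity>"
    using assms by (auto simp: L2_into_def strongly_measurable_def N)
  have "simple_into (H_space s) {a<..<b} (\<sigma> n)" for n
    using \<sigma>[of n] E unfolding simple_into_def by (blast intro: subset_trans)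
  moreover have "AE t in lebesgue_on {a<..<b}. f t \<in> Elems (H_space s) \<and> (\<lambda>n. Norm (H_space s) (\<lambda>x. \<sigma> n t x - f t x)) \<longlonglongrightarrow> 0"
    using lim by eventually_elim (use E in blast)
  ultimately show ?thesis using fin by (auto simp: L2_into_def strongly_measurable_def)
qed

lemma L2_into_H_coeff:
  assumes "L2_into (H_space s) a b f"
  shows "(\<lambda>t. fourier_coeff (f t) k) \<in> borel_measurable (lebesgue_on {a..b})"
    and "(\<integral>\<^sup>+t. Ws s (fourier_coeff (f t)) \<partial>lebesgue_on {a..b}) < \<infinity>"
  using assms by (auto simp: L2_into_H_iff nn_integral_Icc_Ioo intro: measurable_Icc_Ioo)

lemma L2_into_H_I:
  assumes "\<And>k. (\<lambda>t. fourier_coeff (u t) k) \<in> borel_measurable (lebesgue_on {a..b})"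
    and "AE t in lebesgue_on {a<..<b}. u t \<in> Elems L2_space"
    and "(\<integral>\<^sup>+t. Ws s (fourier_coeff (u t)) \<partial>lebesgue_on {a..b}) < \<infinity>"
  shows "L2_into (H_space s) a b u"
  using assms unfolding L2_into_H_iff nn_integral_Icc_Ioo
  by (auto intro: borel_measurable_lebesgue_on_subset[OF _ greaterThanLessThan_subseteq_atLeastAtMost_iff[THEN iffD2]])

lemma Linf_into_H:
  assumes m: "\<And>k. (\<lambda>t. fourier_coeff (u t) k) \<in> borel_measurable (lebesgue_on {a..b})"
    and u: "\<And>t. t \<in> {a..b} \<Longrightarrow> u t \<in> Elems L2_space"
    and B: "\<And>t. t \<in> {a..b} \<Longrightarrow> Ws s (fourier_coeff (u t)) \<le> ennreal B"
  shows "Linf_into (H_space s) a b u"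
proof -
  have el: "u t \<in> Elems (H_space s)" if "t \<in> {a<..<b}" for t
    unfolding H_space_Elems using u[of t] le_less_trans[OF B[of t]] that by auto
  have "Norm (H_space s) (u t) \<le> sqrt (max B 0)" if t: "t \<in> {a<..<b}" for t
  proof (rule real_le_rsqrt)
    have "ennreal ((Norm (H_space s) (u t))\<^sup>2) \<le> ennreal (max B 0)"
      unfolding H_space_Norm[OF el[OF t]] using B[of t] t by (auto intro: order_trans ennreal_leI)
    then show "(Norm (H_space s) (u t))\<^sup>2 \<le> max B 0" by (simp add: ennreal_le_iff)
  qed
  then have "AE t in lebesgue_on {a<..<b}. Norm (H_space s) (u t) \<le> sqrt (max B 0)" by (intro AE_I2) simp
  moreover have "strongly_measurable (H_space s) {a<..<b} u"
  proof (rule strongly_measurable_H)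
    show "(\<lambda>t. fourier_coeff (u t) k) \<in> borel_measurable (lebesgue_on {a<..<b})" for k
      by (rule borel_measurable_lebesgue_on_subset[OF m]) auto
    show "AE t in lebesgue_on {a<..<b}. u t \<in> Elems (H_space s)" by (intro AE_I2) (simp add: el)
  qed simp
  ultimately show ?thesis by (auto simp: Linf_into_def)
qed

lemma AE_lebesgue_on_negligibleI:
  assumes "negligible Z" "S \<in> sets lebesgue" "\<And>t. t \<in> S - Z \<Longrightarrow> P t"
  shows "AE t in lebesgue_on S. P t"
proof -
  have "AE t in lebesgue. t \<notin> Z" using assms(1) by (simp add: AE_not_in negligible_iff_null_sets)
  then have "AE t in lebesgue. t \<in> S \<longrightarrow> P t" by eventually_elim (use assms(3) in blast)
  then show ?thesis using assms(2) by (simp add: AE_restrict_space_iff)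
qed

text \<open>The lattice is countable, so the exceptional null sets of the single coefficients unite
  to one null set.\<close>

lemma weak_time_deriv_representative:
  assumes Y: "fourier_space Y" and X: "fourier_space X" and ab: "a < b" and f: "L2_into X a b f" and f': "L2_into Y a b f'"
    and w: "weak_time_deriv Y a b f f'"
  obtains G where "\<And>k. ac_on a b (\<lambda>t. G t k) (\<lambda>t. fourier_coeff (f' t) k)"
    "AE t in lebesgue_on {a..b}. \<forall>k. fourier_coeff (f t) k = G t k"
proof -
  have "\<exists>G Z. ac_on a b G (\<lambda>t. fourier_coeff (f' t) k) \<and> negligible Z \<and> (\<forall>t\<in>{a..b} - Z. fourier_coeff (f t) k = G t)" for k
  proof -
    have "(\<lambda>t. fourier_coeff (f t) k) absolutely_integrable_on {a..b}"
      using L2_into_coeff_integrable[OF X f] by (simp only: integrable_Ioo_iff)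
    then show ?thesis using weak_time_deriv_ac[OF Y Y ab w _ f', of k] by metis
  qed
  then obtain G Z where G: "\<And>k. ac_on a b (G k) (\<lambda>t. fourier_coeff (f' t) k)" and Z: "\<And>k. negligible (Z k)"
    and eq: "\<And>k t. t \<in> {a..b} - Z k \<Longrightarrow> fourier_coeff (f t) k = G k t" by metis
  have "AE t in lebesgue_on {a..b}. \<forall>k. fourier_coeff (f t) k = G k t"
    by (subst AE_all_countable) (intro allI AE_lebesgue_on_negligibleI[OF Z], auto intro: eq)
  then show ?thesis using G that[of "\<lambda>t k. G k t"] by blast
qed

lemma ac_on_symm:
  assumes "\<And>k. ac_on a b (\<lambda>t. D t k) (\<lambda>t. d t k)"
  shows "ac_on a b (\<lambda>t. symm (D t) k) (\<lambda>t. symm (d t) k)"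
  unfolding symm_def
  by (intro ac_on_linear[OF bounded_linear_scaleR_right] ac_on_add ac_on_linear[OF bounded_linear_vcnj] assms)

theorem theorem4p4:
  fixes \<nu> T :: real and m :: nat
    and u0 :: field and f u :: "real \<Rightarrow> field"
  assumes "\<nu> > 0" and "T > 0" and "m \<ge> 1"
    and "u0 \<in> Elems (H_space 1)"
    and "L2_into (Hdot_space (m - 1)) 0 T f"
    and "strong_solution \<nu> T u0 f u"
  shows "(\<forall>\<epsilon>\<in>{0<..<T}. Linf_into (H_space m) \<epsilon> T u \<and> L2_into (H_space (m + 1)) \<epsilon> T u) \<and>
    (m \<ge> 5 \<and> (\<exists>f'. weak_time_deriv (Hdot_space 2) 0 T f f' \<and> L2_into (Hdot_space 2) 0 T f') \<longrightarrow>
       (\<forall>\<epsilon>\<in>{0<..<T}. Hk_into 1 (H_space 4) \<epsilon> T u \<and> Hk_into 2 (H_space 2) \<epsilon> T u \<and>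
          classical_regularity \<epsilon> T u))"
proof -
  let ?c = "\<lambda>t. fourier_coeff (u t)" and ?f = "\<lambda>t. fourier_coeff (f t)"
  obtain v B where uL: "\<And>t. t \<in> {0..T} \<Longrightarrow> u t \<in> Elems L2_space"
    and vL: "AE t in lebesgue_on {0<..<T}. v t \<in> Elems L2_space"
    and ac: "\<And>k. ac_on 0 T (\<lambda>t. ?c t k) (\<lambda>t. fourier_coeff (v t) k)"
    and eq: "AE t in lebesgue_on {0..T}. \<forall>k. fourier_coeff (v t) k = - (\<nu> * (norm (wave_vector k))\<^sup>2) *\<^sub>R ?c t k
        + ?f t k - curl_conv (?c t) (?c t) k"
    and B: "\<And>t. t \<in> {0..T} \<Longrightarrow> Ws 1 (?c t) \<le> ennreal B"
    and c2: "(\<integral>\<^sup>+t. Ws 2 (?c t) \<partial>lebesgue_on {0..T}) < \<infinity>"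
    by (rule strong_solution_coeff[OF assms(2,6) fourier_space_Hdot assms(5)]) blast
  let ?d = "\<lambda>t. fourier_coeff (v t)"
  note fH = L2_into_H_coeff[OF L2_into_Hdot[OF assms(5)]]
  have boot: "(\<exists>B'. \<forall>t\<in>{\<epsilon>..T}. Ws (n + 1) (?c t) \<le> ennreal B') \<and> (\<integral>\<^sup>+t. Ws (n + 2) (?c t) \<partial>lebesgue_on {\<epsilon>..T}) < \<infinity>"
    if "n \<le> m - 1" "0 < \<epsilon>" "\<epsilon> < T" for n \<epsilon>
    by (rule bootstrap[OF assms(1) ac fH(1) eq _ c2 fH(2) that]) (rule B)
  have cm: "(\<lambda>t. ?c t k) \<in> borel_measurable (lebesgue_on {\<epsilon>..T})" if "0 < \<epsilon>" for \<epsilon> k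
    by (rule borel_measurable_lebesgue_on_subset[OF ac_on_measurable(1)[OF ac]]) (use that in auto)
  have first: "Linf_into (H_space m) \<epsilon> T u \<and> L2_into (H_space (m + 1)) \<epsilon> T u" if \<epsilon>: "0 < \<epsilon>" "\<epsilon> < T" for \<epsilon>
  proof
    \<comment> \<open>Subtraction is truncated on the natural numbers; m being at least 1, the last
      bootstrap index m - 1 yields exactly H^m and H^(m+1).\<close>
    have m: "m - 1 + 1 = m" "m - 1 + 2 = m + 1" using assms(3) by auto
    obtain B' where B': "\<And>t. t \<in> {\<epsilon>..T} \<Longrightarrow> Ws m (?c t) \<le> ennreal B'"
      and I: "(\<integral>\<^sup>+t. Ws (m + 1) (?c t) \<partial>lebesgue_on {\<epsilon>..T}) < \<infinity>"
      using boot[OF order_refl \<epsilon>] unfolding m by blast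
    show "Linf_into (H_space m) \<epsilon> T u" by (rule Linf_into_H[OF cm[OF \<epsilon>(1)] uL B']) (use \<epsilon> in auto)
    show "L2_into (H_space (m + 1)) \<epsilon> T u"
      by (rule L2_into_H_I[OF cm[OF \<epsilon>(1)] _ I]) (use \<epsilon> uL in auto)
  qed
  have second: "Hk_into 1 (H_space 4) \<epsilon> T u \<and> Hk_into 2 (H_space 2) \<epsilon> T u \<and> classical_regularity \<epsilon> T u"
    if m: "5 \<le> m" and f': "weak_time_deriv (Hdot_space 2) 0 T f f'" "L2_into (Hdot_space 2) 0 T f'"
      and \<epsilon>: "0 < \<epsilon>" "\<epsilon> < T" for f' \<epsilon>
  proof -
    have sub: "{\<epsilon>..T} \<subseteq> {0..T}" "{\<epsilon><..<T} \<subseteq> {0<..<T}" using \<epsilon> by auto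
    let ?M = "lebesgue_on {\<epsilon>..T}"
    \<comment> \<open>For m at least 5 the forcing lies in L^2 H^4, so the bootstrap reaches index
      4: bounded in H^5 and square integrable in H^6, as the second time derivative demands.\<close>
    have m4: "4 \<le> m - 1" using m by simp
    obtain B' where c5: "\<And>t. t \<in> {\<epsilon>..T} \<Longrightarrow> Ws 5 (?c t) \<le> ennreal B'"
      and c6: "(\<integral>\<^sup>+t. Ws 6 (?c t) \<partial>?M) < \<infinity>"
      using boot[OF m4 \<epsilon>] by (simp only: numeral_plus_one numeral_plus_numeral Num.add_num_simps) blast
    note f'H = L2_into_H_coeff[OF L2_into_Hdot[OF f'(2)]]
    obtain G where G: "\<And>k. ac_on 0 T (\<lambda>t. G t k) (\<lambda>t. fourier_coeff (f' t) k)"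
      and fG: "AE t in lebesgue_on {0..T}. \<forall>k. ?f t k = G t k"
      by (rule weak_time_deriv_representative[OF fourier_space_Hdot fourier_space_Hdot assms(2,5) f'(2,1)]) blast
    have acu: "ac_on \<epsilon> T (\<lambda>t. ?c t k) (\<lambda>t. ?d t k)" for k by (rule ac_on_subset[OF ac]) (use \<epsilon> in auto)
    have AE: "AE t in ?M. P t" if "AE t in lebesgue_on {0..T}. P t" for P
      by (rule AE_lebesgue_on_subset[OF that sub(1)]) auto
    have int: "(\<integral>\<^sup>+t. h t \<partial>?M) < \<infinity>" if "(\<integral>\<^sup>+t. h t \<partial>lebesgue_on {0..T}) < \<infinity>" for h
      by (rule le_less_trans[OF nn_integral_lebesgue_on_mono[OF sub(1)] that]) auto
    have f4: "(\<integral>\<^sup>+t. Ws 4 (?f t) \<partial>?M) < \<infinity>"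
      by (rule le_less_trans[OF nn_integral_mono int[OF fH(2)]]) (rule Ws_mono[OF m4])
    have fm: "(\<lambda>t. ?f t k) \<in> borel_measurable ?M" for k
      by (rule borel_measurable_lebesgue_on_subset[OF fH(1) sub(1)])
    have Gs: "ac_on \<epsilon> T (\<lambda>t. G t k) (\<lambda>t. fourier_coeff (f' t) k)" for k by (rule ac_on_subset[OF G]) (use \<epsilon> in auto)
    have sl: "(\<integral>\<^sup>+t. Ws 4 (?d t) \<partial>?M) < \<infinity> \<and>
      (\<exists>D d2. (\<forall>k. ac_on \<epsilon> T (\<lambda>t. D t k) (\<lambda>t. d2 t k)) \<and> (AE t in ?M. \<forall>k. ?d t k = D t k) \<and>
         (\<integral>\<^sup>+t. Ws 2 (d2 t) \<partial>?M) < \<infinity>)"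
      by (rule second_level[OF acu AE[OF eq] _ c6 fm f4 Gs AE[OF fG] int[OF f'H(2)]]) (rule c5)
    then obtain D d2 where D: "\<And>k. ac_on \<epsilon> T (\<lambda>t. D t k) (\<lambda>t. d2 t k)"
      and dD: "AE t in ?M. \<forall>k. ?d t k = D t k" and d22: "(\<integral>\<^sup>+t. Ws 2 (d2 t) \<partial>?M) < \<infinity>" by blast
    have d4: "(\<integral>\<^sup>+t. Ws 4 (?d t) \<partial>?M) < \<infinity>" using sl by blast
    have d2I: "(\<integral>\<^sup>+t. Ws 2 (?d t) \<partial>?M) < \<infinity>"
      by (rule le_less_trans[OF nn_integral_mono d4]) (rule Ws_mono, simp)
    have cr: "Ws r (?c t) < \<infinity>" if "r \<le> 5" "t \<in> {\<epsilon>..T}" for r t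
      by (rule le_less_trans[OF Ws_mono[OF that(1)] le_less_trans[OF c5[OF that(2)]]]) simp
    have cI: "(\<integral>\<^sup>+t. Ws r (?c t) \<partial>?M) < \<infinity>" if "r \<le> 6" for r
      by (rule le_less_trans[OF nn_integral_mono c6]) (rule Ws_mono[OF that])
    have uLs: "u t \<in> Elems L2_space" if "t \<in> {\<epsilon>..T}" for t using uL that \<epsilon> by auto
    have uLa: "AE t in lebesgue_on {\<epsilon><..<T}. u t \<in> Elems L2_space" by (intro AE_I2) (simp add: uLs)
    have vLa: "AE t in lebesgue_on {\<epsilon><..<T}. v t \<in> Elems L2_space"
      by (rule AE_lebesgue_on_subset[OF vL sub(2)]) auto
    note um = ac_on_measurable(1)[OF acu] and vm = ac_on_measurable(2)[OF acu]
    have uH: "L2_into (H_space r) \<epsilon> T u" if "r \<le> 6" for r by (rule L2_into_H_I[OF um uLa cI[OF that]])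
    have wu: "weak_time_deriv (H_space r) \<epsilon> T u v" if "2 \<le> r" "r \<le> 4" for r
    proof (rule weak_time_deriv_H[OF that(1) \<epsilon>(2) acu _ uLa vLa])
      show "(\<integral>\<^sup>+t. Ws r (?c t) \<partial>lebesgue_on {\<epsilon><..<T}) < \<infinity>"
        using cI[of r] that by (simp add: nn_integral_Icc_Ioo)
      show "(\<integral>\<^sup>+t. Ws r (?d t) \<partial>lebesgue_on {\<epsilon><..<T}) < \<infinity>"
        unfolding nn_integral_Icc_Ioo[symmetric]
        by (rule le_less_trans[OF nn_integral_mono d4]) (rule Ws_mono[OF that(2)])
    qed simp
    have H1: "Hk_into 1 (H_space 4) \<epsilon> T u"
      using uH wu[of 4] L2_into_H_I[OF vm vLa d4] by auto
    \<comment> \<open>The derivative \<open>d2\<close> of the representative is made into a field.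
      It comes from an existence statement that does not include Hermitian symmetry, hence the
      \<open>symm\<close> in what follows.\<close>
    define v' where "v' t = synth (d2 t)" for t
    have "AE t in ?M. Ws 2 (d2 t) \<noteq> \<infinity>"
      by (rule nn_integral_PInf_AE[OF wsum_measurable[OF ac_on_measurable(2)[OF D]]]) (use d22 in simp)
    then have d2i: "AE t in ?M. integrable lattice (d2 t)"
      by eventually_elim (simp add: Ws2_summable less_top)
    then have v'c: "AE t in ?M. \<forall>k. symm (d2 t) k = fourier_coeff (v' t) k"
      by eventually_elim (simp add: v'_def fourier_coeff_synth)
    have v'L: "AE t in lebesgue_on {\<epsilon><..<T}. v' t \<in> Elems L2_space"
      unfolding AE_Icc_Ioo[symmetric] using d2i by eventually_elim (simp add: v'_def synth_L2)
    have Dv': "ac_on \<epsilon> T (\<lambda>t. symm (D t) k) (\<lambda>t. fourier_coeff (v' t) k)" for k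
      by (rule ac_on_AE_derivative[OF ac_on_symm[OF D] v'c])
    \<comment> \<open>The coefficients of \<open>v t\<close> are Hermitian, so symmetrising the
      representative changes nothing at almost every time.\<close>
    have vD: "AE t in ?M. \<forall>k. ?d t k = symm (D t) k"
      using dD
    proof eventually_elim
      case (elim t)
      then have "D t = ?d t" by (intro ext) simp
      then show ?case by (simp add: symm_fourier_coeff)
    qed
    have v'2: "(\<integral>\<^sup>+t. Ws 2 (fourier_coeff (v' t)) \<partial>?M) < \<infinity>"
    proof (rule le_less_trans[OF nn_integral_mono_AE d22])
      show "AE t in ?M. Ws 2 (fourier_coeff (v' t)) \<le> Ws 2 (d2 t)"
        using v'c
      proof eventually_elim
        case (elim t)
        then have "fourier_coeff (v' t) = symm (d2 t)" by (intro ext) simp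
        then show ?case by (simp add: wsum_symm)
      qed
    qed
    have wv: "weak_time_deriv (H_space 2) \<epsilon> T v v'"
      by (rule weak_time_deriv_H[OF order_refl \<epsilon>(2) Dv' _ vLa v'L])
         (use vD d2I v'2 in \<open>simp_all only: AE_Icc_Ioo nn_integral_Icc_Ioo\<close>)
    have H2: "Hk_into 2 (H_space 2) \<epsilon> T u"
      using uH[of 2] wu[of 2] wv L2_into_H_I[OF vm vLa d2I] L2_into_H_I[OF ac_on_measurable(2)[OF Dv'] v'L v'2]
      by (auto simp: numeral_2_eq_2)
    have acD: "ac_on \<epsilon> T (\<lambda>t. ?c t k) (\<lambda>t. D t k)" for k by (rule ac_on_AE_derivative[OF acu dD])
    have Dd: "AE t in ?M. Ws r (D t) = Ws r (?d t)" for r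
      using dD by eventually_elim (simp add: wsum_def)
    have D4: "(\<integral>\<^sup>+t. Ws 4 (D t) \<partial>?M) < \<infinity>" using d4 by (simp only: nn_integral_cong_AE[OF Dd])
    have "AE t in ?M. Ws 4 (D t) \<noteq> \<infinity>"
      by (rule nn_integral_PInf_AE[OF wsum_measurable[OF ac_on_measurable(1)[OF D]]]) (use D4 in simp)
    \<comment> \<open>At one time \<open>D\<close> is finite in H^4, hence in H^2; the Hoelder bound
      in H^2 spreads this finiteness to every time.\<close>
    then obtain t1 where t1: "t1 \<in> {\<epsilon>..T}" "Ws 4 (D t1) \<noteq> \<infinity>" using AE_interval_ex[OF _ \<epsilon>(2)] by blast
    have D2: "Ws 2 (D t) < \<infinity>" if t: "t \<in> {\<epsilon>..T}" for t
    proof -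
      have "Ws 2 (D t1) \<le> Ws 4 (D t1)" by (rule Ws_mono) simp
      also have "\<dots> < \<infinity>" using t1(2) by (simp add: less_top)
      finally have a: "Ws 2 (D t1) < \<infinity>" .
      have "Ws 2 (\<lambda>k. D t k - D t1 k) \<le> ennreal \<bar>t - t1\<bar> * (\<integral>\<^sup>+t. Ws 2 (d2 t) \<partial>?M)"
        by (rule ac_on_Ws_diff[OF D t1(1) t])
      also have "\<dots> < \<infinity>" using d22 by (simp add: ennreal_mult_less_top)
      finally have b: "Ws 2 (\<lambda>k. D t k - D t1 k) < \<infinity>" .
      have "Ws 2 (\<lambda>k. D t1 k + (D t k - D t1 k)) \<le> 2 * Ws 2 (D t1) + 2 * Ws 2 (\<lambda>k. D t k - D t1 k)"
        by (rule wsum_add) simp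
      also have "\<dots> < \<infinity>" using a b by (simp add: ennreal_mult_less_top)
      finally show ?thesis by simp
    qed
    have "classical_regularity \<epsilon> T u"
      by (rule classical_regularity_synth[OF acD D uLs _ D2 D4 d22]) (assumption | rule cr | simp)+
    then show ?thesis using H1 H2 by blast
  qed
  show ?thesis using first second by auto
qed

end
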